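(* Let $r\ge 1$ be an integer, let $K$ be an admissible kernel of order $r$, let $c(K)=\sqrt{\sup_x\int_{\mathbb R}K^2(x,y)\,dy}$, and suppose that the estimator $f_{n_1}(y,l)$ built from $K$ has the uniform Gumbel property with functions $A,B:\mathbb N\to\mathbb R$. Let $u_n$ be positive integers with $2^{u_n}\simeq(\log n)^2$. There is a finite constant $M'>0$ depending only on $K$ such that, if the resolution level $\hat{\hat j}_n$ is defined with this $M'$ and $$\hat\sigma_n=\sqrt{2^{\hat{\hat j}_n+u_n}/n_1},\qquad \hat A_n=A(\hat{\hat j}_n+u_n),\qquad \hat B_n=B(\hat{\hat j}_n+u_n),$$ then for every $x\in\mathbb R$, $b>0$, $0<b_1\le b_2<\infty$, $j_0\in\mathbb N$, $0<\eta\le r$ and every admissible $\delta>0$, $F=[F_1,F_2]$ with $F_1<0<1<F_2$, writing $\mathcal P=\mathcal P(\eta,r,b,b_1,b_2,j_0,\delta,F)$, $$\sup_{f\in\mathcal P}\left|\Pr\nolimits_f\left\{\hat A_n\left(\sup_{y\in[0,1]}\left|\frac{f_{n_1}(y,\hat{\hat j}_n+u_n)-f(y)}{c(K)\,\hat\sigma_n\sqrt{f_{n_1}(y,\hat{\hat j}_n+u_n)}}\right|-\hat B_n\right)\le x\right\}-e^{-e^{-x}}\right|\to0\quad (n\to\infty).$$ Furthermore, for every $\varepsilon>0$ there is a constant $L$ such that for every $n\in\mathbb N$ (with $t=t(f)$) $$\sup_{f\in\mathcal P}\Pr\nolimits_f\left\{\hat\sigma_n\ge L\,n^{-t/(2t+1)}(\log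 n)^{-1/(2(2t+1))}\,2^{u_n/2}\right\}\le\varepsilon .$$
   Context: Notation. $a_n\simeq b_n$ means that the ratio $a_n/b_n$ is bounded and bounded away from zero (for large index). $\|\cdot\|_\infty$ is the supremum norm on $\mathbb R$. Hölder–Zygmund spaces. A scaling function $\phi$ of a multiresolution analysis is $s$-regular if it is $s$ times weakly differentiable and, for $0\le\alpha\le s$, $|D^\alpha\phi(x)|\le c_1\lambda^{c_2|x|}$ for almost every $x$, for some $c_1,c_2>0$, $0<\lambda<1$. For $t>0$ take an integer $s>t$, an $s$-regular $\phi$ with associated mother wavelet $\psi$, put $\alpha_k(f)=\int f(x)\phi(x-k)\,dx$, $\beta_{lk}(f)=\int f(x)2^{l/2}\psi(2^lx-k)\,dx$, and let $\mathcal C^t(\mathbb R)$ be the set of bounded continuous $f$ with $\|f\|_{t,\infty}=\sup_{k\in\mathbb Z}|\alpha_k(f)|+\sup_{l\ge0}\sup_{k\in\mathbb Z}2^{l(t+1/2)}|\beta_{lk}(f)|<\infty$. (Different bases give the same space with equivalent norms; for non-integer $t$ this is the usual Hölder space.) Sample. $X_1,\dots,X_n$ are i.i.d. with density $f$ on $\mathbb R$; $\Pr_f$ is the corresponding product probability. The sample is split into $S_1=\{X_1,\dots,X_{n_1}\}$ and $S_2=\{X_{n_1+1},\dots,X_{n_1+n_2}\}$, $n=n_1+n_2$, $n_2>1$, with $n_1/n_2$ bounded away from $0$ and $\infty$. $P_{n_1},P_{n_2}$ are the empirical measures of $S_1,S_2$. For a kernel $K(x,y)$, $K_j(y,x)=2^jK(2^jy,2^jx)$,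 $f_{n_v}(y,j)=\int K_j(y,x)\,dP_{n_v}(x)$ ($v=1,2$), and $K_j(f)(y)=\int K_j(y,x)f(x)\,dx=Ef_{n_v}(y,j)$. Admissible kernel of order $r$. One of: (a) $K(x,y)=K(x-y)$ with $K:\mathbb R\to\mathbb R$ symmetric, integrable, of bounded variation, $\int K=1$, $\int K(u)u^l\,du=0$ for $l=1,\dots,r-1$, and $\int|K(u)||u|^r\,du<\infty$; (b) $K(x,y)=\sum_{k\in\mathbb Z}\phi(x-k)\phi(y-k)$ with $\phi$ a compactly supported scaling function of bounded variation such that either $\phi$ is $(r-1)$-regular or the associated wavelet satisfies $\int\psi(u)u^l\,du=0$ for $0\le l\le r-1$; (c) $K(x,y)=\sum_k\phi_r(x-k)\phi_r(y-k)$ with $\phi_r$ the Battle–Lemarié scaling function of order $r$, i.e. the orthonormalized B-spline with Fourier transform $\hat\phi_r(u)=\hat N_r(u)\big(\sum_k|\hat N_r(u+2\pi k)|^2\big)^{-1/2}$, where $N_r$ is the $r$-fold convolution of $1_{[0,1)}$. Resolution level. Integers $0<j_{\min}<j_{\max}$ (depending on $n$) satisfy $2^{j_{\min}}\simeq(n_2/\log n_2)^{1/(2r+1)}$, $2^{j_{\max}}\simeq n_2/(\log n_2)^4$; $\mathcal J_n=[j_{\min},j_{\max}]\cap\mathbb N$. With $M=M'\sqrt{\|f\|_\infty\vee1}$, $$\hat{\hat j}_n=\min\Big\{j\in\mathcal J_n:\|f_{n_2}(\cdot,j)-f_{n_2}(\cdot,l)\|_\infty\le M\sqrt{2^ll/n_2}\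 \text{ for all } l>j,\ l\in\mathcal J_n\Big\}.$$ Density classes. For $F=[F_1,F_2]$, $F_1<0<1<F_2$, and $\alpha,D,\delta>0$, $\mathcal D(\alpha,D,\delta,F)$ is the set of $f:\mathbb R\to\mathbb R$ with $\int f=1$, $f\ge0$ on $\mathbb R$, $f\ge\delta$ on $F$, $\|f\|_{\alpha,\infty}\le D$; given $\alpha,D$, the pair $\delta,F$ is admissible if this set is nonempty. Let $$\mathcal P(\eta,r,b,b_1,b_2,j_0)=\bigcup_{\eta\le t\le r}\{f\in\mathcal C^t(\mathbb R):\|f\|_{\eta,\infty}\le b,\ b_12^{-jt}\le\|K_j(f)-f\|_\infty\le b_22^{-jt}\ \forall j\ge j_0\}$$ and $\mathcal P(\eta,r,b,b_1,b_2,j_0,\delta,F)=\mathcal P(\eta,r,b,b_1,b_2,j_0)\cap\mathcal D(\eta,b,\delta,F)$, with $b$ implicitly large enough for the classes to be nonempty. For $f$ in this class, $t(f)$ is the unique $t\in[\eta,r]$ for which the two-sided bound holds. Uniform Gumbel property with $A,B$. $A(l)\simeq\sqrt l\simeq B(l)$, $A,B$ depend only on $K$, and for every $x\in\mathbb R$, $0<\alpha,D<\infty$, every admissible $\delta>0,F$, and every sequence $l_n\in\mathcal J_n$, as $n\to\infty$, $$\sup_{f\in\mathcal D(\alpha,D,\delta,F)}\left|\Pr\nolimits_f\left\{\sqrt{\frac{n_1}{2^{l_n}}}\sup_{y\in[0,1]}\left|\frac{f_{n_1}(y,l_n)-Ef_{n_1}(y,l_n)}{c(K)\sqrt{f(y)}}\right|\le\frac{x}{A(l_n)}+B(l_n)\right\}-e^{-e^{-x}}\right|\to0.$$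 Convention. The quotient containing $\sqrt{f_{n_1}(y,\hat{\hat j}_n+u_n)}$ is understood on the event $\inf_{y\in[0,1]}f_{n_1}(y,\hat{\hat j}_n+u_n)>0$ (with an arbitrary value otherwise); the probability of this event tends to one uniformly in $\mathcal P$. *)

theory Defs
  imports "HOL-Probability.Probability"
begin

section \<open>Elementary notions\<close>

definition comparable :: "(nat \<Rightarrow> real) \<Rightarrow> (nat \<Rightarrow> real) \<Rightarrow> bool" where
  "comparable a b \<longleftrightarrow>
     (\<exists>c C. 0 < c \<and> (\<forall>\<^sub>F n in sequentially. c \<le> a n / b n \<and> a n / b n \<le> C))"

text \<open>The supremum is taken in the reals; \<open>sup_norm\<close> is only meant for bounded functions.\<close>

definition sup_norm :: "(real \<Rightarrow> real) \<Rightarrow> real" where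
  "sup_norm g = (SUP x. \<bar>g x\<bar>)"

definition bounded_variation :: "(real \<Rightarrow> real) \<Rightarrow> bool" where
  "bounded_variation g \<longleftrightarrow>
     (\<exists>V. \<forall>x :: nat \<Rightarrow> real. mono x \<longrightarrow> (\<forall>n. (\<Sum>i<n. \<bar>g (x (Suc i)) - g (x i)\<bar>) \<le> V))"

definition test_function :: "(real \<Rightarrow> real) \<Rightarrow> bool" where
  "test_function h \<longleftrightarrow>
     (\<forall>k x. ((deriv ^^ k) h) differentiable (at x)) \<and> bounded {x. h x \<noteq> 0}"

definition weak_derivative :: "nat \<Rightarrow> (real \<Rightarrow> real) \<Rightarrow> (real \<Rightarrow> real) \<Rightarrow> bool" where
  "weak_derivative k f g \<longleftrightarrow>
     (\<forall>a b. set_integrable lborel {a..b} f) \<and>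
     (\<forall>a b. set_integrable lborel {a..b} g) \<and>
     (\<forall>h. test_function h \<longrightarrow>
        (\<integral>x. f x * (deriv ^^ k) h x \<partial>lborel) = (-1) ^ k * (\<integral>x. g x * h x \<partial>lborel))"

definition fourier :: "(real \<Rightarrow> real) \<Rightarrow> real \<Rightarrow> complex" where
  "fourier g u = (\<integral>x. complex_of_real (g x) * cis (- (u * x)) \<partial>lborel)"

section \<open>Multiresolution analyses and wavelets\<close>

definition L2 :: "(real \<Rightarrow> real) set" where
  "L2 = {f. f \<in> borel_measurable borel \<and> integrable lborel (\<lambda>x. (f x)\<^sup>2)}"

text \<open>The closed linear span in \<open>L2\<close> of the functions
  \<open>x \<mapsto> 2\<^bsup>j/2\<^esup> \<phi> (2\<^bsup>j\<^esup> x - k)\<close>, where \<open>k\<close> ranges over the integers.\<close>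

definition mra_space :: "(real \<Rightarrow> real) \<Rightarrow> int \<Rightarrow> (real \<Rightarrow> real) set" where
  "mra_space \<phi> j =
     {f \<in> L2. \<forall>\<epsilon>>0. \<exists>S c. finite S \<and>
        (\<integral>x. (f x - (\<Sum>k\<in>S. c k * (2 powr (of_int j / 2) * \<phi> (2 powi j * x - of_int k))))\<^sup>2
           \<partial>lborel) < \<epsilon>}"

definition scaling_function :: "(real \<Rightarrow> real) \<Rightarrow> bool" where
  "scaling_function \<phi> \<longleftrightarrow>
     \<phi> \<in> L2 \<and>
     (\<forall>k m :: int. (\<integral>x. \<phi> (x - of_int k) * \<phi> (x - of_int m) \<partial>lborel) = of_bool (k = m)) \<and>
     (\<forall>j. mra_space \<phi> j \<subseteq> mra_space \<phi> (j + 1)) \<and>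
     (\<forall>f. (\<forall>j. f \<in> mra_space \<phi> j) \<longrightarrow> (AE x in lborel. f x = 0)) \<and>
     (\<forall>f\<in>L2. \<forall>\<epsilon>>0. \<exists>j. \<exists>g\<in>mra_space \<phi> j. (\<integral>x. (f x - g x)\<^sup>2 \<partial>lborel) < \<epsilon>)"

definition filter_coeff :: "(real \<Rightarrow> real) \<Rightarrow> int \<Rightarrow> real" where
  "filter_coeff \<phi> k = sqrt 2 * (\<integral>x. \<phi> x * \<phi> (2 * x - of_int k) \<partial>lborel)"

text \<open>The associated wavelet is normalized by the usual formula
  \<open>\<psi>(x) = \<surd>2 \<Sum>\<^sub>k (-1)\<^sup>k h\<^bsub>1-k\<^esub> \<phi>(2x - k)\<close>.  Other conventions differ by the sign or an
  integer shift, and neither affects the wavelet norms or the vanishing of the moments below.\<close>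

definition mother_wavelet :: "(real \<Rightarrow> real) \<Rightarrow> real \<Rightarrow> real" where
  "mother_wavelet \<phi> x =
     sqrt 2 * (\<Sum>\<^sub>\<infinity>k\<in>(UNIV :: int set).
        (-1) powi k * filter_coeff \<phi> (1 - k) * \<phi> (2 * x - of_int k))"

definition regular :: "nat \<Rightarrow> (real \<Rightarrow> real) \<Rightarrow> bool" where
  "regular s \<phi> \<longleftrightarrow>
     (\<exists>c1 c2 lam. 0 < c1 \<and> 0 < c2 \<and> 0 < lam \<and> lam < 1 \<and>
        (\<forall>\<alpha>\<le>s. \<exists>g. weak_derivative \<alpha> \<phi> g \<and>
           (AE x in lborel. \<bar>g x\<bar> \<le> c1 * lam powr (c2 * \<bar>x\<bar>))))"

section \<open>Hoelder-Zygmund spaces\<close>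

text \<open>The norms depend on the wavelet basis used for each smoothness \<open>t\<close>.  A choice of bases is
  a family \<open>\<Phi>\<close>, where \<open>\<Phi> t\<close> is the scaling function used for \<open>t\<close>.\<close>

definition basis_choice :: "(real \<Rightarrow> real \<Rightarrow> real) \<Rightarrow> bool" where
  "basis_choice \<Phi> \<longleftrightarrow>
     (\<forall>t>0. scaling_function (\<Phi> t) \<and> (\<exists>s::nat. t < real s \<and> regular s (\<Phi> t)))"

definition alpha_coeff :: "(real \<Rightarrow> real) \<Rightarrow> (real \<Rightarrow> real) \<Rightarrow> int \<Rightarrow> real" where
  "alpha_coeff \<phi> f k = (\<integral>x. f x * \<phi> (x - of_int k) \<partial>lborel)"

definition beta_coeff :: "(real \<Rightarrow> real) \<Rightarrow> (real \<Rightarrow> real) \<Rightarrow> nat \<Rightarrow> int \<Rightarrow> real" where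
  "beta_coeff \<phi> f l k =
     (\<integral>x. f x * (2 powr (real l / 2) * mother_wavelet \<phi> (2 ^ l * x - of_int k)) \<partial>lborel)"

definition zygmund_norm :: "(real \<Rightarrow> real \<Rightarrow> real) \<Rightarrow> real \<Rightarrow> (real \<Rightarrow> real) \<Rightarrow> ennreal" where
  "zygmund_norm \<Phi> t f =
     (SUP k. ennreal \<bar>alpha_coeff (\<Phi> t) f k\<bar>) +
     (SUP l. SUP k. ennreal (2 powr (real l * (t + 1/2)) * \<bar>beta_coeff (\<Phi> t) f l k\<bar>))"

definition zygmund_space :: "(real \<Rightarrow> real \<Rightarrow> real) \<Rightarrow> real \<Rightarrow> (real \<Rightarrow> real) set" where
  "zygmund_space \<Phi> t =
     {f. continuous_on UNIV f \<and> bounded (range f) \<and> zygmund_norm \<Phi> t f < \<infinity>}"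

section \<open>Admissible kernels\<close>

definition convolution_kernel :: "nat \<Rightarrow> (real \<Rightarrow> real \<Rightarrow> real) \<Rightarrow> bool" where
  "convolution_kernel r K \<longleftrightarrow>
     (\<exists>k. K = (\<lambda>x y. k (x - y)) \<and>
        (\<forall>u. k (- u) = k u) \<and> integrable lborel k \<and> bounded_variation k \<and>
        (\<integral>u. k u \<partial>lborel) = 1 \<and>
        (\<forall>l. 1 \<le> l \<and> l < r \<longrightarrow> (\<integral>u. k u * u ^ l \<partial>lborel) = 0) \<and>
        integrable lborel (\<lambda>u. \<bar>k u\<bar> * \<bar>u\<bar> ^ r))"

definition projection_kernel :: "(real \<Rightarrow> real) \<Rightarrow> real \<Rightarrow> real \<Rightarrow> real" where
  "projection_kernel \<phi> x y =
     (\<Sum>\<^sub>\<infinity>k\<in>(UNIV :: int set). \<phi> (x - of_int k) * \<phi> (y - of_int k))"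

definition wavelet_kernel :: "nat \<Rightarrow> (real \<Rightarrow> real \<Rightarrow> real) \<Rightarrow> bool" where
  "wavelet_kernel r K \<longleftrightarrow>
     (\<exists>\<phi>. K = projection_kernel \<phi> \<and> scaling_function \<phi> \<and>
        bounded {x. \<phi> x \<noteq> 0} \<and> bounded_variation \<phi> \<and>
        (regular (r - 1) \<phi> \<or> (\<forall>l\<le>r - 1. (\<integral>u. mother_wavelet \<phi> u * u ^ l \<partial>lborel) = 0)))"

definition bspline :: "nat \<Rightarrow> real \<Rightarrow> real" where
  "bspline r =
     ((\<lambda>g x. \<integral>y. g (x - y) * indicat_real {0..<1} y \<partial>lborel) ^^ (r - 1)) (indicat_real {0..<1})"

text \<open>The Fourier transform determines \<open>\<phi>\<close> only almost everywhere.  Right-continuity selects the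
  usual version, namely the continuous one for \<open>r \<ge> 2\<close> and the indicator of \<open>[0,1)\<close> for \<open>r = 1\<close>.\<close>

definition battle_lemarie :: "nat \<Rightarrow> (real \<Rightarrow> real) \<Rightarrow> bool" where
  "battle_lemarie r \<phi> \<longleftrightarrow>
     integrable lborel \<phi> \<and> (\<forall>x. continuous (at_right x) \<phi>) \<and>
     (\<forall>u. fourier \<phi> u =
        fourier (bspline r) u /
        complex_of_real (sqrt (\<Sum>\<^sub>\<infinity>k\<in>(UNIV :: int set).
          (cmod (fourier (bspline r) (u + 2 * pi * of_int k)))\<^sup>2)))"

definition spline_kernel :: "nat \<Rightarrow> (real \<Rightarrow> real \<Rightarrow> real) \<Rightarrow> bool" where
  "spline_kernel r K \<longleftrightarrow> (\<exists>\<phi>. battle_lemarie r \<phi> \<and> K = projection_kernel \<phi>)"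

definition admissible_kernel :: "nat \<Rightarrow> (real \<Rightarrow> real \<Rightarrow> real) \<Rightarrow> bool" where
  "admissible_kernel r K \<longleftrightarrow> convolution_kernel r K \<or> wavelet_kernel r K \<or> spline_kernel r K"

definition kernel_const :: "(real \<Rightarrow> real \<Rightarrow> real) \<Rightarrow> real" where
  "kernel_const K = sqrt (SUP x. \<integral>y. (K x y)\<^sup>2 \<partial>lborel)"

section \<open>Sample and estimators\<close>

definition sample_law :: "(real \<Rightarrow> real) \<Rightarrow> nat \<Rightarrow> (nat \<Rightarrow> real) measure" where
  "sample_law f n = Pi\<^sub>M {1..n} (\<lambda>_. density lborel (\<lambda>x. ennreal (f x)))"

definition scaled_kernel :: "(real \<Rightarrow> real \<Rightarrow> real) \<Rightarrow> nat \<Rightarrow> real \<Rightarrow> real \<Rightarrow> real" where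
  "scaled_kernel K j y x = 2 ^ j * K (2 ^ j * y) (2 ^ j * x)"

definition kernel_op :: "(real \<Rightarrow> real \<Rightarrow> real) \<Rightarrow> nat \<Rightarrow> (real \<Rightarrow> real) \<Rightarrow> real \<Rightarrow> real" where
  "kernel_op K j f y = (\<integral>x. scaled_kernel K j y x * f x \<partial>lborel)"

text \<open>\<open>X i\<close> is the \<open>i\<close>-th observation; \<open>estimator K I X y j\<close> is the integral of
  \<open>scaled_kernel K j y\<close> with respect to the empirical measure of the subsample with index set
  \<open>I\<close>.\<close>

definition estimator ::
    "(real \<Rightarrow> real \<Rightarrow> real) \<Rightarrow> nat set \<Rightarrow> (nat \<Rightarrow> real) \<Rightarrow> real \<Rightarrow> nat \<Rightarrow> real" where
  "estimator K I X y j = (\<Sum>i\<in>I. scaled_kernel K j y (X i)) / real (card I)"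

text \<open>From \<open>n0\<close> on, the sample \<open>1..n\<close> is split into \<open>{1..n1 n}\<close> and \<open>{n1 n + 1..n1 n + n2 n}\<close>.\<close>

definition sample_split :: "nat \<Rightarrow> (nat \<Rightarrow> nat) \<Rightarrow> (nat \<Rightarrow> nat) \<Rightarrow> bool" where
  "sample_split n0 n1 n2 \<longleftrightarrow>
     (\<forall>n\<ge>n0. n1 n + n2 n = n \<and> 1 < n2 n) \<and>
     (\<exists>c C. 0 < c \<and> (\<forall>n\<ge>n0. c \<le> real (n1 n) / real (n2 n) \<and> real (n1 n) / real (n2 n) \<le> C))"

definition resolution_range ::
    "nat \<Rightarrow> nat \<Rightarrow> (nat \<Rightarrow> nat) \<Rightarrow> (nat \<Rightarrow> nat) \<Rightarrow> (nat \<Rightarrow> nat) \<Rightarrow> bool" where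
  "resolution_range r n0 n2 jmin jmax \<longleftrightarrow>
     (\<forall>n\<ge>n0. 0 < jmin n \<and> jmin n < jmax n) \<and>
     comparable (\<lambda>n. 2 ^ jmin n)
       (\<lambda>n. (real (n2 n) / ln (real (n2 n))) powr (1 / (2 * real r + 1))) \<and>
     comparable (\<lambda>n. 2 ^ jmax n) (\<lambda>n. real (n2 n) / (ln (real (n2 n))) ^ 4)"

definition selected_level ::
    "real \<Rightarrow> (real \<Rightarrow> real \<Rightarrow> real) \<Rightarrow> nat \<Rightarrow> nat \<Rightarrow> nat \<Rightarrow> nat \<Rightarrow> (real \<Rightarrow> real) \<Rightarrow>
     (nat \<Rightarrow> real) \<Rightarrow> nat" where
  "selected_level M' K m1 m2 jlo jhi f X =
     (let M = M' * sqrt (max (sup_norm f) 1);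
          I = {m1 + 1..m1 + m2}
      in Min {j \<in> {jlo..jhi}. \<forall>l\<in>{jlo..jhi}. j < l \<longrightarrow>
           sup_norm (\<lambda>y. estimator K I X y j - estimator K I X y l)
             \<le> M * sqrt (2 ^ l * real l / real m2)})"

section \<open>Density classes and the Gumbel property\<close>

definition density_class ::
    "(real \<Rightarrow> real \<Rightarrow> real) \<Rightarrow> real \<Rightarrow> real \<Rightarrow> real \<Rightarrow> real \<Rightarrow> real \<Rightarrow> (real \<Rightarrow> real) set" where
  "density_class \<Phi> \<alpha> D \<delta> F1 F2 =
     {f \<in> zygmund_space \<Phi> \<alpha>. integrable lborel f \<and> (\<integral>x. f x \<partial>lborel) = 1 \<and>
        (\<forall>x. 0 \<le> f x) \<and> (\<forall>x\<in>{F1..F2}. \<delta> \<le> f x) \<and> zygmund_norm \<Phi> \<alpha> f \<le> ennreal D}"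

definition admissible_pair ::
    "(real \<Rightarrow> real \<Rightarrow> real) \<Rightarrow> real \<Rightarrow> real \<Rightarrow> real \<Rightarrow> real \<Rightarrow> real \<Rightarrow> bool" where
  "admissible_pair \<Phi> \<alpha> D \<delta> F1 F2 \<longleftrightarrow>
     0 < \<delta> \<and> F1 < 0 \<and> 1 < F2 \<and> density_class \<Phi> \<alpha> D \<delta> F1 F2 \<noteq> {}"

definition bias_bounds ::
    "(real \<Rightarrow> real \<Rightarrow> real) \<Rightarrow> real \<Rightarrow> real \<Rightarrow> nat \<Rightarrow> real \<Rightarrow> (real \<Rightarrow> real) \<Rightarrow> bool" where
  "bias_bounds K b1 b2 j0 t f \<longleftrightarrow>
     (\<forall>j\<ge>j0. b1 * 2 powr (- (real j * t)) \<le> sup_norm (\<lambda>y. kernel_op K j f y - f y) \<and>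
             sup_norm (\<lambda>y. kernel_op K j f y - f y) \<le> b2 * 2 powr (- (real j * t)))"

definition self_similar_class ::
    "(real \<Rightarrow> real \<Rightarrow> real) \<Rightarrow> (real \<Rightarrow> real \<Rightarrow> real) \<Rightarrow> real \<Rightarrow> nat \<Rightarrow> real \<Rightarrow> real \<Rightarrow> real \<Rightarrow> nat \<Rightarrow>
     (real \<Rightarrow> real) set" where
  "self_similar_class \<Phi> K \<eta> r b b1 b2 j0 =
     (\<Union>t\<in>{\<eta>..real r}. {f \<in> zygmund_space \<Phi> t.
        zygmund_norm \<Phi> \<eta> f \<le> ennreal b \<and> bias_bounds K b1 b2 j0 t f})"

definition self_similar_densities ::
    "(real \<Rightarrow> real \<Rightarrow> real) \<Rightarrow> (real \<Rightarrow> real \<Rightarrow> real) \<Rightarrow> real \<Rightarrow> nat \<Rightarrow> real \<Rightarrow> real \<Rightarrow> real \<Rightarrow> nat \<Rightarrow>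
     real \<Rightarrow> real \<Rightarrow> real \<Rightarrow> (real \<Rightarrow> real) set" where
  "self_similar_densities \<Phi> K \<eta> r b b1 b2 j0 \<delta> F1 F2 =
     self_similar_class \<Phi> K \<eta> r b b1 b2 j0 \<inter> density_class \<Phi> \<eta> b \<delta> F1 F2"

definition smoothness ::
    "(real \<Rightarrow> real \<Rightarrow> real) \<Rightarrow> real \<Rightarrow> nat \<Rightarrow> real \<Rightarrow> real \<Rightarrow> nat \<Rightarrow> (real \<Rightarrow> real) \<Rightarrow> real" where
  "smoothness K \<eta> r b1 b2 j0 f = (THE t. t \<in> {\<eta>..real r} \<and> bias_bounds K b1 b2 j0 t f)"

definition uniform_gumbel ::
    "(real \<Rightarrow> real \<Rightarrow> real) \<Rightarrow> (real \<Rightarrow> real \<Rightarrow> real) \<Rightarrow> nat \<Rightarrow> (nat \<Rightarrow> nat) \<Rightarrow> (nat \<Rightarrow> nat) \<Rightarrow>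
     (nat \<Rightarrow> nat) \<Rightarrow> (nat \<Rightarrow> real) \<Rightarrow> (nat \<Rightarrow> real) \<Rightarrow> bool" where
  "uniform_gumbel \<Phi> K n0 n1 jmin jmax A B \<longleftrightarrow>
     comparable A (\<lambda>l. sqrt (real l)) \<and> comparable B (\<lambda>l. sqrt (real l)) \<and>
     (\<forall>x \<alpha> D \<delta> F1 F2 l.
        0 < \<alpha> \<and> 0 < D \<and> admissible_pair \<Phi> \<alpha> D \<delta> F1 F2 \<and>
        (\<forall>n\<ge>n0. l n \<in> {jmin n..jmax n}) \<longrightarrow>
        (\<lambda>n. SUP f\<in>density_class \<Phi> \<alpha> D \<delta> F1 F2.
           \<bar>\<P>(X in sample_law f n.
               sqrt (real (n1 n) / 2 ^ l n) *
               (SUP y\<in>{0..1}.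
                  \<bar>(estimator K {1..n1 n} X y (l n) -
                     (\<integral>Z. estimator K {1..n1 n} Z y (l n) \<partial>sample_law f n)) /
                   (kernel_const K * sqrt (f y))\<bar>)
               \<le> x / A (l n) + B (l n))
             - exp (- exp (- x))\<bar>) \<longlonglongrightarrow> 0)"

text \<open>The normalized error over \<open>[0,1]\<close>.  The argument \<open>d\<close> is the value given to it when the
  estimator is not bounded away from zero on \<open>[0,1]\<close>.\<close>

definition studentized_error ::
    "(real \<Rightarrow> real \<Rightarrow> real) \<Rightarrow> nat \<Rightarrow> real \<Rightarrow> (real \<Rightarrow> real) \<Rightarrow> (nat \<Rightarrow> real) \<Rightarrow> nat \<Rightarrow> real \<Rightarrow> real" where
  "studentized_error K m1 \<sigma> f X j d =
     (if 0 < (INF y\<in>{0..1}. estimator K {1..m1} X y j)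
      then SUP y\<in>{0..1}.
        \<bar>(estimator K {1..m1} X y j - f y) /
         (kernel_const K * \<sigma> * sqrt (estimator K {1..m1} X y j))\<bar>
      else d)"

definition sigma_hat :: "nat \<Rightarrow> nat \<Rightarrow> real" where
  "sigma_hat m1 j = sqrt (2 ^ j / real m1)"

end

theory Submission
  imports Defs "HOL-Library.Nat_Bijection" "HOL-Real_Asymp.Real_Asymp"
begin

text \<open>
Three things have to be shown about the selected level: on a good event it sits within a bounded
distance of the level that balances bias against noise, it is independent of the subsample that
builds the band, and the extra \<open>u n\<close> levels make the bias negligible.  The limit law is then that of
the centred statistic at a fixed level, which is the hypothesis on \<open>K\<close>.

The noise.  Every admissible kernel is an absolutely convergent combination of translates of one
function \<open>g\<close> whose oscillation is dominated by a bounded monotone function (\<open>tame_kernel\<close>).  The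
deviation of the estimator, uniformly in \<open>y\<close>, is therefore bounded by that of the empirical measure
over the translates of \<open>g (2^l x)\<close>.  Monotonicity yields brackets for these translates under any law
(\<open>translate_brackets\<close>), and Bernstein's inequality on two generations of brackets
(\<open>translate_concentration\<close>) gives noise at most a constant times the square root of
\<open>U 2^l l / m\<close>, where \<open>U\<close> bounds the density (\<open>level_concentration\<close>, \<open>good_event\<close>).  The
constant \<open>noise_const\<close> depends only on the expansion of the kernel.  In particular it does not involve
\<open>r\<close>, which is quantified after \<open>M'\<close>; the theorem holds with \<open>M' = 4 * noise_const\<close>.

The Battle-Lemarie kernels are the one family for which the expansion is not immediate.  The
periodization of the squared transform of a B-spline is an Eisenstein series, hence a polynomial in
a cosine (\<open>bspline_periodization\<close>).  Its inverse square root has an absolutely summable cosine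
expansion (\<open>cosine_wiener\<close>), so the orthonormalized spline is an absolutely convergent combination
of shifted B-splines (\<open>battle_lemarie_tame\<close>).

The selected level.  Let \<open>js\<close> be the first level at which the upper bias bound is below the noise
bound.  On the good event \<open>js\<close> passes the selection test, and a level that passes it has bias
comparable to the noise at \<open>js\<close>.  Self-similarity forbids this far below \<open>js\<close>, so the selected level
lies between \<open>js - q\<close> and \<open>js\<close> with \<open>q\<close> uniform over the class (\<open>selected_level_bracket\<close>).  This
gives the bound for the width, since \<open>2^js\<close> is at most of the order that is optimal for smoothness
\<open>t\<close>.

The limit.  After \<open>u n\<close> further levels the bias is smaller than the noise by a power of
\<open>ln n\<close>, and replacing \<open>f\<close> by its estimator in the denominator costs a lower order term
(\<open>studentized_error_close\<close>, \<open>level_event\<close>).  The Gumbel property is uniform over the levels, because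
it may be applied to the worst level for each \<open>n\<close> (\<open>uniform_gumbel_levels\<close>).  Since the level is a
function of the second subsample and the centred statistic of the first, summation over the values of
the level transfers the limit to the random level (\<open>mixture_upper\<close>, \<open>adaptive_band\<close>).  These
probabilities are of measurable sets: suprema over an uncountable set of \<open>y\<close> reduce to countably many
points, because the estimators jump only at countably many random points (\<open>all_le_measurable\<close>).
\<close>

section \<open>Kernels generated by a function of dominated variation\<close>
text \<open>The role of \<open>T\<close> is that of the variation of \<open>g\<close> on \<open>(-\<infinity>, x]\<close>.  Only monotonicity, boundedness and
domination are recorded, since these three pass to averages and to absolutely convergent combinations
with an explicit new \<open>T\<close>.\<close>

definition variation_dominated :: "(real \<Rightarrow> real) \<Rightarrow> real \<Rightarrow> (real \<Rightarrow> real) \<Rightarrow> bool" where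
  "variation_dominated T V g \<longleftrightarrow>
     mono T \<and> (\<forall>x. 0 \<le> T x \<and> T x \<le> V) \<and> (\<forall>x y. \<bar>g x - g y\<bar> \<le> \<bar>T x - T y\<bar>)"

text \<open>\<open>T x\<close> is the total variation of \<open>g\<close> on \<open>(-\<infinity>, x]\<close>: a partition that ends before \<open>x\<close> can be prolonged by
the points \<open>x\<close> and \<open>y\<close>, which adds the increment of \<open>g\<close> between them.\<close>

lemma bounded_variation_imp_dominated:
  assumes "bounded_variation g"
  shows "\<exists>T V. variation_dominated T V g"
proof -
  obtain V where V: "\<And>s :: nat \<Rightarrow> real. \<And>n. mono s \<Longrightarrow> (\<Sum>i<n. \<bar>g (s (Suc i)) - g (s i)\<bar>) \<le> V"
    using assms unfolding bounded_variation_def by blast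
  define P where "P x = {(\<Sum>i<n. \<bar>g (s (Suc i)) - g (s i)\<bar>) | s n. mono s \<and> s n \<le> x}" for x
  define T where "T x = Sup (P x)" for x
  have const_in: "0 \<in> P x" for x
    unfolding P_def by (rule CollectI, rule exI[of _ "\<lambda>_. x"], rule exI[of _ 0]) (auto simp: mono_def)
  have bdd: "bdd_above (P x)" for x
    unfolding P_def bdd_above_def using V by blast
  have T0: "0 \<le> T x" for x
    unfolding T_def by (rule cSup_upper[OF const_in bdd])
  have TV: "T x \<le> V" for x
    unfolding T_def by (rule cSup_least) (use const_in V in \<open>auto simp: P_def\<close>)
  have step: "T x + \<bar>g y - g x\<bar> \<le> T y" if "x \<le> y" for x y
  proof -
    have "v \<le> T y - \<bar>g y - g x\<bar>" if v: "v \<in> P x" for v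
    proof -
      obtain s n where s: "mono s" "s n \<le> x" "v = (\<Sum>i<n. \<bar>g (s (Suc i)) - g (s i)\<bar>)"
        using v unfolding P_def by blast
      define s' where "s' i = (if i \<le> n then s i else if i = Suc n then x else y)" for i
      have m: "mono s'"
      proof (rule incseq_SucI)
        fix i show "s' i \<le> s' (Suc i)"
          using s(1,2) \<open>x \<le> y\<close> by (auto simp: s'_def incseq_Suc_iff le_Suc_eq not_le)
      qed
      have "(\<Sum>i<Suc (Suc n). \<bar>g (s' (Suc i)) - g (s' i)\<bar>) \<in> P y"
        unfolding P_def using m by (intro CollectI exI[of _ s'] exI[of _ "Suc (Suc n)"]) (auto simp: s'_def)
      then have "(\<Sum>i<Suc (Suc n). \<bar>g (s' (Suc i)) - g (s' i)\<bar>) \<le> T y"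
        unfolding T_def by (rule cSup_upper[OF _ bdd])
      moreover have "(\<Sum>i<n. \<bar>g (s' (Suc i)) - g (s' i)\<bar>) = v"
        unfolding s(3) by (rule sum.cong) (auto simp: s'_def)
      ultimately show ?thesis by (auto simp: s'_def)
    qed
    then have "T x \<le> T y - \<bar>g y - g x\<bar>"
      unfolding T_def[of x] using const_in by (intro cSup_least) auto
    then show ?thesis by simp
  qed
  have "mono T"
    by (rule monoI) (use step in \<open>smt (verit)\<close>)
  moreover have "\<bar>g x - g y\<bar> \<le> \<bar>T x - T y\<bar>" for x y
    using step[of x y] step[of y x] by (cases "x \<le> y") auto
  ultimately show ?thesis
    unfolding variation_dominated_def using T0 TV by blast
qed

context
  fixes T V g
  assumes dom: "variation_dominated T V g"
begin

lemma dominated_mono: "mono T"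
  and dominated_nonneg: "0 \<le> T x"
  and dominated_le: "T x \<le> V"
  and dominated_diff: "\<bar>g x - g y\<bar> \<le> \<bar>T x - T y\<bar>"
  using dom unfolding variation_dominated_def by auto

lemma dominated_bounded: "\<bar>g x\<bar> \<le> \<bar>g 0\<bar> + V"
  using dominated_diff[of x 0] dominated_nonneg[of x] dominated_nonneg[of 0]
    dominated_le[of x] dominated_le[of 0] by linarith

lemma dominated_isCont:
  assumes "isCont T x"
  shows "isCont g x"
proof -
  have "((\<lambda>y. T y - T x) \<longlongrightarrow> 0) (at x)"
    using assms unfolding isCont_def using LIM_zero by blast
  then have "((\<lambda>y. \<bar>T y - T x\<bar>) \<longlongrightarrow> 0) (at x)"
    by (rule tendsto_rabs_zero)
  then have "((\<lambda>y. g y - g x) \<longlongrightarrow> 0) (at x)"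
    by (rule Lim_null_comparison[rotated]) (simp add: dominated_diff)
  then show ?thesis
    unfolding isCont_def using LIM_zero_cancel by blast
qed

lemma dominated_countable_discont: "countable {x. \<not> isCont g x}"
  by (rule countable_subset[OF _ mono_ctble_discont[OF dominated_mono]])
     (use dominated_isCont in auto)

lemma dominated_measurable: "g \<in> borel_measurable borel"
proof (rule borel_measurable_continuous_countable_exceptions[OF dominated_countable_discont])
  show "continuous_on (- {x. \<not> isCont g x}) g"
    by (auto intro!: continuous_at_imp_continuous_on)
qed

lemma dominated_T_measurable: "T \<in> borel_measurable borel"
  by (rule borel_measurable_mono[OF dominated_mono])

end

text \<open>This is what the three families of admissible kernels have in common: \<open>K y\<close> is a combination of
translates of a single function, with weights whose \<open>l1\<close> norm is bounded in \<open>y\<close>.  The noise of the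
estimator, uniformly in \<open>y\<close>, is then at most \<open>C\<close> times the largest deviation over the translates of
\<open>g\<close>, and neither \<open>y\<close> nor the number of terms matters any more.  The countable set \<open>D\<close> of jumps serves
the measurability of suprema over \<open>y\<close>.\<close>

locale tame_kernel =
  fixes K :: "real \<Rightarrow> real \<Rightarrow> real" and g T :: "real \<Rightarrow> real" and V C :: real
    and a c :: "real \<Rightarrow> nat \<Rightarrow> real" and D :: "real set"
  assumes g_integrable: "integrable lborel g"
    and g_dominated: "variation_dominated T V g"
    and weights_summable: "summable (\<lambda>k. \<bar>a y k\<bar>)"
    and weights_bound: "(\<Sum>k. \<bar>a y k\<bar>) \<le> C"
    and expansion: "K y x = (\<Sum>k. a y k * g (x - c y k))"
    and countable_D: "countable D"
    and K_isCont: "y \<notin> D \<Longrightarrow> y - x \<notin> D \<Longrightarrow> isCont (\<lambda>y. K y x) y"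
    and K_measurable: "(\<lambda>(y, x). K y x) \<in> borel_measurable (borel \<Otimes>\<^sub>M borel)"

definition tame :: "(real \<Rightarrow> real \<Rightarrow> real) \<Rightarrow> bool" where
  "tame K \<longleftrightarrow> (\<exists>g T V C a c D. tame_kernel K g T V C a c D)"

lemma convolution_kernel_tame:
  assumes "convolution_kernel r K"
  shows "tame K"
proof -
  obtain k where K: "K = (\<lambda>x y. k (x - y))" and sym: "\<And>u. k (- u) = k u"
    and int: "integrable lborel k" and bv: "bounded_variation k"
    using assms unfolding convolution_kernel_def by blast
  obtain T V where dom: "variation_dominated T V k"
    using bounded_variation_imp_dominated[OF bv] by blast
  note [measurable] = dominated_measurable[OF dom]
  have "tame_kernel K k T V 1 (\<lambda>y m. of_bool (m = 0)) (\<lambda>y m. y) {x. \<not> isCont k x}"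
  proof
    fix y x :: real
    have e: "(\<lambda>m::nat. \<bar>of_bool (m = 0) :: real\<bar>) = (\<lambda>m. if m = 0 then 1 else 0)" by auto
    show "summable (\<lambda>m::nat. \<bar>of_bool (m = 0) :: real\<bar>)"
      unfolding e by (rule summable_If_finite) auto
    have "(\<Sum>m::nat. \<bar>of_bool (m = 0) :: real\<bar>) = 1"
      unfolding e by (subst suminf_finite[of "{0}"]) auto
    then show "(\<Sum>m::nat. \<bar>of_bool (m = 0) :: real\<bar>) \<le> 1" by simp
    have "(\<Sum>m::nat. of_bool (m = 0) * k (x - y)) = k (x - y)"
      by (subst suminf_finite[of "{0}"]) auto
    then show "K y x = (\<Sum>m::nat. of_bool (m = 0) * k (x - y))"
      using sym[of "x - y"] by (simp add: K)
    show "isCont (\<lambda>y. K y x) y" if "y - x \<notin> {x. \<not> isCont k x}"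
    proof -
      have "isCont (\<lambda>y. y - x) y" by simp
      moreover have "isCont k (y - x)" using that by simp
      ultimately show ?thesis unfolding K by (rule isCont_o2)
    qed
    show "(\<lambda>(y, x). K y x) \<in> borel_measurable (borel \<Otimes>\<^sub>M borel)"
      unfolding K by measurable
  qed (use int dom dominated_countable_discont[OF dom] in auto)
  then show ?thesis unfolding tame_def by blast
qed

text \<open>The weights in \<open>y\<close> are the values \<open>\<phi> (y - k)\<close> themselves, enumerated by the naturals.  The kernel can
jump only where some \<open>\<phi> (y - k)\<close> does, by dominated convergence for series.\<close>

lemma projection_kernel_tame:
  fixes \<phi> :: "real \<Rightarrow> real"
  assumes int: "integrable lborel \<phi>" and dom: "variation_dominated T V \<phi>"
    and summ: "\<And>x. (\<lambda>k. \<phi> (x - of_int k)) summable_on (UNIV :: int set)"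
    and bound: "\<And>x. (\<Sum>\<^sub>\<infinity>k\<in>(UNIV :: int set). \<bar>\<phi> (x - of_int k)\<bar>) \<le> C"
  shows "tame (projection_kernel \<phi>)"
proof -
  define z :: "nat \<Rightarrow> real" where "z m = of_int (int_decode m)" for m
  define S where "S = \<bar>\<phi> 0\<bar> + V"
  have S: "\<bar>\<phi> x\<bar> \<le> S" for x
    unfolding S_def by (rule dominated_bounded[OF dom])
  have bij: "bij_betw int_decode UNIV UNIV"
    by (rule bij_int_decode)
  have abs_int: "(\<lambda>k. \<bar>\<phi> (x - of_int k)\<bar>) summable_on (UNIV :: int set)" for x
    using summ[of x] summable_on_iff_abs_summable_on_real[of "\<lambda>k::int. \<phi> (x - of_int k)" UNIV] by simp
  have abs_nat: "(\<lambda>m. \<bar>\<phi> (x - z m)\<bar>) summable_on UNIV" for x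
    using abs_int[of x] summable_on_reindex_bij_betw[OF bij, of "\<lambda>k. \<bar>\<phi> (x - of_int k)\<bar>"]
    by (simp add: z_def)
  have summ_nat: "summable (\<lambda>m. \<bar>\<phi> (x - z m)\<bar>)" for x
    by (rule summable_on_imp_summable[OF abs_nat])
  have le: "(\<Sum>m. \<bar>\<phi> (x - z m)\<bar>) \<le> C" for x
  proof -
    have "(\<Sum>m. \<bar>\<phi> (x - z m)\<bar>) = (\<Sum>\<^sub>\<infinity>m. \<bar>\<phi> (x - z m)\<bar>)"
      using has_sum_imp_sums[OF has_sum_infsum[OF abs_nat]] by (simp add: sums_iff)
    also have "\<dots> = (\<Sum>\<^sub>\<infinity>k\<in>(UNIV :: int set). \<bar>\<phi> (x - of_int k)\<bar>)"
      using infsum_reindex_bij_betw[OF bij, of "\<lambda>k. \<bar>\<phi> (x - of_int k)\<bar>"] by (simp add: z_def)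
    finally show ?thesis using bound[of x] by simp
  qed
  have summ_prod: "summable (\<lambda>m. \<bar>\<phi> (y - z m) * \<phi> (x - z m)\<bar>)" for x y
  proof (rule summable_comparison_test'[of "\<lambda>m. S * \<bar>\<phi> (x - z m)\<bar>" 0])
    show "summable (\<lambda>m. S * \<bar>\<phi> (x - z m)\<bar>)" by (rule summable_mult[OF summ_nat])
  qed (auto simp: abs_mult intro!: mult_right_mono S)
  have expand: "projection_kernel \<phi> y x = (\<Sum>m. \<phi> (y - z m) * \<phi> (x - z m))" for y x
  proof -
    have "projection_kernel \<phi> y x = (\<Sum>\<^sub>\<infinity>m. \<phi> (y - z m) * \<phi> (x - z m))"
      unfolding projection_kernel_def
      using infsum_reindex_bij_betw[OF bij, of "\<lambda>k. \<phi> (y - of_int k) * \<phi> (x - of_int k)"]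
      by (simp add: z_def)
    also have "(\<lambda>m. \<phi> (y - z m) * \<phi> (x - z m)) summable_on UNIV"
      by (rule norm_summable_imp_summable_on) (use summ_prod[of y x] in \<open>simp add: abs_mult\<close>)
    then have "(\<Sum>\<^sub>\<infinity>m. \<phi> (y - z m) * \<phi> (x - z m)) = (\<Sum>m. \<phi> (y - z m) * \<phi> (x - z m))"
      using has_sum_imp_sums[OF has_sum_infsum] by (metis sums_unique)
    finally show ?thesis .
  qed
  define D where "D = (\<Union>m. (\<lambda>x. x + z m) ` {x. \<not> isCont \<phi> x})"
  note [measurable] = dominated_measurable[OF dom]
  have "tame_kernel (projection_kernel \<phi>) \<phi> T V C (\<lambda>y m. \<phi> (y - z m)) (\<lambda>y. z) D"
  proof
    show "countable D"
      unfolding D_def by (intro countable_UN countable_image dominated_countable_discont[OF dom]) auto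
    show "isCont (\<lambda>y. projection_kernel \<phi> y x) y" if "y \<notin> D" for x y
    proof -
      have "isCont \<phi> (y - z m)" for m
      proof (rule ccontr)
        assume "\<not> isCont \<phi> (y - z m)"
        then have "y \<in> (\<lambda>x. x + z m) ` {x. \<not> isCont \<phi> x}"
          by (intro image_eqI[of _ _ "y - z m"]) auto
        with that show False by (auto simp: D_def)
      qed
      then have "isCont (\<lambda>y. \<phi> (y - z m)) y" for m
        by (rule isCont_o2[rotated]) simp
      then have c: "((\<lambda>y. \<phi> (y - z m) * \<phi> (x - z m)) \<longlongrightarrow> \<phi> (y - z m) * \<phi> (x - z m)) (at y)" for m
        unfolding isCont_def by (intro tendsto_mult tendsto_const)
      have "((\<lambda>y. \<Sum>m. \<phi> (y - z m) * \<phi> (x - z m)) \<longlongrightarrow> (\<Sum>m. \<phi> (y - z m) * \<phi> (x - z m))) (at y)"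
        by (rule tannerys_theorem[OF c, where M = "\<lambda>m. S * \<bar>\<phi> (x - z m)\<bar>", THEN conjunct2, THEN conjunct2])
           (auto simp: abs_mult intro!: always_eventually mult_right_mono S summable_mult summ_nat)
      then show ?thesis unfolding isCont_def expand .
    qed
    show "(\<lambda>(y, x). projection_kernel \<phi> y x) \<in> borel_measurable (borel \<Otimes>\<^sub>M borel)"
      unfolding expand by measurable
  qed (use int dom summ_nat le expand in auto)
  then show ?thesis unfolding tame_def by blast
qed

text \<open>At each point only boundedly many integer translates are nonzero, so the bound for the sum is the
largest number of such translates times the supremum.\<close>

lemma bounded_support_integrable:
  fixes \<phi> :: "real \<Rightarrow> real"
  assumes supp: "bounded {x. \<phi> x \<noteq> 0}" and dom: "variation_dominated T V \<phi>"
  shows "integrable lborel \<phi>"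
    and "\<exists>C. \<forall>x. (\<lambda>k. \<phi> (x - of_int k)) summable_on (UNIV :: int set) \<and>
           (\<Sum>\<^sub>\<infinity>k\<in>(UNIV :: int set). \<bar>\<phi> (x - of_int k)\<bar>) \<le> C"
proof -
  define S where "S = \<bar>\<phi> 0\<bar> + V"
  have S: "\<bar>\<phi> x\<bar> \<le> S" for x
    unfolding S_def by (rule dominated_bounded[OF dom])
  have S0: "0 \<le> S" using S[of 0] by simp
  obtain R where R: "\<And>x. \<phi> x \<noteq> 0 \<Longrightarrow> \<bar>x\<bar> \<le> R"
    using supp unfolding bounded_iff by auto
  note [measurable] = dominated_measurable[OF dom]
  show "integrable lborel \<phi>"
  proof (rule Bochner_Integration.integrable_bound[of _ "\<lambda>x. S * indicator {-R..R} x"])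
    show "AE x in lborel. norm (\<phi> x) \<le> norm (S * indicator {-R..R} x)"
    proof (rule AE_I2)
      fix x show "norm (\<phi> x) \<le> norm (S * indicator {-R..R} x :: real)"
        using S[of x] R[of x] S0 by (cases "\<phi> x = 0") (auto simp: indicator_def)
    qed
    show "integrable lborel (\<lambda>x. S * indicator {-R..R} x :: real)"
      by (intro integrable_mult_right integrable_real_indicator) (auto simp: emeasure_lborel_Icc_eq)
  qed measurable
  define I where "I x = {\<lceil>x - R\<rceil>..\<lfloor>x + R\<rfloor>}" for x
  have out: "\<phi> (x - of_int k) = 0" if "k \<notin> I x" for x k
  proof (rule ccontr)
    assume "\<phi> (x - of_int k) \<noteq> 0"
    from R[OF this] have "x - R \<le> of_int k" "of_int k \<le> x + R" by linarith+
    then have "k \<in> I x" by (auto simp: I_def ceiling_le_iff le_floor_iff)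
    with that show False by simp
  qed
  have "(\<lambda>k. \<phi> (x - of_int k)) summable_on (UNIV :: int set)" for x
    by (rule finite_nonzero_values_imp_summable_on)
       (rule finite_subset[of _ "I x"], use out[of _ x] in blast, simp add: I_def)
  moreover have "(\<Sum>\<^sub>\<infinity>k\<in>(UNIV :: int set). \<bar>\<phi> (x - of_int k)\<bar>) \<le> \<bar>2 * R + 1\<bar> * S" for x
  proof -
    have "(\<Sum>\<^sub>\<infinity>k\<in>(UNIV :: int set). \<bar>\<phi> (x - of_int k)\<bar>) = (\<Sum>k\<in>I x. \<bar>\<phi> (x - of_int k)\<bar>)"
      by (subst infsum_cong_neutral[of "I x" UNIV _ "\<lambda>k. \<bar>\<phi> (x - of_int k)\<bar>"])
         (use out in \<open>auto simp: I_def\<close>)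
    also have "\<dots> \<le> of_nat (card (I x)) * S"
      by (rule sum_bounded_above) (rule S)
    also have "real (card (I x)) \<le> \<bar>2 * R + 1\<bar>"
      unfolding I_def by simp linarith
    finally show ?thesis using S0 by (simp add: mult_right_mono order_trans)
  qed
  ultimately show "\<exists>C. \<forall>x. (\<lambda>k. \<phi> (x - of_int k)) summable_on (UNIV :: int set) \<and>
           (\<Sum>\<^sub>\<infinity>k\<in>(UNIV :: int set). \<bar>\<phi> (x - of_int k)\<bar>) \<le> C" by blast
qed

lemma wavelet_kernel_tame:
  assumes "wavelet_kernel r K"
  shows "tame K"
proof -
  obtain \<phi> where K: "K = projection_kernel \<phi>"
    and supp: "bounded {x. \<phi> x \<noteq> 0}" and bv: "bounded_variation \<phi>"
    using assms unfolding wavelet_kernel_def by blast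
  obtain T V where dom: "variation_dominated T V \<phi>"
    using bounded_variation_imp_dominated[OF bv] by blast
  show ?thesis
    unfolding K
    using projection_kernel_tame[OF bounded_support_integrable(1)[OF supp dom] dom]
      bounded_support_integrable(2)[OF supp dom] by blast
qed

section \<open>Inverse square roots of cosine polynomials\<close>
definition cos_sum :: "nat \<Rightarrow> (real \<Rightarrow> real) \<Rightarrow> bool" where
  "cos_sum d f \<longleftrightarrow> (\<exists>c. \<forall>v. f v = (\<Sum>k\<le>d. c k * cos (real k * v)))"

lemma cos_sum_mono:
  assumes "cos_sum d f" "d \<le> e"
  shows "cos_sum e f"
proof -
  obtain c where c: "\<And>v. f v = (\<Sum>k\<le>d. c k * cos (real k * v))"
    using assms(1) unfolding cos_sum_def by blast
  have "f v = (\<Sum>k\<le>e. (if k \<le> d then c k else 0) * cos (real k * v))" for v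
    unfolding c by (rule sum.mono_neutral_cong_left) (use assms(2) in auto)
  then show ?thesis unfolding cos_sum_def by (intro exI[of _ "\<lambda>k. if k \<le> d then c k else 0"]) blast
qed

lemma cos_sum_add:
  assumes "cos_sum d f" "cos_sum d g"
  shows "cos_sum d (\<lambda>v. f v + g v)"
proof -
  obtain c e where c: "\<And>v. f v = (\<Sum>k\<le>d. c k * cos (real k * v))" "\<And>v. g v = (\<Sum>k\<le>d. e k * cos (real k * v))"
    using assms unfolding cos_sum_def by blast
  have "f v + g v = (\<Sum>k\<le>d. (c k + e k) * cos (real k * v))" for v
    unfolding c by (simp add: sum.distrib algebra_simps)
  then show ?thesis unfolding cos_sum_def by (intro exI[of _ "\<lambda>k. c k + e k"]) blast
qed

lemma cos_sum_cmult:
  assumes "cos_sum d f"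
  shows "cos_sum d (\<lambda>v. a * f v)"
proof -
  obtain c where c: "\<And>v. f v = (\<Sum>k\<le>d. c k * cos (real k * v))"
    using assms unfolding cos_sum_def by blast
  have "a * f v = (\<Sum>k\<le>d. (a * c k) * cos (real k * v))" for v
    unfolding c by (simp add: sum_distrib_left mult.assoc)
  then show ?thesis unfolding cos_sum_def by (intro exI[of _ "\<lambda>k. a * c k"]) blast
qed

lemma cos_sum_sum:
  assumes "finite A" "\<And>i. i \<in> A \<Longrightarrow> cos_sum d (f i)"
  shows "cos_sum d (\<lambda>v. \<Sum>i\<in>A. f i v)"
  using assms
proof (induction A)
  case empty
  show ?case unfolding cos_sum_def by (rule exI[of _ "\<lambda>_. 0"]) simp
qed (simp add: cos_sum_add)

lemma cos_sum_cos:
  assumes "k \<le> d"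
  shows "cos_sum d (\<lambda>v. cos (real k * v))"
  unfolding cos_sum_def
proof (rule exI[of _ "\<lambda>i. if i = k then 1 else 0"], rule allI)
  fix v
  show "cos (real k * v) = (\<Sum>i\<le>d. (if i = k then 1 else 0) * cos (real i * v))"
    using assms by (subst sum.mono_neutral_cong_right[where S = "{k}"]) auto
qed

lemma cos_sum_mult_cos:
  assumes "cos_sum d f"
  shows "cos_sum (Suc d) (\<lambda>v. cos v * f v)"
proof -
  obtain c where c: "\<And>v. f v = (\<Sum>k\<le>d. c k * cos (real k * v))"
    using assms unfolding cos_sum_def by blast
  have eq: "cos v * cos (real k * v) = (1/2) * (cos (real (Suc k) * v) + cos (real (if k = 0 then 1 else k - 1) * v))" for k v
    by (auto simp: cos_times_cos algebra_simps of_nat_diff) (simp add: cos_diff cos_add algebra_simps)+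
  have "cos_sum (Suc d) (\<lambda>v. \<Sum>k\<le>d. c k * ((1/2) * (cos (real (Suc k) * v) + cos (real (if k = 0 then 1 else k - 1) * v))))"
    by (intro cos_sum_sum cos_sum_cmult cos_sum_add cos_sum_cos) auto
  then show ?thesis
    unfolding c eq[symmetric] by (simp add: sum_distrib_left mult_ac)
qed

lemma cos_sum_poly:
  fixes p :: "real poly"
  shows "cos_sum (degree p) (\<lambda>v. poly p (cos v))"
proof (induction p rule: pCons_induct)
  case 0
  show ?case unfolding cos_sum_def by (rule exI[of _ "\<lambda>_. 0"]) simp
next
  case (pCons a p)
  show ?case
  proof (cases "p = 0")
    case True
    then show ?thesis unfolding cos_sum_def by (intro exI[of _ "\<lambda>_. a"]) simp
  next
    case False
    have "cos_sum (Suc (degree p)) (\<lambda>v. a * cos (real 0 * v) + cos v * poly p (cos v))"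
      by (intro cos_sum_add cos_sum_cmult cos_sum_cos cos_sum_mult_cos pCons.IH) simp
    then show ?thesis using False by simp
  qed
qed

lemma integral_cos_multiple:
  "((\<lambda>v. cos (of_int k * v)) has_integral (if k = 0 then 2 * pi else 0)) {0..2 * pi}"
proof (cases "k = 0")
  case True
  then show ?thesis using has_integral_const_real[of "1::real" 0 "2 * pi"] by simp
next
  case False
  have "((\<lambda>v. cos (of_int k * v)) has_integral
      (sin (of_int k * (2 * pi)) / of_int k - sin (of_int k * 0) / of_int k)) {0..2 * pi}"
  proof (rule fundamental_theorem_of_calculus)
    fix v :: real
    show "((\<lambda>v. sin (of_int k * v) / of_int k) has_vector_derivative cos (of_int k * v)) (at v within {0..2 * pi})"
      using False by (auto intro!: derivative_eq_intros simp flip: has_real_derivative_iff_has_vector_derivative)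
  qed simp
  moreover have "sin (of_int k * (2 * pi)) = 0"
    by (metis mult.commute mult.left_commute sin_integer_2pi Ints_of_int)
  ultimately show ?thesis using False by simp
qed

text \<open>Orthogonality of the cosines over a period expresses a coefficient as an integral mean of \<open>f\<close>.  The
factor 2 comes from the mean square \<open>1 / 2\<close> of a nonconstant cosine.\<close>

lemma cos_sum_coefficient_bound:
  assumes f: "\<And>v. f v = (\<Sum>k\<le>d. c k * cos (real k * v))" and M: "\<And>v. \<bar>f v\<bar> \<le> M" and l: "l \<le> d"
  shows "\<bar>c l\<bar> \<le> 2 * M"
proof -
  have prod: "((\<lambda>v. cos (real k * v) * cos (real l * v)) has_integral
      ((if int k - int l = 0 then 2 * pi else 0) + (if int k + int l = 0 then 2 * pi else 0)) / 2) {0..2 * pi}" for k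
  proof -
    have "(\<lambda>v. cos (real k * v) * cos (real l * v)) =
        (\<lambda>v. (cos (of_int (int k - int l) * v) + cos (of_int (int k + int l) * v)) / 2)"
      by (rule ext) (simp add: cos_times_cos algebra_simps)
    then show ?thesis
      using has_integral_divide[OF has_integral_add[OF integral_cos_multiple[of "int k - int l"] integral_cos_multiple[of "int k + int l"]], of 2]
      by (simp only:)
  qed
  define s where "s = c l * (((if int l - int l = 0 then 2 * pi else 0) + (if int l + int l = 0 then 2 * pi else 0)) / 2)"
  have "((\<lambda>v. \<Sum>k\<le>d. c k * (cos (real k * v) * cos (real l * v))) has_integral
     (\<Sum>k\<le>d. c k * (((if int k - int l = 0 then 2 * pi else 0) + (if int k + int l = 0 then 2 * pi else 0)) / 2))) {0..2 * pi}"
    by (intro has_integral_sum has_integral_mult_right prod) auto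
  also have "(\<Sum>k\<le>d. c k * (((if int k - int l = 0 then 2 * pi else 0) + (if int k + int l = 0 then 2 * pi else 0)) / 2)) = s"
  proof -
    have "(\<Sum>k\<le>d. c k * (((if int k - int l = 0 then 2 * pi else 0) + (if int k + int l = 0 then 2 * pi else 0)) / 2)) =
        (\<Sum>k\<in>{l}. c k * (((if int k - int l = 0 then 2 * pi else 0) + (if int k + int l = 0 then 2 * pi else 0)) / 2))"
      by (rule sum.mono_neutral_right) (use l in auto)
    then show ?thesis by (simp add: s_def)
  qed
  also have "(\<lambda>v. \<Sum>k\<le>d. c k * (cos (real k * v) * cos (real l * v))) = (\<lambda>v. f v * cos (real l * v))"
    unfolding f by (simp add: sum_distrib_right mult.assoc)
  finally have int: "((\<lambda>v. f v * cos (real l * v)) has_integral s) {0..2 * pi}" .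
  have M0: "0 \<le> M" using M[of 0] by linarith
  have "norm s \<le> M * Henstock_Kurzweil_Integration.content {0..2 * pi}"
  proof (rule has_integral_bound_real[OF M0 finite.emptyI int])
    fix v :: real
    have "\<bar>f v * cos (real l * v)\<bar> \<le> M * 1"
      unfolding abs_mult by (rule mult_mono) (use M M0 abs_cos_le_one in auto)
    then show "norm (f v * cos (real l * v)) \<le> M" by simp
  qed
  then have b: "\<bar>s\<bar> \<le> 2 * pi * M" by (simp add: mult.commute)
  have "pi * \<bar>c l\<bar> \<le> \<bar>s\<bar>"
    unfolding s_def abs_mult by (cases "l = 0") auto
  with b have "pi * \<bar>c l\<bar> \<le> pi * (2 * M)" by linarith
  then show ?thesis by simp
qed

lemma abs_half_gchoose_le_1: "\<bar>(-1/2 :: real) gchoose n\<bar> \<le> 1"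
proof (induction n)
  case (Suc n)
  have "((-1/2 :: real) gchoose Suc n) = ((-1/2) gchoose n) * ((-1/2 - real n) / real (Suc n))"
    by (simp add: gbinomial_absorption' gbinomial_Suc gbinomial_prod_rev divide_simps)
  moreover have "\<bar>(-1/2 - real n) / real (Suc n)\<bar> \<le> 1" by (simp add: divide_simps)
  ultimately show ?case
    using Suc.IH mult_mono[of "\<bar>(-1/2 :: real) gchoose n\<bar>" 1 "\<bar>(-1/2 - real n) / real (Suc n)\<bar>" 1] by (simp add: abs_mult)
qed simp

text \<open>Expand \<open>x powr (-1/2)\<close> in powers of \<open>1 - x\<close>.  Since \<open>1 - p (cos v)\<close> takes values in \<open>[0, q]\<close> with
\<open>q < 1\<close>, its \<open>m\<close>-th power is a cosine polynomial of degree at most \<open>m d\<close> with coefficients at most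
\<open>2 q^m\<close>.  The double series is therefore dominated by \<open>(m d + 1) q^m\<close> and may be summed by
frequency.  This is Wiener's lemma in a case in which the geometric decay replaces Banach algebras.\<close>

lemma cosine_wiener:
  fixes p :: "real poly"
  assumes \<rho>: "0 < \<rho>" and p: "\<And>v. \<rho> \<le> poly p (cos v)" "\<And>v. poly p (cos v) \<le> 1"
  shows "\<exists>E. summable (\<lambda>k. \<bar>E k\<bar>) \<and> (\<forall>v. (\<Sum>k. E k * cos (real k * v)) = 1 / sqrt (poly p (cos v)))"
proof -
  define d where "d = degree (1 - p)"
  define q where "q = 1 - \<rho>"
  have q: "0 \<le> q" "q < 1" using p(1)[of 0] p(2)[of 0] \<rho> unfolding q_def by auto
  have range: "0 \<le> 1 - poly p (cos v)" "1 - poly p (cos v) \<le> q" for v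
    using p[of v] unfolding q_def by auto
  have "\<exists>c. (\<forall>k. m * d < k \<longrightarrow> c k = 0) \<and> (\<forall>v. (1 - poly p (cos v)) ^ m = (\<Sum>k\<le>m * d. c k * cos (real k * v)))" for m
  proof -
    have "cos_sum (m * d) (\<lambda>v. poly ((1 - p) ^ m) (cos v))"
      by (rule cos_sum_mono[OF cos_sum_poly]) (simp add: d_def mult.commute[of m] degree_power_le)
    then obtain c where "\<forall>v. (1 - poly p (cos v)) ^ m = (\<Sum>k\<le>m * d. c k * cos (real k * v))"
      unfolding cos_sum_def by auto
    then show ?thesis by (intro exI[of _ "\<lambda>k. if k \<le> m * d then c k else 0"]) auto
  qed
  then obtain c where c0: "\<And>m k. m * d < k \<Longrightarrow> c m k = 0"
    and c: "\<And>m v. (1 - poly p (cos v)) ^ m = (\<Sum>k\<le>m * d. c m k * cos (real k * v))"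
    by metis
  have cb: "\<bar>c m k\<bar> \<le> 2 * q ^ m" for m k
  proof (cases "k \<le> m * d")
    case True
    show ?thesis
    proof (rule cos_sum_coefficient_bound[OF c _ True])
      show "\<bar>(1 - poly p (cos v)) ^ m\<bar> \<le> q ^ m" for v
        using range[of v] by (simp add: power_mono)
    qed
  qed (use c0 q in auto)
  define \<gamma> where "\<gamma> m = ((-1/2 :: real) gchoose m) * (-1) ^ m" for m :: nat
  have \<gamma>: "\<bar>\<gamma> m\<bar> \<le> 1" for m
    unfolding \<gamma>_def using abs_half_gchoose_le_1[of m] by (simp add: abs_mult power_abs)
  define F where "F = (\<lambda>(m, k). \<gamma> m * c m k)"
  have rows: "(\<lambda>k. norm (F (m, k))) summable_on UNIV" for m
    by (rule finite_nonzero_values_imp_summable_on, rule finite_subset[of _ "{..m * d}"])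
       (use c0[of m] in \<open>auto simp: F_def not_less[symmetric]\<close>)
  have row_sum: "(\<Sum>\<^sub>\<infinity>k. norm (F (m, k))) \<le> 2 * real (d + 1) * (real (Suc m) * q ^ m)" for m
  proof -
    have "(\<Sum>\<^sub>\<infinity>k. norm (F (m, k))) = (\<Sum>k\<le>m * d. norm (F (m, k)))"
      by (subst infsum_cong_neutral[of "{..m * d}" UNIV _ "\<lambda>k. norm (F (m, k))"]) (use c0[of m] in \<open>auto simp: F_def\<close>)
    also have "\<dots> \<le> real (card {..m * d}) * (2 * q ^ m)"
    proof (rule sum_bounded_above)
      fix k show "norm (F (m, k)) \<le> 2 * q ^ m"
        unfolding F_def using mult_mono[OF \<gamma>[of m] cb[of m k]] by (simp add: abs_mult)
    qed
    also have "\<dots> \<le> real ((d + 1) * Suc m) * (2 * q ^ m)"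
      by (rule mult_right_mono) (use q in \<open>auto simp: algebra_simps\<close>)
    finally show ?thesis by (simp add: algebra_simps)
  qed
  have geo: "summable (\<lambda>m. 2 * real (d + 1) * (real (Suc m) * q ^ m))"
    by (rule summable_mult) (use geometric_deriv_sums[of q] q in \<open>auto simp: sums_iff\<close>)
  have row_nonneg: "0 \<le> (\<Sum>\<^sub>\<infinity>k. norm (F (m, k)))" for m by (rule infsum_nonneg) simp
  have "norm (norm (\<Sum>\<^sub>\<infinity>k. norm (F (m, k)))) \<le> 2 * real (d + 1) * (real (Suc m) * q ^ m)" for m
    using row_nonneg[of m] row_sum[of m] by (simp only: real_norm_def abs_of_nonneg abs_abs)
  then have "(\<lambda>m. \<Sum>\<^sub>\<infinity>k. norm (F (m, k))) summable_on UNIV"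
    by (intro norm_summable_imp_summable_on summable_comparison_test'[OF geo, of 0])
  then have absF: "(\<lambda>x. norm (F x)) summable_on UNIV \<times> UNIV"
    using rows by (subst Infinite_Sum.abs_summable_on_Sigma_iff) (auto simp: infsum_nonneg)
  have absF': "(\<lambda>x. norm ((\<lambda>(k, m). \<gamma> m * c m k) x)) summable_on UNIV \<times> UNIV"
  proof -
    have "(\<lambda>x. norm (F x)) summable_on prod.swap ` (UNIV \<times> UNIV)" using absF by simp
    then have "((\<lambda>x. norm (F x)) \<circ> prod.swap) summable_on UNIV \<times> UNIV"
      by (subst (asm) summable_on_reindex) auto
    then show ?thesis by (simp add: F_def comp_def case_prod_unfold)
  qed
  define E where "E k = (\<Sum>\<^sub>\<infinity>m. \<gamma> m * c m k)" for k
  have colE: "(\<lambda>k. \<Sum>\<^sub>\<infinity>m. norm (\<gamma> m * c m k)) summable_on UNIV"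
    and col: "(\<lambda>m. norm (\<gamma> m * c m k)) summable_on UNIV" for k
    using absF' unfolding Infinite_Sum.abs_summable_on_Sigma_iff by (auto simp: infsum_nonneg)
  have E_le: "\<bar>E k\<bar> \<le> (\<Sum>\<^sub>\<infinity>m. norm (\<gamma> m * c m k))" for k
    unfolding E_def using norm_infsum_bound[OF col[of k]] by simp
  have sumE: "summable (\<lambda>k. \<bar>E k\<bar>)"
    by (rule summable_comparison_test'[OF summable_on_imp_summable[OF colE], of 0]) (use E_le in simp)
  have "(\<Sum>k. E k * cos (real k * v)) = 1 / sqrt (poly p (cos v))" for v
  proof -
    define G where "G m k = \<gamma> m * c m k * cos (real k * v)" for m k
    have absG: "(\<lambda>x. norm ((\<lambda>(m, k). G m k) x)) summable_on UNIV \<times> UNIV"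
      by (rule Infinite_Sum.abs_summable_on_comparison_test[OF absF]) 
         (auto simp: G_def F_def abs_mult intro!: mult_left_le abs_cos_le_one)
    have "(\<Sum>k. E k * cos (real k * v)) = (\<Sum>\<^sub>\<infinity>k. E k * cos (real k * v))"
    proof -
      have "summable (\<lambda>k. norm (E k * cos (real k * v)))"
        by (rule summable_comparison_test'[OF sumE, of 0]) (auto simp: abs_mult intro!: mult_left_le abs_cos_le_one)
      then show ?thesis
        using has_sum_imp_sums[OF has_sum_infsum[OF norm_summable_imp_summable_on]] by (metis sums_unique)
    qed
    also have "\<dots> = (\<Sum>\<^sub>\<infinity>k. \<Sum>\<^sub>\<infinity>m. G m k)"
      unfolding E_def G_def by (simp add: infsum_cmult_left' )
    also have "\<dots> = (\<Sum>\<^sub>\<infinity>m. \<Sum>\<^sub>\<infinity>k. G m k)"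
      by (rule infsum_swap_banach[symmetric]) (rule abs_summable_summable[OF absG])
    also have "\<dots> = (\<Sum>\<^sub>\<infinity>m. \<gamma> m * (1 - poly p (cos v)) ^ m)"
    proof (rule infsum_cong)
      fix m
      have "(\<Sum>\<^sub>\<infinity>k. G m k) = (\<Sum>k\<le>m * d. G m k)"
        by (subst infsum_cong_neutral[of "{..m * d}" UNIV _ "G m"]) (use c0[of m] in \<open>auto simp: G_def\<close>)
      then show "(\<Sum>\<^sub>\<infinity>k. G m k) = \<gamma> m * (1 - poly p (cos v)) ^ m"
        unfolding c by (simp add: G_def sum_distrib_left mult.assoc)
    qed
    also have "\<dots> = (\<Sum>m. \<gamma> m * (1 - poly p (cos v)) ^ m)"
    proof -
      have "summable (\<lambda>m. norm (\<gamma> m * (1 - poly p (cos v)) ^ m))"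
      proof (rule summable_comparison_test'[OF summable_geometric[of q], of 0])
        show "norm q < 1" using q by simp
        show "norm (norm (\<gamma> m * (1 - poly p (cos v)) ^ m)) \<le> q ^ m" for m
          using mult_mono[OF \<gamma>[of m], of "\<bar>(1 - poly p (cos v)) ^ m\<bar>" "q ^ m"] range[of v] q(1)
          by (simp add: abs_mult power_abs power_mono)
      qed
      then show ?thesis
        using has_sum_imp_sums[OF has_sum_infsum[OF norm_summable_imp_summable_on]] by (metis sums_unique)
    qed
    also have "\<dots> = (1 + (poly p (cos v) - 1)) powr (-1/2)"
    proof -
      have "\<bar>poly p (cos v) - 1\<bar> < 1" using range[of v] q by auto
      from gen_binomial_real[OF this, of "-1/2"] have
        "(\<lambda>n. \<gamma> n * (1 - poly p (cos v)) ^ n) sums (1 + (poly p (cos v) - 1)) powr (-1/2)"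
        unfolding \<gamma>_def mult.assoc power_mult_distrib[symmetric] by simp
      then show ?thesis by (rule sums_unique[symmetric])
    qed
    also have "\<dots> = 1 / sqrt (poly p (cos v))"
      using p(1)[of v] \<rho> by (simp add: powr_minus_divide powr_half_sqrt divide_powr_uminus)
    finally show ?thesis .
  qed
  then show ?thesis using sumE by blast
qed

section \<open>Eisenstein series\<close>

text \<open>The sum of \<open>(z + k)^(-n-1)\<close> over the integers \<open>k\<close> is this polynomial in \<open>cos (\<pi> z)\<close> times the
\<open>(n+1)\<close>-st power of \<open>\<pi> / sin (\<pi> z)\<close>.  For \<open>n = 0\<close> this is the expansion of the cotangent, and the
recursion is differentiation with respect to \<open>z\<close>.\<close>

fun cot_poly :: "nat \<Rightarrow> real poly" where
  "cot_poly 0 = [:0, 1:]"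
| "cot_poly (Suc n) = [:0, 1:] * cot_poly n + smult (1 / real (Suc n)) ([:1, 0, -1:] * pderiv (cot_poly n))"

lemma sin_pi_mult_pos:
  fixes z :: real
  assumes "0 < z" "z < 1"
  shows "0 < sin (pi * z)"
proof (rule sin_gt_zero)
  show "0 < pi * z" using assms by simp
  have "pi * z < pi * 1" by (rule mult_strict_left_mono[OF assms(2) pi_gt_zero])
  then show "pi * z < pi" by simp
qed

text \<open>The logarithmic derivative of the reflection formula for the Gamma function.\<close>

lemma digamma_reflection:
  fixes z :: real
  assumes "0 < z" "z < 1"
  shows "Digamma z - Digamma (1 - z) = - pi * cos (pi * z) / sin (pi * z)"
proof -
  have refl: "Gamma x * Gamma (1 - x) * sin (pi * x) = pi" if "x \<in> {0<..<1}" for x :: real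
  proof -
    have s: "sin (pi * x) > 0" using that by (intro sin_pi_mult_pos) auto
    have "complex_of_real (Gamma x * Gamma (1 - x)) = complex_of_real (pi / sin (pi * x))"
      using Gamma_reflection_complex[of "complex_of_real x"]
      by (simp add: Gamma_complex_of_real[symmetric] sin_of_real[symmetric])
    then have "Gamma x * Gamma (1 - x) = pi / sin (pi * x)" by (simp only: of_real_eq_iff)
    then show ?thesis using s by simp
  qed
  have ni: "z \<notin> \<int>\<^sub>\<le>\<^sub>0" "1 - z \<notin> \<int>\<^sub>\<le>\<^sub>0" using assms by (auto elim!: nonpos_Ints_cases)
  have s: "sin (pi * z) > 0" by (rule sin_pi_mult_pos[OF assms])
  have G: "Gamma z > 0" "Gamma (1 - z) > 0" using assms by (auto intro!: Gamma_real_pos)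
  let ?d = "Gamma z * Gamma (1 - z) * ((Digamma z - Digamma (1 - z)) * sin (pi * z) + pi * cos (pi * z))"
  have "((\<lambda>x. Gamma x * Gamma (1 - x) * sin (pi * x)) has_real_derivative ?d) (at z)"
  proof -
    have "((\<lambda>x. Gamma (1 - x)) has_real_derivative Gamma (1 - z) * Digamma (1 - z) * (- 1)) (at z)"
      by (rule DERIV_chain2[where f = Gamma and g = "\<lambda>x. 1 - x", OF has_field_derivative_Gamma[OF ni(2)]]) (auto intro!: derivative_eq_intros)
    moreover have "((\<lambda>x. sin (pi * x)) has_real_derivative cos (pi * z) * pi) (at z)"
      by (auto intro!: derivative_eq_intros)
    ultimately show ?thesis
      using DERIV_mult[OF DERIV_mult[OF has_field_derivative_Gamma[OF ni(1)]]] by (fastforce simp: algebra_simps)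
  qed
  moreover have "((\<lambda>x. Gamma x * Gamma (1 - x) * sin (pi * x)) has_real_derivative 0) (at z)"
    by (rule has_field_derivative_transform_within_open[of "\<lambda>_. pi" _ _ "{0<..<1}"]) (use assms refl in auto)
  ultimately have "?d = 0" by (rule DERIV_unique)
  then have "(Digamma z - Digamma (1 - z)) * sin (pi * z) + pi * cos (pi * z) = 0"
    using G by simp
  then show ?thesis using s by (simp add: field_simps)
qed

text \<open>The two halves of the series, over \<open>k \<ge> 0\<close> and \<open>k < 0\<close>, are polygamma values at \<open>z\<close> and \<open>1 - z\<close>.
Differentiating the reflection formula \<open>n\<close> times evaluates their sum.\<close>

lemma eisenstein_polygamma:
  fixes z :: real
  assumes "0 < z" "z < 1"
  shows "(-1) ^ Suc n * (Polygamma n z + (-1) ^ Suc n * Polygamma n (1 - z)) / fact n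
    = poly (cot_poly n) (cos (pi * z)) * (pi / sin (pi * z)) ^ Suc n"
  using assms
proof (induction n arbitrary: z)
  case 0
  then show ?case using digamma_reflection[of z] by simp
next
  case (Suc n)
  have ni: "z \<notin> \<int>\<^sub>\<le>\<^sub>0" "1 - z \<notin> \<int>\<^sub>\<le>\<^sub>0" using Suc.prems by (auto elim!: nonpos_Ints_cases)
  have s: "sin (pi * z) > 0" by (rule sin_pi_mult_pos[OF Suc.prems])
  let ?L = "\<lambda>n z. (-1) ^ Suc n * (Polygamma n z + (-1) ^ Suc n * Polygamma n (1 - z)) / fact n"
  let ?R = "\<lambda>n z. poly (cot_poly n) (cos (pi * z)) * (pi / sin (pi * z)) ^ Suc n"
  have dL: "(?L n has_real_derivative - real (Suc n) * ?L (Suc n) z) (at z)"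
  proof -
    define e :: real where "e = (-1) ^ Suc n"
    have "((\<lambda>z. (e / fact n) * (Polygamma n z + e * Polygamma n (1 - z))) has_real_derivative
        (e / fact n) * (Polygamma (Suc n) z - e * Polygamma (Suc n) (1 - z))) (at z)"
      by (rule derivative_eq_intros refl ni)+ simp
    moreover have "(e / fact n) * (Polygamma (Suc n) z - e * Polygamma (Suc n) (1 - z)) =
        - real (Suc n) * (- e * (Polygamma (Suc n) z - e * Polygamma (Suc n) (1 - z)) / fact (Suc n))"
      by (simp add: divide_simps del: of_nat_Suc)
    ultimately show ?thesis by (simp add: e_def del: of_nat_Suc fact_Suc)
  qed
  define S Co where "S = sin (pi * z)" and "Co = cos (pi * z)"
  have SC: "S\<^sup>2 = 1 - Co\<^sup>2" unfolding S_def Co_def by (simp add: sin_squared_eq)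
  have S0: "S > 0" using s by (simp add: S_def)
  have dinv: "((\<lambda>z. pi / sin (pi * z)) has_real_derivative - (pi\<^sup>2 * Co / S\<^sup>2)) (at z)"
    by (rule derivative_eq_intros refl)+ (use s in \<open>auto simp: S_def Co_def power2_eq_square\<close>)
  have dcos: "((\<lambda>z. cos (pi * z)) has_real_derivative - (pi * S)) (at z)"
    by (rule derivative_eq_intros refl)+ (auto simp: S_def)
  have dpoly: "((\<lambda>z. poly (cot_poly n) (cos (pi * z))) has_real_derivative poly (pderiv (cot_poly n)) Co * (- (pi * S))) (at z)"
    unfolding Co_def by (rule DERIV_chain2[OF poly_DERIV dcos])
  have dR: "(?R n has_real_derivative
      poly (pderiv (cot_poly n)) Co * (- (pi * S)) * (pi / S) ^ Suc n
      + real (Suc n) * (- (pi\<^sup>2 * Co / S\<^sup>2) * (pi / S) ^ n) * poly (cot_poly n) Co) (at z)"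
    using DERIV_mult[OF dpoly DERIV_power_Suc[OF dinv, of n]] by (simp add: S_def Co_def algebra_simps)
  have "(?L n has_real_derivative
      poly (pderiv (cot_poly n)) Co * (- (pi * S)) * (pi / S) ^ Suc n
      + real (Suc n) * (- (pi\<^sup>2 * Co / S\<^sup>2) * (pi / S) ^ n) * poly (cot_poly n) Co) (at z)"
    by (rule has_field_derivative_transform_within_open[OF dR, of "{0<..<1}"]) (use Suc.prems Suc.IH in auto)
  then have "- real (Suc n) * ?L (Suc n) z = poly (pderiv (cot_poly n)) Co * (- (pi * S)) * (pi / S) ^ Suc n
      + real (Suc n) * (- (pi\<^sup>2 * Co / S\<^sup>2) * (pi / S) ^ n) * poly (cot_poly n) Co"
    by (rule DERIV_unique[OF dL])
  also have "\<dots> = - real (Suc n) * ((Co * poly (cot_poly n) Co + S\<^sup>2 * poly (pderiv (cot_poly n)) Co / real (Suc n)) * (pi / S) ^ Suc (Suc n))"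
  proof -
    define w m where "w = (pi / S) ^ n" and "m = real (Suc n)"
    have "m > 0" by (simp add: m_def)
    then show ?thesis using S0
      unfolding power_Suc w_def[symmetric] m_def[symmetric] by (simp add: field_simps power2_eq_square)
  qed
  also have "Co * poly (cot_poly n) Co + S\<^sup>2 * poly (pderiv (cot_poly n)) Co / real (Suc n) = poly (cot_poly (Suc n)) Co"
    unfolding SC by (simp add: power2_eq_square algebra_simps add_divide_distrib[symmetric] del: of_nat_Suc)
  finally have "?L (Suc n) z = poly (cot_poly (Suc n)) Co * (pi / S) ^ Suc (Suc n)"
    by (rule mult_left_cancel[THEN iffD1, rotated]) simp
  then show ?case unfolding S_def Co_def .
qed

lemma cot_poly_1: "poly (cot_poly n) 1 = 1"
  by (induction n) auto

text \<open>For odd \<open>n\<close> the polynomial is even, which makes it independent of the sign ambiguity of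
\<open>cos (u / 2)\<close> under \<open>u \<mapsto> u + 2 \<pi>\<close>.\<close>

lemma cot_poly_minus: "poly (cot_poly n) (- x) = (-1) ^ Suc n * poly (cot_poly n) x"
proof -
  have "pcompose (cot_poly n) [:0, -1:] = smult ((-1) ^ Suc n) (cot_poly n)"
  proof (induction n)
    case 0
    show ?case by (simp add: pcompose_pCons)
  next
    case (Suc n)
    have "pderiv (pcompose (cot_poly n) [:0, -1:]) = pcompose (pderiv (cot_poly n)) [:0, -1:] * [:-1:]"
      by (simp add: pderiv_pcompose pderiv_pCons)
    then have "smult ((-1) ^ Suc n) (pderiv (cot_poly n)) = - pcompose (pderiv (cot_poly n)) [:0, -1:]"
      unfolding Suc.IH pderiv_smult by simp
    then have "pcompose (pderiv (cot_poly n)) [:0, -1:] = - smult ((-1) ^ Suc n) (pderiv (cot_poly n))"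
      by (metis minus_minus)
    then have d: "pcompose (pderiv (cot_poly n)) [:0, -1:] = smult ((-1) ^ Suc (Suc n)) (pderiv (cot_poly n))"
      by simp
    have "pcompose [:1, 0, -1:] [:0, -1 :: real:] = [:1, 0, -1:]" "pcompose [:0, 1:] [:0, -1 :: real:] = [:0, -1:]"
      by (simp_all add: pcompose_pCons)
    then show ?case
      unfolding cot_poly.simps pcompose_add pcompose_mult pcompose_smult Suc.IH d
      by (simp only:) (simp add: smult_add_right)
  qed
  then have "poly (pcompose (cot_poly n) [:0, -1:]) x = poly (smult ((-1) ^ Suc n) (cot_poly n)) x" by simp
  then show ?thesis by (simp add: poly_pcompose)
qed

lemma eisenstein_sum:
  fixes z :: real
  assumes z: "0 < z" "z < 1" and n: "odd n"
  shows "((\<lambda>k. 1 / (z + of_int k) ^ Suc n) has_sum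
    poly (cot_poly n) (cos (pi * z)) * (pi / sin (pi * z)) ^ Suc n) (UNIV :: int set)"
proof -
  let ?f = "\<lambda>k::int. 1 / (z + of_int k) ^ Suc n"
  have n0: "0 < n" and ev: "even (Suc n)" using n by (auto intro: Nat.gr0I)
  have nn: "0 \<le> 1 / w ^ Suc n" for w :: real using ev by (simp add: zero_le_even_power del: power_Suc)
  have a: "(\<lambda>k. 1 / (z + of_nat k) ^ Suc n) sums (Polygamma n z / fact n)"
    using Polygamma_LIMSEQ[of z n] z n0 ev by (simp add: inverse_eq_divide del: power_Suc)
  have b: "(\<lambda>k. 1 / (1 - z + of_nat k) ^ Suc n) sums (Polygamma n (1 - z) / fact n)"
    using Polygamma_LIMSEQ[of "1 - z" n] z n0 ev by (simp add: inverse_eq_divide del: power_Suc)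
  have A: "(?f has_sum Polygamma n z / fact n) (range int)"
    using sums_nonneg_imp_has_sum[OF a nn] by (subst has_sum_reindex) (auto simp: comp_def)
  have eq: "?f (- 1 - int k) = 1 / (1 - z + of_nat k) ^ Suc n" for k
  proof -
    have "(z + of_int (- 1 - int k)) ^ Suc n = (- (z + of_int (- 1 - int k))) ^ Suc n"
      using ev by (metis power_minus_even)
    then show ?thesis by (simp add: algebra_simps del: power_Suc)
  qed
  have comp: "?f \<circ> (\<lambda>k. - 1 - int k) = (\<lambda>k. 1 / (1 - z + of_nat k) ^ Suc n)"
    using eq by (simp only: comp_def)
  have B: "(?f has_sum Polygamma n (1 - z) / fact n) (range (\<lambda>k. - 1 - int k))"
    by (subst has_sum_reindex) (simp add: inj_on_def, unfold comp, rule sums_nonneg_imp_has_sum[OF b nn])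
  have U: "(UNIV :: int set) = range int \<union> range (\<lambda>k. - 1 - int k)"
  proof -
    have "k \<in> range int \<union> range (\<lambda>k. - 1 - int k)" for k :: int
    proof (cases "0 \<le> k")
      case True
      then have "k = int (nat k)" by simp
      then show ?thesis by blast
    next
      case False
      then have "k = - 1 - int (nat (- 1 - k))" by simp
      then show ?thesis by blast
    qed
    then show ?thesis by blast
  qed
  have "(?f has_sum (Polygamma n z / fact n + Polygamma n (1 - z) / fact n)) UNIV"
    unfolding U by (rule has_sum_Un_disjoint[OF A B]) auto
  also have "Polygamma n z / fact n + Polygamma n (1 - z) / fact n =
      poly (cot_poly n) (cos (pi * z)) * (pi / sin (pi * z)) ^ Suc n"
    using eisenstein_polygamma[OF z, of n] ev by (simp add: add_divide_distrib del: power_Suc)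
  finally show ?thesis .
qed

section \<open>Fourier transforms\<close>
lemma fourier_eq_char:
  assumes int: "integrable lborel h" and nn: "\<And>x. 0 \<le> h x"
  shows "fourier h (- t) = (CLINT x | density lborel (\<lambda>x. ennreal (h x)). iexp (t * x))"
  using int nn
  by (subst integral_density) (auto simp: fourier_def cis_conv_exp scaleR_conv_of_real)

lemma fourier_scale: "fourier (\<lambda>x. a * h x) t = of_real a * fourier h t"
  unfolding fourier_def by (simp add: mult.assoc)

lemma integrable_fourier:
  assumes "integrable lborel h"
  shows "integrable lborel (\<lambda>x. complex_of_real (h x) * cis (- (u * x)))"
proof (rule Bochner_Integration.integrable_bound[OF assms])
  have [measurable]: "h \<in> borel_measurable lborel" using assms by (rule borel_measurable_integrable)
  have [measurable]: "cis \<in> borel_measurable borel"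
    by (intro borel_measurable_continuous_onI continuous_intros)
  show "(\<lambda>x. complex_of_real (h x) * cis (- (u * x))) \<in> borel_measurable lborel"
    by measurable
qed (auto simp: norm_mult)

lemma fourier_diff:
  assumes "integrable lborel f" "integrable lborel g"
  shows "fourier (\<lambda>x. f x - g x) u = fourier f u - fourier g u"
  unfolding fourier_def using integrable_fourier[OF assms(1), of u] integrable_fourier[OF assms(2), of u]
  by (simp add: left_diff_distrib)

lemma fourier_zero:
  assumes "integrable lborel h" 
  shows "fourier h 0 = of_real (\<integral>x. h x \<partial>lborel)"
  unfolding fourier_def by simp

text \<open>The positive and the negative part of \<open>f - g\<close> have the same transform, in particular the same mass.
If the mass is positive, normalizing turns them into densities with the same characteristic function,
and Levy's theorem identifies these.\<close>

lemma fourier_unique: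
  assumes f: "integrable lborel f" and g: "integrable lborel g"
    and eq: "\<And>u. fourier f u = fourier g u"
  shows "AE x in lborel. f x = g x"
proof -
  define h where "h x = f x - g x" for x
  have h: "integrable lborel h" unfolding h_def using f g by auto
  have [measurable]: "h \<in> borel_measurable borel" using borel_measurable_integrable[OF h] by simp
  define p where "p x = max 0 (h x)" for x
  define q where "q x = max 0 (- h x)" for x
  have p: "integrable lborel p" and q: "integrable lborel q"
    unfolding p_def q_def using h by (auto intro!: integrable_max)
  have nn: "0 \<le> p x" "0 \<le> q x" for x unfolding p_def q_def by auto
  have [measurable]: "p \<in> borel_measurable borel" "q \<in> borel_measurable borel"
    unfolding p_def q_def by measurable
  have hpq: "h = (\<lambda>x. p x - q x)" unfolding p_def q_def by auto
  have zero: "fourier h u = 0" for u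
    unfolding h_def using fourier_diff[OF f g] eq by simp
  have four: "fourier p u = fourier q u" for u
    using zero[of u] fourier_diff[OF p q, of u] unfolding hpq[symmetric] by simp
  define c where "c = (\<integral>x. p x \<partial>lborel)"
  have cq: "(\<integral>x. q x \<partial>lborel) = c"
    using four[of 0] unfolding fourier_zero[OF p] fourier_zero[OF q] c_def by simp
  have c0: "0 \<le> c" unfolding c_def by (rule Bochner_Integration.integral_nonneg) (rule nn)
  have "AE x in lborel. p x = q x"
  proof (cases "c = 0")
    case True
    have "AE x in lborel. p x = 0"
      using integral_nonneg_eq_0_iff_AE[OF p] nn True unfolding c_def by auto
    moreover have "AE x in lborel. q x = 0"
      using integral_nonneg_eq_0_iff_AE[OF q] nn True cq by auto
    ultimately show ?thesis by eventually_elim simp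
  next
    case False
    then have c: "0 < c" using c0 by simp
    have dist: "real_distribution (density lborel (\<lambda>x. ennreal (1/c * k x)))"
      if k: "integrable lborel k" "\<And>x. 0 \<le> k x" "(\<integral>x. k x \<partial>lborel) = c" "k \<in> borel_measurable borel" for k
    proof -
      note [measurable] = k(4)
      have "(\<integral>\<^sup>+x. ennreal (1/c * k x) \<partial>lborel) = ennreal (\<integral>x. 1/c * k x \<partial>lborel)"
        by (rule nn_integral_eq_integral) (use k c in auto)
      also have "\<dots> = 1" using k c by simp
      finally have "prob_space (density lborel (\<lambda>x. ennreal (1/c * k x)))"
        by (intro prob_spaceI) (simp add: emeasure_density)
      then show ?thesis by (simp add: real_distribution_def real_distribution_axioms_def)
    qed
    have "density lborel (\<lambda>x. ennreal (1/c * p x)) = density lborel (\<lambda>x. ennreal (1/c * q x))"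
    proof (rule Levy_uniqueness)
      show "real_distribution (density lborel (\<lambda>x. ennreal (1/c * p x)))"
        by (rule dist) (use p nn c_def in auto)
      show "real_distribution (density lborel (\<lambda>x. ennreal (1/c * q x)))"
        by (rule dist) (use q nn cq in auto)
      show "char (density lborel (\<lambda>x. ennreal (1/c * p x))) = char (density lborel (\<lambda>x. ennreal (1/c * q x)))"
      proof
        fix t
        have "char (density lborel (\<lambda>x. ennreal (1/c * p x))) t = fourier (\<lambda>x. 1/c * p x) (- t)"
          unfolding char_def by (rule fourier_eq_char[symmetric]) (use p nn c in auto)
        also have "\<dots> = fourier (\<lambda>x. 1/c * q x) (- t)"
          unfolding fourier_scale four ..
        also have "\<dots> = char (density lborel (\<lambda>x. ennreal (1/c * q x))) t"
          unfolding char_def by (rule fourier_eq_char) (use q nn c in auto)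
        finally show "char (density lborel (\<lambda>x. ennreal (1/c * p x))) t = char (density lborel (\<lambda>x. ennreal (1/c * q x))) t" .
      qed
    qed
    then have "AE x in lborel. ennreal (1/c * p x) = ennreal (1/c * q x)"
      by (intro sigma_finite_measure.density_unique[OF lborel.sigma_finite_measure_axioms]) auto
    then show ?thesis
    proof eventually_elim
      case (elim x)
      then have "1/c * p x = 1/c * q x" using nn c by (subst (asm) ennreal_inj) auto
      then show ?case using c by simp
    qed
  qed
  then show ?thesis
  proof eventually_elim
    case (elim x)
    then have "h x = 0" using fun_cong[OF hpq, of x] by simp
    then show ?case by (simp add: h_def)
  qed
qed

text \<open>A transform determines a function only almost everywhere, whereas kernels are evaluated pointwise.
Right-continuity selects the version.\<close>

lemma right_continuous_AE_eq:
  fixes f g :: "real \<Rightarrow> real"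
  assumes f: "\<And>x. continuous (at_right x) f" and g: "\<And>x. continuous (at_right x) g"
    and eq: "AE x in lborel. f x = g x"
  shows "f = g"
proof
  fix x
  have lim: "((\<lambda>y. f y - g y) \<longlongrightarrow> f x - g x) (at_right x)"
    using f[of x] g[of x] unfolding continuous_within by (intro tendsto_diff)
  show "f x = g x"
  proof (rule ccontr)
    assume "f x \<noteq> g x"
    then have "f x - g x \<noteq> 0" by simp
    from tendsto_imp_eventually_ne[OF lim this]
    obtain b where b: "x < b" "\<And>y. x < y \<Longrightarrow> y < b \<Longrightarrow> f y - g y \<noteq> 0"
      unfolding eventually_at_right_field by auto
    have "AE y in lborel. y \<notin> {x<..<b}"
      using eq by eventually_elim (use b in auto)
    then have "emeasure lborel {x<..<b} = 0"
      by (subst (asm) AE_iff_null_sets[symmetric]) auto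
    then show False using b(1) by (simp add: emeasure_lborel_Ioo)
  qed
qed

lemma fourier_shift:
  "fourier (\<lambda>x. h (x - \<tau>)) u = cis (- (u * \<tau>)) * fourier h u"
proof -
  have "fourier (\<lambda>x. h (x - \<tau>)) u = (\<integral>x. complex_of_real (h (\<tau> + 1 * x - \<tau>)) * cis (- (u * (\<tau> + 1 * x))) \<partial>lborel)"
    unfolding fourier_def by (subst lborel_integral_real_affine[of 1 _ \<tau>]) auto
  also have "\<dots> = (\<integral>x. cis (- (u * \<tau>)) * (complex_of_real (h x) * cis (- (u * x))) \<partial>lborel)"
    by (rule Bochner_Integration.integral_cong) (auto simp: cis_mult algebra_simps)
  also have "\<dots> = cis (- (u * \<tau>)) * fourier h u"
    unfolding fourier_def by simp
  finally show ?thesis .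
qed

section \<open>B-splines\<close>

definition box :: "(real \<Rightarrow> real) \<Rightarrow> real \<Rightarrow> real" where
  "box g x = (\<integral>y. g (x - y) * indicat_real {0..<1} y \<partial>lborel)"

lemma bspline_Suc: "bspline (Suc 0) = indicat_real {0..<1}" "bspline (Suc (Suc n)) = box (bspline (Suc n))"
  unfolding bspline_def box_def[abs_def] by simp_all

context
  fixes g T :: "real \<Rightarrow> real" and V :: real
  assumes dom: "variation_dominated T V g"
begin

lemma integrable_unit_interval: "integrable lborel (\<lambda>y::real. B * indicat_real {0..<1} y)"
  by (intro integrable_mult_right integrable_real_indicator) (simp_all add: emeasure_lborel_Ico)

lemma box_integrable:
  fixes h :: "real \<Rightarrow> real"
  assumes [measurable]: "h \<in> borel_measurable borel" and "\<And>x. \<bar>h x\<bar> \<le> B"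
  shows "integrable lborel (\<lambda>y. h (x - y) * indicat_real {0..<1} y)"
proof (rule Bochner_Integration.integrable_bound[of _ "\<lambda>y. B * indicat_real {0..<1} y"])
  have "0 \<le> B" using assms(2)[of 0] by linarith
  then show "AE y in lborel. norm (h (x - y) * indicat_real {0..<1} y) \<le> norm (B * indicat_real {0..<1} y)"
    using assms(2) by (auto simp: indicator_def)
  show "(\<lambda>y. h (x - y) * indicat_real {0..<1} y) \<in> borel_measurable lborel" by measurable
qed (rule integrable_unit_interval)

text \<open>Averaging preserves domination: the same average is applied to \<open>g\<close> and to \<open>T\<close>.\<close>

lemma box_dominated: "variation_dominated (box T) V (box g)"
proof -
  have Tb: "\<bar>T x\<bar> \<le> V" for x using dominated_nonneg[OF dom] dominated_le[OF dom] by simp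
  have iT: "integrable lborel (\<lambda>y. T (x - y) * indicat_real {0..<1} y)" for x
    by (rule box_integrable[OF dominated_T_measurable[OF dom] Tb])
  have ig: "integrable lborel (\<lambda>y. g (x - y) * indicat_real {0..<1} y)" for x
    by (rule box_integrable[OF dominated_measurable[OF dom] dominated_bounded[OF dom]])
  have mono: "mono (box T)"
    unfolding box_def by (intro monoI integral_mono iT mult_right_mono monoD[OF dominated_mono[OF dom]]) auto
  have "0 \<le> box T x" for x
    unfolding box_def by (rule Bochner_Integration.integral_nonneg) (use dominated_nonneg[OF dom] in auto)
  moreover have "box T x \<le> V" for x
  proof -
    have "box T x \<le> (\<integral>y. V * indicat_real {0..<1::real} y \<partial>lborel)"
      unfolding box_def by (rule integral_mono) (auto intro!: mult_right_mono dominated_le[OF dom] iT integrable_unit_interval)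
    then show ?thesis by simp
  qed
  moreover have "\<bar>box g x - box g y\<bar> \<le> \<bar>box T x - box T y\<bar>" for x y
  proof -
    have *: "\<bar>box g x - box g y\<bar> \<le> box T y - box T x" if "x \<le> y" for x y
    proof -
      have "\<bar>box g x - box g y\<bar> = \<bar>\<integral>z. g (x - z) * indicat_real {0..<1} z - g (y - z) * indicat_real {0..<1} z \<partial>lborel\<bar>"
        unfolding box_def by (subst Bochner_Integration.integral_diff[OF ig ig]) simp
      also have "\<dots> \<le> (\<integral>z. \<bar>g (x - z) * indicat_real {0..<1} z - g (y - z) * indicat_real {0..<1} z\<bar> \<partial>lborel)"
        by (rule integral_abs_bound)
      also have "\<dots> \<le> (\<integral>z. T (y - z) * indicat_real {0..<1} z - T (x - z) * indicat_real {0..<1} z \<partial>lborel)"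
      proof (rule integral_mono)
        fix z
        have "\<bar>g (x - z) - g (y - z)\<bar> \<le> T (y - z) - T (x - z)"
          using dominated_diff[OF dom, of "x - z" "y - z"] monoD[OF dominated_mono[OF dom], of "x - z" "y - z"] that by auto
        then show "\<bar>g (x - z) * indicat_real {0..<1} z - g (y - z) * indicat_real {0..<1} z\<bar>
            \<le> T (y - z) * indicat_real {0..<1} z - T (x - z) * indicat_real {0..<1} z"
          by (auto simp: indicator_def)
      qed (use ig iT in auto)
      also have "\<dots> = box T y - box T x"
        unfolding box_def by (rule Bochner_Integration.integral_diff[OF iT iT])
      finally show ?thesis .
    qed
    show ?thesis using *[of x y] *[of y x] by (cases "x \<le> y") (auto simp: abs_minus_commute)
  qed
  ultimately show ?thesis unfolding variation_dominated_def using mono by blast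
qed

text \<open>\<open>g\<close> has only countably many discontinuities, so for almost all \<open>y\<close> in the average \<open>g\<close> is continuous at
\<open>x - y\<close>.\<close>

lemma box_isCont: "isCont (box g) x"
proof (rule continuous_at_sequentiallyI)
  fix s :: "nat \<Rightarrow> real" assume s: "s \<longlonglongrightarrow> x"
  define B where "B = \<bar>g 0\<bar> + V"
  have B: "\<bar>g x\<bar> \<le> B" for x unfolding B_def by (rule dominated_bounded[OF dom])
  have B0: "0 \<le> B" using B[of 0] by linarith
  note [measurable] = dominated_measurable[OF dom]
  show "(\<lambda>n. box g (s n)) \<longlonglongrightarrow> box g x"
    unfolding box_def
  proof (rule integral_dominated_convergence[where w = "\<lambda>y. B * indicat_real {0..<1} y"])
    have "countable ((\<lambda>w. x - w) ` {w. \<not> isCont g w})"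
      by (intro countable_image dominated_countable_discont[OF dom])
    then have "AE y in lborel. y \<notin> (\<lambda>w. x - w) ` {w. \<not> isCont g w}"
      by (intro AE_not_in countable_imp_null_set_lborel)
    then show "AE y in lborel. (\<lambda>n. g (s n - y) * indicat_real {0..<1} y) \<longlonglongrightarrow> g (x - y) * indicat_real {0..<1} y"
    proof eventually_elim
      case (elim y)
      have "isCont g (x - y)"
      proof (rule ccontr)
        assume "\<not> isCont g (x - y)"
        then have "y \<in> (\<lambda>w. x - w) ` {w. \<not> isCont g w}" by (intro image_eqI[of _ _ "x - y"]) auto
        with elim show False by simp
      qed
      moreover have "(\<lambda>n. s n - y) \<longlonglongrightarrow> x - y" by (intro tendsto_intros s)
      ultimately have "(\<lambda>n. g (s n - y)) \<longlonglongrightarrow> g (x - y)" by (rule isCont_tendsto_compose)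
      then show ?case by (intro tendsto_intros)
    qed
    show "AE y in lborel. norm (g (s n - y) * indicat_real {0..<1} y) \<le> B * indicat_real {0..<1} y" for n
      using B by (auto simp: indicator_def)
    show "(\<lambda>y. g (x - y) * indicat_real {0..<1} y) \<in> borel_measurable lborel"
      "(\<lambda>y. g (s n - y) * indicat_real {0..<1} y) \<in> borel_measurable lborel" for n by measurable
  qed (rule integrable_unit_interval)
qed

lemma fourier_box:
  assumes int: "integrable lborel g"
  shows "fourier (box g) u = fourier (indicat_real {0..<1}) u * fourier g u"
proof -
  note [measurable] = dominated_measurable[OF dom]
  have [measurable]: "cis \<in> borel_measurable borel"
    by (intro borel_measurable_continuous_onI continuous_intros)
  define F where "F y x = complex_of_real (g (x - y) * indicat_real {0..<1} y) * cis (- (u * x))" for y x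
  have cF: "integrable lborel (\<lambda>x. F y x)" for y
  proof -
    have "integrable lborel (\<lambda>x. g (x - y) * indicat_real {0..<1} y)"
      using lborel_integrable_real_affine[OF int, of 1 "- y"] by (auto simp: algebra_simps)
    from integrable_fourier[OF this] show ?thesis unfolding F_def .
  qed
  have nF: "(\<integral>x. norm (F y x) \<partial>lborel) = (\<integral>x. \<bar>g x\<bar> \<partial>lborel) * indicat_real {0..<1} y" for y
  proof -
    have "(\<integral>x. norm (F y x) \<partial>lborel) = (\<integral>x. \<bar>g (x - y)\<bar> \<partial>lborel) * indicat_real {0..<1} y"
      unfolding F_def by (simp add: norm_mult abs_mult)
    also have "(\<integral>x. \<bar>g (x - y)\<bar> \<partial>lborel) = (\<integral>x. \<bar>g x\<bar> \<partial>lborel)"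
      by (subst lborel_integral_real_affine[of 1 _ y]) auto
    finally show ?thesis .
  qed
  have "integrable (lborel \<Otimes>\<^sub>M lborel) (case_prod F)"
  proof (rule lborel_pair.Fubini_integrable)
    show "integrable lborel (\<lambda>y. \<integral>x. norm (case_prod F (y, x)) \<partial>lborel)"
      by (simp add: nF)
    show "case_prod F \<in> borel_measurable (lborel \<Otimes>\<^sub>M lborel)"
      unfolding F_def by measurable
  qed (use cF in simp)
  then have "(\<integral>x. (\<integral>y. F y x \<partial>lborel) \<partial>lborel) = (\<integral>y. (\<integral>x. F y x \<partial>lborel) \<partial>lborel)"
    by (rule lborel_pair.Fubini_integral)
  also have "(\<integral>x. (\<integral>y. F y x \<partial>lborel) \<partial>lborel) = fourier (box g) u"
    unfolding fourier_def box_def F_def by (simp only: integral_mult_left_zero integral_complex_of_real)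
  also have "(\<lambda>y. \<integral>x. F y x \<partial>lborel) = (\<lambda>y. (complex_of_real (indicat_real {0..<1} y) * cis (- (u * y))) * fourier g u)"
  proof
    fix y
    have "(\<integral>x. F y x \<partial>lborel) = fourier (\<lambda>x. indicat_real {0..<1} y * g (x - y)) u"
      unfolding F_def fourier_def by (simp add: mult_ac)
    also have "\<dots> = of_real (indicat_real {0..<1} y) * (cis (- (u * y)) * fourier g u)"
      unfolding fourier_scale fourier_shift[of g y] ..
    finally show "(\<integral>x. F y x \<partial>lborel) = (complex_of_real (indicat_real {0..<1} y) * cis (- (u * y))) * fourier g u"
      by (simp add: mult_ac)
  qed
  also have "(\<integral>y. (complex_of_real (indicat_real {0..<1} y) * cis (- (u * y))) * fourier g u \<partial>lborel)
      = fourier (indicat_real {0..<1}) u * fourier g u"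
    unfolding fourier_def by simp
  finally show ?thesis .
qed

end

text \<open>One induction for all four facts, because the product formula for the transform needs the previous
spline to be integrable, and this is read off from its support and its dominated variation.\<close>

lemma bspline_properties:
  "(\<exists>T V. variation_dominated T V (bspline (Suc n))) \<and> (\<forall>x. bspline (Suc n) x \<noteq> 0 \<longrightarrow> 0 \<le> x \<and> x \<le> real (Suc n)) \<and>
   (\<forall>x. continuous (at_right x) (bspline (Suc n))) \<and>
   (\<forall>u. fourier (bspline (Suc n)) u = fourier (indicat_real {0..<1}) u ^ Suc n)"
proof (induction n)
  case 0
  have "variation_dominated (\<lambda>x. indicat_real {0..} x + indicat_real {1..} x) 2 (indicat_real {0..<1})"
    unfolding variation_dominated_def by (auto simp: mono_def indicator_def)
  moreover have "continuous (at_right x) (indicat_real {0..<1})" for x :: real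
  proof -
    have "\<forall>\<^sub>F y in at_right x. indicat_real {0..<1} y = indicat_real {0..<1} x"
      unfolding eventually_at_right_field
      by (rule exI[of _ "if x < 0 then 0 else if x < 1 then 1 else x + 1"]) (auto simp: indicator_def)
    then show ?thesis unfolding continuous_within
      by (rule tendsto_eventually)
  qed
  moreover have "indicat_real {0..<1} x \<noteq> 0 \<longrightarrow> 0 \<le> x \<and> x \<le> real (Suc 0)" for x
    by (simp add: indicator_def)
  ultimately show ?case unfolding bspline_Suc by (simp only: power_Suc0_right) (intro conjI allI exI refl TrueI)
next
  case (Suc n)
  then obtain T V where dom: "variation_dominated T V (bspline (Suc n))" by blast
  have supp: "\<And>x. bspline (Suc n) x \<noteq> 0 \<Longrightarrow> 0 \<le> x \<and> x \<le> real (Suc n)"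
    and four: "\<And>u. fourier (bspline (Suc n)) u = fourier (indicat_real {0..<1}) u ^ Suc n" using Suc by auto
  have "bounded {x. bspline (Suc n) x \<noteq> 0}"
    by (rule bounded_subset[of "{0..real (Suc n)}"]) (use supp in auto)
  from bounded_support_integrable(1)[OF this dom] have int: "integrable lborel (bspline (Suc n))" .
  have "0 \<le> x \<and> x \<le> real (Suc (Suc n))" if "box (bspline (Suc n)) x \<noteq> 0" for x
  proof (rule ccontr)
    assume "\<not> ?thesis"
    then have "bspline (Suc n) (x - y) * indicat_real {0..<1} y = 0" for y
      using supp[of "x - y"] by (auto simp: indicator_def)
    then have "box (bspline (Suc n)) x = 0" unfolding box_def by (simp only: Bochner_Integration.integral_zero)
    then show False using that by simp
  qed
  moreover have "continuous (at_right x) (box (bspline (Suc n)))" for x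
    using box_isCont[OF dom, of x] by (rule continuous_at_imp_continuous_at_within)
  ultimately show ?case
    unfolding bspline_Suc using box_dominated[OF dom] fourier_box[OF dom int] four by auto
qed

lemma norm_fourier_indicator:
  "u \<noteq> 0 \<Longrightarrow> (cmod (fourier (indicat_real {0..<1}) u))\<^sup>2 = (2 * sin (u / 2) / u)\<^sup>2"
  "fourier (indicat_real {0..<1}) 0 = 1"
  "cmod (fourier (indicat_real {0..<1}) u) \<le> 1"
proof -
  have AE: "fourier (indicat_real {0..<1}) u = (\<integral>x. indicator {0..1} x *\<^sub>R cis (- (u * x)) \<partial>lborel)" for u
    unfolding fourier_def
  proof (rule integral_cong_AE)
    have [measurable]: "cis \<in> borel_measurable borel"
      by (intro borel_measurable_continuous_onI continuous_intros)
    show "(\<lambda>x. complex_of_real (indicat_real {0..<1} x) * cis (- (u * x))) \<in> borel_measurable lborel"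
      "(\<lambda>x. indicator {0..1} x *\<^sub>R cis (- (u * x))) \<in> borel_measurable lborel" by measurable
    have "AE x in lborel. x \<notin> {1 :: real}"
      by (intro AE_not_in countable_imp_null_set_lborel) auto
    then show "AE x in lborel. complex_of_real (indicat_real {0..<1} x) * cis (- (u * x)) = indicator {0..1} x *\<^sub>R cis (- (u * x))"
      by eventually_elim (auto simp: indicator_def)
  qed
  show "fourier (indicat_real {0..<1}) 0 = 1"
    by (subst fourier_zero) (auto intro!: integrable_real_indicator)
  have "cmod (fourier (indicat_real {0..<1}) u) \<le> (\<integral>x. cmod (complex_of_real (indicat_real {0..<1} x) * cis (- (u * x))) \<partial>lborel)"
    unfolding fourier_def by (rule integral_norm_bound)
  also have "\<dots> = 1" by (simp add: norm_mult)
  finally show "cmod (fourier (indicat_real {0..<1}) u) \<le> 1" .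
  assume u: "u \<noteq> 0"
  have "(\<integral>x. indicator {0..1} x *\<^sub>R cis (- (u * x)) \<partial>lborel) = cis (- (u * 1)) * (\<i> / u) - cis (- (u * 0)) * (\<i> / u)"
  proof (rule integral_FTC_Icc)
    show "continuous_on {0..1} (\<lambda>x. cis (- (u * x)))" by (intro continuous_intros)
    show "((\<lambda>x. cis (- (u * x)) * (\<i> / u)) has_vector_derivative cis (- (u * x))) (at x within {0..1})" for x
      using u unfolding cis_conv_exp
      by (auto intro!: derivative_eq_intros has_vector_derivative_real_field simp: field_simps)
  qed simp
  then have "fourier (indicat_real {0..<1}) u = (cis (- u) - 1) * (\<i> / u)"
    unfolding AE by (simp add: algebra_simps)
  then have "(cmod (fourier (indicat_real {0..<1}) u))\<^sup>2 = (cmod (cis (- u) - 1))\<^sup>2 / u\<^sup>2"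
    by (simp add: norm_mult norm_divide power_mult_distrib power_divide)
  also have "(cmod (cis (- u) - 1))\<^sup>2 = (cos u - 1)\<^sup>2 + (sin u)\<^sup>2"
    by (simp add: cmod_power2)
  also have "\<dots> = 2 - 2 * cos u"
    using sin_cos_squared_add[of u] by (simp add: power2_eq_square algebra_simps)
  also have "\<dots> = (2 * sin (u / 2))\<^sup>2"
    using cos_double_sin[of "u / 2"] by (simp add: power_mult_distrib)
  finally show "(cmod (fourier (indicat_real {0..<1}) u))\<^sup>2 = (2 * sin (u / 2) / u)\<^sup>2"
    by (simp add: power_divide)
qed

text \<open>The squared modulus of the transform of the indicator at \<open>u\<close> is \<open>(2 sin (u/2) / u)\<^sup>2\<close>, and the sine does
not change in modulus under \<open>u \<mapsto> u + 2 \<pi>\<close>.  With \<open>u = 2 \<pi> (z + k0)\<close> the periodization is thus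
\<open>(sin (\<pi> z) / \<pi>)^(2r)\<close> times an Eisenstein series of exponent \<open>2 r\<close>, and the sines cancel.  At the
multiples of \<open>2 \<pi>\<close> a single term of the periodization survives.  Positivity is what makes the
orthonormalization possible.\<close>

lemma bspline_periodization:
  assumes "r \<ge> 1"
  shows "((\<lambda>k. (cmod (fourier (bspline r) (u + 2 * pi * of_int k)))\<^sup>2) has_sum
     poly (cot_poly (2 * r - 1)) (cos (u / 2))) (UNIV :: int set)"
    and "0 < poly (cot_poly (2 * r - 1)) (cos (u / 2))"
proof -
  define s where "s w = (cmod (fourier (indicat_real {0..<1}) w))\<^sup>2" for w
  obtain n where r: "r = Suc n" using assms by (cases r) auto
  have bs: "(cmod (fourier (bspline r) w))\<^sup>2 = s w ^ r" for w
  proof -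
    have "fourier (bspline r) w = fourier (indicat_real {0..<1}) w ^ r"
      using bspline_properties[of n] unfolding r by blast
    then show ?thesis by (simp add: s_def norm_power mult.commute flip: power_mult)
  qed
  define m where "m = 2 * r - 1"
  have m: "odd m" "Suc m = 2 * r" using r by (auto simp: m_def)
  have par: "poly (cot_poly m) (- c) = poly (cot_poly m) c" for c
    using cot_poly_minus[of m c] m by simp
  have "((\<lambda>k. s (u + 2 * pi * of_int k) ^ r) has_sum poly (cot_poly m) (cos (u / 2))) (UNIV :: int set) \<and>
      0 < poly (cot_poly m) (cos (u / 2))"
  proof (cases "\<exists>k0 :: int. u = 2 * pi * of_int k0")
    case True
    then obtain k0 :: int where k0: "u = 2 * pi * of_int k0" by blast
    have s: "s (u + 2 * pi * of_int k) = (if k = - k0 then 1 else 0)" for k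
    proof (cases "k = - k0")
      case True
      then show ?thesis by (simp add: s_def k0 norm_fourier_indicator(2))
    next
      case False
      have e: "u + 2 * pi * of_int k = 2 * pi * of_int (k + k0)" by (simp add: k0 algebra_simps)
      have "of_int (k + k0) \<noteq> (0::real)" using False by (simp only: of_int_eq_0_iff)
      then have "2 * pi * of_int (k + k0) \<noteq> (0::real)" by simp
      moreover have "sin (2 * pi * of_int (k + k0) / 2) = 0"
        using sin_npi_int[of "k + k0"] by (simp add: mult.commute)
      ultimately have "s (u + 2 * pi * of_int k) = 0"
        unfolding s_def e by (subst norm_fourier_indicator(1)) (assumption, simp only: power_zero_numeral mult_zero_right div_0)
      then show ?thesis using False by simp
    qed
    have "((\<lambda>k. s (u + 2 * pi * of_int k) ^ r) has_sum 1) {- k0}"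
      using s[of "- k0"] by (intro has_sum_finiteI) auto
    then have "((\<lambda>k. s (u + 2 * pi * of_int k) ^ r) has_sum 1) UNIV"
      by (rule has_sum_cong_neutral[THEN iffD1, rotated -1]) (use r in \<open>auto simp: s\<close>)
    moreover have "cos (u / 2) = 1 \<or> cos (u / 2) = - 1"
      using cos_npi_int[of k0] unfolding k0 by (auto split: if_splits)
    then have "poly (cot_poly m) (cos (u / 2)) = 1"
      using cot_poly_1[of m] par[of 1] by auto
    ultimately show ?thesis by simp
  next
    case False
    define k0 where "k0 = \<lfloor>u / (2 * pi)\<rfloor>"
    define z where "z = u / (2 * pi) - of_int k0"
    have uz: "u = 2 * pi * (z + of_int k0)" by (simp add: z_def)
    have hu: "u / 2 = pi * z + pi * of_int k0" unfolding uz by (simp add: algebra_simps)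
    have z: "0 < z" "z < 1"
    proof -
      have "z \<noteq> 0"
      proof
        assume "z = 0"
        with uz have "u = 2 * pi * of_int k0" by simp
        with False show False by blast
      qed
      moreover have "0 \<le> z" "z < 1" unfolding z_def k0_def by linarith+
      ultimately show "0 < z" "z < 1" by auto
    qed
    have S: "0 < sin (pi * z)" by (rule sin_pi_mult_pos[OF z])
    have s: "s (u + 2 * pi * of_int k) ^ r = (sin (pi * z) / pi) ^ Suc m * (1 / (z + of_int (k0 + k)) ^ Suc m)" for k
    proof -
      define w where "w = u + 2 * pi * of_int k"
      have w: "w = 2 * pi * (z + of_int (k0 + k))" by (simp add: w_def uz algebra_simps)
      have zn: "z + of_int (k0 + k) \<noteq> 0"
      proof
        assume "z + of_int (k0 + k) = 0"
        then have "z = of_int (- (k0 + k))" by simp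
        then show False using z by (metis of_int_0_less_iff of_int_less_1_iff int_one_le_iff_zero_less not_le)
      qed
      then have "w \<noteq> 0" by (simp add: w)
      then have "s w = (2 * sin (w / 2) / w)\<^sup>2" unfolding s_def by (rule norm_fourier_indicator(1))
      also have "w / 2 = pi * z + pi * of_int (k0 + k)" by (simp add: w algebra_simps)
      also have "(2 * sin (pi * z + pi * of_int (k0 + k)) / w)\<^sup>2 = (sin (pi * z))\<^sup>2 * (2 / w)\<^sup>2"
        using sin_npi_int[of "k0 + k"] cos_npi_int[of "k0 + k"]
        unfolding sin_add by (auto simp: power_divide power_mult_distrib split: if_splits)
      also have "\<dots> = (sin (pi * z) / pi / (z + of_int (k0 + k)))\<^sup>2"
        unfolding w by (simp add: power_divide power_mult_distrib)
      finally have "s w ^ r = ((sin (pi * z) / pi / (z + of_int (k0 + k)))\<^sup>2) ^ r" by simp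
      also have "\<dots> = (sin (pi * z) / pi / (z + of_int (k0 + k))) ^ Suc m" unfolding m(2) by (simp only: power_mult)
      finally show ?thesis unfolding w_def by (simp add: power_divide power_mult_distrib del: power_Suc)
    qed
    have "((\<lambda>k. 1 / (z + of_int k) ^ Suc m) has_sum
        poly (cot_poly m) (cos (pi * z)) * (pi / sin (pi * z)) ^ Suc m) (range (\<lambda>k. k0 + k))"
      using eisenstein_sum[OF z m(1)] by (simp add: surj_plus del: power_Suc)
    then have "((\<lambda>k. 1 / (z + of_int (k0 + k)) ^ Suc m) has_sum
        poly (cot_poly m) (cos (pi * z)) * (pi / sin (pi * z)) ^ Suc m) (UNIV :: int set)"
      by (subst (asm) has_sum_reindex) (simp_all add: comp_def del: power_Suc)
    from has_sum_cmult_right[OF this, of "(sin (pi * z) / pi) ^ Suc m"]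
    have "((\<lambda>k. s (u + 2 * pi * of_int k) ^ r) has_sum
        (sin (pi * z) / pi) ^ Suc m * (poly (cot_poly m) (cos (pi * z)) * (pi / sin (pi * z)) ^ Suc m)) (UNIV :: int set)"
      unfolding s .
    also have "(sin (pi * z) / pi) ^ Suc m * (poly (cot_poly m) (cos (pi * z)) * (pi / sin (pi * z)) ^ Suc m)
        = poly (cot_poly m) (cos (pi * z))"
      using S by (simp add: power_divide del: power_Suc)
    also have "cos (pi * z) = cos (u / 2) \<or> cos (pi * z) = - cos (u / 2)"
      using sin_npi_int[of "k0"] cos_npi_int[of "k0"] unfolding hu cos_add by (auto split: if_splits)
    then have "poly (cot_poly m) (cos (pi * z)) = poly (cot_poly m) (cos (u / 2))" using par by metis
    finally have hs: "((\<lambda>k. s (u + 2 * pi * of_int k) ^ r) has_sum poly (cot_poly m) (cos (u / 2))) (UNIV :: int set)" .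
    have "s (u + 2 * pi * of_int 0) ^ r \<le> poly (cot_poly m) (cos (u / 2))"
      using has_sum_mono_neutral[OF has_sum_finiteI[of "{0}" _ "\<lambda>k. s (u + 2 * pi * of_int k) ^ r"] hs]
      by (auto simp: s_def)
    moreover have "0 < s (u + 2 * pi * of_int 0) ^ r"
    proof -
      have "(sin (u / 2))\<^sup>2 = (sin (pi * z))\<^sup>2"
        using sin_npi_int[of "k0"] cos_npi_int[of "k0"] unfolding hu sin_add by (auto split: if_splits)
      then have "sin (u / 2) \<noteq> 0" using S by auto
      moreover have "u \<noteq> 0" using False[simplified] by (auto dest: spec[of _ 0])
      ultimately have "s u > 0" unfolding s_def norm_fourier_indicator(1)[OF \<open>u \<noteq> 0\<close>] by simp
      then show ?thesis by simp
    qed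
    ultimately show ?thesis using hs by linarith
  qed
  then show "((\<lambda>k. (cmod (fourier (bspline r) (u + 2 * pi * of_int k)))\<^sup>2) has_sum
     poly (cot_poly (2 * r - 1)) (cos (u / 2))) (UNIV :: int set)"
    and "0 < poly (cot_poly (2 * r - 1)) (cos (u / 2))"
    unfolding bs m_def by auto
qed

text \<open>The transform of the indicator has modulus at most 1, so the periodization decreases in \<open>r\<close>, and for
\<open>r = 1\<close> the polynomial is constantly 1.\<close>

lemma cot_poly_le_1:
  assumes "r \<ge> 1"
  shows "poly (cot_poly (2 * r - 1)) (cos v) \<le> 1"
proof -
  obtain n where r: "r = Suc n" using assms by (cases r) auto
  have one: "poly (cot_poly (2 * 1 - 1)) c = 1" for c
    by (simp add: pderiv_pCons algebra_simps)
  have "poly (cot_poly (2 * r - 1)) (cos (2 * v / 2)) \<le> poly (cot_poly (2 * 1 - 1)) (cos (2 * v / 2))"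
  proof (rule has_sum_mono[OF bspline_periodization(1)[OF assms] bspline_periodization(1)])
    fix k
    let ?F = "cmod (fourier (indicat_real {0..<1}) (2 * v + 2 * pi * of_int k))"
    have "?F ^ r \<le> ?F ^ 1"
      using norm_fourier_indicator(3) r by (intro power_decreasing) auto
    then have "(?F ^ r)\<^sup>2 \<le> (?F ^ 1)\<^sup>2" by (intro power_mono) auto
    then show "(cmod (fourier (bspline r) (2 * v + 2 * pi * of_int k)))\<^sup>2 \<le> (cmod (fourier (bspline 1) (2 * v + 2 * pi * of_int k)))\<^sup>2"
      using bspline_properties[of n] bspline_properties[of 0] unfolding r by (simp add: norm_power norm_mult)
  qed simp
  then show ?thesis unfolding one by simp
qed


section \<open>Battle-Lemarie kernels\<close>

text \<open>Everything required of the generator of a projection kernel is stable under absolutely convergent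
combinations, as long as the bounds are uniform in \<open>k\<close>.\<close>

lemma absolutely_convergent_combination:
  fixes M T :: "nat \<Rightarrow> real \<Rightarrow> real"
  assumes E: "summable (\<lambda>k. \<bar>E k\<bar>)"
    and dom: "\<And>k. variation_dominated (T k) V (M k)" and S: "\<And>k x. \<bar>M k x\<bar> \<le> S"
    and int: "\<And>k. integrable lborel (M k)" and J: "\<And>k. (\<integral>x. \<bar>M k x\<bar> \<partial>lborel) \<le> J"
    and sm: "\<And>k x. (\<lambda>j. M k (x - of_int j)) summable_on (UNIV :: int set)"
    and C: "\<And>k x. (\<Sum>\<^sub>\<infinity>j\<in>(UNIV :: int set). \<bar>M k (x - of_int j)\<bar>) \<le> C"
    and rc: "\<And>k x. continuous (at_right x) (M k)"
  defines "\<phi> \<equiv> \<lambda>x. \<Sum>k. E k * M k x"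
  shows "variation_dominated (\<lambda>x. \<Sum>k. \<bar>E k\<bar> * T k x) ((\<Sum>k. \<bar>E k\<bar>) * V) \<phi>"
    and "integrable lborel \<phi>"
    and "fourier \<phi> u = (\<Sum>k. complex_of_real (E k) * fourier (M k) u)"
    and "(\<lambda>j. \<phi> (x - of_int j)) summable_on (UNIV :: int set)"
    and "(\<Sum>\<^sub>\<infinity>j\<in>(UNIV :: int set). \<bar>\<phi> (x - of_int j)\<bar>) \<le> (\<Sum>k. \<bar>E k\<bar>) * C"
    and "continuous (at_right x) \<phi>"
proof -
  note T0 = dominated_nonneg[OF dom] and TV = dominated_le[OF dom]
  have sumb: "summable (\<lambda>k. \<bar>E k\<bar> * w k)" if "\<And>k. \<bar>w k\<bar> \<le> B" for w B
  proof (rule summable_comparison_test'[OF summable_mult2[OF E, of B], of 0])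
    show "norm (\<bar>E k\<bar> * w k) \<le> \<bar>E k\<bar> * B" for k using that[of k] by (simp add: abs_mult mult_left_mono)
  qed
  have sT: "summable (\<lambda>k. \<bar>E k\<bar> * T k x)" for x by (rule sumb[of _ V]) (use T0 TV in auto)
  have sabs: "summable (\<lambda>k. \<bar>E k\<bar> * \<bar>M k x\<bar>)" for x by (rule sumb[of _ S]) (use S in auto)
  have sM: "summable (\<lambda>k. E k * M k x)" for x
    by (rule summable_rabs_cancel) (use sabs[of x] in \<open>simp add: abs_mult\<close>)
  have abs_le: "\<bar>\<phi> x\<bar> \<le> (\<Sum>k. \<bar>E k\<bar> * \<bar>M k x\<bar>)" for x
    unfolding \<phi>_def using summable_rabs[of "\<lambda>k. E k * M k x"] sabs[of x] by (simp add: abs_mult)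
  have mono: "mono (\<lambda>x. \<Sum>k. \<bar>E k\<bar> * T k x)"
    by (intro monoI suminf_le sT mult_left_mono monoD[OF dominated_mono[OF dom]]) auto
  have diff: "\<bar>\<phi> x - \<phi> y\<bar> \<le> (\<Sum>k. \<bar>E k\<bar> * T k y) - (\<Sum>k. \<bar>E k\<bar> * T k x)" if "x \<le> y" for x y
  proof -
    have le: "\<bar>E k * M k x - E k * M k y\<bar> \<le> \<bar>E k\<bar> * T k y - \<bar>E k\<bar> * T k x" for k
    proof -
      have "\<bar>M k x - M k y\<bar> \<le> T k y - T k x"
        using dominated_diff[OF dom, of k x y] monoD[OF dominated_mono[OF dom, of k] that] by simp
      then have "\<bar>E k\<bar> * \<bar>M k x - M k y\<bar> \<le> \<bar>E k\<bar> * (T k y - T k x)" by (rule mult_left_mono) simp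
      then show ?thesis by (simp add: abs_mult[symmetric] right_diff_distrib)
    qed
    have sd: "summable (\<lambda>k. \<bar>E k\<bar> * T k y - \<bar>E k\<bar> * T k x)" by (rule summable_diff[OF sT sT])
    have sd': "summable (\<lambda>k. \<bar>E k * M k x - E k * M k y\<bar>)"
      by (rule summable_comparison_test'[OF sd, of 0]) (use le in simp)
    have "\<bar>\<phi> x - \<phi> y\<bar> = \<bar>\<Sum>k. E k * M k x - E k * M k y\<bar>"
      unfolding \<phi>_def by (subst suminf_diff[OF sM sM]) simp
    also have "\<dots> \<le> (\<Sum>k. \<bar>E k * M k x - E k * M k y\<bar>)" by (rule summable_rabs[OF sd'])
    also have "\<dots> \<le> (\<Sum>k. \<bar>E k\<bar> * T k y - \<bar>E k\<bar> * T k x)" by (rule suminf_le[OF le sd' sd])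
    also have "\<dots> = (\<Sum>k. \<bar>E k\<bar> * T k y) - (\<Sum>k. \<bar>E k\<bar> * T k x)" by (rule suminf_diff[OF sT sT, symmetric])
    finally show ?thesis .
  qed
  show "variation_dominated (\<lambda>x. \<Sum>k. \<bar>E k\<bar> * T k x) ((\<Sum>k. \<bar>E k\<bar>) * V) \<phi>"
    unfolding variation_dominated_def
  proof (intro conjI allI mono)
    show "0 \<le> (\<Sum>k. \<bar>E k\<bar> * T k x)" for x by (rule suminf_nonneg[OF sT]) (use T0 in simp)
    show "(\<Sum>k. \<bar>E k\<bar> * T k x) \<le> (\<Sum>k. \<bar>E k\<bar>) * V" for x
      unfolding suminf_mult2[OF E] by (rule suminf_le[OF _ sT summable_mult2[OF E]]) (use TV in \<open>auto intro: mult_left_mono\<close>)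
    show "\<bar>\<phi> x - \<phi> y\<bar> \<le> \<bar>(\<Sum>k. \<bar>E k\<bar> * T k x) - (\<Sum>k. \<bar>E k\<bar> * T k y)\<bar>" for x y
      using diff[of x y] diff[of y x] by (cases "x \<le> y") (auto simp: abs_minus_commute)
  qed
  have J': "\<bar>\<integral>x. \<bar>M k x\<bar> \<partial>lborel\<bar> \<le> J" for k
    using J[of k] by (simp add: Bochner_Integration.integral_nonneg)
  have sJ: "summable (\<lambda>k. \<bar>E k\<bar> * (\<integral>x. \<bar>M k x\<bar> \<partial>lborel))" by (rule sumb[OF J'])
  show "integrable lborel \<phi>"
    unfolding \<phi>_def
  proof (rule integrable_suminf)
    show "AE x in lborel. summable (\<lambda>k. norm (E k * M k x))" using sabs by (simp add: abs_mult)
    show "summable (\<lambda>k. \<integral>x. norm (E k * M k x) \<partial>lborel)" using sJ by (simp add: abs_mult)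
  qed (use int in auto)
  have "fourier \<phi> u = (\<integral>x. (\<Sum>k. complex_of_real (E k) * (complex_of_real (M k x) * cis (- (u * x)))) \<partial>lborel)"
    unfolding fourier_def
  proof (rule Bochner_Integration.integral_cong[OF refl])
    fix x
    have "complex_of_real (\<phi> x) = (\<Sum>k. complex_of_real (E k * M k x))"
      unfolding \<phi>_def by (rule suminf_of_real[OF sM])
    then have "complex_of_real (\<phi> x) * cis (- (u * x)) = (\<Sum>k. complex_of_real (E k * M k x) * cis (- (u * x)))"
      using suminf_mult2[OF summable_of_real[OF sM, where 'a = complex]] by simp
    then show "complex_of_real (\<phi> x) * cis (- (u * x)) = (\<Sum>k. complex_of_real (E k) * (complex_of_real (M k x) * cis (- (u * x))))"
      by (simp add: mult.assoc)
  qed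
  also have "\<dots> = (\<Sum>k. \<integral>x. complex_of_real (E k) * (complex_of_real (M k x) * cis (- (u * x))) \<partial>lborel)"
  proof (rule integral_suminf)
    show "AE x in lborel. summable (\<lambda>k. norm (complex_of_real (E k) * (complex_of_real (M k x) * cis (- (u * x)))))"
      using sabs by (simp add: norm_mult)
    show "summable (\<lambda>k. \<integral>x. norm (complex_of_real (E k) * (complex_of_real (M k x) * cis (- (u * x)))) \<partial>lborel)"
      using sJ by (simp add: norm_mult)
  qed (intro integrable_mult_right integrable_fourier[OF int])
  also have "\<dots> = (\<Sum>k. complex_of_real (E k) * fourier (M k) u)"
    unfolding fourier_def by simp
  finally show "fourier \<phi> u = (\<Sum>k. complex_of_real (E k) * fourier (M k) u)" .
  have fin: "(\<Sum>j\<in>F. \<bar>\<phi> (x - of_int j)\<bar>) \<le> (\<Sum>k. \<bar>E k\<bar>) * C" if F: "finite F" for F :: "int set"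
  proof -
    have row: "(\<Sum>j\<in>F. \<bar>M k (x - of_int j)\<bar>) \<le> C" for k
    proof -
      have "(\<lambda>j. \<bar>M k (x - of_int j)\<bar>) summable_on (UNIV :: int set)"
        using sm[of k x] summable_on_iff_abs_summable_on_real[of "\<lambda>j::int. M k (x - of_int j)" UNIV] by simp
      then have "(\<Sum>j\<in>F. \<bar>M k (x - of_int j)\<bar>) \<le> (\<Sum>\<^sub>\<infinity>j\<in>(UNIV :: int set). \<bar>M k (x - of_int j)\<bar>)"
        by (rule finite_sum_le_infsum) (use F in auto)
      with C[of k x] show ?thesis by linarith
    qed
    have "(\<Sum>j\<in>F. \<bar>\<phi> (x - of_int j)\<bar>) \<le> (\<Sum>j\<in>F. \<Sum>k. \<bar>E k\<bar> * \<bar>M k (x - of_int j)\<bar>)"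
      by (rule sum_mono) (rule abs_le)
    also have "\<dots> = (\<Sum>k. \<Sum>j\<in>F. \<bar>E k\<bar> * \<bar>M k (x - of_int j)\<bar>)"
      by (rule suminf_sum[symmetric]) (rule sabs)
    also have "\<dots> \<le> (\<Sum>k. \<bar>E k\<bar> * C)"
    proof (rule suminf_le)
      show "(\<Sum>j\<in>F. \<bar>E k\<bar> * \<bar>M k (x - of_int j)\<bar>) \<le> \<bar>E k\<bar> * C" for k
        unfolding sum_distrib_left[symmetric] by (rule mult_left_mono[OF row]) simp
    qed (intro summable_sum sabs summable_mult2 E)+
    finally show ?thesis by (simp add: suminf_mult2[OF E])
  qed
  then have abs_sm: "(\<lambda>j. \<bar>\<phi> (x - of_int j)\<bar>) summable_on (UNIV :: int set)"
    by (intro nonneg_bdd_above_summable_on) (auto intro!: bdd_aboveI2)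
  then show "(\<lambda>j. \<phi> (x - of_int j)) summable_on (UNIV :: int set)"
    using summable_on_iff_abs_summable_on_real[of "\<lambda>j::int. \<phi> (x - of_int j)" UNIV] by simp
  show "(\<Sum>\<^sub>\<infinity>j\<in>(UNIV :: int set). \<bar>\<phi> (x - of_int j)\<bar>) \<le> (\<Sum>k. \<bar>E k\<bar>) * C"
    by (rule infsum_le_finite_sums[OF abs_sm fin])
  show "continuous (at_right x) \<phi>"
    unfolding continuous_within \<phi>_def
  proof (rule tannerys_theorem[where M = "\<lambda>k. \<bar>E k\<bar> * S", THEN conjunct2, THEN conjunct2])
    show "((\<lambda>y. E k * M k y) \<longlongrightarrow> E k * M k x) (at_right x)" for k
      using rc[of x k] unfolding continuous_within by (intro tendsto_intros)
    show "summable (\<lambda>k. \<bar>E k\<bar> * S)" by (rule summable_mult2[OF E])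
  qed (use S in \<open>auto simp: abs_mult intro!: always_eventually mult_left_mono\<close>)
qed

text \<open>Dividing the transform of the B-spline by the square root of its periodization multiplies it by a
series of cosines in \<open>u / 2\<close>.  Each cosine \<open>cos (k u / 2)\<close> is the transform of averaging the shifts by
\<open>k / 2\<close> and \<open>- k / 2\<close>.  The resulting combination of shifted B-splines has the transform of \<open>\<phi>\<close>, hence
equals \<open>\<phi>\<close> everywhere by right-continuity.\<close>

lemma battle_lemarie_tame:
  assumes r: "1 \<le> r" and bl: "battle_lemarie r \<phi>"
  shows "tame (projection_kernel \<phi>)"
proof -
  obtain n where n: "r = Suc n" using r by (cases r) auto
  define N where "N = bspline r"
  obtain T V where dom: "variation_dominated T V N"
    using bspline_properties[of n] unfolding N_def n by blast
  have supp: "bounded {x. N x \<noteq> 0}"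
    by (rule bounded_subset[of "{0..real r}"]) (use bspline_properties[of n] in \<open>auto simp: N_def n\<close>)
  have int: "integrable lborel N" by (rule bounded_support_integrable(1)[OF supp dom])
  obtain C where C: "\<And>x. (\<lambda>k. N (x - of_int k)) summable_on (UNIV :: int set)"
    "\<And>x. (\<Sum>\<^sub>\<infinity>k\<in>(UNIV :: int set). \<bar>N (x - of_int k)\<bar>) \<le> C"
    using bounded_support_integrable(2)[OF supp dom] by blast
  have rcN: "continuous (at_right x) N" for x
    using bspline_properties[of n] unfolding N_def n by blast
  define p where "p = cot_poly (2 * r - 1)"
  have pos: "0 < poly p (cos v)" for v
    using bspline_periodization(2)[OF r, of "2 * v"] by (simp add: p_def)
  have le1: "poly p (cos v) \<le> 1" for v unfolding p_def by (rule cot_poly_le_1[OF r])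
  \<comment> \<open>The polynomial is positive on \<open>[-1, 1]\<close>, the range of the cosine, hence bounded below there.\<close>
  obtain \<rho> where \<rho>: "0 < \<rho>" "\<And>v. \<rho> \<le> poly p (cos v)"
  proof -
    have "continuous_on {-1..1} (poly p)" by (intro continuous_intros)
    then obtain c where c: "c \<in> {-1..1}" "\<And>y. y \<in> {-1..1} \<Longrightarrow> poly p c \<le> poly p y"
      using continuous_attains_inf[of "{-1..1 :: real}" "poly p"] by auto
    have "0 < poly p (cos (arccos c))" by (rule pos)
    then have "0 < poly p c" using c(1) by (simp add: cos_arccos)
    moreover have "poly p c \<le> poly p (cos v)" for v by (rule c(2)) auto
    ultimately show ?thesis using that by blast
  qed
  obtain E where E: "summable (\<lambda>k. \<bar>E k\<bar>)"
    and Ecos: "\<And>v. (\<Sum>k. E k * cos (real k * v)) = 1 / sqrt (poly p (cos v))"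
    using cosine_wiener[OF \<rho>(1), of p] \<rho>(2) le1 by blast
  define M where "M k x = (N (x - real k / 2) + N (x - (- real k / 2))) / 2" for k :: nat and x
  define TM where "TM k x = (T (x - real k / 2) + T (x - (- real k / 2))) / 2" for k :: nat and x
  have domM: "variation_dominated (TM k) V (M k)" for k
    unfolding variation_dominated_def
  proof (intro conjI allI)
    show "mono (TM k)" unfolding TM_def
      by (intro monoI divide_right_mono add_mono monoD[OF dominated_mono[OF dom]]) auto
    show "0 \<le> TM k x" for x unfolding TM_def using dominated_nonneg[OF dom] by simp
    have "(v + w) / 2 \<le> V" if "v \<le> V" "w \<le> V" for v w using that by simp
    then show "TM k x \<le> V" for x unfolding TM_def using dominated_le[OF dom] by blast
    show "\<bar>M k x - M k y\<bar> \<le> \<bar>TM k x - TM k y\<bar>" for x y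
    proof -
      have "\<bar>M k x - M k y\<bar> \<le> TM k y - TM k x" if "x \<le> y" for x y
      proof -
        have avg: "\<bar>(a + b) / 2 - (c + e) / 2\<bar> \<le> (c' + e') / 2 - (a' + b') / 2"
          if "\<bar>a - c\<bar> \<le> \<bar>a' - c'\<bar>" "\<bar>b - e\<bar> \<le> \<bar>b' - e'\<bar>" "a' \<le> c'" "b' \<le> e'" for a b c e a' b' c' e' :: real
        proof -
          have "\<bar>a - c\<bar> \<le> c' - a'" "\<bar>b - e\<bar> \<le> e' - b'" using that by auto
          then have "a - c \<le> c' - a'" "c - a \<le> c' - a'" "b - e \<le> e' - b'" "e - b \<le> e' - b'" by (auto simp: abs_le_iff)
          then show ?thesis by (simp add: abs_le_iff field_simps)
        qed
        show ?thesis
          unfolding M_def TM_def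
          by (rule avg) (use that in \<open>auto intro!: dominated_diff[OF dom] monoD[OF dominated_mono[OF dom]]\<close>)
      qed
      from this[of x y] this[of y x] show ?thesis by (cases "x \<le> y") (auto simp: abs_minus_commute)
    qed
  qed
  have SM: "\<bar>M k x\<bar> \<le> \<bar>N 0\<bar> + V" for k x
  proof -
    have "\<bar>(v + w) / 2\<bar> \<le> B" if "\<bar>v\<bar> \<le> B" "\<bar>w\<bar> \<le> B" for v w B :: real
      using that abs_triangle_ineq[of v w] by simp
    then show ?thesis unfolding M_def using dominated_bounded[OF dom] by blast
  qed
  have shift_int: "integrable lborel (\<lambda>x. N (x - \<tau>))" for \<tau>
    using lborel_integrable_real_affine[OF int, of 1 "- \<tau>"] by (simp add: algebra_simps)
  have intM: "integrable lborel (M k)" for k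
    unfolding M_def by (intro integrable_divide Bochner_Integration.integrable_add shift_int)
  have shift_abs: "(\<integral>x. \<bar>N (x - \<tau>)\<bar> \<partial>lborel) = (\<integral>x. \<bar>N x\<bar> \<partial>lborel)" for \<tau>
    by (subst lborel_integral_real_affine[of 1 _ \<tau>]) auto
  have JM: "(\<integral>x. \<bar>M k x\<bar> \<partial>lborel) \<le> (\<integral>x. \<bar>N x\<bar> \<partial>lborel)" for k
  proof -
    have "(\<integral>x. \<bar>M k x\<bar> \<partial>lborel) \<le> (\<integral>x. (\<bar>N (x - real k / 2)\<bar> + \<bar>N (x - (- real k / 2))\<bar>) / 2 \<partial>lborel)"
    proof (rule integral_mono)
      show "integrable lborel (\<lambda>x. (\<bar>N (x - real k / 2)\<bar> + \<bar>N (x - (- real k / 2))\<bar>) / 2)"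
        by (intro integrable_divide Bochner_Integration.integrable_add integrable_abs shift_int)
      show "\<bar>M k x\<bar> \<le> (\<bar>N (x - real k / 2)\<bar> + \<bar>N (x - (- real k / 2))\<bar>) / 2" for x
      proof -
        have "\<bar>(v + w) / 2\<bar> \<le> (\<bar>v\<bar> + \<bar>w\<bar>) / 2" for v w :: real by (simp add: abs_triangle_ineq)
        then show ?thesis unfolding M_def .
      qed
    qed (intro integrable_abs intM)
    also have "\<dots> = ((\<integral>x. \<bar>N (x - real k / 2)\<bar> \<partial>lborel) + (\<integral>x. \<bar>N (x - (- real k / 2))\<bar> \<partial>lborel)) / 2"
      by (simp only: integral_divide_zero Bochner_Integration.integral_add[OF integrable_abs[OF shift_int] integrable_abs[OF shift_int]])
    finally show ?thesis unfolding shift_abs by simp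
  qed
  have absN: "(\<lambda>j. \<bar>N (x - of_int j)\<bar>) summable_on (UNIV :: int set)" for x
    using C(1)[of x] summable_on_iff_abs_summable_on_real[of "\<lambda>j::int. N (x - of_int j)" UNIV] by simp
  have Mj: "M k (x - of_int j) = 1/2 * N ((x - real k / 2) - of_int j) + 1/2 * N ((x - (- real k / 2)) - of_int j)" for k x and j :: int
    unfolding M_def by (simp add: algebra_simps)
  have smM: "(\<lambda>j. M k (x - of_int j)) summable_on (UNIV :: int set)" for k x
    unfolding Mj by (intro summable_on_add summable_on_cmult_right C(1))
  have CM: "(\<Sum>\<^sub>\<infinity>j\<in>(UNIV :: int set). \<bar>M k (x - of_int j)\<bar>) \<le> C" for k x
  proof -
    have "(\<Sum>\<^sub>\<infinity>j\<in>(UNIV :: int set). \<bar>M k (x - of_int j)\<bar>) \<le>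
        (\<Sum>\<^sub>\<infinity>j\<in>(UNIV :: int set). 1/2 * \<bar>N ((x - real k / 2) - of_int j)\<bar> + 1/2 * \<bar>N ((x - (- real k / 2)) - of_int j)\<bar>)"
    proof (rule infsum_mono)
      show "(\<lambda>j. \<bar>M k (x - of_int j)\<bar>) summable_on (UNIV :: int set)"
        using smM[of k x] summable_on_iff_abs_summable_on_real[of "\<lambda>j::int. M k (x - of_int j)" UNIV] by simp
      show "(\<lambda>j. 1/2 * \<bar>N ((x - real k / 2) - of_int j)\<bar> + 1/2 * \<bar>N ((x - (- real k / 2)) - of_int j)\<bar>) summable_on (UNIV :: int set)"
        by (intro summable_on_add summable_on_cmult_right absN)
      show "\<bar>M k (x - of_int j)\<bar> \<le> 1/2 * \<bar>N ((x - real k / 2) - of_int j)\<bar> + 1/2 * \<bar>N ((x - (- real k / 2)) - of_int j)\<bar>" for j :: int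
      proof -
        have "\<bar>1/2 * v + 1/2 * w\<bar> \<le> 1/2 * \<bar>v\<bar> + 1/2 * \<bar>w\<bar>" for v w :: real by linarith
        then show ?thesis unfolding Mj .
      qed
    qed
    also have "\<dots> = 1/2 * (\<Sum>\<^sub>\<infinity>j\<in>(UNIV :: int set). \<bar>N ((x - real k / 2) - of_int j)\<bar>) +
        1/2 * (\<Sum>\<^sub>\<infinity>j\<in>(UNIV :: int set). \<bar>N ((x - (- real k / 2)) - of_int j)\<bar>)"
      unfolding infsum_cmult_right'[symmetric] by (intro infsum_add summable_on_cmult_right absN)
    also have "\<dots> \<le> C"
    proof -
      have "1/2 * v + 1/2 * w \<le> C" if "v \<le> C" "w \<le> C" for v w :: real using that by linarith
      then show ?thesis using C(2) by blast
    qed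
    finally show ?thesis .
  qed
  have rcM: "continuous (at_right x) (M k)" for k x
  proof -
    have sh: "((\<lambda>y. N (y - \<tau>)) \<longlongrightarrow> N (x - \<tau>)) (at_right x)" for \<tau>
    proof -
      have "filterlim (\<lambda>y. y - \<tau>) (at_right (x - \<tau>)) (at_right x)"
        unfolding filterlim_at by (auto intro!: tendsto_eq_intros simp: eventually_at_filter)
      then show ?thesis
        using rcN[of "x - \<tau>"] unfolding continuous_within by (rule filterlim_compose[rotated])
    qed
    show ?thesis unfolding continuous_within M_def by (intro tendsto_divide tendsto_add sh tendsto_const) simp
  qed
  have fM: "fourier (M k) u = cos (real k * (u / 2)) * fourier N u" for k u
  proof -
    define N1 N2 where "N1 x = N (x - real k / 2)" and "N2 x = N (x - (- real k / 2))" for x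
    have i12: "integrable lborel N1" "integrable lborel N2"
      unfolding N1_def N2_def by (rule shift_int)+
    have f1: "fourier N1 u = cis (- (u * (real k / 2))) * fourier N u"
      unfolding N1_def by (rule fourier_shift)
    have f2: "fourier N2 u = cis (- (u * (- real k / 2))) * fourier N u"
      unfolding N2_def by (rule fourier_shift)
    have "fourier (\<lambda>x. (1/2) * (N1 x - (- 1) * N2 x)) u = of_real (1/2) * fourier (\<lambda>x. N1 x - (- 1) * N2 x) u"
      by (rule fourier_scale)
    also have "fourier (\<lambda>x. N1 x - (- 1) * N2 x) u = fourier N1 u - fourier (\<lambda>x. (- 1) * N2 x) u"
      by (rule fourier_diff[OF i12(1) integrable_mult_right[OF i12(2)]])
    also have "fourier (\<lambda>x. (- 1) * N2 x) u = of_real (- 1) * fourier N2 u"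
      by (rule fourier_scale)
    also have "of_real (1/2) * (fourier N1 u - of_real (- 1) * fourier N2 u)
       = (1/2) * (cis (- (u * (real k / 2))) + cis (- (u * (- real k / 2)))) * fourier N u"
      unfolding f1 f2 by (simp add: algebra_simps)
    also have "(\<lambda>x. (1/2) * (N1 x - (- 1) * N2 x)) = M k"
      unfolding M_def N1_def N2_def by (rule ext) simp
    also have "(1/2) * (cis (- (u * (real k / 2))) + cis (- (u * (- real k / 2)))) = complex_of_real (cos (real k * (u / 2)))"
      by (simp add: complex_eq_iff mult.commute)
    finally show ?thesis .
  qed
  define \<psi> where "\<psi> = (\<lambda>x. \<Sum>k. E k * M k x)"
  note \<psi> = absolutely_convergent_combination[where M = M and T = TM and E = E, OF E domM SM intM JM smM CM rcM, folded \<psi>_def]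
  have sums: "(\<lambda>j. \<psi> (x - of_int j)) summable_on (UNIV :: int set)"
    "(\<Sum>\<^sub>\<infinity>j\<in>(UNIV :: int set). \<bar>\<psi> (x - of_int j)\<bar>) \<le> (\<Sum>k. \<bar>E k\<bar>) * C" for x
    using \<psi>(4)[of x] \<psi>(5)[of x] by (simp_all add: \<psi>_def)
  have phi: "integrable lborel \<phi>" "\<And>x. continuous (at_right x) \<phi>"
    and fphi: "\<And>u. fourier \<phi> u = fourier N u /
        complex_of_real (sqrt (\<Sum>\<^sub>\<infinity>k\<in>(UNIV :: int set). (cmod (fourier N (u + 2 * pi * of_int k)))\<^sup>2))"
    using bl unfolding battle_lemarie_def N_def by auto
  have "fourier \<phi> u = fourier \<psi> u" for u
  proof -
    have "fourier \<psi> u = (\<Sum>k. complex_of_real (E k * cos (real k * (u / 2))) * fourier N u)"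
      using \<psi>(3)[of u] unfolding fM by (simp only: of_real_mult mult.assoc)
    also have "summable (\<lambda>k. E k * cos (real k * (u / 2)))"
      by (rule summable_rabs_cancel, rule summable_comparison_test'[OF E, of 0])
         (auto simp: abs_mult intro!: mult_left_le abs_cos_le_one)
    then have "(\<Sum>k. complex_of_real (E k * cos (real k * (u / 2))) * fourier N u) =
        complex_of_real (\<Sum>k. E k * cos (real k * (u / 2))) * fourier N u"
      by (simp only: suminf_mult2[OF summable_of_real] suminf_of_real)
    also have "\<dots> = fourier N u / complex_of_real (sqrt (poly p (cos (u / 2))))"
      unfolding Ecos by simp
    also have "\<dots> = fourier \<phi> u"
      unfolding fphi using infsumI[OF bspline_periodization(1)[OF r, of u]] by (simp add: N_def p_def)
    finally show ?thesis by simp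
  qed
  then have "AE x in lborel. \<phi> x = \<psi> x" by (rule fourier_unique[OF phi(1) \<psi>(2)])
  then have "\<phi> = \<psi>" by (rule right_continuous_AE_eq[OF phi(2) \<psi>(6)])
  then show ?thesis
    using projection_kernel_tame[OF \<psi>(2) \<psi>(1) sums(1) sums(2)] by simp
qed

lemma admissible_kernel_tame:
  assumes "1 \<le> r" "admissible_kernel r K"
  shows "tame K"
  using assms convolution_kernel_tame wavelet_kernel_tame battle_lemarie_tame
  unfolding admissible_kernel_def spline_kernel_def by blast

section \<open>Concentration over the translates of a function\<close>
lemma exp_le_quadratic:
  fixes y :: real
  assumes "\<bar>y\<bar> \<le> 1"
  shows "exp y \<le> 1 + y + y\<^sup>2"
proof (cases "0 \<le> y")
  case True
  then show ?thesis using exp_bound[of y] assms by simp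
next
  case False
  have "y ^ 3 \<le> 0" using False by (simp add: power_le_zero_eq)
  then have "1 \<le> (1 - y) * (1 + y + y\<^sup>2)" by (simp add: algebra_simps power2_eq_square power3_eq_cube)
  also have "\<dots> \<le> exp (- y) * (1 + y + y\<^sup>2)"
  proof (rule mult_right_mono)
    show "1 - y \<le> exp (- y)" using exp_ge_add_one_self[of "- y"] by simp
    have "0 \<le> (y + 1/2)\<^sup>2 + 3/4" by simp
    also have "\<dots> = 1 + y + y\<^sup>2" by (simp add: power2_eq_square algebra_simps)
    finally show "0 \<le> 1 + y + y\<^sup>2" .
  qed
  finally show ?thesis by (simp add: exp_minus divide_simps)
qed

locale iid_sample = prob_space P for P :: "real measure" +
  fixes N I :: "nat set"
  assumes sets_P [measurable_cong]: "sets P = sets borel"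
    and finite_N: "finite N" and I_subset: "I \<subseteq> N" and I_nonempty: "I \<noteq> {}"
begin

abbreviation sample where "sample \<equiv> Pi\<^sub>M N (\<lambda>_. P)"
abbreviation m where "m \<equiv> card I"

definition deviation :: "(real \<Rightarrow> real) \<Rightarrow> (nat \<Rightarrow> real) \<Rightarrow> real" where
  "deviation h X = (\<Sum>i\<in>I. h (X i)) / real m - (\<integral>x. h x \<partial>P)"

lemma m_pos: "0 < real m"
  using finite_subset[OF I_subset finite_N] I_nonempty by (simp add: card_gt_0_iff)

sublocale S: prob_space sample
  by (rule prob_space_PiM) (rule prob_space_axioms)

lemma bounded_integrable:
  assumes [measurable]: "h \<in> borel_measurable borel" and "\<And>x. \<bar>h x\<bar> \<le> B"
  shows "integrable P (h :: real \<Rightarrow> real)"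
  by (rule integrable_const_bound[of _ B]) (use assms in auto)

lemma deviation_measurable [measurable]:
  assumes [measurable]: "h \<in> borel_measurable borel"
  shows "deviation h \<in> borel_measurable sample"
proof -
  have "(\<lambda>X. h (X i)) \<in> borel_measurable sample" if "i \<in> I" for i
  proof -
    have [measurable]: "i \<in> N" using that I_subset by auto
    show ?thesis by measurable
  qed
  then show ?thesis unfolding deviation_def by measurable
qed

text \<open>Markov's inequality for the exponential moment, with \<open>exp y \<le> 1 + y + y\<^sup>2\<close> for \<open>\<bar>y\<bar> \<le> 1\<close>.  The
parameter \<open>l\<close> is kept free, since the two generations of brackets below use it in different regimes.\<close>

lemma bernstein_upper:
  assumes h [measurable]: "h \<in> borel_measurable borel" and B: "\<And>x. \<bar>h x\<bar> \<le> B"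
    and v: "(\<integral>x. (h x)\<^sup>2 \<partial>P) \<le> v" and l: "0 < l" "l * (2 * B) \<le> 1"
  shows "S.prob {X \<in> space sample. t < deviation h X} \<le> exp (real m * (l\<^sup>2 * v - l * t))"
proof -
  define \<mu> where "\<mu> = (\<integral>x. h x \<partial>P)"
  have int: "integrable P h" by (rule bounded_integrable[OF h B])
  have sq: "(h x)\<^sup>2 \<le> B\<^sup>2" for x using B[of x] by (rule abs_le_square_iff[THEN iffD1, OF order_trans]) auto
  have int2: "integrable P (\<lambda>x. (h x)\<^sup>2)" by (rule bounded_integrable) (use sq in auto)
  have \<mu>B: "\<bar>\<mu>\<bar> \<le> B"
  proof -
    have "\<bar>\<mu>\<bar> \<le> (\<integral>x. \<bar>h x\<bar> \<partial>P)" unfolding \<mu>_def by (rule integral_abs_bound)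
    also have "\<dots> \<le> (\<integral>x. B \<partial>P)" by (rule integral_mono) (use int B in auto)
    finally show ?thesis by (simp add: prob_space)
  qed
  define e where "e x = exp (l * (h x - \<mu>))" for x
  have [measurable]: "e \<in> borel_measurable borel" unfolding e_def by measurable
  have ev: "e x \<le> 1 + l * (h x - \<mu>) + l\<^sup>2 * (h x - \<mu>)\<^sup>2" for x
  proof -
    have "\<bar>l * (h x - \<mu>)\<bar> \<le> l * (2 * B)"
      using B[of x] \<mu>B l(1) by (simp add: abs_mult)
    then have "\<bar>l * (h x - \<mu>)\<bar> \<le> 1" using l(2) by linarith
    from exp_le_quadratic[OF this] show ?thesis unfolding e_def by (simp add: power_mult_distrib)
  qed
  have inte: "integrable P e"
  proof (rule bounded_integrable)
    fix x
    have "l * (h x - \<mu>) \<le> l * (2 * B)" using B[of x] \<mu>B l(1) by simp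
    then show "\<bar>e x\<bar> \<le> exp 1" using l(2) unfolding e_def by simp
  qed measurable
  have intq: "integrable P (\<lambda>x. (h x - \<mu>)\<^sup>2)"
    unfolding power2_diff using int int2 by auto
  have "(\<integral>x. e x \<partial>P) \<le> (\<integral>x. 1 + l * (h x - \<mu>) + l\<^sup>2 * (h x - \<mu>)\<^sup>2 \<partial>P)"
    by (rule integral_mono) (use inte ev int intq in auto)
  also have "\<dots> = 1 + l * ((\<integral>x. h x \<partial>P) - \<mu>) + l\<^sup>2 * (\<integral>x. (h x - \<mu>)\<^sup>2 \<partial>P)"
    using int intq by (simp add: prob_space)
  also have "(\<integral>x. (h x - \<mu>)\<^sup>2 \<partial>P) = (\<integral>x. (h x)\<^sup>2 \<partial>P) - \<mu>\<^sup>2"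
    unfolding power2_diff using int int2 by (simp add: prob_space \<mu>_def[symmetric] power2_eq_square)
  also have "1 + l * ((\<integral>x. h x \<partial>P) - \<mu>) + l\<^sup>2 * ((\<integral>x. (h x)\<^sup>2 \<partial>P) - \<mu>\<^sup>2) \<le> 1 + l\<^sup>2 * v"
  proof -
    have "(\<integral>x. (h x)\<^sup>2 \<partial>P) - \<mu>\<^sup>2 \<le> v" using v zero_le_power2[of \<mu>] by linarith
    then have "l\<^sup>2 * ((\<integral>x. (h x)\<^sup>2 \<partial>P) - \<mu>\<^sup>2) \<le> l\<^sup>2 * v" by (rule mult_left_mono) simp
    then show ?thesis by (simp add: \<mu>_def[symmetric])
  qed
  also have "\<dots> \<le> exp (l\<^sup>2 * v)" by (rule exp_ge_add_one_self)
  finally have Ee: "(\<integral>x. e x \<partial>P) \<le> exp (l\<^sup>2 * v)" .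
  have e0: "0 \<le> e x" for x unfolding e_def by simp
  have Ie0: "0 \<le> (\<integral>x. e x \<partial>P)" by (rule Bochner_Integration.integral_nonneg) (rule e0)
  define F where "F i x = (if i \<in> I then ennreal (e x) else 1)" for i :: nat and x
  have [measurable]: "F i \<in> borel_measurable borel" for i unfolding F_def by measurable
  interpret PP: product_sigma_finite "\<lambda>_::nat. P" ..
  let ?E = "{X \<in> space sample. t < deviation h X}"
  have fI: "finite I" using finite_subset[OF I_subset finite_N] .
  have "emeasure sample ?E = (\<integral>\<^sup>+X. indicator ?E X \<partial>sample)" by simp
  also have "\<dots> \<le> (\<integral>\<^sup>+X. ennreal (exp (- (l * real m * t))) * (\<Prod>i\<in>N. F i (X i)) \<partial>sample)"
  proof (rule nn_integral_mono)
    fix X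
    have "(\<Prod>i\<in>N. F i (X i)) = (\<Prod>i\<in>I. ennreal (e (X i)))"
      unfolding F_def using I_subset finite_N
      by (subst prod.inter_restrict[symmetric]) (auto simp: Int_absorb1)
    also have "\<dots> = ennreal (\<Prod>i\<in>I. e (X i))"
      by (rule prod_ennreal) (simp add: e_def)
    also have "(\<Prod>i\<in>I. e (X i)) = exp (l * real m * deviation h X)"
      using m_pos unfolding e_def deviation_def \<mu>_def[symmetric]
      by (simp add: exp_sum[OF fI, symmetric] sum_distrib_left[symmetric] sum_subtractf field_simps)
    finally have eq: "(\<Prod>i\<in>N. F i (X i)) = ennreal (exp (l * real m * deviation h X))" .
    show "indicator ?E X \<le> ennreal (exp (- (l * real m * t))) * (\<Prod>i\<in>N. F i (X i))"
    proof (cases "X \<in> ?E")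
      case True
      then have "0 \<le> l * real m * (deviation h X - t)" using l(1) by simp
      then show ?thesis using True
        by (simp add: eq ennreal_mult[symmetric] exp_add[symmetric] algebra_simps del: ennreal_1 flip: ennreal_1)
    qed simp
  qed
  also have "\<dots> = ennreal (exp (- (l * real m * t))) * (\<Prod>i\<in>N. \<integral>\<^sup>+x. F i x \<partial>P)"
    by (subst nn_integral_cmult) (auto simp: PP.product_nn_integral_prod[OF finite_N])
  also have "(\<Prod>i\<in>N. \<integral>\<^sup>+x. F i x \<partial>P) = (\<Prod>i\<in>N. if i \<in> I then ennreal (\<integral>x. e x \<partial>P) else 1)"
  proof (rule prod.cong)
    fix i
    have "(\<integral>\<^sup>+x. ennreal (e x) \<partial>P) = ennreal (\<integral>x. e x \<partial>P)"
      by (rule nn_integral_eq_integral[OF inte]) (simp add: e0)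
    then show "(\<integral>\<^sup>+x. F i x \<partial>P) = (if i \<in> I then ennreal (\<integral>x. e x \<partial>P) else 1)"
      by (cases "i \<in> I") (simp_all add: F_def emeasure_space_1)
  qed simp
  also have "\<dots> = (\<Prod>i\<in>I. ennreal (\<integral>x. e x \<partial>P))"
    using I_subset finite_N by (subst prod.inter_restrict[symmetric]) (auto simp: Int_absorb1)
  also have "\<dots> = ennreal ((\<integral>x. e x \<partial>P) ^ m)"
    by (simp add: ennreal_power Ie0)
  also have "ennreal (exp (- (l * real m * t))) * \<dots> \<le> ennreal (exp (- (l * real m * t)) * exp (l\<^sup>2 * v) ^ m)"
    by (subst ennreal_mult[symmetric]) (auto intro!: ennreal_leI mult_left_mono power_mono Ee simp: Ie0)
  also have "exp (- (l * real m * t)) * exp (l\<^sup>2 * v) ^ m = exp (real m * (l\<^sup>2 * v - l * t))"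
    by (simp add: exp_of_nat_mult[symmetric] exp_add[symmetric] algebra_simps)
  finally show ?thesis
    by (simp add: S.emeasure_eq_measure)
qed

lemma bernstein:
  assumes h [measurable]: "h \<in> borel_measurable borel" and B: "\<And>x. \<bar>h x\<bar> \<le> B"
    and v: "(\<integral>x. (h x)\<^sup>2 \<partial>P) \<le> v" and l: "0 < l" "l * (2 * B) \<le> 1"
  shows "S.prob {X \<in> space sample. t < \<bar>deviation h X\<bar>} \<le> 2 * exp (real m * (l\<^sup>2 * v - l * t))"
proof -
  have neg: "deviation (\<lambda>x. - h x) X = - deviation h X" for X
    by (simp add: deviation_def sum_negf)
  have "{X \<in> space sample. t < \<bar>deviation h X\<bar>} \<subseteq>
      {X \<in> space sample. t < deviation h X} \<union> {X \<in> space sample. t < deviation (\<lambda>x. - h x) X}"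
    by (auto simp: neg)
  then have "S.prob {X \<in> space sample. t < \<bar>deviation h X\<bar>} \<le>
      S.prob ({X \<in> space sample. t < deviation h X} \<union> {X \<in> space sample. t < deviation (\<lambda>x. - h x) X})"
    by (intro S.finite_measure_mono) auto
  also have "\<dots> \<le> S.prob {X \<in> space sample. t < deviation h X} + S.prob {X \<in> space sample. t < deviation (\<lambda>x. - h x) X}"
    by (intro measure_Un_le) auto
  also have "\<dots> \<le> 2 * exp (real m * (l\<^sup>2 * v - l * t))"
    using bernstein_upper[OF h B v l, of t] bernstein_upper[of "\<lambda>x. - h x" B v l t] assms by simp
  finally show ?thesis .
qed

end

text \<open>This replaces an uncountable infimum over shifts by a monotone limit, which stays measurable.  If \<open>A\<close>
has no least element, choose for each rational that is not a lower bound an element of \<open>A\<close> below it.\<close>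

lemma coinitial_sequence:
  fixes A :: "real set"
  assumes "A \<noteq> {}"
  shows "\<exists>p :: nat \<Rightarrow> real. decseq p \<and> range p \<subseteq> A \<and> (\<forall>z\<in>A. \<exists>n. p n \<le> z)"
proof -
  have "\<exists>q :: nat \<Rightarrow> real. range q \<subseteq> A \<and> (\<forall>z\<in>A. \<exists>n. q n \<le> z)"
  proof (cases "\<exists>b\<in>A. \<forall>z\<in>A. b \<le> z")
    case True
    then obtain b where "b \<in> A" "\<forall>z\<in>A. b \<le> z" by blast
    then show ?thesis by (intro exI[of _ "\<lambda>_. b"]) auto
  next
    case False
    define w where "w x = (SOME z. z \<in> A \<and> z < x)" for x :: real
    define Q where "Q = {x \<in> \<rat>. \<exists>z\<in>A. z < x}"
    have w: "w x \<in> A" "w x < x" if "x \<in> Q" for x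
      using someI_ex[of "\<lambda>z. z \<in> A \<and> z < x"] that unfolding w_def Q_def by auto
    have cnt: "countable (w ` Q)"
      unfolding Q_def by (intro countable_image countable_subset[OF _ countable_rat]) auto
    have cof: "\<exists>x\<in>Q. w x \<le> z" if "z \<in> A" for z
    proof -
      obtain z' where z': "z' \<in> A" "z' < z" using False \<open>z \<in> A\<close> by (meson not_le)
      obtain x where "x \<in> \<rat>" "z' < x" "x < z" using Rats_dense_in_real[OF z'(2)] by blast
      then have "x \<in> Q" using z' by (auto simp: Q_def)
      with w[OF this] \<open>x < z\<close> show ?thesis by (intro bexI[of _ x]) auto
    qed
    have ne: "w ` Q \<noteq> {}" using assms cof by blast
    show ?thesis
    proof (intro exI[of _ "from_nat_into (w ` Q)"] conjI ballI)
      show "range (from_nat_into (w ` Q)) \<subseteq> A"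
      proof (rule order_trans[OF range_from_nat_into_subset[OF ne]])
        show "w ` Q \<subseteq> A" using w(1) by auto
      qed
      fix z assume "z \<in> A"
      then obtain x where x: "x \<in> Q" "w x \<le> z" using cof by blast
      then have "w x \<in> range (from_nat_into (w ` Q))"
        using range_from_nat_into[OF ne cnt] by simp
      then obtain n where "w x = from_nat_into (w ` Q) n" by (rule rangeE)
      then show "\<exists>n. from_nat_into (w ` Q) n \<le> z" using x(2) by (intro exI[of _ n]) simp
    qed
  qed
  then obtain q :: "nat \<Rightarrow> real" where q: "range q \<subseteq> A" "\<forall>z\<in>A. \<exists>n. q n \<le> z" by blast
  define p where "p n = Min (q ` {..n})" for n
  have "decseq p"
    unfolding decseq_Suc_iff p_def by (auto intro!: Min_antimono)
  moreover have "range p \<subseteq> A"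
  proof -
    have "p n \<in> q ` {..n}" for n unfolding p_def by (rule Min_in) auto
    then show ?thesis using q(1) by blast
  qed
  moreover have "p n \<le> q n" for n unfolding p_def by (rule Min_le) auto
  ultimately show ?thesis using q(2) by (meson order_trans)
qed

context iid_sample
begin

text \<open>The mean \<open>H z\<close> of \<open>T (s x - z)\<close> is antitone in \<open>z\<close> with values in \<open>[0, V]\<close>.  Group the shifts by the
cell of length \<open>\<epsilon>\<close> that contains \<open>H z\<close>: within a group, \<open>T\<close> oscillates by at most a function \<open>Dv\<close>
whose mean is at most \<open>\<epsilon>\<close>, and \<open>g\<close> oscillates less than \<open>T\<close>.  The number of groups is at most
\<open>V / \<epsilon> + 1\<close> for every law \<open>P\<close> and every scale \<open>s\<close>.\<close>

lemma translate_brackets: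
  assumes dom: "variation_dominated T V g" and eps: "0 < \<epsilon>" and s: "0 < s"
  shows "\<exists>(q::nat) A Dv. real q \<le> V / \<epsilon> + 1 \<and>
     (\<forall>i. Dv i \<in> borel_measurable borel \<and> (\<forall>x. 0 \<le> Dv i x \<and> Dv i x \<le> V) \<and> (\<integral>x. Dv i x \<partial>P) \<le> \<epsilon>) \<and>
     (\<forall>z. \<exists>i<q. \<forall>x. \<bar>g (s * x - z) - g (s * x - A i)\<bar> \<le> Dv i x)"
proof -
  note mono = monoD[OF dominated_mono[OF dom]]
  note T0 = dominated_nonneg[OF dom] and TV = dominated_le[OF dom]
  note [measurable] = dominated_T_measurable[OF dom]
  have V0: "0 \<le> V" using T0[of 0] TV[of 0] by linarith
  have intT: "integrable P (\<lambda>x. T (s * x - z))" for z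
    by (rule bounded_integrable[of _ V]) (use T0 TV in auto)
  define H where "H z = (\<integral>x. T (s * x - z) \<partial>P)" for z
  have H0: "0 \<le> H z" for z unfolding H_def by (rule Bochner_Integration.integral_nonneg) (use T0 in auto)
  have HV: "H z \<le> V" for z
  proof -
    have "H z \<le> (\<integral>x. V \<partial>P)" unfolding H_def by (rule integral_mono) (use intT TV in auto)
    then show ?thesis by (simp add: prob_space)
  qed
  define lev where "lev z = nat \<lfloor>H z / \<epsilon>\<rfloor>" for z
  have lev: "real (lev z) * \<epsilon> \<le> H z" "H z \<le> (real (lev z) + 1) * \<epsilon>" for z
  proof -
    have "real (lev z) = of_int \<lfloor>H z / \<epsilon>\<rfloor>" unfolding lev_def using H0[of z] eps by simp
    then have "real (lev z) \<le> H z / \<epsilon>" "H z / \<epsilon> \<le> real (lev z) + 1" by linarith+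
    then show "real (lev z) * \<epsilon> \<le> H z" "H z \<le> (real (lev z) + 1) * \<epsilon>"
      using eps by (simp_all add: pos_le_divide_eq pos_divide_le_eq)
  qed
  define Q where "Q i = {z. lev z = i}" for i
  define Br where "Br i A Dv \<longleftrightarrow> Dv \<in> borel_measurable borel \<and> (\<forall>x. 0 \<le> Dv x \<and> Dv x \<le> V) \<and>
      (\<integral>x. Dv x \<partial>P) \<le> \<epsilon> \<and> (\<forall>z\<in>Q i. \<forall>x. \<bar>g (s * x - z) - g (s * x - A)\<bar> \<le> Dv x)"
    for i and A :: real and Dv :: "real \<Rightarrow> real"
  have bracket: "\<exists>A Dv. Br i A Dv" for i
  proof (cases "Q i = {}")
    case True
    then show ?thesis using eps V0 unfolding Br_def by (intro exI[of _ 0] exI[of _ "\<lambda>_. 0"]) auto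
  next
    case False
    then obtain z0 where z0: "z0 \<in> Q i" by blast
    \<comment> \<open>A group is an interval of shifts that may lack end points.  It is exhausted by \<open>[lo n, hi n]\<close>, and
      \<open>Dv\<close> is the monotone limit of the oscillations of \<open>T\<close> over these.\<close>
    obtain lo where lo: "decseq lo" "range lo \<subseteq> Q i" "\<forall>z\<in>Q i. \<exists>n. lo n \<le> z"
      using coinitial_sequence[OF False] by blast
    have "uminus ` Q i \<noteq> {}" using False by auto
    from coinitial_sequence[OF this] obtain p where
      p: "decseq p" "range p \<subseteq> uminus ` Q i" "\<forall>z\<in>uminus ` Q i. \<exists>n. p n \<le> z" by blast
    define hi where "hi n = - p n" for n
    have hi: "hi n \<in> Q i" "\<forall>z\<in>Q i. \<exists>n. z \<le> hi n" "incseq hi" for n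
    proof -
      have "p n \<in> uminus ` Q i" using p(2) by blast
      then show "hi n \<in> Q i" unfolding hi_def by auto
      show "\<forall>z\<in>Q i. \<exists>n. z \<le> hi n" using p(3) unfolding hi_def by (auto simp: le_minus_iff minus_le_iff)
      show "incseq hi" using p(1) unfolding hi_def decseq_def incseq_def by auto
    qed
    have lo_in: "lo n \<in> Q i" for n using lo(2) by blast
    define R where "R n x = T (s * x - lo n) - T (s * x - hi n)" for n x
    have [measurable]: "R n \<in> borel_measurable borel" for n unfolding R_def by measurable
    have Rmono: "incseq (\<lambda>n. R n x)" for x
    proof (rule incseq_SucI)
      fix n
      have "lo (Suc n) \<le> lo n" "hi n \<le> hi (Suc n)"
        using lo(1) hi(3) by (auto simp: decseq_Suc_iff incseq_Suc_iff)
      then show "R n x \<le> R (Suc n) x"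
        unfolding R_def by (intro diff_mono mono) auto
    qed
    have RV: "R n x \<le> V" for n x unfolding R_def using T0[of "s * x - hi n"] TV[of "s * x - lo n"] by linarith
    have bdd: "bdd_above (range (\<lambda>n. R n x))" for x using RV by (auto intro!: bdd_aboveI[of _ V])
    define Dv where "Dv x = (SUP n. R n x)" for x
    have lim: "(\<lambda>n. R n x) \<longlonglongrightarrow> Dv x" for x
      unfolding Dv_def by (rule LIMSEQ_incseq_SUP[OF bdd Rmono])
    have [measurable]: "Dv \<in> borel_measurable borel"
      by (rule borel_measurable_LIMSEQ_real[OF lim]) measurable
    have R_le: "R n x \<le> Dv x" for n x unfolding Dv_def by (rule cSUP_upper[OF _ bdd]) auto
    have bnd: "\<bar>g (s * x - z) - g (s * x - w)\<bar> \<le> Dv x" if zw: "z \<in> Q i" "w \<in> Q i" for z w x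
    proof -
      obtain n1 n2 n3 n4 where n: "lo n1 \<le> z" "lo n2 \<le> w" "z \<le> hi n3" "w \<le> hi n4"
        using lo(3) hi(2) zw by blast
      define n where "n = max (max n1 n2) (max n3 n4)"
      have "lo n \<le> lo n1" "lo n \<le> lo n2" "hi n3 \<le> hi n" "hi n4 \<le> hi n"
        using lo(1) hi(3) by (auto simp: n_def decseq_def incseq_def)
      then have b: "lo n \<le> z" "lo n \<le> w" "z \<le> hi n" "w \<le> hi n" using n by linarith+
      have "\<bar>g (s * x - z) - g (s * x - w)\<bar> \<le> \<bar>T (s * x - z) - T (s * x - w)\<bar>"
        by (rule dominated_diff[OF dom])
      also have "\<dots> \<le> R n x"
        unfolding R_def using b mono[of "s * x - z" "s * x - lo n"] mono[of "s * x - w" "s * x - lo n"]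
          mono[of "s * x - hi n" "s * x - z"] mono[of "s * x - hi n" "s * x - w"] by linarith
      finally show ?thesis using R_le[of n x] by linarith
    qed
    have D0: "0 \<le> Dv x" for x using bnd[OF z0 z0, of x] by simp
    have DV: "Dv x \<le> V" for x
      by (rule LIMSEQ_le_const2[OF lim]) (use RV in auto)
    have "\<bar>R n x\<bar> \<le> V" for n x
      unfolding R_def using T0[of "s * x - hi n"] TV[of "s * x - lo n"] TV[of "s * x - hi n"] T0[of "s * x - lo n"] by linarith
    then have "(\<lambda>n. \<integral>x. R n x \<partial>P) \<longlonglongrightarrow> (\<integral>x. Dv x \<partial>P)"
      by (intro integral_dominated_convergence[where w = "\<lambda>_. V"]) (auto intro: lim)
    moreover have "(\<integral>x. R n x \<partial>P) \<le> \<epsilon>" for n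
    proof -
      have "(\<integral>x. R n x \<partial>P) = H (lo n) - H (hi n)"
        unfolding R_def H_def by (rule Bochner_Integration.integral_diff[OF intT intT])
      also have "\<dots> \<le> (real i + 1) * \<epsilon> - real i * \<epsilon>"
        using lev(1)[of "hi n"] lev(2)[of "lo n"] lo_in[of n] hi(1)[of n] unfolding Q_def by auto
      finally show ?thesis by (simp add: algebra_simps)
    qed
    ultimately have "(\<integral>x. Dv x \<partial>P) \<le> \<epsilon>" by (intro LIMSEQ_le_const2) auto
    then show ?thesis using bnd z0 D0 DV unfolding Br_def by (intro exI[of _ z0] exI[of _ Dv]) auto
  qed
  have "\<exists>A. \<forall>i. \<exists>Dv. Br i (A i) Dv" by (rule choice) (use bracket in blast)
  then obtain A where "\<forall>i. \<exists>Dv. Br i (A i) Dv" by blast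
  then have "\<exists>Dv. \<forall>i. Br i (A i) (Dv i)" by (rule choice)
  then obtain Dv where "\<forall>i. Br i (A i) (Dv i)" by blast
  then have ADv: "\<And>i. Dv i \<in> borel_measurable borel" "\<And>i x. 0 \<le> Dv i x \<and> Dv i x \<le> V"
    "\<And>i. (\<integral>x. Dv i x \<partial>P) \<le> \<epsilon>" "\<And>i z x. z \<in> Q i \<Longrightarrow> \<bar>g (s * x - z) - g (s * x - A i)\<bar> \<le> Dv i x"
    unfolding Br_def by blast+
  define q where "q = Suc (nat \<lfloor>V / \<epsilon>\<rfloor>)"
  have "real q \<le> V / \<epsilon> + 1"
    unfolding q_def using V0 eps by simp
  moreover have "lev z < q" for z
    unfolding lev_def q_def using HV[of z] eps by (simp add: less_Suc_eq_le nat_mono floor_mono divide_right_mono)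
  ultimately show ?thesis using ADv unfolding Q_def by (intro exI[of _ q] exI[of _ A] exI[of _ Dv]) blast
qed

text \<open>Chaining in two steps.  There are few coarse brackets, so the translates at their centres can be
controlled with the true variance \<open>v\<close> and a small deviation.  The fine brackets are numerous, but the
functions involved, differences between fine and coarse centres and the fine envelopes, are bounded
by envelopes of mean at most \<open>\<epsilon>0\<close> and thus have a tiny second moment.  A single net of the fine
size would force its logarithm into the deviation.\<close>

lemma translate_concentration:
  assumes dom: "variation_dominated T V g" and s: "0 < s"
    and B: "\<And>x. \<bar>g x\<bar> \<le> B" and v: "\<And>z. (\<integral>x. (g (s * x - z))\<^sup>2 \<partial>P) \<le> v"
    and eps: "0 < \<epsilon>0" "0 < \<epsilon>1"
    and l0: "0 < l0" "l0 * (2 * B) \<le> 1" and l1: "0 < l1" "l1 * (2 * V) \<le> 1"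
  shows "\<exists>G\<in>sets sample.
     S.prob (space sample - G) \<le> (V / \<epsilon>0 + 1) * (2 * exp (real m * (l0\<^sup>2 * v - l0 * t)))
       + 2 * ((V / \<epsilon>1 + 1) * (2 * exp (real m * (l1\<^sup>2 * (V * max \<epsilon>0 \<epsilon>1) - l1 * t)))) \<and>
     (\<forall>X\<in>G. \<forall>z. \<bar>deviation (\<lambda>x. g (s * x - z)) X\<bar> \<le> 3 * t + 2 * \<epsilon>1)"
proof -
  note [measurable] = dominated_measurable[OF dom]
  have V0: "0 \<le> V" using dominated_nonneg[OF dom, of 0] dominated_le[OF dom, of 0] by linarith
  from translate_brackets[OF dom eps(1) s] obtain q0 A0 D0 where b0:
     "real q0 \<le> V / \<epsilon>0 + 1 \<and>
     (\<forall>i. D0 i \<in> borel_measurable borel \<and> (\<forall>x. 0 \<le> D0 i x \<and> D0 i x \<le> V) \<and> (\<integral>x. D0 i x \<partial>P) \<le> \<epsilon>0) \<and>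
     (\<forall>z. \<exists>i<q0. \<forall>x. \<bar>g (s * x - z) - g (s * x - A0 i)\<bar> \<le> D0 i x)"
    by (elim exE)
  then have q0: "real q0 \<le> V / \<epsilon>0 + 1"
    and D0: "\<And>i. D0 i \<in> borel_measurable borel" "\<And>i x. 0 \<le> D0 i x \<and> D0 i x \<le> V" "\<And>i. (\<integral>x. D0 i x \<partial>P) \<le> \<epsilon>0"
    and A0: "\<And>z. \<exists>i<q0. \<forall>x. \<bar>g (s * x - z) - g (s * x - A0 i)\<bar> \<le> D0 i x"
    by blast+
  from translate_brackets[OF dom eps(2) s] obtain q1 A1 D1 where b1:
     "real q1 \<le> V / \<epsilon>1 + 1 \<and>
     (\<forall>i. D1 i \<in> borel_measurable borel \<and> (\<forall>x. 0 \<le> D1 i x \<and> D1 i x \<le> V) \<and> (\<integral>x. D1 i x \<partial>P) \<le> \<epsilon>1) \<and>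
     (\<forall>z. \<exists>i<q1. \<forall>x. \<bar>g (s * x - z) - g (s * x - A1 i)\<bar> \<le> D1 i x)"
    by (elim exE)
  then have q1: "real q1 \<le> V / \<epsilon>1 + 1"
    and D1: "\<And>i. D1 i \<in> borel_measurable borel" "\<And>i x. 0 \<le> D1 i x \<and> D1 i x \<le> V" "\<And>i. (\<integral>x. D1 i x \<partial>P) \<le> \<epsilon>1"
    and A1: "\<And>z. \<exists>i<q1. \<forall>x. \<bar>g (s * x - z) - g (s * x - A1 i)\<bar> \<le> D1 i x"
    by blast+
  note [measurable] = D0(1) D1(1)
  have "\<exists>p. \<forall>i. p i < q0 \<and> (\<forall>x. \<bar>g (s * x - A1 i) - g (s * x - A0 (p i))\<bar> \<le> D0 (p i) x)"
    by (rule choice) (use A0 in blast)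
  then obtain p where p: "\<And>i. p i < q0" "\<And>i x. \<bar>g (s * x - A1 i) - g (s * x - A0 (p i))\<bar> \<le> D0 (p i) x"
    by blast
  \<comment> \<open>The link from the fine centre \<open>A1 i\<close> to the coarse centre of its bracket.\<close>
  define h where "h i x = g (s * x - A1 i) - g (s * x - A0 (p i))" for i x
  have [measurable]: "h i \<in> borel_measurable borel" for i unfolding h_def by measurable
  have sq_bound: "(\<integral>x. (k x)\<^sup>2 \<partial>P) \<le> V * max \<epsilon>0 \<epsilon>1"
    if [measurable]: "k \<in> borel_measurable borel" and k: "\<And>x. \<bar>k x\<bar> \<le> d x" "d \<in> borel_measurable borel" "\<And>x. 0 \<le> d x \<and> d x \<le> V" "(\<integral>x. d x \<partial>P) \<le> max \<epsilon>0 \<epsilon>1" for k d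
  proof -
    note [measurable] = k(2)
    have sq: "(k x)\<^sup>2 \<le> V * d x" for x
    proof -
      have "(k x)\<^sup>2 = \<bar>k x\<bar> * \<bar>k x\<bar>" by (simp add: power2_eq_square abs_mult_self_eq)
      also have "\<dots> \<le> V * d x"
        using k(1)[of x] k(3)[of x] by (intro mult_mono) auto
      finally show ?thesis .
    qed
    have intd: "integrable P d" by (rule bounded_integrable[of _ V]) (use k in auto)
    have "(\<integral>x. (k x)\<^sup>2 \<partial>P) \<le> (\<integral>x. V * d x \<partial>P)"
      by (rule integral_mono'[OF _ sq]) (use intd k(3) V0 in auto)
    also have "\<dots> \<le> V * max \<epsilon>0 \<epsilon>1" using k(4) V0 by (simp add: mult_left_mono)
    finally show ?thesis .
  qed
  define E0 where "E0 i = {X \<in> space sample. t < \<bar>deviation (\<lambda>x. g (s * x - A0 i)) X\<bar>}" for i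
  define E1 where "E1 i = {X \<in> space sample. t < \<bar>deviation (h i) X\<bar>}" for i
  define E2 where "E2 i = {X \<in> space sample. t < \<bar>deviation (D1 i) X\<bar>}" for i
  have [measurable]: "E0 i \<in> sets sample" "E1 i \<in> sets sample" "E2 i \<in> sets sample" for i
    unfolding E0_def E1_def E2_def by measurable
  let ?b0 = "2 * exp (real m * (l0\<^sup>2 * v - l0 * t))"
  let ?b1 = "2 * exp (real m * (l1\<^sup>2 * (V * max \<epsilon>0 \<epsilon>1) - l1 * t))"
  have P0: "S.prob (E0 i) \<le> ?b0" for i
    unfolding E0_def by (rule bernstein[where B = B]) (use B v l0 in auto)
  have P1: "S.prob (E1 i) \<le> ?b1" for i
    unfolding E1_def
  proof (rule bernstein[where B = V])
    show "(\<integral>x. (h i x)\<^sup>2 \<partial>P) \<le> V * max \<epsilon>0 \<epsilon>1"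
      by (rule sq_bound[of "h i" "D0 (p i)"]) (use p(2) D0(2)[of "p i"] D0(3)[of "p i"] in \<open>auto simp: h_def\<close>)
    show "\<bar>h i x\<bar> \<le> V" for x using order_trans[OF p(2) conjunct2[OF D0(2)]] unfolding h_def by blast
  qed (use l1 in auto)
  have P2: "S.prob (E2 i) \<le> ?b1" for i
    unfolding E2_def
  proof (rule bernstein[where B = V])
    show "(\<integral>x. (D1 i x)\<^sup>2 \<partial>P) \<le> V * max \<epsilon>0 \<epsilon>1"
      by (rule sq_bound[of "D1 i" "D1 i"]) (use D1(2)[of i] D1(3)[of i] in auto)
  qed (use l1 D1(2) in auto)
  define Bad where "Bad = (\<Union>i<q0. E0 i) \<union> ((\<Union>i<q1. E1 i) \<union> (\<Union>i<q1. E2 i))"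
  have [measurable]: "Bad \<in> sets sample" unfolding Bad_def by measurable
  have U: "S.prob (\<Union>i<q. E i) \<le> real q * b" if "\<And>i. E i \<in> sets sample" "\<And>i. S.prob (E i) \<le> b" for E b and q :: nat
  proof -
    have "S.prob (\<Union>i<q. E i) \<le> (\<Sum>i<q. S.prob (E i))"
      by (rule S.finite_measure_subadditive_finite) (use that in auto)
    also have "\<dots> \<le> real q * b" using sum_bounded_above[of "{..<q}" "\<lambda>i. S.prob (E i)" b] that(2) by simp
    finally show ?thesis .
  qed
  have "S.prob Bad \<le> S.prob (\<Union>i<q0. E0 i) + S.prob ((\<Union>i<q1. E1 i) \<union> (\<Union>i<q1. E2 i))"
    unfolding Bad_def by (rule measure_Un_le) auto
  also have "S.prob ((\<Union>i<q1. E1 i) \<union> (\<Union>i<q1. E2 i)) \<le> S.prob (\<Union>i<q1. E1 i) + S.prob (\<Union>i<q1. E2 i)"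
    by (rule measure_Un_le) auto
  also have "S.prob (\<Union>i<q0. E0 i) \<le> (V / \<epsilon>0 + 1) * ?b0"
    by (rule order_trans[OF U[OF _ P0]]) (use q0 in \<open>auto intro!: mult_right_mono\<close>)
  also have "S.prob (\<Union>i<q1. E1 i) \<le> (V / \<epsilon>1 + 1) * ?b1"
    by (rule order_trans[OF U[OF _ P1]]) (use q1 in \<open>auto intro!: mult_right_mono\<close>)
  also have "S.prob (\<Union>i<q1. E2 i) \<le> (V / \<epsilon>1 + 1) * ?b1"
    by (rule order_trans[OF U[OF _ P2]]) (use q1 in \<open>auto intro!: mult_right_mono\<close>)
  finally have PB: "S.prob Bad \<le> (V / \<epsilon>0 + 1) * ?b0 + 2 * ((V / \<epsilon>1 + 1) * ?b1)" by simp
  have bnd: "\<bar>deviation (\<lambda>x. g (s * x - z)) X\<bar> \<le> 3 * t + 2 * \<epsilon>1" if X: "X \<in> space sample - Bad" for X z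
  proof -
    obtain i where i: "i < q1" "\<And>x. \<bar>g (s * x - z) - g (s * x - A1 i)\<bar> \<le> D1 i x" using A1 by blast
    have d: "\<bar>deviation (\<lambda>x. g (s * x - A0 (p i))) X\<bar> \<le> t" "\<bar>deviation (h i) X\<bar> \<le> t" "\<bar>deviation (D1 i) X\<bar> \<le> t"
      using X i(1) p(1)[of i] unfolding Bad_def E0_def E1_def E2_def by (auto simp: not_less)
    have intg: "integrable P (\<lambda>x. g (s * x - w))" for w
      by (rule bounded_integrable[of _ B]) (use B in auto)
    have intD: "integrable P (D1 i)" by (rule bounded_integrable[of _ V]) (use D1(2)[of i] in auto)
    define k where "k x = g (s * x - z) - g (s * x - A1 i)" for x
    have intk: "integrable P k" unfolding k_def using intg by auto
    have dec: "deviation (\<lambda>x. g (s * x - z)) X = deviation k X + deviation (h i) X + deviation (\<lambda>x. g (s * x - A0 (p i))) X"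
      unfolding deviation_def k_def h_def using intg
      by (simp add: sum_subtractf diff_divide_distrib)
    have "\<bar>(\<Sum>j\<in>I. k (X j)) / real m\<bar> \<le> (\<Sum>j\<in>I. D1 i (X j)) / real m"
      using i(2) unfolding k_def by (auto simp: abs_divide intro!: divide_right_mono order_trans[OF sum_abs] sum_mono)
    moreover have "\<bar>\<integral>x. k x \<partial>P\<bar> \<le> (\<integral>x. D1 i x \<partial>P)"
      by (rule order_trans[OF integral_abs_bound integral_mono]) (use integrable_abs[OF intk] intD i(2)[folded k_def] in auto)
    ultimately have "\<bar>deviation k X\<bar> \<le> \<bar>deviation (D1 i) X\<bar> + 2 * \<epsilon>1"
      using D1(3)[of i] unfolding deviation_def by linarith
    with d show ?thesis unfolding dec by linarith
  qed
  show ?thesis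
  proof (intro bexI[of _ "space sample - Bad"] conjI ballI allI)
    have "space sample - (space sample - Bad) = Bad" using sets.sets_into_space[of Bad sample] by auto
    then show "S.prob (space sample - (space sample - Bad)) \<le> (V / \<epsilon>0 + 1) * ?b0 + 2 * ((V / \<epsilon>1 + 1) * ?b1)"
      using PB by simp
  qed (use bnd in auto)
qed

end

section \<open>Measurability of suprema\<close>
text \<open>In \<open>y\<close> the function is continuous except at countably many points that depend measurably on \<open>X\<close>.  The
inequality for all \<open>y\<close> is therefore equivalent to the inequality at the rationals and at these
points.\<close>

lemma all_le_measurable:
  fixes H :: "'a \<Rightarrow> real \<Rightarrow> real" and e :: "'b \<Rightarrow> 'a \<Rightarrow> real"
  assumes H [measurable]: "(\<lambda>(X, y). H X y) \<in> borel_measurable (M \<Otimes>\<^sub>M borel)"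
    and cnt: "countable A" and e: "\<And>i. i \<in> A \<Longrightarrow> e i \<in> borel_measurable M"
    and S: "S = {0..1} \<or> S = UNIV"
    and cont: "\<And>X y. X \<in> space M \<Longrightarrow> y \<in> S \<Longrightarrow> (\<And>i. i \<in> A \<Longrightarrow> y \<noteq> e i X) \<Longrightarrow> continuous (at y within S) (H X)"
  shows "{X \<in> space M. \<forall>y\<in>S. H X y \<le> c} \<in> sets M"
proof -
  have [measurable]: "S \<in> sets borel" using S by auto
  have dense: "\<exists>s :: nat \<Rightarrow> real. range s \<subseteq> S \<inter> \<rat> \<and> s \<longlonglongrightarrow> y" if "y \<in> S" for y
  proof -
    have "y \<in> closure (S \<inter> \<rat>)"
    proof -
      have "\<exists>q\<in>S \<inter> \<rat>. dist q y < \<epsilon>" if "\<epsilon> > 0" for \<epsilon>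
      proof -
        obtain l u where lu: "l < u" "y - \<epsilon> \<le> l" "u \<le> y + \<epsilon>" "{l<..<u} \<subseteq> S"
        proof (cases "S = UNIV")
          case True
          then show ?thesis using that[of "y - \<epsilon>" "y + \<epsilon>"] \<open>\<epsilon> > 0\<close> by auto
        next
          case False
          moreover have "{max 0 (y - \<epsilon>)<..<min 1 (y + \<epsilon>)} \<subseteq> {0..1}" by (auto simp: subset_iff)
          ultimately show ?thesis using that[of "max 0 (y - \<epsilon>)" "min 1 (y + \<epsilon>)"] \<open>\<epsilon> > 0\<close> \<open>y \<in> S\<close> S by auto
        qed
        from Rats_dense_in_real[OF lu(1)] obtain q where "q \<in> \<rat>" "l < q" "q < u" by blast
        then show ?thesis using lu by (intro bexI[of _ q]) (auto simp: dist_real_def)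
      qed
      then show ?thesis by (auto simp: closure_approachable)
    qed
    then show ?thesis unfolding closure_sequential by (auto simp: image_subset_iff)
  qed
  have "{X \<in> space M. \<forall>y\<in>S. H X y \<le> c} =
      {X \<in> space M. (\<forall>q\<in>S \<inter> \<rat>. H X q \<le> c) \<and> (\<forall>i\<in>A. e i X \<in> S \<longrightarrow> H X (e i X) \<le> c)}" (is "?L = ?R")
  proof (intro equalityI subsetI)
    fix X assume "X \<in> ?R"
    then have X: "X \<in> space M" "\<And>q. q \<in> S \<inter> \<rat> \<Longrightarrow> H X q \<le> c" "\<And>i. i \<in> A \<Longrightarrow> e i X \<in> S \<Longrightarrow> H X (e i X) \<le> c" by auto
    have "H X y \<le> c" if y: "y \<in> S" for y
    proof (cases "\<exists>i\<in>A. y = e i X")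
      case True
      then show ?thesis using X(3) y by blast
    next
      case False
      then have c: "continuous (at y within S) (H X)" using cont[OF X(1) y] by blast
      obtain s where s: "range s \<subseteq> S \<inter> \<rat>" "s \<longlonglongrightarrow> y" using dense[OF y] by blast
      have "(\<lambda>n. H X (s n)) \<longlonglongrightarrow> H X y"
        by (rule continuous_within_tendsto_compose[OF c _ s(2)]) (use s(1) in \<open>auto intro!: always_eventually\<close>)
      then show ?thesis by (rule LIMSEQ_le_const2) (use s(1) X(2) in blast)
    qed
    then show "X \<in> ?L" using X(1) by simp
  qed auto
  also have "\<dots> = (\<Inter>q\<in>S \<inter> \<rat>. {X \<in> space M. H X q \<le> c}) \<inter> space M \<inter> ((\<Inter>i\<in>A. {X \<in> space M. e i X \<in> S \<longrightarrow> H X (e i X) \<le> c}) \<inter> space M)"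
    by auto
  also have "\<dots> \<in> sets M"
  proof (rule sets.Int)
    have [measurable]: "(\<lambda>X. H X q) \<in> borel_measurable M" for q
      using measurable_compose[OF measurable_Pair2'[of q] H] by simp
    have he: "(\<lambda>X. H X (e i X)) \<in> borel_measurable M" if "i \<in> A" for i
      using measurable_compose[OF measurable_Pair[OF measurable_ident_sets[OF refl] e[OF that]] H] by simp
    show "(\<Inter>q\<in>S \<inter> \<rat>. {X \<in> space M. H X q \<le> c}) \<inter> space M \<in> sets M"
    proof (intro sets.Int sets.countable_INT')
      show "countable (S \<inter> \<rat>)" by (rule countable_subset[OF _ countable_rat]) auto
      have "0 \<in> S \<inter> \<rat>" using S by auto
      then show "S \<inter> \<rat> \<noteq> {}" by blast
      show "(\<lambda>q. {X \<in> space M. H X q \<le> c}) ` (S \<inter> \<rat>) \<subseteq> sets M" by (auto simp: image_subset_iff)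
    qed (rule sets.top)
    show "(\<Inter>i\<in>A. {X \<in> space M. e i X \<in> S \<longrightarrow> H X (e i X) \<le> c}) \<inter> space M \<in> sets M"
    proof (cases "A = {}")
      case False
      have "{X \<in> space M. e i X \<in> S \<longrightarrow> H X (e i X) \<le> c} \<in> sets M" if "i \<in> A" for i
      proof -
        note [measurable] = he[OF that] e[OF that]
        show ?thesis by measurable
      qed
      then show ?thesis using False cnt by (intro sets.Int sets.countable_INT'[OF cnt False]) auto
    qed simp
  qed
  finally show ?thesis .
qed

lemma SUP_measurable:
  fixes H :: "'a \<Rightarrow> real \<Rightarrow> real" and e :: "'b \<Rightarrow> 'a \<Rightarrow> real"
  assumes H: "(\<lambda>(X, y). H X y) \<in> borel_measurable (M \<Otimes>\<^sub>M borel)"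
    and cnt: "countable A" and e: "\<And>i. i \<in> A \<Longrightarrow> e i \<in> borel_measurable M"
    and S: "S = {0..1} \<or> S = UNIV"
    and cont: "\<And>X y. X \<in> space M \<Longrightarrow> y \<in> S \<Longrightarrow> (\<And>i. i \<in> A \<Longrightarrow> y \<noteq> e i X) \<Longrightarrow> continuous (at y within S) (H X)"
    and bdd: "\<And>X. X \<in> space M \<Longrightarrow> bdd_above (H X ` S)"
  shows "(\<lambda>X. SUP y\<in>S. H X y) \<in> borel_measurable M"
  unfolding borel_measurable_iff_le
proof
  fix c
  have ne: "S \<noteq> {}" using S by auto
  have eq: "{X \<in> space M. (SUP y\<in>S. H X y) \<le> c} = {X \<in> space M. \<forall>y\<in>S. H X y \<le> c}"
    by (intro Collect_cong conj_cong refl cSUP_le_iff ne bdd)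
  show "{X \<in> space M. (SUP y\<in>S. H X y) \<le> c} \<in> sets M"
    unfolding eq by (rule all_le_measurable[where A = A and e = e, OF H cnt e S cont])
qed

lemma mult_mono_outer:
  fixes v v' w w' q :: real
  assumes "v \<le> v'" "w \<le> w'" "0 \<le> v" "0 \<le> w" "0 \<le> q"
  shows "v * q * w \<le> v' * q * w'"
  using assms by (intro mult_mono mult_nonneg_nonneg) auto

context tame_kernel
begin

definition K_bound :: real where "K_bound = C * (\<bar>g 0\<bar> + V)"

lemma C_nonneg: "0 \<le> C"
  using suminf_nonneg[OF weights_summable[of 0]] weights_bound[of 0] by simp

lemma K_le: "\<bar>K y x\<bar> \<le> K_bound"
proof -
  let ?S = "\<bar>g 0\<bar> + V"
  have S0: "0 \<le> ?S" using dominated_bounded[OF g_dominated, of 0] by linarith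
  have le: "\<bar>a y k * g (x - c y k)\<bar> \<le> \<bar>a y k\<bar> * ?S" for k
    unfolding abs_mult by (rule mult_left_mono[OF dominated_bounded[OF g_dominated]]) simp
  have s: "summable (\<lambda>k. \<bar>a y k\<bar> * ?S)" by (rule summable_mult2[OF weights_summable])
  have sm: "summable (\<lambda>k. \<bar>a y k * g (x - c y k)\<bar>)"
    by (rule summable_comparison_test'[OF s, of 0]) (use le in simp)
  have "\<bar>K y x\<bar> \<le> (\<Sum>k. \<bar>a y k * g (x - c y k)\<bar>)" unfolding expansion by (rule summable_rabs[OF sm])
  also have "\<dots> \<le> (\<Sum>k. \<bar>a y k\<bar> * ?S)" by (rule suminf_le[OF le sm s])
  also have "\<dots> = (\<Sum>k. \<bar>a y k\<bar>) * ?S" by (rule suminf_mult2[OF weights_summable, symmetric])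
  also have "\<dots> \<le> K_bound" unfolding K_bound_def by (rule mult_right_mono[OF weights_bound S0])
  finally show ?thesis .
qed

lemma K_bound_nonneg: "0 \<le> K_bound"
  using K_le[of 0 0] by linarith

lemma scaled_kernel_le: "\<bar>scaled_kernel K j y x\<bar> \<le> 2 ^ j * K_bound"
  unfolding scaled_kernel_def abs_mult using K_le by (simp add: mult_left_mono)

lemma scaled_kernel_measurable_pair: "(\<lambda>(y, x). scaled_kernel K j y x) \<in> borel_measurable (borel \<Otimes>\<^sub>M borel)"
proof -
  note [measurable] = K_measurable
  show ?thesis unfolding scaled_kernel_def by measurable
qed

lemma scaled_kernel_measurable [measurable]: "scaled_kernel K j y \<in> borel_measurable borel"
  using measurable_compose[OF measurable_Pair1'[of y borel borel] scaled_kernel_measurable_pair[of j]] by simp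

lemma scaled_kernel_isCont:
  assumes "2 ^ j * y \<notin> D" "2 ^ j * y - 2 ^ j * x \<notin> D"
  shows "isCont (\<lambda>y. scaled_kernel K j y x) y"
proof -
  have "isCont (\<lambda>y. K y (2 ^ j * x)) (2 ^ j * y)" by (rule K_isCont[OF assms])
  moreover have "isCont (\<lambda>y. 2 ^ j * y) y" by simp
  ultimately have "isCont (\<lambda>y. K (2 ^ j * y) (2 ^ j * x)) y"
    using isCont_o2[of y "\<lambda>y. 2 ^ j * y" "\<lambda>y. K y (2 ^ j * x)"] by simp
  then show ?thesis unfolding scaled_kernel_def by simp
qed

lemma estimator_le:
  assumes "finite I"
  shows "\<bar>estimator K I X y j\<bar> \<le> 2 ^ j * K_bound"
proof (cases "card I = 0")
  case True
  then show ?thesis using K_bound_nonneg by (simp add: estimator_def)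
next
  case False
  have "\<bar>\<Sum>i\<in>I. scaled_kernel K j y (X i)\<bar> \<le> (\<Sum>i\<in>I. \<bar>scaled_kernel K j y (X i)\<bar>)" by (rule sum_abs)
  also have "\<dots> \<le> real (card I) * (2 ^ j * K_bound)" by (rule sum_bounded_above) (rule scaled_kernel_le)
  finally show ?thesis using False unfolding estimator_def by (simp add: abs_divide divide_le_eq mult.commute)
qed

text \<open>The points at which the estimator at level \<open>j\<close> may be discontinuous: \<open>2^j y\<close> lies in \<open>D\<close> (index 0), or
\<open>2^j (y - X i)\<close> does.\<close>

definition exceptional :: "nat \<Rightarrow> (nat \<times> real) \<Rightarrow> (nat \<Rightarrow> real) \<Rightarrow> real" where
  "exceptional j = (\<lambda>(i, d) X. if i = 0 then d / 2 ^ j else X i + d / 2 ^ j)"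

lemma estimator_isCont:
  assumes I: "finite I" "I \<subseteq> {1..n}"
    and y: "\<And>p. p \<in> {0..n} \<times> D \<Longrightarrow> y \<noteq> exceptional j p X"
  shows "isCont (\<lambda>y. estimator K I X y j) y"
  unfolding estimator_def divide_inverse
proof (intro continuous_intros scaled_kernel_isCont)
  show D0: "2 ^ j * y \<notin> D"
  proof
    assume "2 ^ j * y \<in> D"
    then show False using y[of "(0, 2 ^ j * y)"] by (simp add: exceptional_def)
  qed
  fix i assume "i \<in> I"
  then have i: "i \<noteq> 0" "i \<in> {0..n}" using I by auto
  show "2 ^ j * y - 2 ^ j * X i \<notin> D"
  proof
    assume "2 ^ j * y - 2 ^ j * X i \<in> D"
    then show False using y[of "(i, 2 ^ j * y - 2 ^ j * X i)"] i by (simp add: exceptional_def diff_divide_distrib)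
  qed
qed

end

abbreviation sample_space :: "nat \<Rightarrow> (nat \<Rightarrow> real) measure" where
  "sample_space n \<equiv> Pi\<^sub>M {1..n} (\<lambda>_. borel)"

lemma sets_sample_law: "sets (sample_law f n) = sets (sample_space n)"
  unfolding sample_law_def by (rule sets_PiM_cong) auto

lemma space_sample_law: "space (sample_law f n) = space (sample_space n)"
  by (rule sets_eq_imp_space_eq[OF sets_sample_law])

context tame_kernel
begin

lemma exceptional_measurable:
  assumes "p \<in> {0..n} \<times> D"
  shows "exceptional j p \<in> borel_measurable (sample_space n)"
proof (cases p)
  case (Pair i d)
  show ?thesis
  proof (cases "i = 0")
    case False
    then have [measurable]: "i \<in> {1..n}" using assms Pair by auto
    have "exceptional j p = (\<lambda>X. X i + d / 2 ^ j)" using False by (simp add: Pair exceptional_def)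
    moreover have "(\<lambda>X. X i + d / 2 ^ j) \<in> borel_measurable (sample_space n)" by measurable
    ultimately show ?thesis by (simp only:)
  qed (simp add: Pair exceptional_def)
qed

lemma countable_exceptional: "countable ({0..n :: nat} \<times> D)"
  by (intro countable_SIGMA countable_D countable_finite) auto

lemma estimator_measurable_pair:
  assumes "I \<subseteq> {1..n}"
  shows "(\<lambda>(X, y). estimator K I X y j) \<in> borel_measurable (sample_space n \<Otimes>\<^sub>M borel)"
proof -
  have "(\<lambda>p. scaled_kernel K j (snd p) (fst p i)) \<in> borel_measurable (sample_space n \<Otimes>\<^sub>M borel)" if "i \<in> I" for i
  proof -
    have [measurable]: "i \<in> {1..n}" using that assms by auto
    have "(\<lambda>p. (snd p, fst p i)) \<in> (sample_space n \<Otimes>\<^sub>M borel) \<rightarrow>\<^sub>M borel \<Otimes>\<^sub>M borel" by measurable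
    from measurable_compose[OF this scaled_kernel_measurable_pair[of j]] show ?thesis by simp
  qed
  then have "(\<lambda>p. (\<Sum>i\<in>I. scaled_kernel K j (snd p) (fst p i)) / real (card I)) \<in> borel_measurable (sample_space n \<Otimes>\<^sub>M borel)"
    by (intro borel_measurable_divide borel_measurable_sum) auto
  then show ?thesis unfolding estimator_def case_prod_beta .
qed

lemma sup_norm_measurable:
  assumes I: "I \<subseteq> {1..n}"
  shows "(\<lambda>X. sup_norm (\<lambda>y. estimator K I X y j - estimator K I X y l)) \<in> borel_measurable (sample_space n)"
  unfolding sup_norm_def
proof (rule SUP_measurable[where A = "{0..n} \<times> D <+> {0..n} \<times> D" and e = "\<lambda>p. case p of Inl p \<Rightarrow> exceptional j p | Inr p \<Rightarrow> exceptional l p"])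
  have fI: "finite I" using I by (rule finite_subset) simp
  note [measurable] = estimator_measurable_pair[OF I]
  show "(\<lambda>(X, y). \<bar>estimator K I X y j - estimator K I X y l\<bar>) \<in> borel_measurable (sample_space n \<Otimes>\<^sub>M borel)"
    by measurable
  show "countable ({0..n} \<times> D <+> {0..n} \<times> D)" by (intro countable_Plus countable_exceptional)
  show "(case p of Inl p \<Rightarrow> exceptional j p | Inr p \<Rightarrow> exceptional l p) \<in> borel_measurable (sample_space n)"
    if "p \<in> {0..n} \<times> D <+> {0..n} \<times> D" for p
    using that by (elim PlusE) (simp_all only: sum.case exceptional_measurable)
  fix X y assume ne: "\<And>p. p \<in> {0..n} \<times> D <+> {0..n} \<times> D \<Longrightarrow> y \<noteq> (case p of Inl p \<Rightarrow> exceptional j p | Inr p \<Rightarrow> exceptional l p) X"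
  have "isCont (\<lambda>y. estimator K I X y j) y"
    by (rule estimator_isCont[OF fI I]) (use ne[OF InlI] in simp)
  moreover have "isCont (\<lambda>y. estimator K I X y l) y"
    by (rule estimator_isCont[OF fI I]) (use ne[OF InrI] in simp)
  ultimately show "isCont (\<lambda>y. \<bar>estimator K I X y j - estimator K I X y l\<bar>) y"
    by (intro continuous_intros)
next
  fix X
  have fI: "finite I" using I by (rule finite_subset) simp
  have "\<bar>estimator K I X y j - estimator K I X y l\<bar> \<le> 2 ^ j * K_bound + 2 ^ l * K_bound" for y
    using estimator_le[OF fI, of X y j] estimator_le[OF fI, of X y l] by linarith
  then show "bdd_above (range (\<lambda>y. \<bar>estimator K I X y j - estimator K I X y l\<bar>))" by (intro bdd_aboveI2)
qed simp

text \<open>The level is a function of the set of those levels that pass the test, and this set takes finitely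
many values, each on a measurable set.\<close>

lemma selected_level_measurable:
  assumes n: "m1 + m2 = n"
  shows "selected_level M' K m1 m2 jlo jhi f \<in> sample_space n \<rightarrow>\<^sub>M count_space UNIV"
proof -
  let ?I = "{m1 + 1..m1 + m2}"
  define Q where "Q j X \<longleftrightarrow> (\<forall>l\<in>{jlo..jhi}. j < l \<longrightarrow>
      sup_norm (\<lambda>y. estimator K ?I X y j - estimator K ?I X y l) \<le> M' * sqrt (max (sup_norm f) 1) * sqrt (2 ^ l * real l / real m2))" for j X
  have sel: "selected_level M' K m1 m2 jlo jhi f X = Min {j \<in> {jlo..jhi}. Q j X}" for X
    unfolding selected_level_def Q_def Let_def ..
  have [measurable]: "(\<lambda>X. sup_norm (\<lambda>y. estimator K ?I X y j - estimator K ?I X y l)) \<in> borel_measurable (sample_space n)" for j l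
    by (rule sup_norm_measurable) (use n in auto)
  have [measurable]: "Measurable.pred (sample_space n) (Q j)" for j
    unfolding Q_def
  proof (rule pred_intros_finite(3)[OF finite_atLeastAtMost])
    fix l
    show "Measurable.pred (sample_space n) (\<lambda>X. j < l \<longrightarrow>
      sup_norm (\<lambda>y. estimator K ?I X y j - estimator K ?I X y l) \<le> M' * sqrt (max (sup_norm f) 1) * sqrt (2 ^ l * real l / real m2))"
    proof (cases "j < l")
      case True
      have "Measurable.pred (sample_space n) (\<lambda>X.
        sup_norm (\<lambda>y. estimator K ?I X y j - estimator K ?I X y l) \<le> M' * sqrt (max (sup_norm f) 1) * sqrt (2 ^ l * real l / real m2))"
        unfolding pred_def by (rule borel_measurable_le) (rule sup_norm_measurable, use n in simp, simp)
      with True show ?thesis by (simp only: simp_thms)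
    qed simp
  qed
  have R: "{X \<in> space (sample_space n). {j \<in> {jlo..jhi}. Q j X} = R} \<in> sets (sample_space n)" if "R \<subseteq> {jlo..jhi}" for R
  proof -
    have "{X \<in> space (sample_space n). {j \<in> {jlo..jhi}. Q j X} = R} = {X \<in> space (sample_space n). \<forall>j\<in>{jlo..jhi}. Q j X \<longleftrightarrow> j \<in> R}"
      using that by auto
    also have "Measurable.pred (sample_space n) (\<lambda>X. \<forall>j\<in>{jlo..jhi}. Q j X \<longleftrightarrow> j \<in> R)"
      by (intro pred_intros_finite(3) finite_atLeastAtMost) measurable
    then have "{X \<in> space (sample_space n). \<forall>j\<in>{jlo..jhi}. Q j X \<longleftrightarrow> j \<in> R} \<in> sets (sample_space n)"
      by (simp only: pred_def)
    finally show ?thesis .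
  qed
  show ?thesis
  proof (rule measurable_count_space_eq2_countable[THEN iffD2])
    show "selected_level M' K m1 m2 jlo jhi f \<in> space (sample_space n) \<rightarrow> UNIV \<and>
      (\<forall>a\<in>UNIV. selected_level M' K m1 m2 jlo jhi f -` {a} \<inter> space (sample_space n) \<in> sets (sample_space n))"
    proof (intro conjI ballI)
      fix a
      have "selected_level M' K m1 m2 jlo jhi f -` {a} \<inter> space (sample_space n) =
        (\<Union>R\<in>{R. R \<subseteq> {jlo..jhi} \<and> Min R = a}. {X \<in> space (sample_space n). {j \<in> {jlo..jhi}. Q j X} = R})"
        unfolding vimage_def sel by auto
      also have "\<dots> \<in> sets (sample_space n)"
        by (rule sets.finite_UN) (use R in auto)
      finally show "selected_level M' K m1 m2 jlo jhi f -` {a} \<inter> space (sample_space n) \<in> sets (sample_space n)" .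
    qed auto
  qed
qed

lemma sup_interval_measurable:
  fixes h :: "(nat \<Rightarrow> real) \<Rightarrow> real \<Rightarrow> real"
  assumes I: "I \<subseteq> {1..n}" and h: "(\<lambda>(X, y). h X y) \<in> borel_measurable (sample_space n \<Otimes>\<^sub>M borel)"
    and cont: "\<And>X y. X \<in> space (sample_space n) \<Longrightarrow> y \<in> {0..1} \<Longrightarrow> 2 ^ j * y \<notin> D \<Longrightarrow>
       continuous (at y within {0..1}) (\<lambda>y. estimator K I X y j) \<Longrightarrow> continuous (at y within {0..1}) (h X)"
    and bdd: "\<And>X. X \<in> space (sample_space n) \<Longrightarrow> bdd_above (h X ` {0..1})"
  shows "(\<lambda>X. SUP y\<in>{0..1}. h X y) \<in> borel_measurable (sample_space n)"
proof (rule SUP_measurable[where A = "{0..n} \<times> D" and e = "exceptional j"])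
  fix X y assume X: "X \<in> space (sample_space n)" and y: "y \<in> {0..1 :: real}" and ne: "\<And>p. p \<in> {0..n} \<times> D \<Longrightarrow> y \<noteq> exceptional j p X"
  have fI: "finite I" using I by (rule finite_subset) simp
  have "2 ^ j * y \<notin> D"
  proof
    assume "2 ^ j * y \<in> D"
    then show False using ne[of "(0, 2 ^ j * y)"] by (simp add: exceptional_def)
  qed
  then show "continuous (at y within {0..1}) (h X)"
    by (rule cont[OF X y]) (rule continuous_at_imp_continuous_at_within[OF estimator_isCont[OF fI I ne]])
qed (use bdd h countable_exceptional exceptional_measurable in auto)

text \<open>Where the infimum of the estimator is positive, the quotient is bounded and inherits continuity from
the estimator off the exceptional points; the infimum itself is measurable for the same reason.\<close>

lemma studentized_error_measurable:
  assumes m1: "m1 \<le> n" and f: "continuous_on UNIV f" and d: "d \<in> borel_measurable (sample_space n)"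
  shows "(\<lambda>X. studentized_error K m1 \<sigma> f X j (d X)) \<in> borel_measurable (sample_space n)"
proof -
  let ?I = "{1..m1}"
  have I: "?I \<subseteq> {1..n}" using m1 by auto
  note [measurable] = d estimator_measurable_pair[OF I] borel_measurable_continuous_onI[OF f]
  have bddI: "bdd_below ((\<lambda>y. estimator K ?I X y j) ` {0..1})" for X
  proof (rule bdd_belowI2)
    show "- (2 ^ j * K_bound) \<le> estimator K ?I X y j" for y using estimator_le[of ?I X y j] by simp
  qed
  define inf where "inf X = (INF y\<in>{0..1}. estimator K ?I X y j)" for X
  have le_inf: "inf X \<le> estimator K ?I X y j" if "y \<in> {0..1}" for X y
    unfolding inf_def by (rule cINF_lower[OF bddI that])
  have [measurable]: "inf \<in> borel_measurable (sample_space n)"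
  proof -
    have "inf = (\<lambda>X. - (SUP y\<in>{0..1}. - estimator K ?I X y j))"
      unfolding inf_def Inf_real_def by (simp add: image_image)
    moreover have "(\<lambda>X. SUP y\<in>{0..1}. - estimator K ?I X y j) \<in> borel_measurable (sample_space n)"
    proof (rule sup_interval_measurable[OF I])
      show "bdd_above ((\<lambda>y. - estimator K ?I X y j) ` {0..1})" for X
        by (rule bdd_aboveI2[of _ _ "2 ^ j * K_bound"]) (use estimator_le[of ?I X _ j] in \<open>simp add: abs_le_iff\<close>)
    qed (measurable, intro continuous_intros)
    ultimately show ?thesis by simp
  qed
  define h where "h X y = (if 0 < inf X then \<bar>(estimator K ?I X y j - f y) / (kernel_const K * \<sigma> * sqrt (estimator K ?I X y j))\<bar> else 0)" for X y
  have "(\<lambda>X. SUP y\<in>{0..1}. h X y) \<in> borel_measurable (sample_space n)"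
  proof (rule sup_interval_measurable[OF I])
    have "(\<lambda>p. h (fst p) (snd p)) \<in> borel_measurable (sample_space n \<Otimes>\<^sub>M borel)"
      unfolding h_def by measurable
    then show "(\<lambda>(X, y). h X y) \<in> borel_measurable (sample_space n \<Otimes>\<^sub>M borel)" by (simp add: case_prod_beta')
    fix X
    obtain B where B: "\<And>y. y \<in> {0..1} \<Longrightarrow> \<bar>f y\<bar> \<le> B"
    proof -
      have "compact (f ` {0..1})"
        by (rule compact_continuous_image[OF continuous_on_subset[OF f]]) auto
      from compact_imp_bounded[OF this] obtain B where "\<forall>x\<in>{0..1}. \<bar>f x\<bar> \<le> B" unfolding bounded_iff by auto
      then show ?thesis using that[of B] by blast
    qed
    show "bdd_above (h X ` {0..1})"
    proof (cases "0 < inf X")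
      case True
      have "h X y \<le> (2 ^ j * K_bound + B) * (1 / \<bar>kernel_const K * \<sigma>\<bar>) * (1 / sqrt (inf X))" if y: "y \<in> {0..1}" for y
      proof -
        have e: "0 < estimator K ?I X y j" "inf X \<le> estimator K ?I X y j" using le_inf[OF y, of X] True by linarith+
        have "\<bar>estimator K ?I X y j - f y\<bar> \<le> 2 ^ j * K_bound + B"
          using estimator_le[of ?I X y j] B[OF y] by simp
        moreover have "1 / sqrt (estimator K ?I X y j) \<le> 1 / sqrt (inf X)"
          using e True by (intro divide_left_mono) (auto intro!: mult_pos_pos)
        moreover have "h X y = \<bar>estimator K ?I X y j - f y\<bar> * (1 / \<bar>kernel_const K * \<sigma>\<bar>) * (1 / sqrt (estimator K ?I X y j))"
          unfolding h_def using True e by (simp add: abs_mult)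
        ultimately show ?thesis using e True by (simp only:) (rule mult_mono_outer, auto)
      qed
      then show ?thesis by (rule bdd_aboveI2)
    next
      case False
      then show ?thesis unfolding h_def by (auto intro!: bdd_aboveI2)
    qed
    fix y assume y: "y \<in> {0..1 :: real}" and c: "continuous (at y within {0..1}) (\<lambda>y. estimator K ?I X y j)"
    show "continuous (at y within {0..1}) (h X)"
    proof (cases "kernel_const K * \<sigma> = 0 \<or> \<not> 0 < inf X")
      case True
      then have "h X = (\<lambda>_. 0)" unfolding h_def by auto
      then show ?thesis by simp
    next
      case False
      have e: "0 < estimator K ?I X y j" using le_inf[OF y, of X] False by linarith
      have "isCont f y" using f by (simp add: continuous_on_eq_continuous_at)
      then have cf: "continuous (at y within {0..1}) f" by (rule continuous_at_imp_continuous_at_within)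
      have "h X = (\<lambda>y. \<bar>(estimator K ?I X y j - f y) / (kernel_const K * \<sigma> * sqrt (estimator K ?I X y j))\<bar>)"
        unfolding h_def using False by auto
      moreover have "continuous (at y within {0..1}) (\<lambda>y. \<bar>(estimator K ?I X y j - f y) / (kernel_const K * \<sigma> * sqrt (estimator K ?I X y j))\<bar>)"
        unfolding continuous_within
        by (intro tendsto_rabs tendsto_divide tendsto_diff tendsto_mult tendsto_const tendsto_real_sqrt
            c[unfolded continuous_within] cf[unfolded continuous_within]) (use False e in auto)
      ultimately show ?thesis by simp
    qed
  qed
  note [measurable] = this
  have "(\<lambda>X. studentized_error K m1 \<sigma> f X j (d X)) = (\<lambda>X. if 0 < inf X then (SUP y\<in>{0..1}. h X y) else d X)"
    unfolding studentized_error_def inf_def[symmetric] h_def by (rule ext) simp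
  moreover have "(\<lambda>X. if 0 < inf X then (SUP y\<in>{0..1}. h X y) else d X) \<in> borel_measurable (sample_space n)"
    by measurable
  ultimately show ?thesis by (simp only:)
qed

lemma kernel_op_isCont:
  assumes f: "integrable lborel f" and y: "2 ^ j * y \<notin> D"
  shows "isCont (kernel_op K j f) y"
proof (rule continuous_at_sequentiallyI)
  fix s :: "nat \<Rightarrow> real" assume s: "s \<longlonglongrightarrow> y"
  have [measurable]: "f \<in> borel_measurable borel" using borel_measurable_integrable[OF f] by simp
  show "(\<lambda>n. kernel_op K j f (s n)) \<longlonglongrightarrow> kernel_op K j f y"
    unfolding kernel_op_def
  proof (rule integral_dominated_convergence[where w = "\<lambda>x. 2 ^ j * K_bound * \<bar>f x\<bar>"])
    have "countable ((\<lambda>d. y - d / 2 ^ j) ` D)" by (rule countable_image[OF countable_D])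
    then have "AE x in lborel. x \<notin> (\<lambda>d. y - d / 2 ^ j) ` D"
      by (intro AE_not_in countable_imp_null_set_lborel)
    then show "AE x in lborel. (\<lambda>n. scaled_kernel K j (s n) x * f x) \<longlonglongrightarrow> scaled_kernel K j y x * f x"
    proof eventually_elim
      case (elim x)
      have "2 ^ j * y - 2 ^ j * x \<notin> D"
      proof
        assume "2 ^ j * y - 2 ^ j * x \<in> D"
        then have "x \<in> (\<lambda>d. y - d / 2 ^ j) ` D"
          by (rule rev_image_eqI) (simp add: diff_divide_distrib)
        with elim show False by simp
      qed
      then have "(\<lambda>n. scaled_kernel K j (s n) x) \<longlonglongrightarrow> scaled_kernel K j y x"
        by (intro isCont_tendsto_compose[OF scaled_kernel_isCont[OF y] s])
      then show ?case by (intro tendsto_intros)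
    qed
    show "AE x in lborel. norm (scaled_kernel K j (s n) x * f x) \<le> 2 ^ j * K_bound * \<bar>f x\<bar>" for n
      using scaled_kernel_le by (auto simp: abs_mult intro!: mult_right_mono)
    show "(\<lambda>x. scaled_kernel K j y x * f x) \<in> borel_measurable lborel"
      "(\<lambda>x. scaled_kernel K j (s n) x * f x) \<in> borel_measurable lborel" for n by measurable
  qed (use f in auto)
qed

lemma kernel_op_measurable:
  assumes f: "integrable lborel f"
  shows "kernel_op K j f \<in> borel_measurable borel"
proof (rule borel_measurable_continuous_countable_exceptions)
  show "countable ((\<lambda>d. d / 2 ^ j) ` D)" by (rule countable_image[OF countable_D])
  show "continuous_on (- (\<lambda>d. d / 2 ^ j) ` D) (kernel_op K j f)"
  proof (intro continuous_at_imp_continuous_on ballI kernel_op_isCont[OF f])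
    fix y assume y: "y \<in> - (\<lambda>d. d / 2 ^ j) ` D"
    show "2 ^ j * y \<notin> D"
    proof
      assume "2 ^ j * y \<in> D"
      then have "y \<in> (\<lambda>d. d / 2 ^ j) ` D" by (rule rev_image_eqI) simp
      with y show False by simp
    qed
  qed
qed

lemma centred_sup_measurable:
  assumes m1: "m1 \<le> n" and f: "continuous_on UNIV f" "integrable lborel f" and pos: "\<And>y. y \<in> {0..1} \<Longrightarrow> 0 < f y"
  shows "(\<lambda>X. SUP y\<in>{0..1}. \<bar>(estimator K {1..m1} X y j - kernel_op K j f y) / (kernel_const K * sqrt (f y))\<bar>)
     \<in> borel_measurable (sample_space n)"
proof (rule sup_interval_measurable[where I = "{1..m1}" and j = j])
  show I: "{1..m1} \<subseteq> {1..n}" using m1 by auto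
  note [measurable] = estimator_measurable_pair[OF I] borel_measurable_continuous_onI[OF f(1)] kernel_op_measurable[OF f(2)]
  show "(\<lambda>(X, y). \<bar>(estimator K {1..m1} X y j - kernel_op K j f y) / (kernel_const K * sqrt (f y))\<bar>)
      \<in> borel_measurable (sample_space n \<Otimes>\<^sub>M borel)" by measurable
  fix X
  show "bdd_above ((\<lambda>y. \<bar>(estimator K {1..m1} X y j - kernel_op K j f y) / (kernel_const K * sqrt (f y))\<bar>) ` {0..1})"
  proof -
    have "continuous_on {0..1} f" by (rule continuous_on_subset[OF f(1)]) simp
    then obtain y0 where y0: "y0 \<in> {0..1}" "\<And>y. y \<in> {0..1} \<Longrightarrow> f y0 \<le> f y"
      using continuous_attains_inf[of "{0..1 :: real}" f] by auto
    let ?m = "2 ^ j * K_bound + 2 ^ j * K_bound * (\<integral>x. \<bar>f x\<bar> \<partial>lborel)"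
    have "\<bar>(estimator K {1..m1} X y j - kernel_op K j f y) / (kernel_const K * sqrt (f y))\<bar> \<le>
        ?m * (1 / \<bar>kernel_const K\<bar>) * (1 / sqrt (f y0))" if y: "y \<in> {0..1}" for y
    proof -
      have "\<bar>kernel_op K j f y\<bar> \<le> (\<integral>x. \<bar>scaled_kernel K j y x * f x\<bar> \<partial>lborel)"
        unfolding kernel_op_def by (rule integral_abs_bound)
      also have "\<dots> \<le> (\<integral>x. 2 ^ j * K_bound * \<bar>f x\<bar> \<partial>lborel)"
        by (rule integral_mono') (use f(2) scaled_kernel_le K_bound_nonneg in \<open>auto simp: abs_mult intro!: mult_right_mono\<close>)
      finally have "\<bar>estimator K {1..m1} X y j - kernel_op K j f y\<bar> \<le> ?m"
        using estimator_le[of "{1..m1}" X y j] by simp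
      moreover have "1 / sqrt (f y) \<le> 1 / sqrt (f y0)"
        using y0(2)[OF y] pos[OF y0(1)] pos[OF y] by (intro divide_left_mono) auto
      moreover have "\<bar>(estimator K {1..m1} X y j - kernel_op K j f y) / (kernel_const K * sqrt (f y))\<bar> =
         \<bar>estimator K {1..m1} X y j - kernel_op K j f y\<bar> * (1 / \<bar>kernel_const K\<bar>) * (1 / sqrt (f y))"
        using pos[OF y] by (simp add: abs_mult)
      ultimately show ?thesis using pos[OF y] by (simp only:) (rule mult_mono_outer, auto)
    qed
    then show ?thesis by (rule bdd_aboveI2)
  qed
  fix y assume y: "y \<in> {0..1 :: real}" and D: "2 ^ j * y \<notin> D"
    and c: "continuous (at y within {0..1}) (\<lambda>y. estimator K {1..m1} X y j)"
  have "isCont f y" using f(1) by (simp add: continuous_on_eq_continuous_at)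
  then have cf: "(f \<longlongrightarrow> f y) (at y within {0..1})"
    by (rule continuous_within[THEN iffD1, OF continuous_at_imp_continuous_at_within])
  have ck: "(kernel_op K j f \<longlongrightarrow> kernel_op K j f y) (at y within {0..1})"
    by (rule continuous_within[THEN iffD1, OF continuous_at_imp_continuous_at_within[OF kernel_op_isCont[OF f(2) D]]])
  have f0: "sqrt (f y) \<noteq> 0" using pos[OF y] by simp
  show "continuous (at y within {0..1}) (\<lambda>y. \<bar>(estimator K {1..m1} X y j - kernel_op K j f y) / (kernel_const K * sqrt (f y))\<bar>)"
  proof (cases "kernel_const K = 0")
    case True
    then have "(\<lambda>y. \<bar>(estimator K {1..m1} X y j - kernel_op K j f y) / (kernel_const K * sqrt (f y))\<bar>) = (\<lambda>_. 0)" by simp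
    then show ?thesis by (simp only: continuous_const)
  next
    case False
    then have "kernel_const K * sqrt (f y) \<noteq> 0" using f0 by simp
    then show ?thesis unfolding continuous_within
      by (intro tendsto_rabs tendsto_divide tendsto_diff tendsto_mult tendsto_const tendsto_real_sqrt
            c[unfolded continuous_within] cf ck)
  qed
qed

end

section \<open>Laws of samples and the noise of the estimator\<close>
definition probability_density :: "(real \<Rightarrow> real) \<Rightarrow> bool" where
  "probability_density f \<longleftrightarrow> integrable lborel f \<and> (\<integral>x. f x \<partial>lborel) = 1 \<and> (\<forall>x. 0 \<le> f x)"

lemma probability_density_prob_space:
  assumes "probability_density f"
  shows "prob_space (density lborel (\<lambda>x. ennreal (f x)))"
proof (rule prob_spaceI)
  have f: "integrable lborel f" "\<And>x. 0 \<le> f x" "(\<integral>x. f x \<partial>lborel) = 1" using assms unfolding probability_density_def by auto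
  have [measurable]: "f \<in> borel_measurable borel" using borel_measurable_integrable[OF f(1)] by simp
  have "(\<integral>\<^sup>+x. ennreal (f x) \<partial>lborel) = ennreal (\<integral>x. f x \<partial>lborel)"
    by (rule nn_integral_eq_integral) (use f in auto)
  then show "emeasure (density lborel (\<lambda>x. ennreal (f x))) (space (density lborel (\<lambda>x. ennreal (f x)))) = 1"
    using f(3) by (simp add: emeasure_density)
qed

lemma sample_law_prob_space:
  assumes "probability_density f"
  shows "prob_space (sample_law f n)"
  unfolding sample_law_def by (rule prob_space_PiM) (rule probability_density_prob_space[OF assms])

lemma integral_density_law:
  fixes h :: "real \<Rightarrow> real"
  assumes f: "probability_density f" and h: "h \<in> borel_measurable borel"
  shows "(\<integral>x. h x \<partial>density lborel (\<lambda>x. ennreal (f x))) = (\<integral>x. f x * h x \<partial>lborel)"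
proof -
  have [measurable]: "f \<in> borel_measurable borel" using f borel_measurable_integrable[of lborel f] unfolding probability_density_def by simp
  note [measurable] = h
  show ?thesis using f unfolding probability_density_def by (subst integral_density) auto
qed

text \<open>The sample law is the image of the product of the laws of the two blocks of coordinates, under which
\<open>A\<close> and \<open>B\<close> become cylinders over one factor each.\<close>

lemma sample_law_independent:
  assumes f: "probability_density f"
    and A: "A \<in> sets (sample_law f n)" "\<And>X Y. X \<in> space (sample_law f n) \<Longrightarrow> Y \<in> space (sample_law f n) \<Longrightarrow> (\<And>i. i \<in> J \<Longrightarrow> X i = Y i) \<Longrightarrow> X \<in> A \<Longrightarrow> Y \<in> A"
    and B: "B \<in> sets (sample_law f n)" "\<And>X Y. X \<in> space (sample_law f n) \<Longrightarrow> Y \<in> space (sample_law f n) \<Longrightarrow> (\<And>i. i \<in> {1..n} - J \<Longrightarrow> X i = Y i) \<Longrightarrow> X \<in> B \<Longrightarrow> Y \<in> B"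
    and J: "J \<subseteq> {1..n}"
  shows "measure (sample_law f n) (A \<inter> B) = measure (sample_law f n) A * measure (sample_law f n) B"
proof -
  define P where "P = density lborel (\<lambda>x. ennreal (f x))"
  interpret P: prob_space P unfolding P_def by (rule probability_density_prob_space[OF f])
  interpret PP: product_prob_space "\<lambda>_::nat. P" ..
  define J' where "J' = {1..n} - J"
  define M1 M2 where "M1 = Pi\<^sub>M J (\<lambda>_. P)" and "M2 = Pi\<^sub>M J' (\<lambda>_. P)"
  interpret M1: prob_space M1 unfolding M1_def by (rule prob_space_PiM) (rule P.prob_space_axioms)
  interpret M2: prob_space M2 unfolding M2_def by (rule prob_space_PiM) (rule P.prob_space_axioms)
  have fin: "finite J" "finite J'" and dis: "J \<inter> J' = {}" and un: "J \<union> J' = {1..n}"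
    using J unfolding J'_def by (auto intro: finite_subset)
  let ?M = "sample_law f n"
  let ?mg = "merge J J'"
  have M: "?M = distr (M1 \<Otimes>\<^sub>M M2) (Pi\<^sub>M (J \<union> J') (\<lambda>_. P)) ?mg"
    unfolding M1_def M2_def by (subst PP.distr_merge[OF dis fin]) (simp add: un sample_law_def P_def)
  have meas: "?mg \<in> M1 \<Otimes>\<^sub>M M2 \<rightarrow>\<^sub>M ?M"
    using measurable_merge[of J J' "\<lambda>_. P"] unfolding M1_def M2_def un sample_law_def P_def .
  obtain x0 where x0: "x0 \<in> space M1" using M1.not_empty by blast
  obtain y0 where y0: "y0 \<in> space M2" using M2.not_empty by blast
  define A' where "A' = {x \<in> space M1. ?mg (x, y0) \<in> A}"
  define B' where "B' = {y \<in> space M2. ?mg (x0, y) \<in> B}"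
  have A': "A' \<in> sets M1"
  proof -
    have "(\<lambda>x. ?mg (x, y0)) \<in> M1 \<rightarrow>\<^sub>M ?M"
      by (rule measurable_compose[OF measurable_Pair2'[OF y0] meas])
    from measurable_sets[OF this A(1)] show ?thesis unfolding A'_def by (simp add: vimage_def Int_def conj_commute)
  qed
  have B': "B' \<in> sets M2"
  proof -
    have "(\<lambda>y. ?mg (x0, y)) \<in> M2 \<rightarrow>\<^sub>M ?M"
      by (rule measurable_compose[OF measurable_Pair1'[OF x0] meas])
    from measurable_sets[OF this B(1)] show ?thesis unfolding B'_def by (simp add: vimage_def Int_def conj_commute)
  qed
  have sp: "?mg (x, y) \<in> space ?M" if "x \<in> space M1" "y \<in> space M2" for x y
    using measurable_space[OF meas, of "(x, y)"] that by (simp add: space_pair_measure)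
  have mJ: "?mg (x, y) i = x i" if "i \<in> J" for x y :: "nat \<Rightarrow> real" and i using that by (simp add: merge_def)
  have mJ': "?mg (x, y) i = y i" if "i \<in> J'" for x y :: "nat \<Rightarrow> real" and i using that dis by (auto simp: merge_def)
  have inA: "?mg (x, y) \<in> A \<longleftrightarrow> x \<in> A'" if "x \<in> space M1" "y \<in> space M2" for x y
  proof -
    have "?mg (x, y) \<in> A \<longleftrightarrow> ?mg (x, y0) \<in> A"
      using A(2)[OF sp[OF that] sp[OF that(1) y0]] A(2)[OF sp[OF that(1) y0] sp[OF that]] mJ by auto
    then show ?thesis using that unfolding A'_def by simp
  qed
  have inB: "?mg (x, y) \<in> B \<longleftrightarrow> y \<in> B'" if "x \<in> space M1" "y \<in> space M2" for x y
  proof -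
    have "?mg (x, y) \<in> B \<longleftrightarrow> ?mg (x0, y) \<in> B"
      using B(2)[OF sp[OF that] sp[OF x0 that(2)]] B(2)[OF sp[OF x0 that(2)] sp[OF that]] mJ' unfolding J'_def[symmetric] by auto
    then show ?thesis using that unfolding B'_def by simp
  qed
  have rect: "emeasure ?M E = emeasure M1 E1 * emeasure M2 E2"
    if E: "E \<in> sets ?M" "E1 \<in> sets M1" "E2 \<in> sets M2"
      and eq: "\<And>x y. x \<in> space M1 \<Longrightarrow> y \<in> space M2 \<Longrightarrow> ?mg (x, y) \<in> E \<longleftrightarrow> x \<in> E1 \<and> y \<in> E2" for E E1 E2
  proof -
    have E': "E \<in> sets (Pi\<^sub>M (J \<union> J') (\<lambda>_. P))" using E(1) unfolding un sample_law_def P_def .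
    have meas': "?mg \<in> M1 \<Otimes>\<^sub>M M2 \<rightarrow>\<^sub>M Pi\<^sub>M (J \<union> J') (\<lambda>_. P)"
      using meas unfolding un sample_law_def P_def .
    have "emeasure ?M E = emeasure (M1 \<Otimes>\<^sub>M M2) (?mg -` E \<inter> space (M1 \<Otimes>\<^sub>M M2))"
      by (subst M) (rule emeasure_distr[OF meas' E'])
    also have "?mg -` E \<inter> space (M1 \<Otimes>\<^sub>M M2) = E1 \<times> E2"
    proof (intro equalityI subsetI)
      fix p assume "p \<in> ?mg -` E \<inter> space (M1 \<Otimes>\<^sub>M M2)"
      then show "p \<in> E1 \<times> E2" using eq[of "fst p" "snd p"] by (auto simp: space_pair_measure)
    next
      fix p assume p: "p \<in> E1 \<times> E2"
      then have "fst p \<in> space M1" "snd p \<in> space M2" using sets.sets_into_space[OF E(2)] sets.sets_into_space[OF E(3)] by auto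
      then show "p \<in> ?mg -` E \<inter> space (M1 \<Otimes>\<^sub>M M2)" using eq[of "fst p" "snd p"] p by (auto simp: space_pair_measure)
    qed
    finally show ?thesis using M2.emeasure_pair_measure_Times[OF E(2,3)] by simp
  qed
  interpret S: prob_space ?M by (rule sample_law_prob_space[OF f])
  have 1: "emeasure ?M (A \<inter> B) = emeasure M1 A' * emeasure M2 B'"
    by (rule rect) (use A B A' B' inA inB in auto)
  have 2: "emeasure ?M A = emeasure M1 A' * emeasure M2 (space M2)"
    by (rule rect) (use A A' inA in auto)
  have 3: "emeasure ?M B = emeasure M1 (space M1) * emeasure M2 B'"
    by (rule rect) (use B B' inB in auto)
  show ?thesis
    unfolding measure_def 1 2 3 by (simp add: M1.emeasure_space_1 M2.emeasure_space_1 enn2real_mult)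
qed

context tame_kernel
begin

lemma kernel_op_expectation:
  assumes f: "probability_density f"
  shows "kernel_op K j f y = (\<integral>x. scaled_kernel K j y x \<partial>density lborel (\<lambda>x. ennreal (f x)))"
  unfolding kernel_op_def by (subst integral_density_law[OF f]) (auto simp: mult.commute)

lemma estimator_mean:
  assumes f: "probability_density f" and I: "I \<subseteq> {1..n}" "I \<noteq> {}"
  shows "(\<integral>Z. estimator K I Z y j \<partial>sample_law f n) = kernel_op K j f y"
proof -
  define P where "P = density lborel (\<lambda>x. ennreal (f x))"
  interpret P: prob_space P unfolding P_def by (rule probability_density_prob_space[OF f])
  have [measurable_cong]: "sets P = sets borel" unfolding P_def by simp
  have fI: "finite I" using I(1) by (rule finite_subset) simp
  have int: "integrable P (scaled_kernel K j y)"
    by (rule P.integrable_const_bound[of _ "2 ^ j * K_bound"]) (use scaled_kernel_le in auto)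
  have dist: "distr (sample_law f n) P (\<lambda>Z. Z i) = P" if "i \<in> I" for i
    unfolding sample_law_def P_def[symmetric]
    by (rule distr_PiM_component) (use that I P.prob_space_axioms in auto)
  have comp: "(\<lambda>Z. Z i) \<in> sample_law f n \<rightarrow>\<^sub>M P" if "i \<in> I" for i
    unfolding sample_law_def P_def[symmetric] by (rule measurable_component_singleton) (use that I in auto)
  have sm: "scaled_kernel K j y \<in> borel_measurable P" by measurable
  have each: "(\<integral>Z. scaled_kernel K j y (Z i) \<partial>sample_law f n) = kernel_op K j f y" if "i \<in> I" for i
  proof -
    have "(\<integral>Z. scaled_kernel K j y (Z i) \<partial>sample_law f n) = (\<integral>x. scaled_kernel K j y x \<partial>distr (sample_law f n) P (\<lambda>Z. Z i))"
      by (rule integral_distr[OF comp[OF that] sm, symmetric])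
    then show ?thesis unfolding dist[OF that] by (simp only: kernel_op_expectation[OF f, folded P_def])
  qed
  have inti: "integrable (sample_law f n) (\<lambda>Z. scaled_kernel K j y (Z i))" if "i \<in> I" for i
    by (rule integrable_distr[OF comp[OF that]]) (simp only: dist[OF that] int)
  have "(\<integral>Z. estimator K I Z y j \<partial>sample_law f n) = (\<Sum>i\<in>I. \<integral>Z. scaled_kernel K j y (Z i) \<partial>sample_law f n) / real (card I)"
    unfolding estimator_def using inti by (simp add: Bochner_Integration.integral_sum)
  also have "\<dots> = kernel_op K j f y"
    using each fI I(2) by (simp add: card_gt_0_iff)
  finally show ?thesis .
qed

text \<open>Both the estimator and its mean are expanded in the translates of \<open>g\<close>; the weights are the same and
have \<open>l1\<close> norm at most \<open>C\<close>.  The bound is uniform in \<open>y\<close> since the shifts are arbitrary.\<close>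

lemma kernel_deviation_le:
  assumes f: "probability_density f" and I: "finite I" "I \<noteq> {}"
    and dev: "\<And>z. \<bar>(\<Sum>i\<in>I. g (2 ^ j * X i - z)) / real (card I) - (\<integral>x. g (2 ^ j * x - z) \<partial>density lborel (\<lambda>x. ennreal (f x)))\<bar> \<le> \<tau>"
  shows "\<bar>estimator K I X y j - kernel_op K j f y\<bar> \<le> 2 ^ j * (C * \<tau>)"
proof -
  define P where "P = density lborel (\<lambda>x. ennreal (f x))"
  interpret P: prob_space P unfolding P_def by (rule probability_density_prob_space[OF f])
  have sP [measurable_cong]: "sets P = sets borel" unfolding P_def by simp
  note [measurable] = dominated_measurable[OF g_dominated]
  define y' where "y' = 2 ^ j * y"
  define B where "B = \<bar>g 0\<bar> + V"
  have B: "\<bar>g x\<bar> \<le> B" for x unfolding B_def by (rule dominated_bounded[OF g_dominated])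
  have int: "integrable P (\<lambda>x. g (2 ^ j * x - z))" for z
    by (rule P.integrable_const_bound[of _ B]) (use B in auto)
  define e where "e k = (\<integral>x. g (2 ^ j * x - c y' k) \<partial>P)" for k
  have eB: "\<bar>e k\<bar> \<le> B" for k
  proof -
    have "\<bar>e k\<bar> \<le> (\<integral>x. \<bar>g (2 ^ j * x - c y' k)\<bar> \<partial>P)" unfolding e_def by (rule integral_abs_bound)
    also have "\<dots> \<le> (\<integral>x. B \<partial>P)" by (rule integral_mono) (use int B in auto)
    finally show ?thesis by (simp add: P.prob_space)
  qed
  have wB: "summable (\<lambda>k. \<bar>a y' k\<bar> * B)" by (rule summable_mult2[OF weights_summable])
  have s1: "summable (\<lambda>k. \<bar>a y' k * h k\<bar>)" if "\<And>k. \<bar>h k\<bar> \<le> B" for h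
    by (rule summable_comparison_test'[OF wB, of 0]) (use that in \<open>auto simp: abs_mult intro!: mult_left_mono\<close>)
  have se: "summable (\<lambda>k. a y' k * e k)" by (rule summable_rabs_cancel[OF s1[OF eB]])
  have sg: "summable (\<lambda>k. a y' k * g (x - c y' k))" for x by (rule summable_rabs_cancel[OF s1[OF B]])
  have absint: "\<bar>\<integral>x. \<bar>g (2 ^ j * x - c y' k)\<bar> \<partial>P\<bar> \<le> B" for k
  proof -
    have "(\<integral>x. \<bar>g (2 ^ j * x - c y' k)\<bar> \<partial>P) \<le> (\<integral>x. B \<partial>P)" by (rule integral_mono) (use int B in auto)
    then show ?thesis by (simp add: P.prob_space Bochner_Integration.integral_nonneg)
  qed
  have "kernel_op K j f y = 2 ^ j * (\<integral>x. (\<Sum>k. a y' k * g (2 ^ j * x - c y' k)) \<partial>P)"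
    unfolding kernel_op_expectation[OF f] P_def[symmetric] scaled_kernel_def expansion y'_def by simp
  also have "(\<integral>x. (\<Sum>k. a y' k * g (2 ^ j * x - c y' k)) \<partial>P) = (\<Sum>k. \<integral>x. a y' k * g (2 ^ j * x - c y' k) \<partial>P)"
  proof (rule integral_suminf)
    show "integrable P (\<lambda>x. a y' k * g (2 ^ j * x - c y' k))" for k using int by simp
    show "AE x in P. summable (\<lambda>k. norm (a y' k * g (2 ^ j * x - c y' k)))"
      using s1[OF B] by simp
    show "summable (\<lambda>k. \<integral>x. norm (a y' k * g (2 ^ j * x - c y' k)) \<partial>P)"
      using s1[OF absint] by (simp add: abs_mult Bochner_Integration.integral_nonneg)
  qed
  also have "\<dots> = (\<Sum>k. a y' k * e k)" unfolding e_def by simp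
  finally have op: "kernel_op K j f y = 2 ^ j * (\<Sum>k. a y' k * e k)" .
  define h where "h k = (\<Sum>i\<in>I. g (2 ^ j * X i - c y' k)) / real (card I)" for k
  have "estimator K I X y j = 2 ^ j * ((\<Sum>i\<in>I. \<Sum>k. a y' k * g (2 ^ j * X i - c y' k)) / real (card I))"
    unfolding estimator_def scaled_kernel_def expansion y'_def by (simp add: sum_distrib_left)
  also have "(\<Sum>i\<in>I. \<Sum>k. a y' k * g (2 ^ j * X i - c y' k)) = (\<Sum>k. \<Sum>i\<in>I. a y' k * g (2 ^ j * X i - c y' k))"
    by (rule suminf_sum[symmetric]) (rule sg)
  also have "\<dots> / real (card I) = (\<Sum>k. (\<Sum>i\<in>I. a y' k * g (2 ^ j * X i - c y' k)) / real (card I))"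
    by (rule suminf_divide[symmetric]) (intro summable_sum sg)
  also have "\<dots> = (\<Sum>k. a y' k * h k)"
    unfolding h_def by (simp add: sum_distrib_left[symmetric])
  finally have est: "estimator K I X y j = 2 ^ j * (\<Sum>k. a y' k * h k)" .
  have he: "\<bar>h k - e k\<bar> \<le> \<tau>" for k
    unfolding h_def e_def P_def by (rule dev)
  have sw: "summable (\<lambda>k. \<bar>a y' k\<bar> * \<tau>)" by (rule summable_mult2[OF weights_summable])
  have le: "\<bar>a y' k * (h k - e k)\<bar> \<le> \<bar>a y' k\<bar> * \<tau>" for k
    unfolding abs_mult by (rule mult_left_mono[OF he]) simp
  have sd: "summable (\<lambda>k. \<bar>a y' k * (h k - e k)\<bar>)"
    by (rule summable_comparison_test'[OF sw, of 0]) (use le in simp)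
  have sh: "summable (\<lambda>k. a y' k * h k)"
  proof -
    have "(\<lambda>k. a y' k * h k) = (\<lambda>k. a y' k * (h k - e k) + a y' k * e k)" by (simp add: algebra_simps)
    then show ?thesis using summable_add[OF summable_rabs_cancel[OF sd] se] by simp
  qed
  have \<tau>0: "0 \<le> \<tau>" using he[of 0] by linarith
  have "\<bar>(\<Sum>k. a y' k * h k) - (\<Sum>k. a y' k * e k)\<bar> = \<bar>\<Sum>k. a y' k * (h k - e k)\<bar>"
    by (subst suminf_diff[OF sh se]) (simp add: right_diff_distrib)
  also have "\<dots> \<le> (\<Sum>k. \<bar>a y' k * (h k - e k)\<bar>)" by (rule summable_rabs[OF sd])
  also have "\<dots> \<le> (\<Sum>k. \<bar>a y' k\<bar> * \<tau>)" by (rule suminf_le[OF le sd sw])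
  also have "\<dots> = (\<Sum>k. \<bar>a y' k\<bar>) * \<tau>" by (rule suminf_mult2[OF weights_summable, symmetric])
  also have "\<dots> \<le> C * \<tau>" by (rule mult_right_mono[OF weights_bound \<tau>0])
  finally have "2 ^ j * \<bar>(\<Sum>k. a y' k * h k) - (\<Sum>k. a y' k * e k)\<bar> \<le> 2 ^ j * (C * \<tau>)" by simp
  then show ?thesis unfolding est op by (simp only: right_diff_distrib[symmetric] abs_mult) simp
qed

text \<open>\<open>dev_const\<close> is large enough that Bernstein's exponent for a single translate at level \<open>j\<close>, which is
\<open>dev_const\<^sup>2 j / (4 g_energy)\<close>, is at least \<open>3 j\<close>.  The summand 1 in \<open>g_energy\<close> and in \<open>noise_const\<close> keeps
them positive.\<close>

definition g_energy :: real where "g_energy = (\<integral>x. (g x)\<^sup>2 \<partial>lborel) + 1"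
definition dev_const :: real where "dev_const = 2 + sqrt (12 * g_energy)"
definition noise_const :: real where "noise_const = 4 * dev_const * C + 1"

lemma g_square_integrable: "integrable lborel (\<lambda>x. (g x)\<^sup>2)"
proof (rule Bochner_Integration.integrable_bound[of _ "\<lambda>x. (\<bar>g 0\<bar> + V) * g x"])
  note [measurable] = dominated_measurable[OF g_dominated]
  show "AE x in lborel. norm ((g x)\<^sup>2) \<le> norm ((\<bar>g 0\<bar> + V) * g x)"
  proof (rule AE_I2)
    fix x
    have "\<bar>g x\<bar> * \<bar>g x\<bar> \<le> \<bar>\<bar>g 0\<bar> + V\<bar> * \<bar>g x\<bar>"
      using dominated_bounded[OF g_dominated, of x] by (intro mult_right_mono) auto
    then show "norm ((g x)\<^sup>2) \<le> norm ((\<bar>g 0\<bar> + V) * g x)" by (simp add: power2_eq_square abs_mult)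
  qed
qed (use g_integrable dominated_measurable[OF g_dominated] in auto)

lemma g_energy_ge_1: "1 \<le> g_energy"
  unfolding g_energy_def by (simp add: Bochner_Integration.integral_nonneg)

lemma dev_const: "2 \<le> dev_const" "12 * g_energy \<le> dev_const\<^sup>2"
proof -
  have "0 \<le> sqrt (12 * g_energy)" using g_energy_ge_1 by simp
  then show "2 \<le> dev_const" unfolding dev_const_def by simp
  have "12 * g_energy = (sqrt (12 * g_energy))\<^sup>2" using g_energy_ge_1 by simp
  also have "\<dots> \<le> dev_const\<^sup>2" unfolding dev_const_def by (rule power_mono) (use g_energy_ge_1 in auto)
  finally show "12 * g_energy \<le> dev_const\<^sup>2" .
qed

lemma noise_const_pos: "0 < noise_const"
  unfolding noise_const_def using dev_const(1) C_nonneg by (simp add: add_nonneg_pos)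

text \<open>The second moment of \<open>g (2^j x - z)\<close> is of order \<open>U / 2^j\<close>.  With coarse brackets of size \<open>4^(-j)\<close>
there are about \<open>4^j\<close> centres, and a deviation \<open>t\<close> of order \<open>sqrt (U j / (2^j m))\<close> has probability of
order at most \<open>8^(-j)\<close> at each of them.  The fine brackets have size \<open>1 / m\<^sup>2\<close>, negligible against \<open>t\<close>; the
parameter \<open>w\<close> is the logarithm of the probability that is conceded at each.\<close>

lemma level_concentration:
  assumes f: "probability_density f" and U: "\<And>x. f x \<le> U" "1 \<le> U"
    and I: "I \<subseteq> {1..n}" "I \<noteq> {}" and j: "1 \<le> j" "2 ^ j \<le> real (card I)" and w: "0 < w"
    and small: "dev_const * (\<bar>g 0\<bar> + V) * sqrt (2 ^ j * real j / real (card I)) \<le> g_energy"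
    and w1: "2 * V * w \<le> dev_const * sqrt (real (card I) * real j / 2 ^ j)"
    and w2: "w\<^sup>2 * V \<le> dev_const\<^sup>2 * 2 ^ j"
  shows "\<exists>E\<in>sets (sample_law f n).
     measure (sample_law f n) (space (sample_law f n) - E) \<le> 2 * (V + 1) / 2 ^ j + 4 * (V * (real (card I))\<^sup>2 + 1) * exp (1 - w) \<and>
     (\<forall>X\<in>E. \<forall>y. \<bar>estimator K I X y j - kernel_op K j f y\<bar> \<le> noise_const * sqrt (U * 2 ^ j * real j / real (card I)))"
proof -
  define P where "P = density lborel (\<lambda>x. ennreal (f x))"
  define m where "m = card I"
  have fI: "finite I" using I(1) by (rule finite_subset) simp
  interpret iid_sample P "{1..n}" I
    by (intro iid_sample.intro iid_sample_axioms.intro)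
       (use I probability_density_prob_space[OF f] in \<open>auto simp: P_def\<close>)
  have samp: "sample = sample_law f n" unfolding sample_law_def P_def ..
  have mm: "0 < real m" unfolding m_def by (rule m_pos)
  have V0: "0 \<le> V" using dominated_nonneg[OF g_dominated, of 0] dominated_le[OF g_dominated, of 0] by linarith
  note [measurable] = dominated_measurable[OF g_dominated]
  define s :: real where "s = 2 ^ j"
  define B where "B = \<bar>g 0\<bar> + V"
  define A where "A = dev_const"
  define G where "G = g_energy"
  have s: "0 < s" "2 \<le> s"
  proof -
    show "0 < s" unfolding s_def by simp
    have "(2::real) ^ 1 \<le> 2 ^ j" by (rule power_increasing) (use j in auto)
    then show "2 \<le> s" unfolding s_def by simp
  qed
  have A: "2 \<le> A" "12 * G \<le> A\<^sup>2" unfolding A_def G_def by (rule dev_const)+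
  have G: "1 \<le> G" unfolding G_def by (rule g_energy_ge_1)
  have B: "\<bar>g x\<bar> \<le> B" for x unfolding B_def by (rule dominated_bounded[OF g_dominated])
  have B0: "0 \<le> B" using B[of 0] by linarith
  define v where "v = U * G / s"
  have v0: "0 < v" unfolding v_def using U(2) G s by simp
  define t where "t = A * sqrt (U * real j / (s * real m))"
  have j0: "1 \<le> real j" using j by simp
  have t0: "0 < t" unfolding t_def using A U(2) j0 s mm by simp
  have t2: "t\<^sup>2 = A\<^sup>2 * (U * real j / (s * real m))"
    unfolding t_def power_mult_distrib using U(2) j0 s mm by simp
  have var: "(\<integral>x. (g (s * x - z))\<^sup>2 \<partial>P) \<le> v" for z
  proof -
    have gi: "integrable lborel (\<lambda>x. (g (- z + s * x))\<^sup>2)"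
      by (rule lborel_integrable_real_affine[OF g_square_integrable]) (use s in auto)
    have eqz: "s * x - z = - z + s * x" for x by simp
    have fi: "integrable lborel f" "\<And>x. 0 \<le> f x" using f unfolding probability_density_def by auto
    have [measurable]: "f \<in> borel_measurable borel" using borel_measurable_integrable[OF fi(1)] by simp
    have "(\<integral>x. (g (s * x - z))\<^sup>2 \<partial>P) = (\<integral>x. f x * (g (- z + s * x))\<^sup>2 \<partial>lborel)"
      unfolding P_def eqz by (rule integral_density_law[OF f]) measurable
    also have "\<dots> \<le> (\<integral>x. U * (g (- z + s * x))\<^sup>2 \<partial>lborel)"
    proof (rule integral_mono')
      show "integrable lborel (\<lambda>x. U * (g (- z + s * x))\<^sup>2)" using gi by simp
    qed (use U fi in \<open>auto intro!: mult_right_mono\<close>)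
    also have "\<dots> = U * ((\<integral>x. (g x)\<^sup>2 \<partial>lborel) / s)"
      using lborel_integral_real_affine[of s "\<lambda>x. (g x)\<^sup>2" "- z"] s by simp
    also have "\<dots> \<le> v" unfolding v_def G_def g_energy_def using U(2) s by (simp add: divide_right_mono mult_left_mono)
    finally show ?thesis .
  qed
  \<comment> \<open>The minimizer of Bernstein's exponent \<open>l\<^sup>2 v - l t\<close>.\<close>
  define l0 where "l0 = t / (2 * v)"
  have l0: "0 < l0" "l0 * (2 * B) \<le> 1"
  proof -
    show "0 < l0" unfolding l0_def using t0 v0 by simp
    have "A * B * sqrt (s * real j / real m) \<le> G" using small unfolding A_def B_def G_def s_def m_def .
    have sq: "sqrt (U * real j / (s * real m)) = sqrt U * sqrt (s * real j / real m) / s"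
    proof -
      have "U * real j / (s * real m) = U * (s * real j / real m) / s\<^sup>2" using s mm by (simp add: power2_eq_square field_simps)
      then show ?thesis using s by (simp add: real_sqrt_mult real_sqrt_divide)
    qed
    have "t * B = sqrt U * (A * B * sqrt (s * real j / real m)) / s"
      unfolding t_def sq by simp
    also have "\<dots> \<le> sqrt U * G / s"
      using \<open>A * B * sqrt (s * real j / real m) \<le> G\<close> s U(2) by (intro divide_right_mono mult_left_mono) auto
    also have "\<dots> \<le> v"
    proof -
      have "sqrt U \<le> sqrt (U * U)" using U(2) by (intro real_sqrt_le_mono) (simp add: mult_le_cancel_left1)
      then have "sqrt U \<le> U" using U(2) by simp
      then show ?thesis unfolding v_def using G s by (intro divide_right_mono mult_right_mono) auto
    qed
    finally show "l0 * (2 * B) \<le> 1" unfolding l0_def using v0 by (simp add: field_simps)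
  qed
  \<comment> \<open>The linear term of the exponent becomes \<open>- w\<close>; the quadratic one is at most 1, because the second
    moment of a link or a fine envelope is at most \<open>V \<epsilon>0\<close>.\<close>
  define l1 where "l1 = w / (real m * t)"
  have sqm: "real m * sqrt (U * real j / (s * real m)) = sqrt (U * (real m * real j / s))"
  proof -
    have "U * (real m * real j / s) = (real m)\<^sup>2 * (U * real j / (s * real m))"
      using s mm by (simp add: power2_eq_square field_simps)
    moreover have "sqrt ((real m)\<^sup>2 * x) = real m * sqrt x" for x by (simp add: real_sqrt_mult)
    ultimately show ?thesis by (simp only:)
  qed
  have l1: "0 < l1" "l1 * (2 * V) \<le> 1"
  proof -
    show "0 < l1" unfolding l1_def using w mm t0 by simp
    have "2 * V * w \<le> A * sqrt (real m * real j / s)" using w1 unfolding A_def m_def s_def .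
    also have "\<dots> \<le> A * sqrt (U * (real m * real j / s))"
    proof (intro mult_left_mono real_sqrt_le_mono)
      have "1 * (real m * real j / s) \<le> U * (real m * real j / s)"
        by (rule mult_right_mono[OF U(2)]) (use s in auto)
      then show "real m * real j / s \<le> U * (real m * real j / s)" by simp
    qed (use A in auto)
    also have "\<dots> = real m * t" unfolding t_def sqm[symmetric] by simp
    finally show "l1 * (2 * V) \<le> 1" unfolding l1_def using mm t0 by (simp add: field_simps)
  qed
  define \<epsilon>0 \<epsilon>1 where "\<epsilon>0 = 1 / s\<^sup>2" and "\<epsilon>1 = 1 / (real m)\<^sup>2"
  have eps: "0 < \<epsilon>0" "0 < \<epsilon>1" unfolding \<epsilon>0_def \<epsilon>1_def using s mm by auto
  have sm: "s \<le> real m" using j(2) unfolding s_def m_def .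
  have mx: "max \<epsilon>0 \<epsilon>1 = \<epsilon>0"
  proof -
    have "\<epsilon>1 \<le> \<epsilon>0" unfolding \<epsilon>0_def \<epsilon>1_def using s sm mm by (intro divide_left_mono power_mono mult_pos_pos) auto
    then show ?thesis by simp
  qed
  obtain E where E: "E \<in> sets sample"
    and PE: "S.prob (space sample - E) \<le> (V / \<epsilon>0 + 1) * (2 * exp (real m * (l0\<^sup>2 * v - l0 * t)))
       + 2 * ((V / \<epsilon>1 + 1) * (2 * exp (real m * (l1\<^sup>2 * (V * max \<epsilon>0 \<epsilon>1) - l1 * t))))"
    and dev: "\<And>X z. X \<in> E \<Longrightarrow> \<bar>deviation (\<lambda>x. g (s * x - z)) X\<bar> \<le> 3 * t + 2 * \<epsilon>1"
    using translate_concentration[OF g_dominated s(1) B var eps l0 l1, of t] unfolding m_def by blast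
  have e0: "real m * (l0\<^sup>2 * v - l0 * t) \<le> - (3 * real j)"
  proof -
    have "real m * (l0\<^sup>2 * v - l0 * t) = - (real m * t\<^sup>2 / (4 * v))"
      unfolding l0_def using v0 by (simp add: field_simps power2_eq_square)
    also have "real m * t\<^sup>2 / (4 * v) = A\<^sup>2 * real j / (4 * G)"
      unfolding t2 v_def using mm s U(2) G by (simp add: field_simps)
    finally have eq: "real m * (l0\<^sup>2 * v - l0 * t) = - (A\<^sup>2 * real j / (4 * G))" .
    have "12 * G * real j / (4 * G) \<le> A\<^sup>2 * real j / (4 * G)"
      using A(2) G j0 by (intro divide_right_mono mult_right_mono) auto
    then have "3 * real j \<le> A\<^sup>2 * real j / (4 * G)" using G by simp
    then show ?thesis unfolding eq by simp
  qed
  have first: "(V / \<epsilon>0 + 1) * (2 * exp (real m * (l0\<^sup>2 * v - l0 * t))) \<le> 2 * (V + 1) / s"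
  proof -
    have "exp (real m * (l0\<^sup>2 * v - l0 * t)) \<le> exp (- (3 * real j))" using e0 by simp
    also have "exp (- (3 * real j)) = 1 / exp 1 ^ (3 * j)"
      by (simp add: exp_minus exp_of_nat_mult[symmetric] divide_inverse)
    also have "\<dots> \<le> 1 / 2 ^ (3 * j)"
      using exp_ge_add_one_self[of 1] by (intro divide_left_mono power_mono) auto
    also have "(2::real) ^ (3 * j) = s ^ 3" unfolding s_def by (simp add: power_mult[symmetric] mult.commute)
    finally have x: "exp (real m * (l0\<^sup>2 * v - l0 * t)) \<le> 1 / s ^ 3" .
    have "V / \<epsilon>0 + 1 \<le> (V + 1) * s\<^sup>2"
    proof -
      have "1 \<le> s\<^sup>2" using s by (simp add: one_le_power)
      then show ?thesis unfolding \<epsilon>0_def by (simp add: algebra_simps)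
    qed
    then have "(V / \<epsilon>0 + 1) * (2 * exp (real m * (l0\<^sup>2 * v - l0 * t))) \<le> ((V + 1) * s\<^sup>2) * (2 * (1 / s ^ 3))"
      using x V0 s by (intro mult_mono) auto
    also have "\<dots> = 2 * (V + 1) / s" using s by (simp add: power2_eq_square power3_eq_cube)
    finally show ?thesis .
  qed
  have second: "(V / \<epsilon>1 + 1) * (2 * exp (real m * (l1\<^sup>2 * (V * max \<epsilon>0 \<epsilon>1) - l1 * t))) \<le> (V * (real m)\<^sup>2 + 1) * (2 * exp (1 - w))"
  proof -
    have "real m * (l1\<^sup>2 * (V * \<epsilon>0) - l1 * t) = w\<^sup>2 * V / (s\<^sup>2 * (real m * t\<^sup>2)) - w"
      unfolding l1_def \<epsilon>0_def using mm t0 s by (simp add: field_simps power2_eq_square)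
    also have "w\<^sup>2 * V / (s\<^sup>2 * (real m * t\<^sup>2)) \<le> 1"
    proof -
      have "real m * t\<^sup>2 = A\<^sup>2 * U * real j / s" unfolding t2 using mm s by (simp add: field_simps)
      then have "s\<^sup>2 * (real m * t\<^sup>2) = (A\<^sup>2 * s) * (U * real j)" using s by (simp add: power2_eq_square)
      moreover have "(A\<^sup>2 * s) * 1 \<le> (A\<^sup>2 * s) * (U * real j)"
        using s U(2) j0 mult_mono[of 1 U 1 "real j"] by (intro mult_left_mono) auto
      moreover have "w\<^sup>2 * V \<le> A\<^sup>2 * s" using w2 unfolding A_def s_def .
      ultimately have "w\<^sup>2 * V \<le> s\<^sup>2 * (real m * t\<^sup>2)" by linarith
      moreover have "0 < s\<^sup>2 * (real m * t\<^sup>2)" using s mm t0 by simp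
      ultimately show ?thesis by (simp add: divide_le_eq)
    qed
    finally have "exp (real m * (l1\<^sup>2 * (V * max \<epsilon>0 \<epsilon>1) - l1 * t)) \<le> exp (1 - w)" unfolding mx by simp
    moreover have "V / \<epsilon>1 = V * (real m)\<^sup>2" unfolding \<epsilon>1_def by simp
    ultimately show ?thesis using V0 by (simp add: mult_left_mono)
  qed
  have e1: "2 * \<epsilon>1 \<le> t"
  proof -
    have "2 * \<epsilon>1 \<le> 2 / real m"
      unfolding \<epsilon>1_def using mm sm s by (simp add: power2_eq_square divide_simps)
    also have "\<dots> \<le> A / real m" using A mm by (intro divide_right_mono) auto
    also have "\<dots> = A * sqrt (1 / (real m)\<^sup>2)" using mm by (simp add: real_sqrt_divide)
    also have "\<dots> \<le> t"
      unfolding t_def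
    proof (intro mult_left_mono real_sqrt_le_mono)
      have "1 / (real m)\<^sup>2 \<le> 1 / (s * real m)" using sm s mm by (intro divide_left_mono) (auto simp: power2_eq_square intro!: mult_right_mono)
      also have "\<dots> \<le> U * real j / (s * real m)"
        using mult_mono[of 1 U 1 "real j"] U(2) j0 s mm by (intro divide_right_mono) auto
      finally show "1 / (real m)\<^sup>2 \<le> U * real j / (s * real m)" .
    qed (use A in auto)
    finally show ?thesis .
  qed
  have "measure (sample_law f n) (space (sample_law f n) - E) \<le> 2 * (V + 1) / 2 ^ j + 4 * (V * (real (card I))\<^sup>2 + 1) * exp (1 - w)"
  proof -
    have "p \<le> x + 4 * R * e" if "p \<le> y + 2 * z" "y \<le> x" "z \<le> R * (2 * e)" for p x y z R e :: real
      using that by (simp add: mult.assoc)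
    from this[OF PE first second] show ?thesis unfolding samp m_def s_def .
  qed
  moreover have "\<bar>estimator K I X y j - kernel_op K j f y\<bar> \<le> noise_const * sqrt (U * 2 ^ j * real j / real (card I))"
    if X: "X \<in> E" for X y
  proof -
    have "\<bar>estimator K I X y j - kernel_op K j f y\<bar> \<le> 2 ^ j * (C * (4 * t))"
    proof (rule kernel_deviation_le[OF f fI I(2)])
      show "\<bar>(\<Sum>i\<in>I. g (2 ^ j * X i - z)) / real (card I) - (\<integral>x. g (2 ^ j * x - z) \<partial>density lborel (\<lambda>x. ennreal (f x)))\<bar> \<le> 4 * t" for z
        using dev[OF X, of z, unfolded deviation_def s_def, unfolded P_def] e1 by linarith
    qed
    also have "\<dots> = 4 * A * C * (s * sqrt (U * real j / (s * real m)))" unfolding t_def s_def by simp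
    also have "s * sqrt (U * real j / (s * real m)) = sqrt (U * s * real j / real m)"
    proof -
      have "U * s * real j / real m = s\<^sup>2 * (U * real j / (s * real m))" using s mm by (simp add: power2_eq_square field_simps)
      moreover have "sqrt (s\<^sup>2 * x) = s * sqrt x" for x using s by (simp add: real_sqrt_mult)
      ultimately show ?thesis by (simp only:)
    qed
    also have "4 * A * C * \<dots> \<le> noise_const * \<dots>"
      unfolding noise_const_def A_def using U(2) s j0 mm by (intro mult_right_mono) auto
    finally show ?thesis unfolding s_def m_def .
  qed
  ultimately show ?thesis using E unfolding samp by blast
qed

end

section \<open>The selected level\<close>
lemma sup_norm_upper:
  assumes "\<And>y. \<bar>h y\<bar> \<le> B"
  shows "\<bar>h y\<bar> \<le> sup_norm h"
  unfolding sup_norm_def by (rule cSUP_upper) (use assms in \<open>auto intro!: bdd_aboveI2\<close>)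

lemma sup_norm_least:
  assumes "\<And>y. \<bar>h y\<bar> \<le> B"
  shows "sup_norm h \<le> B"
  unfolding sup_norm_def by (rule cSUP_least) (use assms in auto)

lemma abs_SUP_diff_le:
  fixes v w :: "'a \<Rightarrow> real"
  assumes "S \<noteq> {}" and w: "bdd_above (w ` S)" and d: "\<And>y. y \<in> S \<Longrightarrow> \<bar>v y - w y\<bar> \<le> e"
  shows "\<bar>(SUP y\<in>S. v y) - (SUP y\<in>S. w y)\<bar> \<le> e"
proof -
  obtain B where B: "\<And>y. y \<in> S \<Longrightarrow> w y \<le> B" using w by (auto simp: bdd_above_def)
  have v: "bdd_above (v ` S)"
  proof (rule bdd_aboveI2)
    fix y assume "y \<in> S"
    then show "v y \<le> B + e" using B[of y] d[of y] by linarith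
  qed
  have "(SUP y\<in>S. v y) \<le> (SUP y\<in>S. w y) + e"
  proof (rule cSUP_least[OF assms(1)])
    fix y assume y: "y \<in> S"
    then show "v y \<le> (SUP y\<in>S. w y) + e" using d[OF y] cSUP_upper[OF y w] by linarith
  qed
  moreover have "(SUP y\<in>S. w y) \<le> (SUP y\<in>S. v y) + e"
  proof (rule cSUP_least[OF assms(1)])
    fix y assume y: "y \<in> S"
    then show "w y \<le> (SUP y\<in>S. v y) + e" using d[OF y] cSUP_upper[OF y v] by linarith
  qed
  ultimately show ?thesis by linarith
qed

context tame_kernel
begin

lemma kernel_op_le:
  assumes f: "probability_density f"
  shows "\<bar>kernel_op K j f y\<bar> \<le> 2 ^ j * K_bound"
proof -
  have fi: "integrable lborel f" "(\<integral>x. f x \<partial>lborel) = 1" "\<And>x. 0 \<le> f x" using f unfolding probability_density_def by auto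
  have "\<bar>kernel_op K j f y\<bar> \<le> (\<integral>x. \<bar>scaled_kernel K j y x * f x\<bar> \<partial>lborel)"
    unfolding kernel_op_def by (rule integral_abs_bound)
  also have "\<dots> \<le> (\<integral>x. 2 ^ j * K_bound * f x \<partial>lborel)"
    by (rule integral_mono') (use fi scaled_kernel_le K_bound_nonneg in \<open>auto simp: abs_mult intro!: mult_right_mono\<close>)
  also have "\<dots> = 2 ^ j * K_bound" using fi by simp
  finally show ?thesis .
qed

text \<open>The supremum norm is a real supremum, so boundedness of the bias has to be known before the norm can
be used pointwise.\<close>

lemma bias_le:
  assumes f: "probability_density f" "bounded (range f)" and b: "bias_bounds K b1 b2 j0 t f" and j: "j0 \<le> j"
  shows "\<bar>kernel_op K j f y - f y\<bar> \<le> b2 * 2 powr (- (real j * t))"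
proof -
  obtain B where B: "\<And>y. \<bar>f y\<bar> \<le> B" using f(2) unfolding bounded_iff by auto
  have "\<bar>kernel_op K j f y - f y\<bar> \<le> 2 ^ j * K_bound + B" for y using kernel_op_le[OF f(1), of j y] B[of y] by linarith
  from sup_norm_upper[where h = "\<lambda>y. kernel_op K j f y - f y", OF this, of y] show ?thesis using b j unfolding bias_bounds_def by force
qed

text \<open>Let \<open>js\<close> be the first level at which the bias bound is below the noise bound \<open>S\<close>.  From \<open>js\<close> on, two
estimators differ by at most two noise and two bias terms, at most \<open>4 S l\<close>; hence \<open>js\<close> passes the test
and \<open>jh \<le> js\<close>.  Conversely \<open>jh\<close> has passed the test against \<open>js\<close>, so its bias is at most
\<open>7 S js\<close>: four from the test, one from the noise at each of the two levels and one from the bias at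
\<open>js\<close>.  Going back one level at most doubles \<open>S\<close>, and at \<open>js - 1\<close> the bias bound is above \<open>S\<close>.  So
\<open>b1 2^(-jh t)\<close> is below \<open>14 b2 2^(-(js-1) t)\<close>, which bounds \<open>js - jh\<close>.\<close>

lemma selected_level_bracket:
  fixes f :: "real \<Rightarrow> real" and X :: "nat \<Rightarrow> real" and m1 m2 jlo jhi q :: nat
  defines "U \<equiv> max (sup_norm f) (1 :: real)"
  defines "S \<equiv> \<lambda>l::nat. noise_const * sqrt (U * 2 ^ l * real l / real m2)"
  assumes f: "probability_density f" "bounded (range f)" and bias: "bias_bounds K b1 b2 j0 t f"
    and b: "0 < b1" "0 < b2" and t: "0 < \<eta>" "\<eta> \<le> t" and j: "j0 \<le> jlo" "0 < jlo" "jlo < jhi" and m2: "0 < m2"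
    and noise: "\<And>l y. l \<in> {jlo..jhi} \<Longrightarrow> \<bar>estimator K {m1 + 1..m1 + m2} X y l - kernel_op K l f y\<bar> \<le> S l"
    and top: "b2 * 2 powr (- (real jhi * t)) \<le> S jhi"
    and q: "14 \<le> b1 / b2 * 2 powr (real q * \<eta>)"
  defines "jh \<equiv> selected_level (4 * noise_const) K m1 m2 jlo jhi f X"
  shows "\<exists>js. jlo \<le> js \<and> js \<le> jhi \<and> b2 * 2 powr (- (real js * t)) \<le> S js \<and>
     (js = jlo \<or> S (js - 1) < b2 * 2 powr (- (real (js - 1) * t))) \<and> jlo \<le> jh \<and> jh \<le> jhi \<and> jh \<le> js \<and> js \<le> jh + q"
proof -
  let ?I = "{m1 + 1..m1 + m2}"
  define bi where "bi l = b2 * 2 powr (- (real l * t))" for l :: nat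
  have U1: "1 \<le> U" unfolding U_def by simp
  have biasp: "\<bar>kernel_op K l f y - f y\<bar> \<le> bi l" if "l \<in> {jlo..jhi}" for l y
    unfolding bi_def by (rule bias_le[OF f bias]) (use that j in auto)
  have bi_mono: "bi l \<le> bi k" if "k \<le> l" for k l
    unfolding bi_def using that b t by (intro mult_left_mono powr_mono) (auto intro!: mult_right_mono)
  have S_mono: "S k \<le> S l" if "k \<le> l" for k l
    unfolding S_def using that U1 noise_const_pos
    by (intro mult_left_mono real_sqrt_le_mono divide_right_mono mult_mono) (auto intro: power_increasing)
  have S0: "0 \<le> S l" for l unfolding S_def using U1 noise_const_pos by simp
  have thr: "4 * noise_const * sqrt U * sqrt (2 ^ l * real l / real m2) = 4 * S l" for l
    unfolding S_def by (simp add: real_sqrt_mult[symmetric] mult.assoc)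
  define js where "js = (LEAST l. jlo \<le> l \<and> bi l \<le> S l)"
  have ex: "jlo \<le> jhi \<and> bi jhi \<le> S jhi" using j top unfolding bi_def by simp
  have js: "jlo \<le> js" "bi js \<le> S js" using LeastI[of "\<lambda>l. jlo \<le> l \<and> bi l \<le> S l", OF ex] unfolding js_def by auto
  have js_hi: "js \<le> jhi" unfolding js_def by (rule Least_le[of "\<lambda>l. jlo \<le> l \<and> bi l \<le> S l", OF ex])
  have js_pred: "js = jlo \<or> S (js - 1) < bi (js - 1)"
  proof (cases "js = jlo")
    case False
    then have "js - 1 < js" "jlo \<le> js - 1" using js(1) j(2) by auto
    then show ?thesis using not_less_Least[of "js - 1" "\<lambda>l. jlo \<le> l \<and> bi l \<le> S l"] unfolding js_def by auto
  qed simp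
  have bdd: "\<bar>estimator K ?I X y k - estimator K ?I X y l\<bar> \<le> 2 ^ k * K_bound + 2 ^ l * K_bound" for k l y
    using estimator_le[of ?I X y k] estimator_le[of ?I X y l] by simp
  define Q where "Q = {k \<in> {jlo..jhi}. \<forall>l\<in>{jlo..jhi}. k < l \<longrightarrow>
      sup_norm (\<lambda>y. estimator K ?I X y k - estimator K ?I X y l) \<le> 4 * S l}"
  have jh: "jh = Min Q" unfolding jh_def selected_level_def Q_def Let_def U_def[symmetric] thr ..
  have fin: "finite Q" unfolding Q_def by simp
  have jsQ: "js \<in> Q"
  proof -
    have "sup_norm (\<lambda>y. estimator K ?I X y js - estimator K ?I X y l) \<le> 4 * S l" if l: "l \<in> {jlo..jhi}" "js < l" for l
    proof (rule sup_norm_least)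
      fix y
      have "js \<in> {jlo..jhi}" using js js_hi by simp
      from noise[OF this, of y] biasp[OF this, of y] noise[OF l(1), of y] biasp[OF l(1), of y]
      have "\<bar>estimator K ?I X y js - estimator K ?I X y l\<bar> \<le> S js + S l + bi js + bi l" by linarith
      also have "\<dots> \<le> 4 * S l" using bi_mono[of js l] S_mono[of js l] js(2) l(2) by linarith
      finally show "\<bar>estimator K ?I X y js - estimator K ?I X y l\<bar> \<le> 4 * S l" .
    qed
    then show ?thesis unfolding Q_def using js js_hi by simp
  qed
  have jh_le: "jh \<le> js" unfolding jh by (rule Min_le[OF fin jsQ])
  have "jh \<in> Q" unfolding jh by (rule Min_in[OF fin]) (use jsQ in blast)
  then have jhQ: "jh \<in> {jlo..jhi}" "\<And>l. l \<in> {jlo..jhi} \<Longrightarrow> jh < l \<Longrightarrow> sup_norm (\<lambda>y. estimator K ?I X y jh - estimator K ?I X y l) \<le> 4 * S l"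
    unfolding Q_def by auto
  have "js \<le> jh + q"
  proof (rule ccontr)
    assume "\<not> js \<le> jh + q"
    then have lt: "jh + q < js" by simp
    have jsJ: "js \<in> {jlo..jhi}" using js js_hi by simp
    have "\<bar>kernel_op K jh f y - f y\<bar> \<le> 7 * S js" for y
    proof -
      have "\<bar>estimator K ?I X y jh - estimator K ?I X y js\<bar> \<le> 4 * S js"
        using order_trans[OF sup_norm_upper[where h = "\<lambda>y. estimator K ?I X y jh - estimator K ?I X y js", OF bdd] jhQ(2)[OF jsJ]] lt by simp
      then show ?thesis
        using noise[OF jsJ, of y] biasp[OF jsJ, of y] noise[OF jhQ(1), of y] S_mono[of jh js] js(2) lt by linarith
    qed
    from sup_norm_least[of "\<lambda>y. kernel_op K jh f y - f y", OF this]
    have "b1 * 2 powr (- (real jh * t)) \<le> 7 * S js"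
    proof (rule order_trans[rotated])
      have "j0 \<le> jh" using jhQ(1) j by simp
      then show "b1 * 2 powr (- (real jh * t)) \<le> sup_norm (\<lambda>y. kernel_op K jh f y - f y)"
        using bias unfolding bias_bounds_def by blast
    qed
    moreover have "S js \<le> 2 * S (js - 1)"
    proof -
      have "2 \<le> js" using lt jhQ(1) j by simp
      then have e: "2 ^ js = 2 * (2::real) ^ (js - 1)" "real js \<le> 2 * real (js - 1)"
        by (simp_all add: power_eq_if of_nat_diff)
      have "U * 2 ^ js * real js / real m2 \<le> U * (2 * 2 ^ (js - 1)) * (2 * real (js - 1)) / real m2"
        unfolding e(1) using U1 e(2) by (intro divide_right_mono mult_left_mono) auto
      also have "\<dots> = 2\<^sup>2 * (U * 2 ^ (js - 1) * real (js - 1) / real m2)" by simp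
      finally have "sqrt (U * 2 ^ js * real js / real m2) \<le> sqrt (2\<^sup>2 * (U * 2 ^ (js - 1) * real (js - 1) / real m2))"
        by (rule real_sqrt_le_mono)
      also have "\<dots> = 2 * sqrt (U * 2 ^ (js - 1) * real (js - 1) / real m2)" by (subst real_sqrt_mult) simp
      finally show ?thesis unfolding S_def using noise_const_pos by (simp add: mult.left_commute mult_left_mono)
    qed
    moreover have "S (js - 1) < bi (js - 1)"
      using js_pred lt jhQ(1) by auto
    ultimately have "b1 * 2 powr (- (real jh * t)) < 14 * bi (js - 1)" by linarith
    also have "bi (js - 1) = b2 * (2 powr (- (real jh * t)) * 2 powr (- ((real (js - 1) - real jh) * t)))"
      unfolding bi_def by (simp add: powr_add[symmetric] algebra_simps)
    also have "14 * (b2 * (2 powr (- (real jh * t)) * 2 powr (- ((real (js - 1) - real jh) * t))))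
       \<le> 14 * (b2 * (2 powr (- (real jh * t)) * 2 powr (- (real q * \<eta>))))"
    proof -
      have "real q \<le> real (js - 1) - real jh" using lt by (simp add: of_nat_diff)
      then have "real q * \<eta> \<le> (real (js - 1) - real jh) * t" using t by (intro mult_mono) auto
      then show ?thesis using b by (intro mult_left_mono powr_mono) auto
    qed
    finally have "b1 < 14 * (b2 * 2 powr (- (real q * \<eta>)))" by simp
    then have "b1 / b2 * 2 powr (real q * \<eta>) < 14" using b by (simp add: powr_minus field_simps)
    with q show False by simp
  qed
  then show ?thesis using js js_hi js_pred jh_le jhQ(1) unfolding bi_def[symmetric] by (intro exI[of _ js]) auto
qed

end

section \<open>Studentization\<close>

lemma inverse_sqrt_diff_le:
  fixes a b d :: real
  assumes d: "0 < d" and a: "d \<le> a" and b: "d \<le> b"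
  shows "\<bar>1 / sqrt a - 1 / sqrt b\<bar> \<le> \<bar>a - b\<bar> / (d * sqrt d)"
proof -
  have s: "sqrt d > 0" "sqrt d \<le> sqrt a" "sqrt d \<le> sqrt b" "0 < sqrt a" "0 < sqrt b" using assms by auto
  have "1 / sqrt a - 1 / sqrt b = (sqrt b - sqrt a) / (sqrt a * sqrt b)" using s by (simp add: field_simps)
  also have "\<dots> = (b - a) / (sqrt a * sqrt b * (sqrt a + sqrt b))"
  proof -
    have "(y - x) / (x * y) = (y - x) * (x + y) / (x * y * (x + y))" if "0 < x" "0 < y" for x y :: real
      by (rule nonzero_mult_divide_mult_cancel_right[symmetric]) (use that in simp)
    from this[OF s(4,5)] have "(sqrt b - sqrt a) / (sqrt a * sqrt b) =
        (sqrt b - sqrt a) * (sqrt a + sqrt b) / (sqrt a * sqrt b * (sqrt a + sqrt b))" .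
    moreover have "(sqrt b - sqrt a) * (sqrt a + sqrt b) = b - a" using assms by (simp add: algebra_simps)
    ultimately show ?thesis by (simp only:)
  qed
  finally have "\<bar>1 / sqrt a - 1 / sqrt b\<bar> = \<bar>a - b\<bar> / (sqrt a * sqrt b * (sqrt a + sqrt b))"
    using s by (simp add: abs_mult abs_minus_commute)
  also have "\<dots> \<le> \<bar>a - b\<bar> / (d * sqrt d)"
  proof (rule divide_left_mono)
    have "d * sqrt d = sqrt d * sqrt d * (sqrt d + 0)" using d by simp
    also have "\<dots> \<le> sqrt a * sqrt b * (sqrt a + sqrt b)" using s by (intro mult_mono add_mono) auto
    finally show "d * sqrt d \<le> sqrt a * sqrt b * (sqrt a + sqrt b)" .
    show "0 < sqrt a * sqrt b * (sqrt a + sqrt b) * (d * sqrt d)" using s d by (intro mult_pos_pos add_pos_pos) auto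
  qed simp
  finally show ?thesis .
qed

text \<open>Two replacements: \<open>f\<close> by the mean \<open>p\<close> in the numerator, at the cost of the bias, and the estimator by
\<open>f\<close> under the root, at the cost of its error, which multiplies the noise.  The smallness assumption
keeps the estimator above \<open>\<delta> / 2\<close> on \<open>[0,1]\<close>, so that the quotient is the one given by the formula and
the default value \<open>dd\<close> does not occur.\<close>

lemma studentized_error_close:
  fixes f :: "real \<Rightarrow> real" and e p :: "real \<Rightarrow> real"
  assumes m1: "0 < m1" and \<delta>: "0 < \<delta>" "\<And>y. y \<in> {0..1} \<Longrightarrow> \<delta> \<le> f y"
    and noise: "\<And>y. \<bar>estimator K {1..m1} X y j - p y\<bar> \<le> \<zeta>" and bias: "\<And>y. \<bar>p y - f y\<bar> \<le> \<beta>"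
    and small: "\<zeta> + \<beta> \<le> \<delta> / 2"
  defines "s \<equiv> sqrt (real m1 / 2 ^ j)" and "k \<equiv> 1 / \<bar>kernel_const K\<bar>"
  shows "\<bar>studentized_error K m1 (sigma_hat m1 j) f X j dd
      - s * (SUP y\<in>{0..1}. \<bar>(estimator K {1..m1} X y j - p y) / (kernel_const K * sqrt (f y))\<bar>)\<bar>
    \<le> k * s * (\<beta> / sqrt (\<delta> / 2) + \<zeta> * (\<zeta> + \<beta>) / (\<delta> / 2 * sqrt (\<delta> / 2)))"
proof -
  let ?e = "\<lambda>y. estimator K {1..m1} X y j"
  define d where "d = \<delta> / 2"
  have d: "0 < d" using \<delta>(1) by (simp add: d_def)
  have s0: "0 < s" unfolding s_def using m1 by simp
  have k0: "0 \<le> k" unfolding k_def by simp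
  have z0: "0 \<le> \<zeta>" "0 \<le> \<beta>" using noise[of 0] bias[of 0] by linarith+
  have est: "d \<le> ?e y" "d \<le> f y" "\<bar>?e y - f y\<bar> \<le> \<zeta> + \<beta>" if "y \<in> {0..1}" for y
  proof -
    show 1: "\<bar>?e y - f y\<bar> \<le> \<zeta> + \<beta>" using noise[of y] bias[of y] by linarith
    show "d \<le> ?e y" "d \<le> f y" using 1 \<delta>(2)[OF that] small \<delta>(1) unfolding d_def by linarith+
  qed
  have "d \<le> (INF y\<in>{0..1}. ?e y)" by (rule cINF_greatest) (use est in auto)
  then have pos: "0 < (INF y\<in>{0..1}. ?e y)" using d by linarith
  have sig: "sigma_hat m1 j = 1 / s"
    unfolding sigma_hat_def s_def by (simp add: real_sqrt_divide)
  let ?v = "\<lambda>y. \<bar>(?e y - f y) / (kernel_const K * sigma_hat m1 j * sqrt (?e y))\<bar>"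
  let ?w = "\<lambda>y. s * \<bar>(?e y - p y) / (kernel_const K * sqrt (f y))\<bar>"
  have veq: "?v y = k * s * (\<bar>?e y - f y\<bar> * (1 / sqrt (?e y)))" if "y \<in> {0..1}" for y
    unfolding sig k_def using est[OF that] d s0 by (simp add: abs_mult divide_simps)
  have weq: "?w y = k * s * (\<bar>?e y - p y\<bar> * (1 / sqrt (f y)))" if "y \<in> {0..1}" for y
    unfolding k_def using est[OF that] d by (simp add: abs_mult divide_simps)
  have sd: "0 < sqrt d" using d by simp
  have inv: "1 / sqrt x \<le> 1 / sqrt d" if "d \<le> x" for x
    using that d by (intro divide_left_mono) (auto intro!: mult_pos_pos)
  have bddw: "bdd_above (?w ` {0..1})"
  proof (rule bdd_aboveI2)
    fix y :: real assume y: "y \<in> {0..1}"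
    show "?w y \<le> k * s * (\<zeta> * (1 / sqrt d))"
      unfolding weq[OF y] using noise[of y] inv[OF est(2)[OF y]] s0 k0 z0 est(2)[OF y] d
      by (intro mult_left_mono mult_mono) auto
  qed
  have close: "\<bar>?v y - ?w y\<bar> \<le> k * s * (\<beta> / sqrt d + \<zeta> * (\<zeta> + \<beta>) / (d * sqrt d))" if y: "y \<in> {0..1}" for y
  proof -
    define a b where "a = 1 / sqrt (?e y)" and "b = 1 / sqrt (f y)"
    have a: "0 \<le> a" "a \<le> 1 / sqrt d" unfolding a_def using inv[OF est(1)[OF y]] est(1)[OF y] d by auto
    have ab: "\<bar>a - b\<bar> \<le> (\<zeta> + \<beta>) / (d * sqrt d)"
    proof -
      have "\<bar>a - b\<bar> \<le> \<bar>?e y - f y\<bar> / (d * sqrt d)" unfolding a_def b_def by (rule inverse_sqrt_diff_le[OF d est(1,2)[OF y]])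
      also have "\<dots> \<le> (\<zeta> + \<beta>) / (d * sqrt d)" using est(3)[OF y] d by (intro divide_right_mono) auto
      finally show ?thesis .
    qed
    have "\<bar>?e y - f y\<bar> * a - \<bar>?e y - p y\<bar> * b = (\<bar>?e y - f y\<bar> - \<bar>?e y - p y\<bar>) * a + \<bar>?e y - p y\<bar> * (a - b)"
      by (simp add: algebra_simps)
    then have "\<bar>\<bar>?e y - f y\<bar> * a - \<bar>?e y - p y\<bar> * b\<bar> \<le> \<bar>\<bar>?e y - f y\<bar> - \<bar>?e y - p y\<bar>\<bar> * \<bar>a\<bar> + \<bar>\<bar>?e y - p y\<bar>\<bar> * \<bar>a - b\<bar>"
      unfolding abs_mult[symmetric] by (simp only: abs_triangle_ineq)
    also have "\<dots> \<le> \<beta> * (1 / sqrt d) + \<zeta> * ((\<zeta> + \<beta>) / (d * sqrt d))"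
    proof (intro add_mono mult_mono ab)
      show "\<bar>\<bar>?e y - f y\<bar> - \<bar>?e y - p y\<bar>\<bar> \<le> \<beta>" using bias[of y] by linarith
      show "\<bar>\<bar>?e y - p y\<bar>\<bar> \<le> \<zeta>" using noise[of y] by simp
    qed (use a z0 in auto)
    finally have "k * s * \<bar>\<bar>?e y - f y\<bar> * a - \<bar>?e y - p y\<bar> * b\<bar> \<le> k * s * (\<beta> / sqrt d + \<zeta> * (\<zeta> + \<beta>) / (d * sqrt d))"
      using k0 s0 by (intro mult_left_mono) auto
    moreover have "\<bar>?v y - ?w y\<bar> = k * s * \<bar>\<bar>?e y - f y\<bar> * a - \<bar>?e y - p y\<bar> * b\<bar>"
      unfolding veq[OF y] weq[OF y] a_def b_def right_diff_distrib[symmetric] abs_mult using k0 s0 by simp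
    ultimately show ?thesis by simp
  qed
  have sup_mult: "s * (SUP y\<in>{0..1}. \<bar>(?e y - p y) / (kernel_const K * sqrt (f y))\<bar>) = (SUP y\<in>{0..1}. ?w y)"
  proof -
    let ?u = "\<lambda>y. \<bar>(?e y - p y) / (kernel_const K * sqrt (f y))\<bar>"
    have bu: "bdd_above (?u ` {0..1})"
    proof -
      obtain B where B: "\<forall>x\<in>?w ` {0..1}. x \<le> B" using bddw unfolding bdd_above_def by blast
      then have "?w y \<le> B" if "y \<in> {0..1}" for y using that by blast
      then show ?thesis using s0 by (intro bdd_aboveI2[of _ _ "B / s"]) (simp add: pos_le_divide_eq mult.commute)
    qed
    show ?thesis
    proof (rule antisym)
      have "(SUP y\<in>{0..1}. ?u y) \<le> (SUP y\<in>{0..1}. ?w y) / s"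
      proof (rule cSUP_least)
        fix y :: real assume "y \<in> {0..1}"
        from cSUP_upper[OF this bddw] show "?u y \<le> (SUP y\<in>{0..1}. ?w y) / s"
          using s0 by (simp add: pos_le_divide_eq mult.commute)
      qed simp
      then show "s * (SUP y\<in>{0..1}. ?u y) \<le> (SUP y\<in>{0..1}. ?w y)" using s0 by (simp add: pos_le_divide_eq mult.commute)
      show "(SUP y\<in>{0..1}. ?w y) \<le> s * (SUP y\<in>{0..1}. ?u y)"
      proof (rule cSUP_least)
        fix y :: real assume "y \<in> {0..1}"
        from cSUP_upper[OF this bu] show "?w y \<le> s * (SUP y\<in>{0..1}. ?u y)"
          by (rule mult_left_mono) (use s0 in simp)
      qed simp
    qed
  qed
  show ?thesis
    unfolding studentized_error_def sup_mult if_P[OF pos] d_def[symmetric]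
    by (rule abs_SUP_diff_le[OF _ bddw close]) auto
qed

section \<open>The Gumbel limit, uniformly over the levels\<close>

abbreviation centred_statistic :: "(real \<Rightarrow> real \<Rightarrow> real) \<Rightarrow> nat \<Rightarrow> (real \<Rightarrow> real) \<Rightarrow> (nat \<Rightarrow> real) \<Rightarrow> nat \<Rightarrow> real" where
  "centred_statistic K m1 f X l \<equiv> sqrt (real m1 / 2 ^ l) *
     (SUP y\<in>{0..1}. \<bar>(estimator K {1..m1} X y l - kernel_op K l f y) / (kernel_const K * sqrt (f y))\<bar>)"

definition gumbel_event :: "(real \<Rightarrow> real \<Rightarrow> real) \<Rightarrow> nat \<Rightarrow> nat \<Rightarrow> (real \<Rightarrow> real) \<Rightarrow> nat \<Rightarrow> real \<Rightarrow> (nat \<Rightarrow> real) set" where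
  "gumbel_event K n m1 f l z = {X \<in> space (sample_law f n). centred_statistic K m1 f X l \<le> z}"

lemma density_class_imp:
  assumes "f \<in> density_class \<Phi> \<alpha> D' \<delta> F1 F2"
  shows "probability_density f" "continuous_on UNIV f" "bounded (range f)" "\<And>x. x \<in> {F1..F2} \<Longrightarrow> \<delta> \<le> f x"
  using assms unfolding density_class_def zygmund_space_def probability_density_def by auto

text \<open>The hypothesis concerns an arbitrary sequence of levels.  It is applied to the sequence that picks,
for each \<open>n\<close>, a level at which the discrepancy is largest.\<close>

lemma (in tame_kernel) uniform_gumbel_levels:
  assumes G: "uniform_gumbel \<Phi> K n0 n1 jmin jmax A B" and \<alpha>: "0 < \<alpha>" "0 < D'" "admissible_pair \<Phi> \<alpha> D' \<delta> F1 F2"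
    and J: "\<And>n. n0 \<le> n \<Longrightarrow> jmin n < jmax n" and n1: "\<And>n. n0 \<le> n \<Longrightarrow> 0 < n1 n \<and> n1 n \<le> n" and \<epsilon>: "0 < \<epsilon>"
  shows "\<forall>\<^sub>F n in sequentially. \<forall>l\<in>{jmin n..jmax n}. \<forall>f\<in>density_class \<Phi> \<alpha> D' \<delta> F1 F2.
     \<bar>measure (sample_law f n) (gumbel_event K n (n1 n) f l (x / A l + B l)) - exp (- exp (- x))\<bar> < \<epsilon>"
proof -
  let ?C = "density_class \<Phi> \<alpha> D' \<delta> F1 F2"
  have ne: "?C \<noteq> {}" using \<alpha>(3) unfolding admissible_pair_def by blast
  define v where "v n l f = \<bar>measure (sample_law f n) (gumbel_event K n (n1 n) f l (x / A l + B l)) - exp (- exp (- x))\<bar>" for n l f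
  have v1: "v n l f \<le> 1" if "f \<in> ?C" for n l f
  proof -
    interpret prob_space "sample_law f n" by (rule sample_law_prob_space[OF density_class_imp(1)[OF that]])
    have "0 \<le> prob (gumbel_event K n (n1 n) f l (x / A l + B l))" "prob (gumbel_event K n (n1 n) f l (x / A l + B l)) \<le> 1"
      by (rule measure_nonneg, rule prob_le_1)
    moreover have "0 \<le> exp (- exp (- x))" "exp (- exp (- x)) \<le> 1" by auto
    ultimately show ?thesis unfolding v_def by linarith
  qed
  have bdd: "bdd_above (v n l ` ?C)" for n l using v1 by (auto intro!: bdd_aboveI2)
  define w where "w n l = (SUP f\<in>?C. v n l f)" for n l
  have "\<exists>l. (n0 \<le> n \<longrightarrow> l \<in> {jmin n..jmax n} \<and> (\<forall>k\<in>{jmin n..jmax n}. w n k \<le> w n l))" for n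
  proof (cases "n0 \<le> n")
    case True
    have fin: "finite {jmin n..jmax n}" "{jmin n..jmax n} \<noteq> {}" using J[OF True] by auto
    have "Max (w n ` {jmin n..jmax n}) \<in> w n ` {jmin n..jmax n}" using fin by (intro Max_in) auto
    then obtain l where l: "l \<in> {jmin n..jmax n}" "w n l = Max (w n ` {jmin n..jmax n})" by force
    then show ?thesis using fin by (intro exI[of _ l]) auto
  qed simp
  then obtain l where l: "\<And>n. n0 \<le> n \<Longrightarrow> l n \<in> {jmin n..jmax n}"
    "\<And>n k. n0 \<le> n \<Longrightarrow> k \<in> {jmin n..jmax n} \<Longrightarrow> w n k \<le> w n (l n)" by metis
  have "(\<lambda>n. SUP f\<in>?C. \<bar>\<P>(X in sample_law f n.
               sqrt (real (n1 n) / 2 ^ l n) *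
               (SUP y\<in>{0..1}.
                  \<bar>(estimator K {1..n1 n} X y (l n) -
                     (\<integral>Z. estimator K {1..n1 n} Z y (l n) \<partial>sample_law f n)) /
                   (kernel_const K * sqrt (f y))\<bar>)
               \<le> x / A (l n) + B (l n)) - exp (- exp (- x))\<bar>) \<longlonglongrightarrow> 0"
    using G l(1) \<alpha> unfolding uniform_gumbel_def by blast
  then have "\<forall>\<^sub>F n in sequentially. (SUP f\<in>?C. \<bar>\<P>(X in sample_law f n.
               sqrt (real (n1 n) / 2 ^ l n) *
               (SUP y\<in>{0..1}.
                  \<bar>(estimator K {1..n1 n} X y (l n) -
                     (\<integral>Z. estimator K {1..n1 n} Z y (l n) \<partial>sample_law f n)) /
                   (kernel_const K * sqrt (f y))\<bar>)
               \<le> x / A (l n) + B (l n)) - exp (- exp (- x))\<bar>) < \<epsilon>"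
    by (rule order_tendstoD(2)) (rule \<epsilon>)
  moreover have "\<forall>\<^sub>F n in sequentially. n0 \<le> n" by (rule eventually_ge_at_top)
  ultimately show ?thesis
  proof eventually_elim
    case (elim n)
    have "{1..n1 n} \<subseteq> {1..n}" "{1..n1 n} \<noteq> {}" using n1[OF elim(2)] by auto
    note mean = estimator_mean[OF density_class_imp(1) this]
    have "w n (l n) = (SUP f\<in>?C. \<bar>\<P>(X in sample_law f n.
               sqrt (real (n1 n) / 2 ^ l n) *
               (SUP y\<in>{0..1}.
                  \<bar>(estimator K {1..n1 n} X y (l n) -
                     (\<integral>Z. estimator K {1..n1 n} Z y (l n) \<partial>sample_law f n)) /
                   (kernel_const K * sqrt (f y))\<bar>)
               \<le> x / A (l n) + B (l n)) - exp (- exp (- x))\<bar>)"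
      unfolding w_def v_def gumbel_event_def by (rule SUP_cong[OF refl]) (simp only: mean)
    then have w: "w n (l n) < \<epsilon>" using elim(1) by simp
    show ?case
    proof (intro ballI)
      fix k f assume k: "k \<in> {jmin n..jmax n}" and f: "f \<in> ?C"
      have "v n k f \<le> w n k" unfolding w_def by (rule cSUP_upper[OF f bdd])
      also have "\<dots> \<le> w n (l n)" by (rule l(2)[OF elim(2) k])
      finally show "\<bar>measure (sample_law f n) (gumbel_event K n (n1 n) f k (x / A k + B k)) - exp (- exp (- x))\<bar> < \<epsilon>"
        using w unfolding v_def by linarith
    qed
  qed
qed

section \<open>Noise on all levels at once\<close>
text \<open>The asymptotic hypotheses on the sizes of the subsamples and on the range of levels, restated for a
single \<open>n\<close> and in terms of \<open>n\<close>.\<close>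

definition regime :: "real \<Rightarrow> real \<Rightarrow> real \<Rightarrow> nat \<Rightarrow> nat \<Rightarrow> nat \<Rightarrow> nat \<Rightarrow> nat \<Rightarrow> bool" where
  "regime c C p n m1 m2 jlo jhi \<longleftrightarrow>
     m1 + m2 = n \<and> 0 < m1 \<and> 0 < m2 \<and> c * real n \<le> real m1 \<and> c * real n \<le> real m2 \<and> 0 < jlo \<and> jlo < jhi \<and>
     c * real n / ln (real n) ^ 4 \<le> 2 ^ jhi \<and> 2 ^ jhi \<le> C * real n / ln (real n) ^ 4 \<and>
     c * (real n / ln (real n)) powr p \<le> 2 ^ jlo \<and> 2 ^ jlo \<le> C * (real n / ln (real n)) powr p \<and>
     c * ln (real n) \<le> real jlo \<and> real jhi \<le> 2 * ln (real n)"

lemma sample_split_positive: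
  assumes "sample_split n0 n1 n2" "n0 \<le> n"
  shows "n1 n + n2 n = n" "0 < n1 n" "1 < n2 n"
proof -
  obtain c C where cC: "0 < c" "\<And>n. n0 \<le> n \<Longrightarrow> c \<le> real (n1 n) / real (n2 n)"
    using assms(1) unfolding sample_split_def by blast
  show "n1 n + n2 n = n" "1 < n2 n" using assms unfolding sample_split_def by auto
  have "0 < real (n1 n) / real (n2 n)" using cC(1) cC(2)[OF assms(2)] by linarith
  then show "0 < n1 n" by (cases "n1 n = 0") auto
qed

text \<open>The sizes \<open>n1\<close> and \<open>n2\<close> are at least a fixed fraction of \<open>n\<close>, so \<open>ln (n2 n)\<close> lies between
\<open>ln n / 2\<close> and \<open>ln n\<close>; this converts every bound in \<open>n2\<close> into one in \<open>n\<close>.\<close>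

lemma regimeE:
  assumes split: "sample_split n0 n1 n2" and res: "resolution_range r n0 n2 jmin jmax"
  defines "p \<equiv> 1 / (2 * real r + 1)"
  obtains c C where "0 < c" "0 < C" "\<forall>\<^sub>F n in sequentially. regime c C p n (n1 n) (n2 n) (jmin n) (jmax n)"
proof -
  have p: "0 < p" "p \<le> 1" unfolding p_def by (auto simp: divide_simps)
  obtain c0 C0 where c0: "0 < c0" "\<And>n. n0 \<le> n \<Longrightarrow> c0 \<le> real (n1 n) / real (n2 n)" "\<And>n. n0 \<le> n \<Longrightarrow> real (n1 n) / real (n2 n) \<le> C0"
    using split unfolding sample_split_def by blast
  have C0: "0 < C0" using c0(1) c0(2)[of n0] c0(3)[of n0] by linarith
  define k where "k = min (1 / (1 + C0)) (c0 / (1 + C0))"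
  have k: "0 < k" unfolding k_def using c0 C0 by auto
  have ge: "k * real n \<le> real (n1 n)" "k * real n \<le> real (n2 n)" if "n0 \<le> n" for n
  proof -
    note s = sample_split_positive[OF split that]
    have r: "c0 * real (n2 n) \<le> real (n1 n)" "real (n1 n) \<le> C0 * real (n2 n)"
      using c0(2,3)[OF that] s(3) by (auto simp: le_divide_eq divide_le_eq)
    have n: "real n = real (n1 n) + real (n2 n)" using s(1) by (metis of_nat_add)
    then have n2: "real n / (1 + C0) \<le> real (n2 n)" using r C0 by (simp add: divide_le_eq algebra_simps)
    have "k * real n \<le> 1 / (1 + C0) * real n" unfolding k_def by (rule mult_right_mono) auto
    then show "k * real n \<le> real (n2 n)" using n2 by simp
    have "k * real n \<le> c0 / (1 + C0) * real n" unfolding k_def by (rule mult_right_mono) auto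
    also have "\<dots> = c0 * (real n / (1 + C0))" by simp
    also have "\<dots> \<le> c0 * real (n2 n)" using n2 c0(1) by (intro mult_left_mono) auto
    also have "\<dots> \<le> real (n1 n)" by (rule r(1))
    finally show "k * real n \<le> real (n1 n)" .
  qed
  obtain a A where a: "0 < a" and ev1: "\<forall>\<^sub>F n in sequentially. a \<le> 2 ^ jmin n / (real (n2 n) / ln (real (n2 n))) powr p \<and>
      2 ^ jmin n / (real (n2 n) / ln (real (n2 n))) powr p \<le> A"
    using res unfolding resolution_range_def comparable_def p_def by auto
  obtain a' A' where a': "0 < a'" and ev2: "\<forall>\<^sub>F n in sequentially. a' \<le> 2 ^ jmax n / (real (n2 n) / ln (real (n2 n)) ^ 4) \<and>
      2 ^ jmax n / (real (n2 n) / ln (real (n2 n)) ^ 4) \<le> A'"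
    using res unfolding resolution_range_def comparable_def by auto
  have kp: "0 < a * k powr p" using a k by simp
  define c where "c = Min {k, a' * k, a * k powr p, p / 2}"
  define C where "C = Max {1, A' * 16, A * 2 powr p}"
  have c: "0 < c" "c \<le> k" "c \<le> a' * k" "c \<le> a * k powr p" "c \<le> p / 2" unfolding c_def using a a' k p by auto
  have C: "0 < C" "A' * 16 \<le> C" "A * 2 powr p \<le> C" unfolding C_def by (auto simp: less_max_iff_disj)
  have e1: "\<forall>\<^sub>F n in sequentially. sqrt (real n) \<le> k * real n" using k by real_asymp
  have e2: "\<forall>\<^sub>F n in sequentially. C * real n / ln (real n) ^ 4 \<le> real n" using C(1) by real_asymp
  have e3: "\<forall>\<^sub>F n::nat in sequentially. p / 2 * ln (real n) \<le> ln (a * k powr p * (real n / ln (real n)) powr p)"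
    using p kp by real_asymp
  have "\<forall>\<^sub>F n in sequentially. n0 \<le> n" "\<forall>\<^sub>F n in sequentially. 3 \<le> (n::nat)" by (rule eventually_ge_at_top)+
  then have "\<forall>\<^sub>F n in sequentially. regime c C p n (n1 n) (n2 n) (jmin n) (jmax n)"
    using ev1 ev2 e1 e2 e3
  proof eventually_elim
    case (elim n)
    note s = sample_split_positive[OF split elim(1)] and g = ge[OF elim(1)]
    have n3: "3 \<le> real n" using elim(2) by simp
    have ln1: "1 \<le> ln (real n)"
    proof -
      have "exp 1 \<le> real n" using e_less_272 n3 by linarith
      then show ?thesis using n3 by (subst ln_ge_iff) auto
    qed
    have n2n: "real (n2 n) \<le> real n" "2 \<le> real (n2 n)" using s by linarith+
    have lnu: "ln (real (n2 n)) \<le> ln (real n)" using n2n by (subst ln_le_cancel_iff) auto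
    have lnl: "ln (real n) / 2 \<le> ln (real (n2 n))"
    proof -
      have "ln (sqrt (real n)) \<le> ln (real (n2 n))" using elim(5) g(2) n3 n2n by (subst ln_le_cancel_iff) auto
      then show ?thesis using n3 by (simp add: ln_sqrt)
    qed
    have ln2: "0 < ln (real (n2 n))" using lnl ln1 by linarith
    have q0: "0 < real (n2 n) / ln (real (n2 n))" "0 < real (n2 n) / ln (real (n2 n)) ^ 4" "0 < real n / ln (real n)"
      using n2n ln2 ln1 n3 by auto
    have hi: "a' * (real (n2 n) / ln (real (n2 n)) ^ 4) \<le> 2 ^ jmax n" "2 ^ jmax n \<le> A' * (real (n2 n) / ln (real (n2 n)) ^ 4)"
      using elim(4) q0(2) by (simp_all only: pos_le_divide_eq pos_divide_le_eq)
    have lo: "a * (real (n2 n) / ln (real (n2 n))) powr p \<le> 2 ^ jmin n" "2 ^ jmin n \<le> A * (real (n2 n) / ln (real (n2 n))) powr p"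
      using elim(3) q0(1) by (simp_all only: pos_le_divide_eq pos_divide_le_eq powr_gt_zero)
    have A': "0 \<le> A'" using elim(4) a' by linarith
    have A0: "0 \<le> A" using elim(3) a by linarith
    have hi_l: "c * real n / ln (real n) ^ 4 \<le> 2 ^ jmax n"
    proof -
      have "c * real n / ln (real n) ^ 4 \<le> a' * k * real n / ln (real n) ^ 4"
        using c(3) ln1 by (intro divide_right_mono mult_right_mono) auto
      also have "\<dots> = a' * (k * real n / ln (real n) ^ 4)" by simp
      also have "\<dots> \<le> a' * (real (n2 n) / ln (real (n2 n)) ^ 4)"
        using a' g(2) ln2 lnu k ln1 n2n by (intro mult_left_mono frac_le power_mono) auto
      finally show ?thesis using hi(1) by linarith
    qed
    have hi_u: "2 ^ jmax n \<le> C * real n / ln (real n) ^ 4"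
    proof -
      have "A' * (real (n2 n) / ln (real (n2 n)) ^ 4) \<le> A' * (real n / (ln (real n) / 2) ^ 4)"
        using A' n2n lnl ln1 by (intro mult_left_mono frac_le power_mono) auto
      also have "\<dots> = A' * 16 * real n / ln (real n) ^ 4" by (simp add: power_divide)
      also have "\<dots> \<le> C * real n / ln (real n) ^ 4" using C(2) ln1 by (intro divide_right_mono mult_right_mono) auto
      finally show ?thesis using hi(2) by linarith
    qed
    have lo_l': "a * k powr p * (real n / ln (real n)) powr p \<le> 2 ^ jmin n"
    proof -
      have "a * k powr p * (real n / ln (real n)) powr p = a * (k * real n / ln (real n)) powr p"
        using k q0(3) by (simp add: powr_mult[symmetric])
      also have "\<dots> \<le> a * (real (n2 n) / ln (real (n2 n))) powr p"
        using a g(2) ln2 lnu k ln1 n2n p q0 by (intro mult_left_mono powr_mono2 frac_le) auto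
      finally show ?thesis using lo(1) by linarith
    qed
    have lo_l: "c * (real n / ln (real n)) powr p \<le> 2 ^ jmin n"
      by (rule order_trans[OF mult_right_mono[OF c(4)] lo_l']) simp
    have lo_u: "2 ^ jmin n \<le> C * (real n / ln (real n)) powr p"
    proof -
      have "A * (real (n2 n) / ln (real (n2 n))) powr p \<le> A * (real n / (ln (real n) / 2)) powr p"
        using A0 n2n lnl ln1 p q0 by (intro mult_left_mono powr_mono2 frac_le) auto
      also have "real n / (ln (real n) / 2) = 2 * (real n / ln (real n))" by simp
      also have "A * (2 * (real n / ln (real n))) powr p = A * 2 powr p * (real n / ln (real n)) powr p"
      proof -
        have "(2 * (real n / ln (real n))) powr p = 2 powr p * (real n / ln (real n)) powr p"
          by (rule powr_mult)
        then show ?thesis by (simp only: mult.assoc)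
      qed
      also have "\<dots> \<le> C * (real n / ln (real n)) powr p" using C(3) by (intro mult_right_mono) auto
      finally show ?thesis using lo(2) by linarith
    qed
    have ln2_bounds: "1 / 2 \<le> ln (2::real)" "ln (2::real) \<le> 1" using ln2_ge_two_thirds ln_le_minus_one[of "2::real"] by auto
    have lnpow: "ln (2 ^ j) = real j * ln (2::real)" for j :: nat by (simp add: ln_realpow)
    have jl: "c * ln (real n) \<le> real (jmin n)"
    proof -
      have "c * ln (real n) \<le> p / 2 * ln (real n)" using c(5) ln1 by (intro mult_right_mono) auto
      also have "\<dots> \<le> ln (a * k powr p * (real n / ln (real n)) powr p)" by (rule elim(7))
      also have "\<dots> \<le> ln (2 ^ jmin n)"
      proof (subst ln_le_cancel_iff)
        have "real n / ln (real n) \<noteq> 0" using q0(3) by (rule less_imp_neq[symmetric])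
        then have "0 < (real n / ln (real n)) powr p" unfolding powr_gt_zero .
        then show "0 < a * k powr p * (real n / ln (real n)) powr p" by (rule mult_pos_pos[OF kp])
      qed (use lo_l' in auto)
      also have "\<dots> \<le> real (jmin n) * 1" unfolding lnpow using ln2_bounds(2) by (intro mult_left_mono) auto
      finally show ?thesis by simp
    qed
    have jh: "real (jmax n) \<le> 2 * ln (real n)"
    proof -
      have "2 ^ jmax n \<le> real n" using hi_u elim(6) by linarith
      then have "ln (2 ^ jmax n) \<le> ln (real n)" using n3 by (subst ln_le_cancel_iff) auto
      moreover have "real (jmax n) * (1 / 2) \<le> real (jmax n) * ln 2" using ln2_bounds(1) by (intro mult_left_mono) auto
      ultimately show ?thesis unfolding lnpow by linarith
    qed
    have "c * real n \<le> k * real n" using c(2) by (intro mult_right_mono) auto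
    then have "c * real n \<le> real (n1 n)" "c * real n \<le> real (n2 n)" using g by (blast intro: order_trans)+
    moreover have "0 < jmin n" "jmin n < jmax n" using res elim(1) unfolding resolution_range_def by auto
    ultimately show ?case
      unfolding regime_def using s hi_l hi_u lo_l lo_u jl jh by auto
  qed
  with c(1) C(1) show ?thesis by (rule that)
qed

text \<open>Two subsamples times at most \<open>2 ln n + 1\<close> levels times the failure probability from
\<open>level_concentration\<close> at the lowest level, with \<open>w = (ln n)\<^sup>2\<close>.\<close>

definition failure_bound :: "real \<Rightarrow> real \<Rightarrow> real \<Rightarrow> nat \<Rightarrow> real" where
  "failure_bound V c p n = 2 * (2 * ln (real n) + 1) *
     (2 * (V + 1) / (c * (real n / ln (real n)) powr p) + 4 * (V * (real n)\<^sup>2 + 1) * exp (1 - (ln (real n))\<^sup>2))"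

lemma failure_bound_tendsto:
  assumes "0 < c" "0 < p" "0 \<le> V"
  shows "failure_bound V c p \<longlonglongrightarrow> 0"
proof (cases "V = 0")
  case True
  show ?thesis unfolding failure_bound_def[abs_def] True using assms by real_asymp
next
  case False
  then have "0 < V" using assms by simp
  then show ?thesis unfolding failure_bound_def[abs_def] using assms by real_asymp
qed

lemma (in tame_kernel) V_nonneg: "0 \<le> V"
  using dominated_nonneg[OF g_dominated, of 0] dominated_le[OF g_dominated, of 0] by linarith

text \<open>A union bound over the levels and the two subsamples.  The choice \<open>w = (ln n)\<^sup>2\<close> beats the factor
\<open>n\<^sup>2\<close> of fine brackets, and the side conditions of \<open>level_concentration\<close> hold because \<open>2^l\<close> is at most
of order \<open>n / (ln n)^4\<close> at the top and at least a power of \<open>n / ln n\<close> at the bottom.\<close>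

lemma (in tame_kernel) good_event:
  assumes \<kappa>: "0 < \<kappa>" "0 < C'" "0 < p"
  shows "\<forall>\<^sub>F n in sequentially. \<forall>m1 m2 jlo jhi. regime \<kappa> C' p n m1 m2 jlo jhi \<longrightarrow>
    (\<forall>f U. probability_density f \<longrightarrow> (\<forall>x. f x \<le> U) \<longrightarrow> 1 \<le> U \<longrightarrow>
      (\<exists>E\<in>sets (sample_law f n). measure (sample_law f n) (space (sample_law f n) - E) \<le> failure_bound V \<kappa> p n \<and>
        (\<forall>X\<in>E. \<forall>l\<in>{jlo..jhi}. \<forall>y.
          \<bar>estimator K {1..m1} X y l - kernel_op K l f y\<bar> \<le> noise_const * sqrt (U * 2 ^ l * real l / real m1) \<and>
          \<bar>estimator K {m1 + 1..m1 + m2} X y l - kernel_op K l f y\<bar> \<le> noise_const * sqrt (U * 2 ^ l * real l / real m2))))"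
proof -
  define B where "B = dev_const * (\<bar>g 0\<bar> + V)"
  have B0: "0 \<le> B" unfolding B_def using dev_const(1) V_nonneg by simp
  have e1: "\<forall>\<^sub>F n::nat in sequentially. C' * real n / ln (real n) ^ 4 \<le> \<kappa> * real n" using \<kappa> by real_asymp
  have "(\<lambda>n::nat. B * sqrt ((C' * 2 / \<kappa>) / ln (real n) ^ 3)) \<longlonglongrightarrow> 0" using \<kappa> by real_asymp
  then have e2: "\<forall>\<^sub>F n::nat in sequentially. B * sqrt ((C' * 2 / \<kappa>) / ln (real n) ^ 3) < 1" by (rule order_tendstoD(2)) simp
  have "(\<lambda>n::nat. 2 * V * (ln (real n))\<^sup>2 / sqrt (\<kappa> * \<kappa> / C' * ln (real n) ^ 5)) \<longlonglongrightarrow> 0" using \<kappa> by real_asymp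
  then have e3: "\<forall>\<^sub>F n::nat in sequentially. 2 * V * (ln (real n))\<^sup>2 / sqrt (\<kappa> * \<kappa> / C' * ln (real n) ^ 5) < 2" by (rule order_tendstoD(2)) simp
  have "(\<lambda>n::nat. (ln (real n))^4 * V / (4 * (\<kappa> * (real n / ln (real n)) powr p))) \<longlonglongrightarrow> 0" using \<kappa> by real_asymp
  then have e4: "\<forall>\<^sub>F n::nat in sequentially. (ln (real n))^4 * V / (4 * (\<kappa> * (real n / ln (real n)) powr p)) < 1" by (rule order_tendstoD(2)) simp
  have "\<forall>\<^sub>F n in sequentially. 3 \<le> (n::nat)" by (rule eventually_ge_at_top)
  then show ?thesis using e1 e2 e3 e4
  proof eventually_elim
    case (elim n)
    show ?case
    proof (intro allI impI)
      fix m1 m2 jlo jhi f U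
      assume R: "regime \<kappa> C' p n m1 m2 jlo jhi" and f: "probability_density f" and U: "\<forall>x. f x \<le> U" "1 \<le> U"
      have n3: "3 \<le> real n" using elim(1) by simp
      have ln1: "1 \<le> ln (real n)"
      proof -
        have "exp 1 \<le> real n" using e_less_272 n3 by linarith
        then show ?thesis using n3 by (subst ln_ge_iff) auto
      qed
      define w where "w = (ln (real n))\<^sup>2"
      have w: "0 < w" unfolding w_def using ln1 by simp
      have q0: "0 < (real n / ln (real n)) powr p" using n3 ln1 by simp
      have nl: "0 < \<kappa> * real n / ln (real n) ^ 4" using \<kappa> n3 ln1 by simp
      interpret S: prob_space "sample_law f n" by (rule sample_law_prob_space[OF f])
      define pb where "pb = 2 * (V + 1) / (\<kappa> * (real n / ln (real n)) powr p) + 4 * (V * (real n)\<^sup>2 + 1) * exp (1 - w)"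
      have single: "\<exists>E\<in>sets (sample_law f n). measure (sample_law f n) (space (sample_law f n) - E) \<le> pb \<and>
         (\<forall>X\<in>E. \<forall>y. \<bar>estimator K I X y l - kernel_op K l f y\<bar> \<le> noise_const * sqrt (U * 2 ^ l * real l / real (card I)))"
        if I: "I \<subseteq> {1..n}" "\<kappa> * real n \<le> real (card I)" and l: "l \<in> {jlo..jhi}" for I l
      proof -
        have cm1: "0 < \<kappa> * real n" using \<kappa>(1) n3 by simp
        then have cm2: "0 < real (card I)" using I(2) by linarith
        note cm = cm1 cm2
        have I0: "I \<noteq> {}" using cm2 by auto
        have l1: "1 \<le> l" "\<kappa> * ln (real n) \<le> real l" "real l \<le> 2 * ln (real n)"
          using l R unfolding regime_def by auto
        have "(2::real) ^ l \<le> 2 ^ jhi" "(2::real) ^ jlo \<le> 2 ^ l" using l by (auto intro!: power_increasing)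
        moreover have "2 ^ jhi \<le> C' * real n / ln (real n) ^ 4" "\<kappa> * (real n / ln (real n)) powr p \<le> 2 ^ jlo"
          using R unfolding regime_def by blast+
        ultimately have pl: "2 ^ l \<le> C' * real n / ln (real n) ^ 4" "\<kappa> * (real n / ln (real n)) powr p \<le> 2 ^ l"
          by linarith+
        have cardn: "card I \<le> n" using card_mono[OF _ I(1)] by simp
        have "2 ^ l * real l / real (card I) \<le> (C' * real n / ln (real n) ^ 4) * (2 * ln (real n)) / (\<kappa> * real n)"
          using pl(1) l1 I(2) cm ln1 \<kappa> n3 by (intro frac_le mult_mono) auto
        also have "\<dots> = (C' * 2 / \<kappa>) / ln (real n) ^ 3"
          using n3 ln1 \<kappa> by (simp add: field_simps eval_nat_numeral)
        finally have r1: "2 ^ l * real l / real (card I) \<le> (C' * 2 / \<kappa>) / ln (real n) ^ 3" .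
        have "\<kappa> * \<kappa> / C' * ln (real n) ^ 5 = (\<kappa> * real n) * (\<kappa> * ln (real n)) / (C' * real n / ln (real n) ^ 4)"
          using n3 ln1 \<kappa> by (simp add: field_simps eval_nat_numeral)
        also have "\<dots> \<le> real (card I) * real l / 2 ^ l"
          using pl(1) l1 I(2) cm ln1 \<kappa> n3 by (intro frac_le mult_mono) auto
        finally have r2: "\<kappa> * \<kappa> / C' * ln (real n) ^ 5 \<le> real (card I) * real l / 2 ^ l" .
        have sq5: "0 < sqrt (\<kappa> * \<kappa> / C' * ln (real n) ^ 5)" using \<kappa> ln1 by simp
        have "\<exists>E\<in>sets (sample_law f n).
           measure (sample_law f n) (space (sample_law f n) - E) \<le> 2 * (V + 1) / 2 ^ l + 4 * (V * (real (card I))\<^sup>2 + 1) * exp (1 - w) \<and>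
           (\<forall>X\<in>E. \<forall>y. \<bar>estimator K I X y l - kernel_op K l f y\<bar> \<le> noise_const * sqrt (U * 2 ^ l * real l / real (card I)))"
        proof (rule level_concentration[OF f _ U(2) I(1) I0 l1(1) _ w])
          show "f x \<le> U" for x using U(1) by simp
          show "2 ^ l \<le> real (card I)" using pl(1) elim(2) I(2) by linarith
          have "B * sqrt (2 ^ l * real l / real (card I)) \<le> B * sqrt ((C' * 2 / \<kappa>) / ln (real n) ^ 3)"
            using r1 B0 by (intro mult_left_mono real_sqrt_le_mono) auto
          then show "dev_const * (\<bar>g 0\<bar> + V) * sqrt (2 ^ l * real l / real (card I)) \<le> g_energy"
            using elim(3) g_energy_ge_1 unfolding B_def by linarith
          have "2 * V * w \<le> 2 * sqrt (\<kappa> * \<kappa> / C' * ln (real n) ^ 5)"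
            using elim(4) sq5 unfolding w_def by (simp add: pos_divide_less_eq)
          also have "\<dots> \<le> dev_const * sqrt (real (card I) * real l / 2 ^ l)"
            using r2 dev_const(1) sq5 by (intro mult_mono real_sqrt_le_mono) auto
          finally show "2 * V * w \<le> dev_const * sqrt (real (card I) * real l / 2 ^ l)" .
          have "w\<^sup>2 * V = ln (real n) ^ 4 * V" unfolding w_def by (simp add: power_mult[symmetric])
          also have "\<dots> \<le> 4 * (\<kappa> * (real n / ln (real n)) powr p)"
            using elim(5) \<kappa> q0 by (simp add: pos_divide_less_eq)
          also have "\<dots> \<le> dev_const\<^sup>2 * 2 ^ l"
          proof (rule mult_mono)
            have "(2::real)\<^sup>2 \<le> dev_const\<^sup>2" using dev_const(1) by (intro power_mono) auto
            then show "4 \<le> dev_const\<^sup>2" by simp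
          qed (use pl(2) \<kappa> in auto)
          finally show "w\<^sup>2 * V \<le> dev_const\<^sup>2 * 2 ^ l" .
        qed
        moreover have "2 * (V + 1) / 2 ^ l + 4 * (V * (real (card I))\<^sup>2 + 1) * exp (1 - w) \<le> pb"
          unfolding pb_def using pl(2) V_nonneg cardn \<kappa> q0
          by (intro add_mono divide_left_mono mult_right_mono mult_left_mono power_mono) auto
        ultimately show ?thesis by (meson order_trans)
      qed
      define I1 I2 where "I1 = {1..m1}" and "I2 = {m1 + 1..m1 + m2}"
      have I: "I1 \<subseteq> {1..n}" "I2 \<subseteq> {1..n}" "card I1 = m1" "card I2 = m2"
        "\<kappa> * real n \<le> real (card I1)" "\<kappa> * real n \<le> real (card I2)"
        using R unfolding I1_def I2_def regime_def by auto
      define good where "good I m l E \<longleftrightarrow> E \<in> sets (sample_law f n) \<and> measure (sample_law f n) (space (sample_law f n) - E) \<le> pb \<and>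
         (\<forall>X\<in>E. \<forall>y. \<bar>estimator K I X y l - kernel_op K l f y\<bar> \<le> noise_const * sqrt (U * 2 ^ l * real l / real m))" for I m l E
      have ex1: "\<forall>l. \<exists>E. l \<in> {jlo..jhi} \<longrightarrow> good I1 m1 l E"
        using single[OF I(1,5)] unfolding good_def I(3) by blast
      from choice[OF ex1] obtain E1 where "\<forall>l. l \<in> {jlo..jhi} \<longrightarrow> good I1 m1 l (E1 l)" by (rule exE)
      then have E1: "\<And>l. l \<in> {jlo..jhi} \<Longrightarrow> E1 l \<in> sets (sample_law f n)"
         "\<And>l. l \<in> {jlo..jhi} \<Longrightarrow> measure (sample_law f n) (space (sample_law f n) - E1 l) \<le> pb"
         "\<And>l X y. l \<in> {jlo..jhi} \<Longrightarrow> X \<in> E1 l \<Longrightarrow> \<bar>estimator K I1 X y l - kernel_op K l f y\<bar> \<le> noise_const * sqrt (U * 2 ^ l * real l / real m1)"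
        unfolding good_def by blast+
      have ex2: "\<forall>l. \<exists>E. l \<in> {jlo..jhi} \<longrightarrow> good I2 m2 l E"
        using single[OF I(2,6)] unfolding good_def I(4) by blast
      from choice[OF ex2] obtain E2 where "\<forall>l. l \<in> {jlo..jhi} \<longrightarrow> good I2 m2 l (E2 l)" by (rule exE)
      then have E2: "\<And>l. l \<in> {jlo..jhi} \<Longrightarrow> E2 l \<in> sets (sample_law f n)"
         "\<And>l. l \<in> {jlo..jhi} \<Longrightarrow> measure (sample_law f n) (space (sample_law f n) - E2 l) \<le> pb"
         "\<And>l X y. l \<in> {jlo..jhi} \<Longrightarrow> X \<in> E2 l \<Longrightarrow> \<bar>estimator K I2 X y l - kernel_op K l f y\<bar> \<le> noise_const * sqrt (U * 2 ^ l * real l / real m2)"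
        unfolding good_def by blast+
      define bad where "bad = (\<Union>l\<in>{jlo..jhi}. (space (sample_law f n) - E1 l) \<union> (space (sample_law f n) - E2 l))"
      have badm: "bad \<in> sets (sample_law f n)" unfolding bad_def using E1(1) E2(1) by (intro sets.finite_UN sets.Un sets.Diff) auto
      have pb0: "0 \<le> pb" unfolding pb_def using V_nonneg \<kappa> q0 by (intro add_nonneg_nonneg divide_nonneg_pos mult_nonneg_nonneg) auto
      have "S.prob bad \<le> (\<Sum>l\<in>{jlo..jhi}. S.prob ((space (sample_law f n) - E1 l) \<union> (space (sample_law f n) - E2 l)))"
        unfolding bad_def using E1(1) E2(1) by (intro S.finite_measure_subadditive_finite) auto
      also have "\<dots> \<le> (\<Sum>l\<in>{jlo..jhi}. 2 * pb)"
      proof (rule sum_mono)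
        fix l assume l: "l \<in> {jlo..jhi}"
        have "S.prob ((space (sample_law f n) - E1 l) \<union> (space (sample_law f n) - E2 l)) \<le>
           S.prob (space (sample_law f n) - E1 l) + S.prob (space (sample_law f n) - E2 l)"
          by (rule measure_Un_le) (use E1(1)[OF l] E2(1)[OF l] in auto)
        then show "S.prob ((space (sample_law f n) - E1 l) \<union> (space (sample_law f n) - E2 l)) \<le> 2 * pb"
          using E1(2)[OF l] E2(2)[OF l] by linarith
      qed
      also have "\<dots> = real (card {jlo..jhi}) * (2 * pb)" by simp
      also have "\<dots> \<le> (2 * ln (real n) + 1) * (2 * pb)"
      proof (rule mult_right_mono)
        have "real (card {jlo..jhi}) \<le> real jhi + 1" by simp
        then show "real (card {jlo..jhi}) \<le> 2 * ln (real n) + 1" using R unfolding regime_def by linarith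
      qed (use pb0 in simp)
      also have "\<dots> = failure_bound V \<kappa> p n" unfolding failure_bound_def pb_def w_def by (simp only: mult_ac)
      finally have Pb: "S.prob bad \<le> failure_bound V \<kappa> p n" .
      have "space (sample_law f n) - (space (sample_law f n) - bad) = bad" using sets.sets_into_space[OF badm] by auto
      moreover have "X \<in> E1 l \<and> X \<in> E2 l" if "X \<in> space (sample_law f n) - bad" "l \<in> {jlo..jhi}" for X l
        using that unfolding bad_def by blast
      ultimately show "\<exists>E\<in>sets (sample_law f n). measure (sample_law f n) (space (sample_law f n) - E) \<le> failure_bound V \<kappa> p n \<and>
        (\<forall>X\<in>E. \<forall>l\<in>{jlo..jhi}. \<forall>y.
          \<bar>estimator K {1..m1} X y l - kernel_op K l f y\<bar> \<le> noise_const * sqrt (U * 2 ^ l * real l / real m1) \<and>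
          \<bar>estimator K {m1 + 1..m1 + m2} X y l - kernel_op K l f y\<bar> \<le> noise_const * sqrt (U * 2 ^ l * real l / real m2))"
        using Pb badm E1(3) E2(3) unfolding I1_def I2_def
        by (intro bexI[of _ "space (sample_law f n) - bad"] conjI ballI allI) auto
    qed
  qed
qed

section \<open>The band at the selected level\<close>
text \<open>Conditioning on an integer-valued \<open>h\<close>: if \<open>Ev\<close> occurs only together with \<open>H (h X)\<close>, and each \<open>H j\<close> is
independent of the event \<open>h X = j\<close>, then \<open>Ev\<close> is at most a mixture of the probabilities of the \<open>H j\<close>.\<close>

lemma mixture_upper:
  fixes h :: "'a \<Rightarrow> nat"
  assumes "prob_space M" and h: "h \<in> M \<rightarrow>\<^sub>M count_space UNIV" and R: "finite R"
    and meas: "E \<in> sets M" "Ev \<in> sets M" "\<And>j. j \<in> R \<Longrightarrow> H j \<in> sets M"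
    and E: "measure M (space M - E) \<le> \<nu>"
    and indep: "\<And>j. j \<in> R \<Longrightarrow> measure M ({X \<in> space M. h X = j} \<inter> H j) = measure M {X \<in> space M. h X = j} * measure M (H j)"
    and bound: "\<And>j. j \<in> R \<Longrightarrow> measure M (H j) \<le> w" "0 \<le> w"
    and sub: "\<And>X. X \<in> E \<Longrightarrow> X \<in> Ev \<Longrightarrow> h X \<in> R \<and> X \<in> H (h X)"
  shows "measure M Ev \<le> \<nu> + w"
proof -
  interpret prob_space M by fact
  have hj: "{X \<in> space M. h X = j} \<in> sets M" for j
    using measurable_sets[OF h, of "{j}"] by (simp add: vimage_def Int_def conj_commute)
  let ?W = "\<Union>j\<in>R. {X \<in> space M. h X = j} \<inter> H j"
  have "Ev \<subseteq> (space M - E) \<union> ?W"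
    using sub sets.sets_into_space[OF meas(2)] by blast
  then have "prob Ev \<le> prob ((space M - E) \<union> ?W)"
    by (rule finite_measure_mono) (use meas hj R in auto)
  also have "\<dots> \<le> prob (space M - E) + prob ?W"
    by (rule measure_Un_le) (use meas hj R in auto)
  also have "prob ?W \<le> (\<Sum>j\<in>R. prob ({X \<in> space M. h X = j} \<inter> H j))"
    by (rule finite_measure_subadditive_finite[OF R]) (use meas hj in auto)
  also have "\<dots> \<le> (\<Sum>j\<in>R. prob {X \<in> space M. h X = j} * w)"
    by (rule sum_mono) (use indep bound in \<open>auto intro!: mult_left_mono\<close>)
  also have "\<dots> = prob (\<Union>j\<in>R. {X \<in> space M. h X = j}) * w"
    unfolding sum_distrib_right[symmetric]
    by (subst finite_measure_finite_Union[OF R]) (use hj in \<open>auto simp: disjoint_family_on_def\<close>)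
  also have "\<dots> \<le> 1 * w" by (rule mult_right_mono) (use bound in auto)
  finally show ?thesis using E by simp
qed

text \<open>For two exponents the lower bound for the smaller would cross the upper bound for the larger as
\<open>j\<close> grows.\<close>

lemma smoothness_eq:
  assumes t: "t \<in> {\<eta>..real r}" "bias_bounds K b1 b2 j0 t f" and b: "0 < b1"
  shows "smoothness K \<eta> r b1 b2 j0 f = t"
proof -
  have le: "t' \<le> s" if s: "bias_bounds K b1 b2 j0 s f" and t': "bias_bounds K b1 b2 j0 t' f" for s t'
  proof (rule ccontr)
    assume "\<not> t' \<le> s"
    then have st: "0 < t' - s" by simp
    have "filterlim (\<lambda>j::nat. 2 powr (real j * (t' - s))) at_top sequentially" using st by real_asymp
    then have "\<forall>\<^sub>F j in sequentially. b2 / b1 < 2 powr (real j * (t' - s))" by (simp add: filterlim_at_top_dense)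
    moreover have "\<forall>\<^sub>F j in sequentially. j0 \<le> j" by (rule eventually_ge_at_top)
    ultimately have "\<forall>\<^sub>F j::nat in sequentially. False"
    proof eventually_elim
      case (elim j)
      have "b1 * 2 powr (- (real j * s)) \<le> b2 * 2 powr (- (real j * t'))"
        using s t' elim(2) unfolding bias_bounds_def by (meson order_trans)
      then have "b1 * (2 powr (- (real j * s)) * 2 powr (real j * t')) \<le> b2 * (2 powr (- (real j * t')) * 2 powr (real j * t'))"
        unfolding mult.assoc[symmetric] by (rule mult_right_mono) simp
      then have "b1 * 2 powr (real j * (t' - s)) \<le> b2" by (simp add: powr_add[symmetric] algebra_simps)
      then show False using elim(1) b by (simp add: field_simps)
    qed
    then show False by simp
  qed
  show ?thesis unfolding smoothness_def
    by (rule the_equality) (use t le in \<open>auto intro!: antisym\<close>)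
qed

lemma estimator_cong:
  assumes "\<And>i. i \<in> I \<Longrightarrow> X i = Y i"
  shows "estimator K I X y j = estimator K I Y y j"
  unfolding estimator_def using assms by simp

lemma selected_level_cong:
  assumes "\<And>i. i \<in> {m1 + 1..m1 + m2} \<Longrightarrow> X i = Y i"
  shows "selected_level M' K m1 m2 jlo jhi f X = selected_level M' K m1 m2 jlo jhi f Y"
proof -
  have "estimator K {m1 + 1..m1 + m2} X = estimator K {m1 + 1..m1 + m2} Y"
    by (intro ext estimator_cong assms)
  then show ?thesis unfolding selected_level_def by simp
qed

lemma selected_level_le:
  assumes "jlo \<le> jhi"
  shows "selected_level M' K m1 m2 jlo jhi f X \<le> jhi"
  unfolding selected_level_def Let_def by (rule Min_le) (use assms in auto)

context tame_kernel
begin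

text \<open>Outside an event of probability at most \<open>\<nu>\<close>, the selected level is in range with \<open>2^jh \<le> R\<close>, and \<open>v\<close> levels
higher the studentized error agrees with the centred statistic up to \<open>\<Delta>\<close> after scaling with \<open>A\<close>.\<close>

abbreviation level_control :: "nat \<Rightarrow> nat \<Rightarrow> nat \<Rightarrow> nat \<Rightarrow> nat \<Rightarrow> nat \<Rightarrow> (nat \<Rightarrow> real) \<Rightarrow> (real \<Rightarrow> real) \<Rightarrow> real \<Rightarrow> real \<Rightarrow> real \<Rightarrow> bool" where
  "level_control n m1 m2 jlo jhi v A f \<nu> R \<Delta> \<equiv>
     \<exists>E\<in>sets (sample_law f n). measure (sample_law f n) (space (sample_law f n) - E) \<le> \<nu> \<and>
       (\<forall>X\<in>E. \<forall>jh l. jh = selected_level (4 * noise_const) K m1 m2 jlo jhi f X \<longrightarrow> l = jh + v \<longrightarrow>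
          jlo \<le> jh \<and> l \<le> jhi \<and> 0 < A l \<and> 2 ^ jh \<le> R \<and>
          (\<forall>dd. A l * \<bar>studentized_error K m1 (sigma_hat m1 l) f X l dd - centred_statistic K m1 f X l\<bar> \<le> \<Delta>))"

text \<open>On the good event \<open>selected_level_bracket\<close> places the selected level.  Minimality of \<open>js\<close> gives
\<open>2^(js (2t+1))\<close> at most of order \<open>n / ln n\<close>, hence \<open>R\<close>.  At level \<open>jh + u n\<close> the bias, relative to the
noise, has lost a factor \<open>2^(-(u n) (t + 1/2))\<close>, which up to constants is at most
\<open>(ln n)^(-1-2\<eta>)\<close>; the factor \<open>sqrt l\<close> in the noise bound and the scaling with \<open>A\<close> return
\<open>ln n\<close>, and \<open>(ln n)^(-2\<eta>)\<close> remains.  All rates are uniform over the class, which is why \<open>\<Delta>\<close> and \<open>Q\<close> are fixed before \<open>f\<close>.\<close>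

lemma level_event:
  fixes r :: nat and u :: "nat \<Rightarrow> nat" and A :: "nat \<Rightarrow> real"
  assumes \<kappa>: "0 < \<kappa>" "0 < C'" and p: "p = 1 / (2 * real r + 1)" and \<eta>: "0 < \<eta>" "\<eta> \<le> real r"
    and b: "0 < b1" "b1 \<le> b2" and \<delta>: "0 < \<delta>"
    and u: "comparable (\<lambda>n. 2 ^ u n) (\<lambda>n. (ln (real n))\<^sup>2)" and A: "comparable A (\<lambda>l. sqrt (real l))"
  obtains \<Delta> Q where "\<Delta> \<longlonglongrightarrow> 0" "0 < Q"
    "\<forall>\<^sub>F n in sequentially. \<forall>m1 m2 jlo jhi. regime \<kappa> C' p n m1 m2 jlo jhi \<longrightarrow>
      (\<forall>f t. probability_density f \<longrightarrow> continuous_on UNIV f \<longrightarrow> bounded (range f) \<longrightarrow> (\<forall>y\<in>{0..1}. \<delta> \<le> f y) \<longrightarrow>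
         t \<in> {\<eta>..real r} \<longrightarrow> bias_bounds K b1 b2 j0 t f \<longrightarrow>
        (level_control n m1 m2 jlo jhi (u n) A f (failure_bound V \<kappa> p n) (Q * (real n / ln (real n)) powr (1 / (2 * t + 1))) (\<Delta> n)))"
proof -
  define nc where "nc = noise_const"
  have nc: "0 < nc" unfolding nc_def by (rule noise_const_pos)
  have p0: "0 < p" unfolding p by simp
  have b2: "0 < b2" using b by linarith
  obtain q :: nat where q: "14 \<le> b1 / b2 * 2 powr (real q * \<eta>)"
  proof -
    have "\<forall>\<^sub>F q::nat in sequentially. 14 \<le> b1 / b2 * 2 powr (real q * \<eta>)" using b b2 \<eta> by real_asymp
    then show ?thesis using that eventually_happens'[OF sequentially_bot] by blast
  qed
  obtain cu Cu where cu: "0 < cu" and evu: "\<forall>\<^sub>F n in sequentially. cu \<le> 2 ^ u n / (ln (real n))\<^sup>2 \<and> 2 ^ u n / (ln (real n))\<^sup>2 \<le> Cu"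
    using u unfolding comparable_def by blast
  obtain ca CA where ca: "0 < ca" and evA: "\<forall>\<^sub>F l in sequentially. ca \<le> A l / sqrt (real l) \<and> A l / sqrt (real l) \<le> CA"
    using A unfolding comparable_def by blast
  obtain L0 where L0: "\<And>l. L0 \<le> l \<Longrightarrow> ca \<le> A l / sqrt (real l) \<and> A l / sqrt (real l) \<le> CA"
    using evA unfolding eventually_sequentially by blast
  have CA: "0 < CA" using L0[of L0] ca by linarith
  define CU where "CU = max Cu 1"
  have CU: "0 < CU" "Cu \<le> CU" unfolding CU_def by auto
  \<comment> \<open>Over the class, \<open>f\<close> is bounded by its smoothing at level \<open>j0\<close> plus the bias there; so the factor
    \<open>U\<close> in the noise is bounded uniformly.\<close>
  define U1 where "U1 = max (b2 + 2 ^ j0 * K_bound) 1"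
  have U1: "1 \<le> U1" unfolding U1_def by simp
  define D1 where "D1 = max 1 ((b2 / nc)\<^sup>2 / \<kappa>)"
  define Q where "Q = max C' (2 * D1)"
  have D1: "1 \<le> D1" "(b2 / nc)\<^sup>2 / \<kappa> \<le> D1" unfolding D1_def by auto
  have Q: "0 < Q" "C' \<le> Q" "2 * D1 \<le> Q" unfolding Q_def using \<kappa>(2) by auto
  define d where "d = \<delta> / 2"
  have d: "0 < d" unfolding d_def using \<delta> by simp
  define k where "k = 1 / \<bar>kernel_const K\<bar>"
  have k: "0 \<le> k" unfolding k_def by simp
  \<comment> \<open>With \<open>\<zeta>\<close> and \<open>\<beta>\<close> the noise and the bias at the level of the band and \<open>s\<close> the normalization,
    \<open>ZB\<close>, \<open>BB\<close>, \<open>SZ\<close> and \<open>SB\<close> bound \<open>\<zeta>\<close>, \<open>\<beta>\<close>, \<open>s \<zeta>\<close> and \<open>s \<beta>\<close>.\<close>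
  define ZB where "ZB n = nc * sqrt (U1 * (2 * C' / \<kappa>) / ln (real n) ^ 3)" for n :: nat
  define BB where "BB n = b2 * (\<kappa> * (real n / ln (real n)) powr p) powr (- \<eta>)" for n :: nat
  define SZ where "SZ n = nc * sqrt (U1 * 2 * ln (real n))" for n :: nat
  define SB where "SB n = nc * 2 powr (real q * real r) * sqrt ((U1 * 2 / \<kappa> * 2 ^ q) * ln (real n) / (cu * (ln (real n))\<^sup>2)) * (cu * (ln (real n))\<^sup>2) powr (- \<eta>)" for n :: nat
  define \<Delta> where "\<Delta> n = CA * sqrt (2 * ln (real n)) * (k * (SB n / sqrt d + SZ n * (ZB n + BB n) / (d * sqrt d)))" for n
  have W: "0 < U1 * 2 / \<kappa> * 2 ^ q" using U1 \<kappa> by simp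
  have U10: "0 < U1" using U1 by linarith
  have lim1: "(\<lambda>n. sqrt (2 * ln (real n)) * SB n) \<longlonglongrightarrow> 0"
  proof -
    have "(\<lambda>n::nat. sqrt (2 * ln (real n)) * (nc * y * sqrt (x * ln (real n) / (cu * (ln (real n))\<^sup>2)) * (cu * (ln (real n))\<^sup>2) powr (- \<eta>))) \<longlonglongrightarrow> 0"
      if "0 < x" for x y using that cu \<eta> nc by real_asymp
    from this[OF W] show ?thesis unfolding SB_def .
  qed
  have lim2: "(\<lambda>n. sqrt (2 * ln (real n)) * SZ n * ZB n) \<longlonglongrightarrow> 0"
    unfolding SZ_def ZB_def using nc U10 \<kappa> by real_asymp
  have lim3: "(\<lambda>n. sqrt (2 * ln (real n)) * SZ n * BB n) \<longlonglongrightarrow> 0"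
    unfolding SZ_def BB_def using nc U10 \<kappa> p0 \<eta> by real_asymp
  have limD: "\<Delta> \<longlonglongrightarrow> 0"
  proof -
    have "(\<lambda>n. CA * (k * ((sqrt (2 * ln (real n)) * SB n) / sqrt d + (sqrt (2 * ln (real n)) * SZ n * ZB n + sqrt (2 * ln (real n)) * SZ n * BB n) / (d * sqrt d)))) \<longlonglongrightarrow> CA * (k * (0 / sqrt d + (0 + 0) / (d * sqrt d)))"
      by (intro tendsto_intros lim1 lim2 lim3) (use d in auto)
    moreover have "\<Delta> = (\<lambda>n. CA * (k * ((sqrt (2 * ln (real n)) * SB n) / sqrt d + (sqrt (2 * ln (real n)) * SZ n * ZB n + sqrt (2 * ln (real n)) * SZ n * BB n) / (d * sqrt d))))"
      unfolding \<Delta>_def by (rule ext) (simp add: field_simps)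
    ultimately show ?thesis by simp
  qed
  have limZB: "(\<lambda>n. ZB n + BB n) \<longlonglongrightarrow> 0"
  proof -
    have "ZB \<longlonglongrightarrow> 0" unfolding ZB_def[abs_def] using nc U10 \<kappa> by real_asymp
    moreover have "BB \<longlonglongrightarrow> 0" unfolding BB_def[abs_def] using \<kappa> p0 \<eta> by real_asymp
    ultimately show ?thesis using tendsto_add[of ZB 0 sequentially BB 0] by simp
  qed
  have ev_small: "\<forall>\<^sub>F n in sequentially. ZB n + BB n < d" by (rule order_tendstoD(2)[OF limZB d])
  \<comment> \<open>At the top level the noise exceeds the bias, so \<open>js\<close> exists.\<close>
  have ev_top: "\<forall>\<^sub>F n::nat in sequentially. b2 * (\<kappa> * real n / ln (real n) ^ 4) powr (- \<eta>) \<le> nc * sqrt (\<kappa> / ln (real n) ^ 4)"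
    using b2 \<kappa> \<eta> nc by real_asymp
  \<comment> \<open>Adding \<open>u n\<close> levels to \<open>js\<close> does not leave the range of levels.\<close>
  have ev_room: "\<forall>\<^sub>F n::nat in sequentially. Q * (real n / ln (real n)) powr (1 / (2 * \<eta> + 1)) * (CU * (ln (real n))\<^sup>2) \<le> \<kappa> * real n / ln (real n) ^ 4"
  proof -
    have "\<forall>\<^sub>F n::nat in sequentially. Q * (real n / ln (real n)) powr x * (CU * (ln (real n))\<^sup>2) \<le> \<kappa> * real n / ln (real n) ^ 4"
      if "0 < x" "x < 1" for x using that Q(1) CU(1) \<kappa> by real_asymp
    then show ?thesis using \<eta> by simp
  qed
  have ev_j: "\<forall>\<^sub>F n::nat in sequentially. real (max j0 L0) \<le> \<kappa> * ln (real n)" using \<kappa> by real_asymp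
  have ev3: "\<forall>\<^sub>F n in sequentially. 3 \<le> (n::nat)" by (rule eventually_ge_at_top)
  have ev: "\<forall>\<^sub>F n in sequentially. \<forall>m1 m2 jlo jhi. regime \<kappa> C' p n m1 m2 jlo jhi \<longrightarrow>
      (\<forall>f t. probability_density f \<longrightarrow> continuous_on UNIV f \<longrightarrow> bounded (range f) \<longrightarrow> (\<forall>y\<in>{0..1}. \<delta> \<le> f y) \<longrightarrow>
         t \<in> {\<eta>..real r} \<longrightarrow> bias_bounds K b1 b2 j0 t f \<longrightarrow>
        (level_control n m1 m2 jlo jhi (u n) A f (failure_bound V \<kappa> p n) (Q * (real n / ln (real n)) powr (1 / (2 * t + 1))) (\<Delta> n)))"
    using ev3 ev_small ev_top ev_room ev_j evu good_event[OF \<kappa> p0]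
  proof eventually_elim
    case (elim n)
    show ?case
    proof (intro allI impI)
      fix m1 m2 jlo jhi f t
      assume R: "regime \<kappa> C' p n m1 m2 jlo jhi" and f: "probability_density f" and fc: "continuous_on UNIV f"
        and fb: "bounded (range f)" and f\<delta>: "\<forall>y\<in>{0..1}. \<delta> \<le> f y" and t: "t \<in> {\<eta>..real r}" and bias: "bias_bounds K b1 b2 j0 t f"
      have n3: "3 \<le> real n" using elim(1) by simp
      define ll where "ll = ln (real n)"
      have ll1: "1 \<le> ll"
      proof -
        have "exp 1 \<le> real n" using e_less_272 n3 by linarith
        then show ?thesis unfolding ll_def using n3 by (subst ln_ge_iff) auto
      qed
      have nl: "1 \<le> real n / ll"
      proof -
        have "ll \<le> real n" unfolding ll_def using ln_le_minus_one[of "real n"] n3 by linarith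
        then show ?thesis using ll1 by (simp add: le_divide_eq)
      qed
      have Rr: "0 < m1" "0 < m2" "\<kappa> * real n \<le> real m1" "\<kappa> * real n \<le> real m2" "0 < jlo" "jlo < jhi"
        "\<kappa> * real n / ll ^ 4 \<le> 2 ^ jhi" "2 ^ jhi \<le> C' * real n / ll ^ 4"
        "\<kappa> * (real n / ll) powr p \<le> 2 ^ jlo" "2 ^ jlo \<le> C' * (real n / ll) powr p"
        "\<kappa> * ll \<le> real jlo" "real jhi \<le> 2 * ll" "m1 + m2 = n"
        using R unfolding regime_def ll_def by blast+
      have mn: "real m1 \<le> real n" "real m2 \<le> real n" using Rr(13) by auto
      have t': "0 < t" "\<eta> \<le> t" "t \<le> real r" using t \<eta> by auto
      have j0: "j0 \<le> jlo" "L0 \<le> jlo" using elim(5) Rr(11) unfolding ll_def by linarith+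
      define U where "U = max (sup_norm f) 1"
      obtain Bf where Bf: "\<And>y. \<bar>f y\<bar> \<le> Bf" using fb unfolding bounded_iff by auto
      have fU: "f x \<le> U" for x using sup_norm_upper[where h = f, OF Bf, of x] unfolding U_def by linarith
      have U: "1 \<le> U" unfolding U_def by simp
      have UU1: "U \<le> U1"
      proof -
        have "sup_norm f \<le> b2 + 2 ^ j0 * K_bound"
        proof (rule sup_norm_least)
          fix y
          have "b2 * 2 powr (- (real j0 * t)) \<le> b2 * 2 powr 0" using b2 t' by (intro mult_left_mono powr_mono) auto
          then show "\<bar>f y\<bar> \<le> b2 + 2 ^ j0 * K_bound"
            using bias_le[OF f fb bias order_refl, of y] kernel_op_le[OF f, of j0 y] by simp
        qed
        then show ?thesis unfolding U_def U1_def by simp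
      qed
      obtain E where E: "E \<in> sets (sample_law f n)" "measure (sample_law f n) (space (sample_law f n) - E) \<le> failure_bound V \<kappa> p n"
        and noise1: "\<And>X l y. X \<in> E \<Longrightarrow> l \<in> {jlo..jhi} \<Longrightarrow> \<bar>estimator K {1..m1} X y l - kernel_op K l f y\<bar> \<le> nc * sqrt (U * 2 ^ l * real l / real m1)"
        and noise2: "\<And>X l y. X \<in> E \<Longrightarrow> l \<in> {jlo..jhi} \<Longrightarrow> \<bar>estimator K {m1 + 1..m1 + m2} X y l - kernel_op K l f y\<bar> \<le> nc * sqrt (U * 2 ^ l * real l / real m2)"
        using elim(7)[rule_format, OF R f fU U] unfolding nc_def by blast
      have top: "b2 * 2 powr (- (real jhi * t)) \<le> nc * sqrt (U * 2 ^ jhi * real jhi / real m2)"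
      proof -
        have x0: "0 < \<kappa> * real n / ll ^ 4" using \<kappa> n3 ll1 by simp
        have "2 powr (- (real jhi * t)) \<le> 2 powr (- (real jhi * \<eta>))" using t' by (intro powr_mono) (auto intro!: mult_left_mono)
        also have "\<dots> = (2 powr real jhi) powr (- \<eta>)" by (simp add: powr_powr)
        also have "\<dots> = (2 ^ jhi) powr (- \<eta>)" by (simp add: powr_realpow)
        also have "\<dots> \<le> (\<kappa> * real n / ll ^ 4) powr (- \<eta>)"
          using Rr(7) x0 \<eta> by (intro powr_mono2') auto
        finally have "b2 * 2 powr (- (real jhi * t)) \<le> b2 * (\<kappa> * real n / ll ^ 4) powr (- \<eta>)" using b2 by simp
        also have "\<dots> \<le> nc * sqrt (\<kappa> / ll ^ 4)" using elim(3) unfolding ll_def .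
        also have "\<dots> \<le> nc * sqrt (U * 2 ^ jhi * real jhi / real m2)"
        proof (intro mult_left_mono real_sqrt_le_mono)
          have "\<kappa> / ll ^ 4 = (\<kappa> * real n / ll ^ 4) / real n" using n3 by simp
          also have "\<dots> \<le> 2 ^ jhi / real m2"
            using Rr mn n3 \<kappa> ll1 by (intro frac_le) auto
          also have "\<dots> \<le> U * 2 ^ jhi * real jhi / real m2"
          proof (rule divide_right_mono)
            have "1 * 2 ^ jhi * 1 \<le> U * 2 ^ jhi * real jhi" using U Rr by (intro mult_mono) auto
            then show "2 ^ jhi \<le> U * 2 ^ jhi * real jhi" by simp
          qed simp
          finally show "\<kappa> / ll ^ 4 \<le> U * 2 ^ jhi * real jhi / real m2" .
        qed (use nc in auto)
        finally show ?thesis .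
      qed
      show "level_control n m1 m2 jlo jhi (u n) A f (failure_bound V \<kappa> p n) (Q * (real n / ln (real n)) powr (1 / (2 * t + 1))) (\<Delta> n)"
      proof (rule bexI[OF _ E(1)], rule conjI[OF E(2)], intro ballI allI impI conjI)
        fix X jh l assume X: "X \<in> E" and jh: "jh = selected_level (4 * noise_const) K m1 m2 jlo jhi f X" and l: "l = jh + u n"
        define S where "S l = nc * sqrt (U * 2 ^ l * real l / real m2)" for l :: nat
        obtain js where js: "jlo \<le> js" "js \<le> jhi" "b2 * 2 powr (- (real js * t)) \<le> S js"
          "js = jlo \<or> S (js - 1) < b2 * 2 powr (- (real (js - 1) * t))" "jlo \<le> jh" "jh \<le> jhi" "jh \<le> js" "js \<le> jh + q"
          using selected_level_bracket[OF f fb bias b(1) b2 \<eta>(1) t'(2) j0(1) Rr(5,6,2) _ _ q, of m1 X]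
            noise2[OF X] top unfolding S_def nc_def U_def jh by blast
        define \<theta> where "\<theta> = 1 / (2 * t + 1)"
        have \<theta>: "0 < \<theta>" "\<theta> \<le> 1" "p \<le> \<theta>" "\<theta> \<le> 1 / (2 * \<eta> + 1)"
          unfolding \<theta>_def p using t' \<eta> by (auto intro!: divide_left_mono mult_pos_pos simp: divide_simps)
        have js_le: "2 ^ js \<le> Q * (real n / ll) powr \<theta>"
        proof (cases "js = jlo")
          case True
          have "2 ^ jlo \<le> C' * (real n / ll) powr p" by (rule Rr(10))
          also have "\<dots> \<le> Q * (real n / ll) powr \<theta>"
            using Q(1,2) nl \<theta>(3) by (intro mult_mono powr_mono) auto
          finally show ?thesis using True by simp
        next
          case False
          \<comment> \<open>Below \<open>js\<close> the noise is smaller than the bias bound; squaring and solving for \<open>2^kk\<close> gives the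
            optimal rate.\<close>
          define kk where "kk = js - 1"
          have kk: "jlo \<le> kk" "js = Suc kk" using False js(1) Rr(5) unfolding kk_def by auto
          have kl: "\<kappa> * ll \<le> real kk" using Rr(11) kk(1) by linarith
          have k0: "0 < real kk" using kk Rr(5) by simp
          have lt: "nc * sqrt (2 ^ kk * real kk / real m2) < b2 * 2 powr (- (real kk * t))"
          proof -
            have "nc * sqrt (2 ^ kk * real kk / real m2) \<le> S kk"
              unfolding S_def
            proof (intro mult_left_mono real_sqrt_le_mono divide_right_mono)
              show "2 ^ kk * real kk \<le> U * 2 ^ kk * real kk"
                using mult_right_mono[OF U, of "2 ^ kk * real kk"] by (simp add: mult.assoc)
            qed (use nc in auto)
            then show ?thesis using js(4) False unfolding kk_def by linarith
          qed
          have "(nc * sqrt (2 ^ kk * real kk / real m2))\<^sup>2 \<le> (b2 * 2 powr (- (real kk * t)))\<^sup>2"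
            using lt nc by (intro power_mono) auto
          moreover have "(nc * sqrt (2 ^ kk * real kk / real m2))\<^sup>2 = nc\<^sup>2 * (2 ^ kk * real kk / real m2)"
            unfolding power_mult_distrib by (subst real_sqrt_pow2) simp_all
          moreover have "(b2 * 2 powr (- (real kk * t)))\<^sup>2 = b2\<^sup>2 * 2 powr (- (2 * real kk * t))"
          proof -
            have "(2 powr z)\<^sup>2 = 2 powr (2 * z)" for z :: real by (simp add: power2_eq_square powr_add[symmetric])
            from this[of "- (real kk * t)"] show ?thesis by (simp add: power_mult_distrib mult.assoc)
          qed
          ultimately have "nc\<^sup>2 * (2 ^ kk * real kk / real m2) \<le> b2\<^sup>2 * 2 powr (- (2 * real kk * t))"
            by (simp only:)
          then have "2 ^ kk * real kk \<le> (b2 / nc)\<^sup>2 * real m2 * 2 powr (- (2 * real kk * t))"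
            using nc Rr(2) by (simp add: field_simps)
          then have "2 ^ kk * real kk * 2 powr (2 * real kk * t) \<le> (b2 / nc)\<^sup>2 * real m2 * 2 powr (- (2 * real kk * t)) * 2 powr (2 * real kk * t)"
            by (rule mult_right_mono) simp
          then have a1: "2 ^ kk * 2 powr (2 * real kk * t) * real kk \<le> (b2 / nc)\<^sup>2 * real m2"
            by (simp add: powr_minus field_simps)
          have e: "2 ^ kk * 2 powr (2 * real kk * t) = 2 powr (real kk / \<theta>)"
          proof -
            have "(2::real) ^ kk = 2 powr real kk" by (simp add: powr_realpow)
            then show ?thesis unfolding \<theta>_def by (simp add: powr_add[symmetric] algebra_simps)
          qed
          have "2 powr (real kk / \<theta>) * (\<kappa> * ll) \<le> 2 powr (real kk / \<theta>) * real kk" using kl by (intro mult_left_mono) auto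
          also have "\<dots> \<le> (b2 / nc)\<^sup>2 * real m2" using a1 unfolding e .
          also have "\<dots> \<le> (b2 / nc)\<^sup>2 * real n" using mn by (intro mult_left_mono) auto
          finally have "2 powr (real kk / \<theta>) * (\<kappa> * ll) \<le> (b2 / nc)\<^sup>2 * real n" .
          moreover have "0 < \<kappa> * ll" using \<kappa>(1) ll1 by simp
          ultimately have "2 powr (real kk / \<theta>) \<le> (b2 / nc)\<^sup>2 * real n / (\<kappa> * ll)"
            by (simp only: pos_le_divide_eq)
          also have "\<dots> = (b2 / nc)\<^sup>2 / \<kappa> * (real n / ll)" by simp
          also have "\<dots> \<le> D1 * (real n / ll)" using D1 nl by (intro mult_right_mono) auto
          finally have "(2 powr (real kk / \<theta>)) powr \<theta> \<le> (D1 * (real n / ll)) powr \<theta>" using \<theta> by (intro powr_mono2) auto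
          then have "2 ^ kk \<le> (D1 * (real n / ll)) powr \<theta>" using \<theta> by (simp add: powr_powr powr_realpow)
          also have "\<dots> = D1 powr \<theta> * (real n / ll) powr \<theta>" by (rule powr_mult)
          also have "\<dots> \<le> D1 powr 1 * (real n / ll) powr \<theta>" using D1 \<theta> by (intro mult_right_mono powr_mono) auto
          finally have "2 ^ js \<le> 2 * D1 * (real n / ll) powr \<theta>" using D1 unfolding kk(2) by simp
          also have "\<dots> \<le> Q * (real n / ll) powr \<theta>" using Q(3) by (intro mult_right_mono) auto
          finally show ?thesis .
        qed
        have jh_js: "(2::real) ^ jh \<le> 2 ^ js" using js(7) by (intro power_increasing) auto
        have uu: "cu * ll\<^sup>2 \<le> 2 ^ u n" "2 ^ u n \<le> CU * ll\<^sup>2"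
        proof -
          have l2: "0 < ll\<^sup>2" using ll1 by simp
          show "cu * ll\<^sup>2 \<le> 2 ^ u n" using elim(6) l2 unfolding ll_def by (simp add: pos_le_divide_eq)
          have "2 ^ u n \<le> Cu * ll\<^sup>2" using elim(6) l2 unfolding ll_def by (simp add: pos_divide_le_eq)
          also have "\<dots> \<le> CU * ll\<^sup>2" using CU by (intro mult_right_mono) auto
          finally show "2 ^ u n \<le> CU * ll\<^sup>2" .
        qed
        have l_hi: "l \<le> jhi"
        proof -
          have "(2::real) ^ l = 2 ^ jh * 2 ^ u n" unfolding l by (rule power_add)
          also have "\<dots> \<le> (Q * (real n / ll) powr \<theta>) * (CU * ll\<^sup>2)"
            using order_trans[OF jh_js js_le] uu(2) Q(1) by (intro mult_mono mult_nonneg_nonneg) auto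
          also have "\<dots> \<le> (Q * (real n / ll) powr (1 / (2 * \<eta> + 1))) * (CU * ll\<^sup>2)"
            using Q(1) CU(1) nl \<theta>(4) by (intro mult_right_mono mult_left_mono powr_mono) auto
          also have "\<dots> \<le> \<kappa> * real n / ll ^ 4" using elim(4) unfolding ll_def .
          also have "\<dots> \<le> 2 ^ jhi" by (rule Rr(7))
          finally show ?thesis by (rule power_le_imp_le_exp[rotated]) simp
        qed
        have l_lo: "jlo \<le> l" using js(5) unfolding l by simp
        have lJ: "l \<in> {jlo..jhi}" using l_lo l_hi by simp
        have l1: "0 < real l" "real l \<le> 2 * ll" using l_lo Rr(5) l_hi Rr(12) by linarith+
        have Al: "0 < A l" "A l \<le> CA * sqrt (2 * ll)"
        proof -
          have x: "ca \<le> A l / sqrt (real l)" "A l / sqrt (real l) \<le> CA" using L0[of l] j0(2) l_lo by auto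
          have sl: "0 < sqrt (real l)" using l1 by simp
          have "ca * sqrt (real l) \<le> A l" using x(1) sl by (simp add: pos_le_divide_eq)
          moreover have "0 < ca * sqrt (real l)" using ca sl by (rule mult_pos_pos)
          ultimately show "0 < A l" by linarith
          have "A l \<le> CA * sqrt (real l)" using x(2) sl by (simp add: pos_divide_le_eq)
          also have "\<dots> \<le> CA * sqrt (2 * ll)" using CA l1(2) by (intro mult_left_mono real_sqrt_le_mono) auto
          finally show "A l \<le> CA * sqrt (2 * ll)" .
        qed
        show "jlo \<le> jh" by (rule js(5))
        show "l \<le> jhi" by (rule l_hi)
        show "0 < A l" by (rule Al(1))
        show "2 ^ jh \<le> Q * (real n / ln (real n)) powr (1 / (2 * t + 1))"
          using jh_js js_le unfolding \<theta>_def ll_def by linarith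
        fix dd
        define \<zeta> where "\<zeta> = nc * sqrt (U * 2 ^ l * real l / real m1)"
        define \<beta> where "\<beta> = b2 * 2 powr (- (real l * t))"
        define s where "s = sqrt (real m1 / 2 ^ l)"
        have s0: "0 < s" unfolding s_def using Rr(1) by simp
        have \<zeta>0: "0 \<le> \<zeta>" unfolding \<zeta>_def using nc U by simp
        have \<beta>0: "0 \<le> \<beta>" unfolding \<beta>_def using b2 by simp
        have pl: "(2::real) ^ l \<le> 2 ^ jhi" "(2::real) ^ jlo \<le> 2 ^ l" using lJ by (auto intro!: power_increasing)
        have zb: "\<zeta> \<le> ZB n"
          unfolding \<zeta>_def ZB_def ll_def[symmetric]
        proof (intro mult_left_mono real_sqrt_le_mono)
          have "U * 2 ^ l * real l / real m1 \<le> U1 * (C' * real n / ll ^ 4) * (2 * ll) / (\<kappa> * real n)"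
            using UU1 U order_trans[OF pl(1) Rr(8)] l1 Rr(3) \<kappa> n3 ll1 by (intro frac_le mult_mono) auto
          also have "\<dots> = U1 * (2 * C' / \<kappa>) / ll ^ 3"
            using n3 ll1 \<kappa> by (simp add: field_simps eval_nat_numeral)
          finally show "U * 2 ^ l * real l / real m1 \<le> U1 * (2 * C' / \<kappa>) / ll ^ 3" .
        qed (use nc in simp)
        have bb: "\<beta> \<le> BB n"
          unfolding \<beta>_def BB_def ll_def[symmetric]
        proof (rule mult_left_mono)
          have "2 powr (- (real l * t)) \<le> 2 powr (- (real jlo * \<eta>))"
            using t' \<eta> l_lo by (intro powr_mono) (auto intro!: mult_mono)
          also have "\<dots> = (2 powr real jlo) powr (- \<eta>)" by (simp add: powr_powr)
          also have "\<dots> = (2 ^ jlo) powr (- \<eta>)" by (simp add: powr_realpow)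
          also have "\<dots> \<le> (\<kappa> * (real n / ll) powr p) powr (- \<eta>)"
            using Rr(9) \<kappa> nl \<eta> n3 ll1 by (intro powr_mono2') (auto intro!: mult_pos_pos)
          finally show "2 powr (- (real l * t)) \<le> (\<kappa> * (real n / ll) powr p) powr (- \<eta>)" .
        qed (use b2 in simp)
        have sz: "s * \<zeta> \<le> SZ n"
        proof -
          have "s * \<zeta> = nc * sqrt (real m1 / 2 ^ l * (U * 2 ^ l * real l / real m1))"
            unfolding s_def \<zeta>_def real_sqrt_mult by simp
          also have "real m1 / 2 ^ l * (U * 2 ^ l * real l / real m1) = U * real l" using Rr(1) by simp
          also have "nc * sqrt (U * real l) \<le> nc * sqrt (U1 * 2 * ln (real n))"
          proof (intro mult_left_mono real_sqrt_le_mono)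
            have "U * real l \<le> U1 * (2 * ll)" using UU1 U l1 by (intro mult_mono) auto
            then show "U * real l \<le> U1 * 2 * ln (real n)" unfolding ll_def by simp
          qed (use nc in simp)
          finally show ?thesis unfolding SZ_def .
        qed
        have sb: "s * \<beta> \<le> SB n"
        proof -
          have pu: "2 powr (- (real (u n) * \<eta>)) \<le> (cu * ll\<^sup>2) powr (- \<eta>)"
          proof -
            have "2 powr (- (real (u n) * \<eta>)) = (2 ^ u n) powr (- \<eta>)" by (simp add: powr_powr powr_realpow[symmetric])
            also have "\<dots> \<le> (cu * ll\<^sup>2) powr (- \<eta>)" using uu(1) cu ll1 \<eta> by (intro powr_mono2') auto
            finally show ?thesis .
          qed
          have "- (real l * t) = - (real js * t) + ((real js - real jh) * t + - (real (u n) * t))"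
            unfolding l by (simp add: algebra_simps)
          then have "2 powr (- (real l * t)) = 2 powr (- (real js * t)) * (2 powr ((real js - real jh) * t) * 2 powr (- (real (u n) * t)))"
            by (simp only: powr_add)
          moreover have "2 powr ((real js - real jh) * t) \<le> 2 powr (real q * real r)"
            using js(7,8) t' by (intro powr_mono mult_mono) auto
          moreover have "2 powr (- (real (u n) * t)) \<le> 2 powr (- (real (u n) * \<eta>))"
            using t' by (intro powr_mono) (auto intro!: mult_left_mono)
          then have "2 powr (- (real (u n) * t)) \<le> (cu * ll\<^sup>2) powr (- \<eta>)" using pu by (rule order_trans)
          ultimately have "2 powr (- (real l * t)) \<le> 2 powr (- (real js * t)) * (2 powr (real q * real r) * (cu * ll\<^sup>2) powr (- \<eta>))"
            by (simp only:) (intro mult_left_mono mult_mono powr_ge_zero)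
          then have "\<beta> \<le> (b2 * 2 powr (- (real js * t))) * (2 powr (real q * real r) * (cu * ll\<^sup>2) powr (- \<eta>))"
            unfolding \<beta>_def mult.assoc using b2 by (intro mult_left_mono) auto
          also have "\<dots> \<le> S js * (2 powr (real q * real r) * (cu * ll\<^sup>2) powr (- \<eta>))"
            using js(3) by (intro mult_right_mono) auto
          finally have \<beta>_le: "\<beta> \<le> S js * (2 powr (real q * real r) * (cu * ll\<^sup>2) powr (- \<eta>))" .
          have "s * S js = nc * sqrt (real m1 / 2 ^ l * (U * 2 ^ js * real js / real m2))"
            unfolding s_def S_def real_sqrt_mult by simp
          also have "\<dots> \<le> nc * sqrt ((U1 * 2 / \<kappa> * 2 ^ q) * ll / (cu * ll\<^sup>2))"
          proof (intro mult_left_mono real_sqrt_le_mono)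
            have "(2::real) ^ js \<le> 2 ^ (jh + q)" using js(8) by (intro power_increasing) auto
            then have pw: "(2::real) ^ js \<le> 2 ^ jh * 2 ^ q" by (simp add: power_add)
            have js2: "real js \<le> 2 * ll" using js(2) Rr(12) by linarith
            have "real m1 / 2 ^ l * (U * 2 ^ js * real js / real m2) = (U * real js * 2 ^ js * real m1) / (2 ^ jh * 2 ^ u n * real m2)"
              unfolding l by (simp add: power_add)
            also have "\<dots> \<le> (U1 * (2 * ll) * (2 ^ jh * 2 ^ q) * real n) / (2 ^ jh * (cu * ll\<^sup>2) * (\<kappa> * real n))"
              using UU1 U js2 pw mn uu(1) Rr(4) \<kappa> cu ll1 n3 by (intro frac_le mult_mono mult_pos_pos mult_nonneg_nonneg) auto
            also have "\<dots> = (U1 * 2 / \<kappa> * 2 ^ q) * ll / (cu * ll\<^sup>2)"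
              using n3 by (simp add: mult_ac)
            finally show "real m1 / 2 ^ l * (U * 2 ^ js * real js / real m2) \<le> (U1 * 2 / \<kappa> * 2 ^ q) * ll / (cu * ll\<^sup>2)" .
          qed (use nc in simp)
          finally have sS: "s * S js \<le> nc * sqrt ((U1 * 2 / \<kappa> * 2 ^ q) * ll / (cu * ll\<^sup>2))" .
          have "s * \<beta> \<le> (s * S js) * (2 powr (real q * real r) * (cu * ll\<^sup>2) powr (- \<eta>))"
            using mult_left_mono[OF \<beta>_le, of s] s0 by (simp add: mult.assoc)
          also have "\<dots> \<le> (nc * sqrt ((U1 * 2 / \<kappa> * 2 ^ q) * ll / (cu * ll\<^sup>2))) * (2 powr (real q * real r) * (cu * ll\<^sup>2) powr (- \<eta>))"
            using sS by (intro mult_right_mono) auto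
          also have "\<dots> = SB n" unfolding SB_def ll_def by (simp only: mult_ac)
          finally show ?thesis .
        qed
        have close: "\<bar>studentized_error K m1 (sigma_hat m1 l) f X l dd -
            s * (SUP y\<in>{0..1}. \<bar>(estimator K {1..m1} X y l - kernel_op K l f y) / (kernel_const K * sqrt (f y))\<bar>)\<bar>
            \<le> k * s * (\<beta> / sqrt d + \<zeta> * (\<zeta> + \<beta>) / (d * sqrt d))"
          unfolding s_def k_def d_def
        proof (rule studentized_error_close[OF Rr(1) \<delta>])
          show "\<delta> \<le> f y" if "y \<in> {0..1}" for y using f\<delta> that by blast
          show "\<bar>estimator K {1..m1} X y l - kernel_op K l f y\<bar> \<le> \<zeta>" for y unfolding \<zeta>_def by (rule noise1[OF X lJ])
          show "\<bar>kernel_op K l f y - f y\<bar> \<le> \<beta>" for y unfolding \<beta>_def by (rule bias_le[OF f fb bias]) (use j0(1) l_lo in simp)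
          show "\<zeta> + \<beta> \<le> \<delta> / 2" using zb bb elim(2) unfolding d_def by linarith
        qed
        have SZ0: "0 \<le> SZ n" using sz s0 \<zeta>0 by (meson mult_nonneg_nonneg less_imp_le order_trans)
        have "k * s * (\<beta> / sqrt d + \<zeta> * (\<zeta> + \<beta>) / (d * sqrt d)) = k * ((s * \<beta>) / sqrt d + (s * \<zeta>) * (\<zeta> + \<beta>) / (d * sqrt d))"
          by (simp add: algebra_simps)
        also have "\<dots> \<le> k * (SB n / sqrt d + SZ n * (ZB n + BB n) / (d * sqrt d))"
          using sb sz zb bb k d SZ0 \<zeta>0 \<beta>0 by (intro mult_left_mono add_mono divide_right_mono mult_mono) auto
        finally have close': "\<bar>studentized_error K m1 (sigma_hat m1 l) f X l dd -
            s * (SUP y\<in>{0..1}. \<bar>(estimator K {1..m1} X y l - kernel_op K l f y) / (kernel_const K * sqrt (f y))\<bar>)\<bar>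
            \<le> k * (SB n / sqrt d + SZ n * (ZB n + BB n) / (d * sqrt d))" using close by linarith
        show "A l * \<bar>studentized_error K m1 (sigma_hat m1 l) f X l dd -
            centred_statistic K m1 f X l\<bar> \<le> \<Delta> n"
          unfolding \<Delta>_def s_def[symmetric] using close' Al CA ll1 unfolding ll_def by (intro mult_mono) auto
      qed
    qed
  qed
  show ?thesis by (rule that[OF limD Q(1) ev])
qed

end

section \<open>Independence of level and band\<close>
context tame_kernel
begin

lemma selected_level_sets:
  assumes "m1 + m2 = n"
  shows "{X \<in> space (sample_law f n). selected_level M' K m1 m2 jlo jhi f' X = j} \<in> sets (sample_law f n)"
  using measurable_sets[OF selected_level_measurable[OF assms, of M' jlo jhi f'], of "{j}"]
  unfolding sets_sample_law space_sample_law by (simp add: vimage_def Int_def conj_commute)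

lemma gumbel_event_sets:
  assumes m: "m1 \<le> n" and f: "probability_density f" "continuous_on UNIV f" "0 < \<delta>" "\<And>y. y \<in> {0..1} \<Longrightarrow> \<delta> \<le> f y"
  shows "gumbel_event K n m1 f l z \<in> sets (sample_law f n)"
proof -
  have pos: "0 < f y" if "y \<in> {0..1}" for y using f(3) f(4)[OF that] by linarith
  have "integrable lborel f" using f(1) unfolding probability_density_def by simp
  note [measurable] = centred_sup_measurable[OF m f(2) this pos, of l]
  have "{X \<in> space (sample_space n). centred_statistic K m1 f X l \<le> z} \<in> sets (sample_space n)"
    by measurable
  then show ?thesis unfolding gumbel_event_def sets_sample_law space_sample_law .
qed

lemma selected_gumbel_independent:
  fixes jlo jhi :: nat and M' :: real
  assumes m: "m1 + m2 = n" and f: "probability_density f" "continuous_on UNIV f" "0 < \<delta>" "\<And>y. y \<in> {0..1} \<Longrightarrow> \<delta> \<le> f y"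
  defines "S \<equiv> \<lambda>j. {X \<in> space (sample_law f n). selected_level M' K m1 m2 jlo jhi f X = j}"
  shows "measure (sample_law f n) (S j \<inter> gumbel_event K n m1 f l z) = measure (sample_law f n) (S j) * measure (sample_law f n) (gumbel_event K n m1 f l z)"
    and "measure (sample_law f n) (S j \<inter> (space (sample_law f n) - gumbel_event K n m1 f l z)) =
      measure (sample_law f n) (S j) * measure (sample_law f n) (space (sample_law f n) - gumbel_event K n m1 f l z)"
proof -
  have mn: "m1 \<le> n" using m by simp
  have G: "gumbel_event K n m1 f l z \<in> sets (sample_law f n)" by (rule gumbel_event_sets[OF mn f])
  have Sj: "S j \<in> sets (sample_law f n)" unfolding S_def by (rule selected_level_sets[OF m])
  have dG: "Y \<in> gumbel_event K n m1 f l z" if "Y \<in> space (sample_law f n)" "\<And>i. i \<in> {1..m1} \<Longrightarrow> X i = Y i" "X \<in> gumbel_event K n m1 f l z" for X Y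
  proof -
    have "estimator K {1..m1} X = estimator K {1..m1} Y" by (intro ext estimator_cong that(2))
    then show ?thesis using that(1,3) unfolding gumbel_event_def by simp
  qed
  have dS: "Y \<in> S j" if "Y \<in> space (sample_law f n)" "\<And>i. i \<in> {1..n} - {1..m1} \<Longrightarrow> X i = Y i" "X \<in> S j" for X Y
  proof -
    have "selected_level M' K m1 m2 jlo jhi f X = selected_level M' K m1 m2 jlo jhi f Y"
      by (rule selected_level_cong) (use that(2) m in auto)
    then show ?thesis using that(1,3) unfolding S_def by simp
  qed
  have J: "{1..m1} \<subseteq> {1..n}" using mn by auto
  show "measure (sample_law f n) (S j \<inter> gumbel_event K n m1 f l z) = measure (sample_law f n) (S j) * measure (sample_law f n) (gumbel_event K n m1 f l z)"
  proof -
    have "measure (sample_law f n) (gumbel_event K n m1 f l z \<inter> S j) = measure (sample_law f n) (gumbel_event K n m1 f l z) * measure (sample_law f n) (S j)"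
      by (rule sample_law_independent[OF f(1) G _ Sj _ J]) (blast intro: dG, blast intro: dS)
    then show ?thesis by (simp add: Int_commute mult.commute)
  qed
  have dG': "Y \<in> space (sample_law f n) - gumbel_event K n m1 f l z" if "X \<in> space (sample_law f n)" "Y \<in> space (sample_law f n)" "\<And>i. i \<in> {1..m1} \<Longrightarrow> X i = Y i"
      "X \<in> space (sample_law f n) - gumbel_event K n m1 f l z" for X Y
    using dG[of X Y, OF that(1) that(3)[symmetric]] that(2,4) by blast
  have Gc: "space (sample_law f n) - gumbel_event K n m1 f l z \<in> sets (sample_law f n)" using G by auto
  have "measure (sample_law f n) ((space (sample_law f n) - gumbel_event K n m1 f l z) \<inter> S j) =
      measure (sample_law f n) (space (sample_law f n) - gumbel_event K n m1 f l z) * measure (sample_law f n) (S j)"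
    by (rule sample_law_independent[OF f(1) Gc _ Sj _ J]) (rule dG', assumption+, blast intro: dS)
  then show "measure (sample_law f n) (S j \<inter> (space (sample_law f n) - gumbel_event K n m1 f l z)) =
      measure (sample_law f n) (S j) * measure (sample_law f n) (space (sample_law f n) - gumbel_event K n m1 f l z)"
    by (simp only: Int_commute mult.commute)
qed

lemma studentized_event_sets:
  assumes m: "m1 + m2 = n" and f: "continuous_on UNIV f" and dm: "dd \<in> borel_measurable (sample_space n)"
  shows "{X \<in> space (sample_law f n). (let j = selected_level M' K m1 m2 jlo jhi f X + v; \<sigma> = sigma_hat m1 j
            in A j * (studentized_error K m1 \<sigma> f X j (dd X) - B j) \<le> x)} \<in> sets (sample_law f n)" (is "?E \<in> _")
proof -
  define Ev where "Ev j = {X \<in> space (sample_space n). A (j + v) * (studentized_error K m1 (sigma_hat m1 (j + v)) f X (j + v) (dd X) - B (j + v)) \<le> x}" for j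
  have Ev: "Ev j \<in> sets (sample_space n)" for j
  proof -
    have m1: "m1 \<le> n" using m by simp
    note [measurable] = studentized_error_measurable[OF m1 f dm, of "sigma_hat m1 (j + v)" "j + v"]
    show ?thesis unfolding Ev_def by measurable
  qed
  have "?E = (\<Union>j. {X \<in> space (sample_law f n). selected_level M' K m1 m2 jlo jhi f X = j} \<inter> Ev j)"
    unfolding Ev_def Let_def space_sample_law by auto
  also have "\<dots> \<in> sets (sample_law f n)"
    using selected_level_sets[OF m, of f M' jlo jhi f] Ev sets_sample_law[of f n] by (intro sets.countable_UN'' sets.Int) auto
  finally show ?thesis .
qed

end

section \<open>Coverage and width of the band\<close>

lemma rate_identity:
  fixes N l t :: real
  assumes "1 \<le> N" "1 \<le> l" "0 < t"
  shows "(N / l) powr (1 / (2 * t + 1)) / N = (N powr (- (t / (2 * t + 1))) * l powr (- (1 / (2 * (2 * t + 1)))))\<^sup>2"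
proof -
  define \<theta> where "\<theta> = 1 / (2 * t + 1)"
  have t: "t / (2 * t + 1) = (1 - \<theta>) / 2" "1 / (2 * (2 * t + 1)) = \<theta> / 2"
    unfolding \<theta>_def using assms(3) by (simp_all add: field_simps)
  have sq: "(z powr w)\<^sup>2 = z powr (2 * w)" for z w :: real by (simp add: power2_eq_square powr_add[symmetric])
  have "(N powr (- ((1 - \<theta>) / 2)) * l powr (- (\<theta> / 2)))\<^sup>2 = N powr (\<theta> - 1) * l powr (- \<theta>)"
  proof -
    have e: "2 * (- ((1 - \<theta>) / 2)) = \<theta> - 1" "2 * (- (\<theta> / 2)) = - \<theta>" by (simp_all add: field_simps)
    show ?thesis unfolding power_mult_distrib sq e ..
  qed
  also have "\<dots> = N powr \<theta> / N * (1 / l powr \<theta>)"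
    using assms by (simp add: powr_diff powr_minus divide_inverse)
  also have "\<dots> = (N / l) powr \<theta> / N"
    using assms by (simp add: powr_divide)
  finally show ?thesis unfolding t \<theta>_def[symmetric] by simp
qed

lemma gumbel_cdf_continuous:
  fixes x \<epsilon> :: real
  assumes "0 < \<epsilon>"
  obtains h where "0 < h" "exp (- exp (- (x + h))) < exp (- exp (- x)) + \<epsilon>" "exp (- exp (- x)) - \<epsilon> < exp (- exp (- (x - h)))"
proof -
  have "((\<lambda>h. exp (- exp (- (x + h)))) \<longlongrightarrow> exp (- exp (- (x + 0)))) (at_right (0::real))"
    by (intro tendsto_intros)
  then have 1: "\<forall>\<^sub>F h in at_right (0::real). exp (- exp (- (x + h))) < exp (- exp (- x)) + \<epsilon>"
    by (rule order_tendstoD(2)) (use assms in simp)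
  have "((\<lambda>h. exp (- exp (- (x - h)))) \<longlongrightarrow> exp (- exp (- (x - 0)))) (at_right (0::real))"
    by (intro tendsto_intros)
  then have 2: "\<forall>\<^sub>F h in at_right (0::real). exp (- exp (- x)) - \<epsilon> < exp (- exp (- (x - h)))"
    by (rule order_tendstoD(1)) (use assms in simp)
  have 3: "\<forall>\<^sub>F h in at_right (0::real). 0 < h" by (simp add: eventually_at_right_less)
  have "\<forall>\<^sub>F h in at_right (0::real). 0 < h \<and> exp (- exp (- (x + h))) < exp (- exp (- x)) + \<epsilon> \<and> exp (- exp (- x)) - \<epsilon> < exp (- exp (- (x - h)))"
    using 1 2 3 by eventually_elim simp
  then obtain h where "0 < h \<and> exp (- exp (- (x + h))) < exp (- exp (- x)) + \<epsilon> \<and> exp (- exp (- x)) - \<epsilon> < exp (- exp (- (x - h)))"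
    using eventually_happens'[OF trivial_limit_at_right_real] by blast
  then show ?thesis using that by blast
qed

context tame_kernel
begin

abbreviation coverage_prob where
  "coverage_prob n m1 m2 jlo jhi v A B dd x f \<equiv> \<P>(X in sample_law f n.
     (let j = selected_level (4 * noise_const) K m1 m2 jlo jhi f X + v; \<sigma> = sigma_hat m1 j
      in A j * (studentized_error K m1 \<sigma> f X j (dd X) - B j) \<le> x))"

abbreviation wide_band_prob where
  "wide_band_prob n m1 m2 jlo jhi v t f L \<equiv> \<P>(X in sample_law f n.
     (let j = selected_level (4 * noise_const) K m1 m2 jlo jhi f X + v; t = t
      in sigma_hat m1 j \<ge>
           L * real n powr (- (t / (2 * t + 1))) *
           ln (real n) powr (- (1 / (2 * (2 * t + 1)))) * 2 powr (real v / 2)))"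

end

text \<open>Both inequalities for the coverage come from \<open>mixture_upper\<close>, the lower one applied to the complement.
The argument \<open>x\<close> is moved by \<open>h\<close> to absorb the difference \<open>\<Delta>\<close> between the studentized error and the
centred statistic.\<close>

lemma (in tame_kernel) adaptive_band:
  fixes r n0 j0 :: nat and n1 n2 jmin jmax u :: "nat \<Rightarrow> nat" and A B :: "nat \<Rightarrow> real"
    and \<Phi> :: "real \<Rightarrow> real \<Rightarrow> real" and dd :: "nat \<Rightarrow> (nat \<Rightarrow> real) \<Rightarrow> real"
  assumes split: "sample_split n0 n1 n2" and res: "resolution_range r n0 n2 jmin jmax"
    and G: "uniform_gumbel \<Phi> K n0 n1 jmin jmax A B"
    and u: "comparable (\<lambda>n. 2 ^ u n) (\<lambda>n. (ln (real n))\<^sup>2)"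
    and dm: "\<And>n. dd n \<in> borel_measurable (sample_space n)"
    and b: "0 < b" "0 < b1" "b1 \<le> b2" and \<eta>: "0 < \<eta>" "\<eta> \<le> real r" and adm: "admissible_pair \<Phi> \<eta> b \<delta> F1 F2"
  defines "P \<equiv> self_similar_densities \<Phi> K \<eta> r b b1 b2 j0 \<delta> F1 F2"
  assumes ne: "P \<noteq> {}"
  shows "(\<lambda>n. SUP f\<in>P. \<bar>coverage_prob n (n1 n) (n2 n) (jmin n) (jmax n) (u n) A B (dd n) x f
            - exp (- exp (- x))\<bar>) \<longlonglongrightarrow> 0" (is ?band)
    and "0 < \<epsilon> \<Longrightarrow> \<exists>L. \<forall>n\<ge>n0. (SUP f\<in>P. wide_band_prob n (n1 n) (n2 n) (jmin n) (jmax n) (u n) (smoothness K \<eta> r b1 b2 j0 f) f L) \<le> \<epsilon>"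
proof -
  define p where "p = 1 / (2 * real r + 1)"
  have p0: "0 < p" unfolding p_def by simp
  have \<delta>: "0 < \<delta>" "F1 < 0" "1 < F2" using adm unfolding admissible_pair_def by auto
  have cA: "comparable A (\<lambda>l. sqrt (real l))" using G unfolding uniform_gumbel_def by blast
  obtain \<kappa> C' where \<kappa>: "0 < \<kappa>" "0 < C'" and reg: "\<forall>\<^sub>F n in sequentially. regime \<kappa> C' p n (n1 n) (n2 n) (jmin n) (jmax n)"
    using regimeE[OF split res] unfolding p_def by blast
  have fP: "f \<in> density_class \<Phi> \<eta> b \<delta> F1 F2" "\<exists>t\<in>{\<eta>..real r}. bias_bounds K b1 b2 j0 t f" if "f \<in> P" for f
    using that unfolding P_def self_similar_densities_def self_similar_class_def by auto
  have f\<delta>: "\<delta> \<le> f y" if "f \<in> P" "y \<in> {0..1}" for f y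
    by (rule density_class_imp(4)[OF fP(1)[OF that(1)]]) (use that(2) \<delta> in auto)
  obtain \<Delta> Q where \<Delta>: "\<Delta> \<longlonglongrightarrow> 0" and Q: "0 < Q" and ev0:
    "\<forall>\<^sub>F n in sequentially. \<forall>m1 m2 jlo jhi. regime \<kappa> C' p n m1 m2 jlo jhi \<longrightarrow>
      (\<forall>f t. probability_density f \<longrightarrow> continuous_on UNIV f \<longrightarrow> bounded (range f) \<longrightarrow> (\<forall>y\<in>{0..1}. \<delta> \<le> f y) \<longrightarrow>
         t \<in> {\<eta>..real r} \<longrightarrow> bias_bounds K b1 b2 j0 t f \<longrightarrow>
        (level_control n m1 m2 jlo jhi (u n) A f (failure_bound V \<kappa> p n) (Q * (real n / ln (real n)) powr (1 / (2 * t + 1))) (\<Delta> n)))"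
    by (rule level_event[OF \<kappa> p_def \<eta> b(2,3) \<delta>(1) u cA, where ?j0.0 = j0]) blast
  have ev: "\<forall>\<^sub>F n in sequentially. \<forall>f\<in>P. \<forall>t\<in>{\<eta>..real r}. bias_bounds K b1 b2 j0 t f \<longrightarrow>
        (level_control n (n1 n) (n2 n) (jmin n) (jmax n) (u n) A f (failure_bound V \<kappa> p n) (Q * (real n / ln (real n)) powr (1 / (2 * t + 1))) (\<Delta> n))"
    using ev0 reg
  proof eventually_elim
    case (elim n)
    show ?case
    proof (intro ballI impI)
      fix f t assume f: "f \<in> P" and t: "t \<in> {\<eta>..real r}" and bias: "bias_bounds K b1 b2 j0 t f"
      have "\<forall>y\<in>{0..1}. \<delta> \<le> f y" using f\<delta>[OF f] by blast
      from elim(1)[rule_format, OF elim(2) density_class_imp(1-3)[OF fP(1)[OF f]] _ t bias] this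
      show "level_control n (n1 n) (n2 n) (jmin n) (jmax n) (u n) A f (failure_bound V \<kappa> p n) (Q * (real n / ln (real n)) powr (1 / (2 * t + 1))) (\<Delta> n)"
        by blast
    qed
  qed
  have fb: "\<forall>\<^sub>F n in sequentially. failure_bound V \<kappa> p n < e" if "0 < e" for e
    by (rule order_tendstoD(2)[OF failure_bound_tendsto[OF \<kappa>(1) p0 V_nonneg] that])
  have pos: "n1 n \<le> n \<and> 0 < n1 n" if "n0 \<le> n" for n using sample_split_positive[OF split that] by simp
  have Jlt: "jmin n < jmax n" if "n0 \<le> n" for n using res that unfolding resolution_range_def by blast
  have gum: "\<forall>\<^sub>F n in sequentially. \<forall>l\<in>{jmin n..jmax n}. \<forall>f\<in>density_class \<Phi> \<eta> b \<delta> F1 F2.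
     \<bar>measure (sample_law f n) (gumbel_event K n (n1 n) f l (z / A l + B l)) - exp (- exp (- z))\<bar> < e'" if "0 < e'" for e' z
    by (rule uniform_gumbel_levels[OF G \<eta>(1) b(1) adm _ _ that]) (use Jlt pos in auto)
  show ?band
  proof (rule tendstoI)
    fix e :: real assume e: "0 < e"
    obtain h where h: "0 < h" "exp (- exp (- (x + h))) < exp (- exp (- x)) + e / 8" "exp (- exp (- x)) - e / 8 < exp (- exp (- (x - h)))"
      using gumbel_cdf_continuous[of "e / 8" x] e by auto
    have e8: "0 < e / 8" using e by simp
    have evn: "\<forall>\<^sub>F n in sequentially. n0 \<le> n" by (rule eventually_ge_at_top)
    have ev\<Delta>: "\<forall>\<^sub>F n in sequentially. \<Delta> n < h" by (rule order_tendstoD(2)[OF \<Delta> h(1)])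
    show "\<forall>\<^sub>F n in sequentially. dist (SUP f\<in>P. \<bar>coverage_prob n (n1 n) (n2 n) (jmin n) (jmax n) (u n) A B (dd n) x f
            - exp (- exp (- x))\<bar>) 0 < e"
      using ev fb[OF e8] gum[OF e8, of "x + h"] gum[OF e8, of "x - h"] evn ev\<Delta>
    proof eventually_elim
      case (elim n)
      define m1 m2 jlo jhi v where "m1 = n1 n" and "m2 = n2 n" and "jlo = jmin n" and "jhi = jmax n" and "v = u n"
      define Ev where "Ev f = {X \<in> space (sample_law f n).
              (let j = selected_level (4 * noise_const) K m1 m2 jlo jhi f X + v;
                   \<sigma> = sigma_hat m1 j
               in A j * (studentized_error K m1 \<sigma> f X j (dd n X) - B j) \<le> x)}" for f
      have m: "m1 + m2 = n" "m1 \<le> n" using sample_split_positive[OF split elim(5)] unfolding m1_def m2_def by auto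
      have each: "\<bar>measure (sample_law f n) (Ev f) - exp (- exp (- x))\<bar> \<le> e / 2" if f: "f \<in> P" for f
      proof -
        note dens = density_class_imp[OF fP(1)[OF f]]
        interpret S: prob_space "sample_law f n" by (rule sample_law_prob_space[OF dens(1)])
        obtain t where t: "t \<in> {\<eta>..real r}" "bias_bounds K b1 b2 j0 t f" using fP(2)[OF f] by blast
        define sel where "sel X = selected_level (4 * noise_const) K m1 m2 jlo jhi f X" for X
        define W where "W X l = centred_statistic K m1 f X l" for X l
        define Z where "Z X = studentized_error K m1 (sigma_hat m1 (sel X + v)) f X (sel X + v) (dd n X)" for X
        obtain E where E: "E \<in> sets (sample_law f n)" "S.prob (space (sample_law f n) - E) \<le> failure_bound V \<kappa> p n"
          and EX: "\<And>X. X \<in> E \<Longrightarrow> jlo \<le> sel X \<and> sel X + v \<le> jhi \<and> 0 < A (sel X + v) \<and> A (sel X + v) * \<bar>Z X - W X (sel X + v)\<bar> \<le> \<Delta> n"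
          using elim(1)[rule_format, OF f t] unfolding sel_def W_def Z_def m1_def m2_def jlo_def jhi_def v_def by blast
        have EvX: "X \<in> Ev f \<longleftrightarrow> X \<in> space (sample_law f n) \<and> A (sel X + v) * (Z X - B (sel X + v)) \<le> x" for X
          unfolding Ev_def sel_def Z_def Let_def by simp
        have Evm: "Ev f \<in> sets (sample_law f n)" unfolding Ev_def by (rule studentized_event_sets[OF m(1) dens(2) dm])
        define H where "H z j = gumbel_event K n m1 f (j + v) (z / A (j + v) + B (j + v))" for z j
        have HX: "X \<in> H z j \<longleftrightarrow> X \<in> space (sample_law f n) \<and> W X (j + v) \<le> z / A (j + v) + B (j + v)" for X z j
          unfolding H_def gumbel_event_def W_def by simp
        have Hm: "H z j \<in> sets (sample_law f n)" for z j
          unfolding H_def by (rule gumbel_event_sets[OF m(2) dens(1,2) \<delta>(1) f\<delta>[OF f]])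
        define R where "R = {j. jlo \<le> j \<and> j + v \<le> jhi}"
        have R: "finite R" by (rule finite_subset[of _ "{..jhi}"]) (auto simp: R_def)
        have Gup: "\<bar>S.prob (H (x + h) j) - exp (- exp (- (x + h)))\<bar> < e / 8" and Glo: "\<bar>S.prob (H (x - h) j) - exp (- exp (- (x - h)))\<bar> < e / 8" if "j \<in> R" for j
        proof -
          have "j + v \<in> {jmin n..jmax n}" using that unfolding R_def jlo_def jhi_def by auto
          then show "\<bar>S.prob (H (x + h) j) - exp (- exp (- (x + h)))\<bar> < e / 8" "\<bar>S.prob (H (x - h) j) - exp (- exp (- (x - h)))\<bar> < e / 8"
            using elim(3,4) fP(1)[OF f] unfolding H_def m1_def by blast+
        qed
        have selm: "sel \<in> sample_law f n \<rightarrow>\<^sub>M count_space UNIV"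
          using selected_level_measurable[OF m(1), of "4 * noise_const" jlo jhi f]
          unfolding sel_def[abs_def] measurable_cong_sets[OF sets_sample_law refl] .
        note ind = selected_gumbel_independent[OF m(1) dens(1,2) \<delta>(1) f\<delta>[OF f], of "4 * noise_const" jlo jhi, folded sel_def]
        have g1: "0 \<le> exp (- exp (- z))" "exp (- exp (- z)) \<le> (1::real)" for z :: real by auto
        have up: "S.prob (Ev f) \<le> failure_bound V \<kappa> p n + (exp (- exp (- (x + h))) + e / 8)"
        proof (rule mixture_upper[where h = sel and R = R and E = E and H = "H (x + h)", OF S.prob_space_axioms selm R E(1) Evm Hm E(2)])
          show "S.prob ({X \<in> space (sample_law f n). sel X = j} \<inter> H (x + h) j) = S.prob {X \<in> space (sample_law f n). sel X = j} * S.prob (H (x + h) j)" for j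
            unfolding H_def by (rule ind(1))
          show "S.prob (H (x + h) j) \<le> exp (- exp (- (x + h))) + e / 8" if "j \<in> R" for j using Gup[OF that] by linarith
          show "0 \<le> exp (- exp (- (x + h))) + e / 8" using g1(1)[of "x + h"] e by linarith
          fix X assume X: "X \<in> E" "X \<in> Ev f"
          define l where "l = sel X + v"
          have Al: "0 < A l" "A l * \<bar>Z X - W X l\<bar> \<le> \<Delta> n" using EX[OF X(1)] unfolding l_def by auto
          have "A l * (W X l - B l) = A l * (Z X - B l) + A l * (W X l - Z X)" by (simp add: algebra_simps)
          also have "A l * (W X l - Z X) \<le> A l * \<bar>Z X - W X l\<bar>" using Al(1) by (intro mult_left_mono) auto
          finally have "A l * (W X l - B l) \<le> x + h" using X(2) Al(2) elim(6) unfolding EvX l_def by linarith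
          then have "W X l - B l \<le> (x + h) / A l" using Al(1) by (simp add: pos_le_divide_eq mult.commute)
          then show "sel X \<in> R \<and> X \<in> H (x + h) (sel X)"
            using EX[OF X(1)] X(2) unfolding HX R_def EvX l_def by auto
        qed
        have lo: "S.prob (space (sample_law f n) - Ev f) \<le> failure_bound V \<kappa> p n + (1 - exp (- exp (- (x - h))) + e / 8)"
        proof (rule mixture_upper[where h = sel and R = R and E = E and H = "\<lambda>j. space (sample_law f n) - H (x - h) j", OF S.prob_space_axioms selm R E(1) _ _ E(2)])
          show "space (sample_law f n) - Ev f \<in> S.events" using Evm by auto
          show "space (sample_law f n) - H (x - h) j \<in> S.events" for j using Hm by auto
          show "S.prob ({X \<in> space (sample_law f n). sel X = j} \<inter> (space (sample_law f n) - H (x - h) j)) =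
              S.prob {X \<in> space (sample_law f n). sel X = j} * S.prob (space (sample_law f n) - H (x - h) j)" for j
            unfolding H_def by (rule ind(2))
          show "S.prob (space (sample_law f n) - H (x - h) j) \<le> 1 - exp (- exp (- (x - h))) + e / 8" if "j \<in> R" for j
            using Glo[OF that, unfolded abs_less_iff] S.prob_compl[OF Hm[of "x - h" j]] by linarith
          show "0 \<le> 1 - exp (- exp (- (x - h))) + e / 8" using g1(2)[of "x - h"] e by linarith
          fix X assume X: "X \<in> E" "X \<in> space (sample_law f n) - Ev f"
          define l where "l = sel X + v"
          have Al: "0 < A l" "A l * \<bar>Z X - W X l\<bar> \<le> \<Delta> n" using EX[OF X(1)] unfolding l_def by auto
          have "A l * (Z X - B l) = A l * (W X l - B l) + A l * (Z X - W X l)" by (simp add: algebra_simps)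
          also have "A l * (Z X - W X l) \<le> A l * \<bar>Z X - W X l\<bar>" using Al(1) by (intro mult_left_mono) auto
          finally have "x - h < A l * (W X l - B l)" using X(2) Al(2) elim(6) unfolding Diff_iff EvX l_def by auto
          then have "(x - h) / A l < W X l - B l" using Al(1) by (simp add: pos_divide_less_eq mult.commute)
          then show "sel X \<in> R \<and> X \<in> space (sample_law f n) - H (x - h) (sel X)"
            using EX[OF X(1)] X(2) unfolding Diff_iff HX R_def l_def by auto
        qed
        show ?thesis
          using up lo S.prob_compl[OF Evm] h(2,3) elim(2) by (simp only: abs_le_iff) linarith
      qed
      have eqE: "coverage_prob n (n1 n) (n2 n) (jmin n) (jmax n) (u n) A B (dd n) x f = measure (sample_law f n) (Ev f)" for f
        unfolding Ev_def m1_def m2_def jlo_def jhi_def v_def ..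
      have "(SUP f\<in>P. \<bar>measure (sample_law f n) (Ev f) - exp (- exp (- x))\<bar>) \<le> e / 2"
        by (rule cSUP_least[OF ne each])
      moreover have "0 \<le> (SUP f\<in>P. \<bar>measure (sample_law f n) (Ev f) - exp (- exp (- x))\<bar>)"
      proof -
        obtain f where f: "f \<in> P" using ne by blast
        have "bdd_above ((\<lambda>f. \<bar>measure (sample_law f n) (Ev f) - exp (- exp (- x))\<bar>) ` P)"
          by (rule bdd_aboveI2[OF each])
        from cSUP_upper[OF f this] show ?thesis by (rule order_trans[OF abs_ge_zero])
      qed
      ultimately show ?case unfolding eqE dist_real_def using e by simp
    qed
  qed
  assume \<epsilon>: "0 < \<epsilon>"
  have "\<forall>\<^sub>F n in sequentially. n0 \<le> n" by (rule eventually_ge_at_top)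
  then have "\<forall>\<^sub>F n in sequentially. \<forall>L\<ge>sqrt (Q / \<kappa>) + 1. \<forall>f\<in>P. wide_band_prob n (n1 n) (n2 n) (jmin n) (jmax n) (u n) (smoothness K \<eta> r b1 b2 j0 f) f L \<le> \<epsilon>"
    using ev fb[OF \<epsilon>] reg
  proof eventually_elim
    case (elim n)
    show ?case
    proof (intro allI impI ballI)
      fix L f assume L: "sqrt (Q / \<kappa>) + 1 \<le> L" and f: "f \<in> P"
      note dens = density_class_imp[OF fP(1)[OF f]]
      interpret S: prob_space "sample_law f n" by (rule sample_law_prob_space[OF dens(1)])
      obtain t where t: "t \<in> {\<eta>..real r}" "bias_bounds K b1 b2 j0 t f" using fP(2)[OF f] by blast
      have sm: "smoothness K \<eta> r b1 b2 j0 f = t" by (rule smoothness_eq[OF t b(2)])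
      define sel where "sel X = selected_level (4 * noise_const) K (n1 n) (n2 n) (jmin n) (jmax n) f X" for X
      obtain E where E: "E \<in> sets (sample_law f n)" "S.prob (space (sample_law f n) - E) \<le> failure_bound V \<kappa> p n"
        and EX: "\<And>X. X \<in> E \<Longrightarrow> 2 ^ sel X \<le> Q * (real n / ln (real n)) powr (1 / (2 * t + 1))"
        using elim(2)[rule_format, OF f t] unfolding sel_def by blast
      have n3: "3 \<le> n" using sample_split_positive[OF split elim(1)] by linarith
      have ln1: "1 \<le> ln (real n)"
      proof -
        have "exp 1 \<le> real n" using e_less_272 n3 by linarith
        then show ?thesis using n3 by (subst ln_ge_iff) auto
      qed
      have t0: "0 < t" using t(1) \<eta>(1) by simp
      define \<rho> where "\<rho> = real n powr (- (t / (2 * t + 1))) * ln (real n) powr (- (1 / (2 * (2 * t + 1))))"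
      have \<rho>: "0 < \<rho>" unfolding \<rho>_def using n3 ln1 by simp
      define w where "w = 2 powr (real (u n) / 2)"
      have w: "0 < w" "w\<^sup>2 = 2 ^ u n"
      proof -
        show "0 < w" unfolding w_def by simp
        show "w\<^sup>2 = 2 ^ u n" unfolding w_def by (simp add: power2_eq_square powr_add[symmetric] powr_realpow)
      qed
      have m1: "\<kappa> * real n \<le> real (n1 n)" using elim(4) unfolding regime_def by blast
      have "{X \<in> space (sample_law f n). sigma_hat (n1 n) (sel X + u n) \<ge> L * \<rho> * w} \<subseteq> space (sample_law f n) - E"
      proof (intro subsetI DiffI notI)
        fix X assume X: "X \<in> {X \<in> space (sample_law f n). sigma_hat (n1 n) (sel X + u n) \<ge> L * \<rho> * w}"
        then show "X \<in> space (sample_law f n)" by simp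
        assume XE: "X \<in> E"
        have "2 ^ (sel X + u n) / real (n1 n) \<le> (Q * (real n / ln (real n)) powr (1 / (2 * t + 1))) * w\<^sup>2 / (\<kappa> * real n)"
          unfolding power_add w(2) using EX[OF XE] m1 \<kappa>(1) n3 Q
          by (intro frac_le mult_right_mono mult_nonneg_nonneg mult_pos_pos) auto
        also have "\<dots> = Q / \<kappa> * ((real n / ln (real n)) powr (1 / (2 * t + 1)) / real n) * w\<^sup>2" by simp
        also have "(real n / ln (real n)) powr (1 / (2 * t + 1)) / real n = \<rho>\<^sup>2"
          unfolding \<rho>_def by (rule rate_identity) (use n3 ln1 t0 in auto)
        finally have "sigma_hat (n1 n) (sel X + u n) \<le> sqrt (Q / \<kappa> * \<rho>\<^sup>2 * w\<^sup>2)"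
          unfolding sigma_hat_def by (rule real_sqrt_le_mono)
        also have "\<dots> = sqrt (Q / \<kappa>) * \<rho> * w" using \<rho> w(1) by (simp only: real_sqrt_mult real_sqrt_abs abs_of_pos)
        also have "\<dots> < L * \<rho> * w" using L \<rho> w(1) by (intro mult_strict_right_mono) auto
        finally show False using X by simp
      qed
      then have "S.prob {X \<in> space (sample_law f n). sigma_hat (n1 n) (sel X + u n) \<ge> L * \<rho> * w} \<le> S.prob (space (sample_law f n) - E)"
        by (rule S.finite_measure_mono) (use E(1) in auto)
      also have "\<dots> \<le> \<epsilon>" using E(2) elim(3) by linarith
      finally show "wide_band_prob n (n1 n) (n2 n) (jmin n) (jmax n) (u n) (smoothness K \<eta> r b1 b2 j0 f) f L \<le> \<epsilon>"
        unfolding Let_def sm sel_def[symmetric] w_def[symmetric] \<rho>_def by (simp only: mult.assoc)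
    qed
  qed
  then obtain N where N: "\<And>n L f. N \<le> n \<Longrightarrow> sqrt (Q / \<kappa>) + 1 \<le> L \<Longrightarrow> f \<in> P \<Longrightarrow> wide_band_prob n (n1 n) (n2 n) (jmin n) (jmax n) (u n) (smoothness K \<eta> r b1 b2 j0 f) f L \<le> \<epsilon>"
    unfolding eventually_sequentially by blast
  \<comment> \<open>Finitely many \<open>n\<close> remain.  There the level is at most \<open>jmax n\<close> and the rate is at least
    \<open>1 / (n ln n)\<close>, so a large \<open>L\<close> makes the event empty.\<close>
  define M where "M n = sqrt (2 ^ (jmax n + u n) / real (n1 n)) * (real n * ln (real n)) + 1" for n
  define L where "L = Max (insert (sqrt (Q / \<kappa>) + 1) (M ` {..<N}))"
  have L1: "sqrt (Q / \<kappa>) + 1 \<le> L" unfolding L_def by (rule Max_ge) auto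
  have LM: "M n \<le> L" if "n < N" for n unfolding L_def by (rule Max_ge) (use that in auto)
  show "\<exists>L. \<forall>n\<ge>n0. (SUP f\<in>P. wide_band_prob n (n1 n) (n2 n) (jmin n) (jmax n) (u n) (smoothness K \<eta> r b1 b2 j0 f) f L) \<le> \<epsilon>"
  proof (rule exI[of _ L], intro allI impI cSUP_least[OF ne])
    fix n f assume n: "n0 \<le> n" and f: "f \<in> P"
    show "wide_band_prob n (n1 n) (n2 n) (jmin n) (jmax n) (u n) (smoothness K \<eta> r b1 b2 j0 f) f L \<le> \<epsilon>"
    proof (cases "N \<le> n")
      case True
      then show ?thesis by (rule N[OF _ L1 f])
    next
      case False
      then have L: "M n \<le> L" by (intro LM) simp
      obtain t where t: "t \<in> {\<eta>..real r}" "bias_bounds K b1 b2 j0 t f" using fP(2)[OF f] by blast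
      have sm: "smoothness K \<eta> r b1 b2 j0 f = t" by (rule smoothness_eq[OF t b(2)])
      have t0: "0 < t" using t(1) \<eta>(1) by simp
      have n3: "3 \<le> n" using sample_split_positive[OF split n] by linarith
      have ln1: "1 \<le> ln (real n)"
      proof -
        have "exp 1 \<le> real n" using e_less_272 n3 by linarith
        then show ?thesis using n3 by (subst ln_ge_iff) auto
      qed
      have "sigma_hat (n1 n) (selected_level (4 * noise_const) K (n1 n) (n2 n) (jmin n) (jmax n) f X + u n) <
          L * real n powr (- (t / (2 * t + 1))) * ln (real n) powr (- (1 / (2 * (2 * t + 1)))) * 2 powr (real (u n) / 2)" for X
      proof -
        let ?s = "sqrt (2 ^ (jmax n + u n) / real (n1 n))"
        have a1: "inverse (real n) \<le> real n powr (- (t / (2 * t + 1)))"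
        proof -
          have "real n powr (- 1) \<le> real n powr (- (t / (2 * t + 1)))" using n3 t0 by (intro powr_mono) (auto simp: divide_le_eq)
          then show ?thesis using n3 by (simp add: powr_minus)
        qed
        have a2: "inverse (ln (real n)) \<le> ln (real n) powr (- (1 / (2 * (2 * t + 1))))"
        proof -
          have "ln (real n) powr (- 1) \<le> ln (real n) powr (- (1 / (2 * (2 * t + 1))))" using ln1 t0 by (intro powr_mono) (auto simp: divide_le_eq)
          then show ?thesis using ln1 by (simp add: powr_minus)
        qed
        have a3: "1 \<le> (2::real) powr (real (u n) / 2)" by (simp add: ge_one_powr_ge_zero)
        have M0: "0 < M n" unfolding M_def using ln1 by (intro add_nonneg_pos mult_nonneg_nonneg) auto
        have "sigma_hat (n1 n) (selected_level (4 * noise_const) K (n1 n) (n2 n) (jmin n) (jmax n) f X + u n) \<le> ?s"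
          unfolding sigma_hat_def
        proof (intro real_sqrt_le_mono divide_right_mono power_increasing add_right_mono)
          show "selected_level (4 * noise_const) K (n1 n) (n2 n) (jmin n) (jmax n) f X \<le> jmax n"
            by (rule selected_level_le) (use Jlt[OF n] in simp)
        qed auto
        also have "?s = ?s * (real n * ln (real n)) * inverse (real n) * inverse (ln (real n)) * 1"
        proof -
          have "real n \<noteq> 0" "ln (real n) \<noteq> 0" using n3 ln1 by linarith+
          then show ?thesis by (simp add: field_simps)
        qed
        also have "\<dots> < M n * inverse (real n) * inverse (ln (real n)) * 1"
          unfolding M_def using n3 ln1 by (intro mult_strict_right_mono) auto
        also have "\<dots> \<le> L * real n powr (- (t / (2 * t + 1))) * ln (real n) powr (- (1 / (2 * (2 * t + 1)))) * 2 powr (real (u n) / 2)"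
          using L M0 a1 a2 a3 ln1 by (intro mult_mono mult_nonneg_nonneg) auto
        finally show ?thesis .
      qed
      then have "{X \<in> space (sample_law f n).
            (let j = selected_level (4 * noise_const) K (n1 n) (n2 n) (jmin n) (jmax n) f X + u n;
                 t = smoothness K \<eta> r b1 b2 j0 f
             in sigma_hat (n1 n) j \<ge>
                  L * real n powr (- (t / (2 * t + 1))) *
                  ln (real n) powr (- (1 / (2 * (2 * t + 1)))) * 2 powr (real (u n) / 2))} = {}"
        unfolding Let_def sm by (auto simp: not_le)
      then show ?thesis using \<epsilon> by (simp only: measure_empty less_imp_le)
    qed
  qed
qed

theorem theorem1:
  fixes K :: "real \<Rightarrow> real \<Rightarrow> real"
  shows "\<exists>M'>0. \<forall>(r::nat) (n0::nat) (n1 :: nat \<Rightarrow> nat) (n2 :: nat \<Rightarrow> nat) (jmin :: nat \<Rightarrow> nat)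
      (jmax :: nat \<Rightarrow> nat) (u :: nat \<Rightarrow> nat) (A :: nat \<Rightarrow> real) (B :: nat \<Rightarrow> real)
      (\<Phi> :: real \<Rightarrow> real \<Rightarrow> real) (d :: nat \<Rightarrow> (nat \<Rightarrow> real) \<Rightarrow> real).
    1 \<le> r \<and> admissible_kernel r K \<and> sample_split n0 n1 n2 \<and>
    resolution_range r n0 n2 jmin jmax \<and> basis_choice \<Phi> \<and>
    uniform_gumbel \<Phi> K n0 n1 jmin jmax A B \<and>
    (\<forall>n. 0 < u n) \<and> comparable (\<lambda>n. 2 ^ u n) (\<lambda>n. (ln (real n))\<^sup>2) \<and>
    (\<forall>n. d n \<in> borel_measurable (Pi\<^sub>M {1..n} (\<lambda>_. borel))) \<longrightarrow>
    (\<forall>(b::real) (b1::real) (b2::real) (j0::nat) (\<eta>::real) (\<delta>::real) (F1::real) (F2::real).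
      0 < b \<and> 0 < b1 \<and> b1 \<le> b2 \<and> 0 < \<eta> \<and> \<eta> \<le> real r \<and> admissible_pair \<Phi> \<eta> b \<delta> F1 F2 \<and>
      self_similar_densities \<Phi> K \<eta> r b b1 b2 j0 \<delta> F1 F2 \<noteq> {} \<longrightarrow>
      (\<forall>x::real.
        (\<lambda>n. SUP f\<in>self_similar_densities \<Phi> K \<eta> r b b1 b2 j0 \<delta> F1 F2.
          \<bar>\<P>(X in sample_law f n.
              (let j = selected_level M' K (n1 n) (n2 n) (jmin n) (jmax n) f X + u n;
                   \<sigma> = sigma_hat (n1 n) j
               in A j * (studentized_error K (n1 n) \<sigma> f X j (d n X) - B j) \<le> x))
            - exp (- exp (- x))\<bar>) \<longlonglongrightarrow> 0) \<and>
      (\<forall>\<epsilon>>0. \<exists>L. \<forall>n\<ge>n0.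
        (SUP f\<in>self_similar_densities \<Phi> K \<eta> r b b1 b2 j0 \<delta> F1 F2.
          \<P>(X in sample_law f n.
            (let j = selected_level M' K (n1 n) (n2 n) (jmin n) (jmax n) f X + u n;
                 t = smoothness K \<eta> r b1 b2 j0 f
             in sigma_hat (n1 n) j \<ge>
                  L * real n powr (- (t / (2 * t + 1))) *
                  ln (real n) powr (- (1 / (2 * (2 * t + 1)))) * 2 powr (real (u n) / 2))))
        \<le> \<epsilon>))"
proof (cases "\<exists>r\<ge>1. admissible_kernel r K")
  case False
  \<comment> \<open>Every constant will do for a kernel that is not admissible of any order.\<close>
  then have no: "\<not> (1 \<le> r \<and> admissible_kernel r K \<and> Q)" for r Q by blast
  show ?thesis by (rule exI[of _ 1], rule conjI[OF zero_less_one], intro allI impI, erule notE[OF no])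
next
  case True
  then have "tame K" using admissible_kernel_tame by blast
  then obtain g T V C a c D where "tame_kernel K g T V C a c D" unfolding tame_def by blast
  then interpret tame_kernel K g T V C a c D .
  show ?thesis
  proof (rule exI[of _ "4 * noise_const"], intro conjI allI impI)
    show "0 < 4 * noise_const" using noise_const_pos by simp
  next
    fix r n0 :: nat and n1 n2 jmin jmax u :: "nat \<Rightarrow> nat" and A B :: "nat \<Rightarrow> real"
      and \<Phi> :: "real \<Rightarrow> real \<Rightarrow> real" and d :: "nat \<Rightarrow> (nat \<Rightarrow> real) \<Rightarrow> real"
      and b b1 b2 :: real and j0 :: nat and \<eta> \<delta> F1 F2 x :: real
    assume h: "1 \<le> r \<and> admissible_kernel r K \<and> sample_split n0 n1 n2 \<and>
        resolution_range r n0 n2 jmin jmax \<and> basis_choice \<Phi> \<and>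
        uniform_gumbel \<Phi> K n0 n1 jmin jmax A B \<and>
        (\<forall>n. 0 < u n) \<and> comparable (\<lambda>n. 2 ^ u n) (\<lambda>n. (ln (real n))\<^sup>2) \<and>
        (\<forall>n. d n \<in> borel_measurable (Pi\<^sub>M {1..n} (\<lambda>_. borel)))"
      and k: "0 < b \<and> 0 < b1 \<and> b1 \<le> b2 \<and> 0 < \<eta> \<and> \<eta> \<le> real r \<and> admissible_pair \<Phi> \<eta> b \<delta> F1 F2 \<and>
        self_similar_densities \<Phi> K \<eta> r b b1 b2 j0 \<delta> F1 F2 \<noteq> {}"
    have dm: "d n \<in> borel_measurable (sample_space n)" for n using h by blast
    show "(\<lambda>n. SUP f\<in>self_similar_densities \<Phi> K \<eta> r b b1 b2 j0 \<delta> F1 F2.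
          \<bar>\<P>(X in sample_law f n.
              (let j = selected_level (4 * noise_const) K (n1 n) (n2 n) (jmin n) (jmax n) f X + u n;
                   \<sigma> = sigma_hat (n1 n) j
               in A j * (studentized_error K (n1 n) \<sigma> f X j (d n X) - B j) \<le> x))
            - exp (- exp (- x))\<bar>) \<longlonglongrightarrow> 0"
      by (rule adaptive_band(1)[OF _ _ _ _ dm]) (use h k in blast)+
  next
    fix r n0 :: nat and n1 n2 jmin jmax u :: "nat \<Rightarrow> nat" and A B :: "nat \<Rightarrow> real"
      and \<Phi> :: "real \<Rightarrow> real \<Rightarrow> real" and d :: "nat \<Rightarrow> (nat \<Rightarrow> real) \<Rightarrow> real"
      and b b1 b2 :: real and j0 :: nat and \<eta> \<delta> F1 F2 \<epsilon> :: real
    assume h: "1 \<le> r \<and> admissible_kernel r K \<and> sample_split n0 n1 n2 \<and>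
        resolution_range r n0 n2 jmin jmax \<and> basis_choice \<Phi> \<and>
        uniform_gumbel \<Phi> K n0 n1 jmin jmax A B \<and>
        (\<forall>n. 0 < u n) \<and> comparable (\<lambda>n. 2 ^ u n) (\<lambda>n. (ln (real n))\<^sup>2) \<and>
        (\<forall>n. d n \<in> borel_measurable (Pi\<^sub>M {1..n} (\<lambda>_. borel)))"
      and k: "0 < b \<and> 0 < b1 \<and> b1 \<le> b2 \<and> 0 < \<eta> \<and> \<eta> \<le> real r \<and> admissible_pair \<Phi> \<eta> b \<delta> F1 F2 \<and>
        self_similar_densities \<Phi> K \<eta> r b b1 b2 j0 \<delta> F1 F2 \<noteq> {}" and \<epsilon>: "0 < \<epsilon>"
    have dm: "d n \<in> borel_measurable (sample_space n)" for n using h by blast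
    show "\<exists>L. \<forall>n\<ge>n0.
        (SUP f\<in>self_similar_densities \<Phi> K \<eta> r b b1 b2 j0 \<delta> F1 F2.
          \<P>(X in sample_law f n.
            (let j = selected_level (4 * noise_const) K (n1 n) (n2 n) (jmin n) (jmax n) f X + u n;
                 t = smoothness K \<eta> r b1 b2 j0 f
             in sigma_hat (n1 n) j \<ge>
                  L * real n powr (- (t / (2 * t + 1))) *
                  ln (real n) powr (- (1 / (2 * (2 * t + 1)))) * 2 powr (real (u n) / 2))))
        \<le> \<epsilon>"
      by (rule adaptive_band(2)[OF _ _ _ _ dm _ _ _ _ _ _ _ \<epsilon>]) (use h k in blast)+
  qed
qed

end
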